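(* (Decidability of synthesis.) Given an $\mathit{MSO}[<]$ formula $\Psi(X,Y)$, it is decidable whether there exists a C-operator $F$ (not necessarily definable) such that $\mathit{FVsig}\models \forall X.\ \Psi(X,F(X))$.
   Context: A (finitely variable) signal over a finite set $\Sigma$ is a function $f:\mathbb{R}^{\geq 0}\to\Sigma$ for which there is an unbounded strictly increasing sequence $0=\tau_0<\tau_1<\cdots$ of reals such that $f$ is constant on every open interval $(\tau_i,\tau_{i+1})$; boolean signals are identified with subsets of $\mathbb{R}^{\geq 0}$, and signals over a finite $\Sigma$ are coded in the standard way by tuples of boolean signals. $\mathit{MSO}[<]$ is monadic second-order logic with atomic formulas $t<v$ and $X(t)$, boolean connectives, and first- and second-order quantifiers. $\mathit{FVsig}$ is the structure in which first-order variables range over $\mathbb{R}^{\geq 0}$ with its usual order and monadic second-order variables range over the finitely variable boolean signals. An operator is a function $F$ from signals to signals. $F$ is a C-operator (causal) if for every $t\geq 0$ and all signals $X_1,X_2$ that agree on $[0,t]$, $F(X_1)(t)=F(X_2)(t)$. *)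

theory Defs
  imports "HOL-Analysis.Analysis" "HOL-Library.Nat_Bijection"
begin

subsection \<open>Signals and operators\<close>

(* The domain of nonnegative reals is the set {0..}; a signal is an extensional function on it,
   so that equality of HOL functions is equality of signals. *)
definition finitely_variable :: "(real \<Rightarrow> 'a) \<Rightarrow> bool" where
  "finitely_variable f \<longleftrightarrow>
     (\<exists>\<tau> :: nat \<Rightarrow> real. \<tau> 0 = 0 \<and> strict_mono \<tau> \<and> \<not> bdd_above (range \<tau>) \<and>
        (\<forall>i. f constant_on {\<tau> i<..<\<tau> (Suc i)}))"

definition signals :: "'a set \<Rightarrow> (real \<Rightarrow> 'a) set" where
  "signals \<Sigma> = {f \<in> {0..} \<rightarrow>\<^sub>E \<Sigma>. finitely_variable f}"

definition boolean_signals :: "real set set" where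
  "boolean_signals = {S. S \<subseteq> {0..} \<and> (\<lambda>t\<in>{0..}. t \<in> S) \<in> signals UNIV}"

definition C_operator :: "'a set \<Rightarrow> 'b set \<Rightarrow> ((real \<Rightarrow> 'a) \<Rightarrow> (real \<Rightarrow> 'b)) \<Rightarrow> bool" where
  "C_operator \<Sigma> \<Delta> F \<longleftrightarrow>
     F \<in> signals \<Sigma> \<rightarrow> signals \<Delta> \<and>
     (\<forall>t\<ge>0. \<forall>X\<^sub>1\<in>signals \<Sigma>. \<forall>X\<^sub>2\<in>signals \<Sigma>. (\<forall>s\<in>{0..t}. X\<^sub>1 s = X\<^sub>2 s) \<longrightarrow> F X\<^sub>1 t = F X\<^sub>2 t)"

(* The alphabet {0,1}^k; a signal over it is a k-tuple of boolean signals, its tracks. *)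
definition bits :: "nat \<Rightarrow> bool list set" where
  "bits k = {b. length b = k}"

definition track :: "(real \<Rightarrow> bool list) \<Rightarrow> nat \<Rightarrow> real set" where
  "track f i = {t \<in> {0..}. f t ! i}"


subsection \<open>Monadic second-order logic of order\<close>

(* First-order and monadic second-order variables are two separate copies of the naturals. *)
datatype mso =
    Less nat nat
  | Pred nat nat  (* Pred X t is the atom X(t) *)
  | Neg mso
  | Conj mso mso
  | Disj mso mso
  | Impl mso mso
  | Ex1 nat mso
  | All1 nat mso
  | Ex2 nat mso
  | All2 nat mso

fun fv1 :: "mso \<Rightarrow> nat set" where
  "fv1 (Less t v) = {t, v}"
| "fv1 (Pred X t) = {t}"
| "fv1 (Neg \<phi>) = fv1 \<phi>"
| "fv1 (Conj \<phi> \<psi>) = fv1 \<phi> \<union> fv1 \<psi>"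
| "fv1 (Disj \<phi> \<psi>) = fv1 \<phi> \<union> fv1 \<psi>"
| "fv1 (Impl \<phi> \<psi>) = fv1 \<phi> \<union> fv1 \<psi>"
| "fv1 (Ex1 t \<phi>) = fv1 \<phi> - {t}"
| "fv1 (All1 t \<phi>) = fv1 \<phi> - {t}"
| "fv1 (Ex2 X \<phi>) = fv1 \<phi>"
| "fv1 (All2 X \<phi>) = fv1 \<phi>"

fun fv2 :: "mso \<Rightarrow> nat set" where
  "fv2 (Less t v) = {}"
| "fv2 (Pred X t) = {X}"
| "fv2 (Neg \<phi>) = fv2 \<phi>"
| "fv2 (Conj \<phi> \<psi>) = fv2 \<phi> \<union> fv2 \<psi>"
| "fv2 (Disj \<phi> \<psi>) = fv2 \<phi> \<union> fv2 \<psi>"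
| "fv2 (Impl \<phi> \<psi>) = fv2 \<phi> \<union> fv2 \<psi>"
| "fv2 (Ex1 t \<phi>) = fv2 \<phi>"
| "fv2 (All1 t \<phi>) = fv2 \<phi>"
| "fv2 (Ex2 X \<phi>) = fv2 \<phi> - {X}"
| "fv2 (All2 X \<phi>) = fv2 \<phi> - {X}"

text \<open>Satisfaction in the structure FVsig.\<close>

fun FVsig_sat :: "(nat \<Rightarrow> real) \<Rightarrow> (nat \<Rightarrow> real set) \<Rightarrow> mso \<Rightarrow> bool" where
  "FVsig_sat \<alpha> \<beta> (Less t v) \<longleftrightarrow> \<alpha> t < \<alpha> v"
| "FVsig_sat \<alpha> \<beta> (Pred X t) \<longleftrightarrow> \<alpha> t \<in> \<beta> X"
| "FVsig_sat \<alpha> \<beta> (Neg \<phi>) \<longleftrightarrow> \<not> FVsig_sat \<alpha> \<beta> \<phi>"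
| "FVsig_sat \<alpha> \<beta> (Conj \<phi> \<psi>) \<longleftrightarrow> FVsig_sat \<alpha> \<beta> \<phi> \<and> FVsig_sat \<alpha> \<beta> \<psi>"
| "FVsig_sat \<alpha> \<beta> (Disj \<phi> \<psi>) \<longleftrightarrow> FVsig_sat \<alpha> \<beta> \<phi> \<or> FVsig_sat \<alpha> \<beta> \<psi>"
| "FVsig_sat \<alpha> \<beta> (Impl \<phi> \<psi>) \<longleftrightarrow> (FVsig_sat \<alpha> \<beta> \<phi> \<longrightarrow> FVsig_sat \<alpha> \<beta> \<psi>)"
| "FVsig_sat \<alpha> \<beta> (Ex1 t \<phi>) \<longleftrightarrow> (\<exists>r\<in>{0..}. FVsig_sat (\<alpha>(t := r)) \<beta> \<phi>)"
| "FVsig_sat \<alpha> \<beta> (All1 t \<phi>) \<longleftrightarrow> (\<forall>r\<in>{0..}. FVsig_sat (\<alpha>(t := r)) \<beta> \<phi>)"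
| "FVsig_sat \<alpha> \<beta> (Ex2 X \<phi>) \<longleftrightarrow> (\<exists>S\<in>boolean_signals. FVsig_sat \<alpha> (\<beta>(X := S)) \<phi>)"
| "FVsig_sat \<alpha> \<beta> (All2 X \<phi>) \<longleftrightarrow> (\<forall>S\<in>boolean_signals. FVsig_sat \<alpha> (\<beta>(X := S)) \<phi>)"

(* A formula \<Psi>(X,Y) about a signal X over {0,1}^m and a signal Y over {0,1}^n: its free variables
   are the second-order variables 0, ..., m - 1 for the tracks of X and m, ..., m + n - 1 for
   the tracks of Y. *)
definition is_spec :: "nat \<Rightarrow> nat \<Rightarrow> mso \<Rightarrow> bool" where
  "is_spec m n \<Psi> \<longleftrightarrow> fv1 \<Psi> = {} \<and> fv2 \<Psi> \<subseteq> {..<m + n}"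

(* The default values (0 for first-order variables, the empty set for second-order variables from
   m + n on) are irrelevant under is_spec m n \<Psi>. *)
definition FVsig_models ::
  "nat \<Rightarrow> nat \<Rightarrow> mso \<Rightarrow> (real \<Rightarrow> bool list) \<Rightarrow> (real \<Rightarrow> bool list) \<Rightarrow> bool" where
  "FVsig_models m n \<Psi> X Y \<longleftrightarrow>
     FVsig_sat (\<lambda>_. 0)
       (\<lambda>i. if i < m then track X i else if i < m + n then track Y (i - m) else {}) \<Psi>"


subsection \<open>Decidability\<close>

(* recursive k f: the restriction of f to argument lists of length k is a (total) general
   recursive function; minimisation is only applied to regular functions, which suffices
   for total functions by Kleene's normal form theorem. *)
inductive recursive :: "nat \<Rightarrow> (nat list \<Rightarrow> nat) \<Rightarrow> bool" where
  zero: "recursive k (\<lambda>xs. 0)"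
| succ: "recursive 1 (\<lambda>xs. Suc (xs ! 0))"
| proj: "i < k \<Longrightarrow> recursive k (\<lambda>xs. xs ! i)"
| comp: "recursive (length gs) f \<Longrightarrow> (\<forall>g\<in>set gs. recursive k g) \<Longrightarrow>
    recursive k (\<lambda>xs. f (map (\<lambda>g. g xs) gs))"
| prim_rec: "recursive k f \<Longrightarrow> recursive (Suc (Suc k)) g \<Longrightarrow>
    recursive (Suc k) (\<lambda>xs. rec_nat (f (tl xs)) (\<lambda>y r. g (y # r # tl xs)) (hd xs))"
| mu: "recursive (Suc k) f \<Longrightarrow> (\<forall>xs. length xs = k \<longrightarrow> (\<exists>y. f (y # xs) = 0)) \<Longrightarrow>
    recursive k (\<lambda>xs. LEAST y. f (y # xs) = 0)"
| ext: "recursive k f \<Longrightarrow> (\<forall>xs. length xs = k \<longrightarrow> f xs = g xs) \<Longrightarrow> recursive k g"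

(* Decidability of the property P of instances ranging over I, presented to the algorithm
   through the Goedel numbering enc. *)
definition decidable_problem :: "('a \<Rightarrow> nat) \<Rightarrow> 'a set \<Rightarrow> ('a \<Rightarrow> bool) \<Rightarrow> bool" where
  "decidable_problem enc I P \<longleftrightarrow>
     (\<exists>f. recursive 1 f \<and> (\<forall>x\<in>I. f [enc x] = (if P x then 1 else 0)))"

fun mso_encode :: "mso \<Rightarrow> nat" where
  "mso_encode (Less t v) = prod_encode (0, prod_encode (t, v))"
| "mso_encode (Pred X t) = prod_encode (1, prod_encode (X, t))"
| "mso_encode (Neg \<phi>) = prod_encode (2, mso_encode \<phi>)"
| "mso_encode (Conj \<phi> \<psi>) = prod_encode (3, prod_encode (mso_encode \<phi>, mso_encode \<psi>))"
| "mso_encode (Disj \<phi> \<psi>) = prod_encode (4, prod_encode (mso_encode \<phi>, mso_encode \<psi>))"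
| "mso_encode (Impl \<phi> \<psi>) = prod_encode (5, prod_encode (mso_encode \<phi>, mso_encode \<psi>))"
| "mso_encode (Ex1 t \<phi>) = prod_encode (6, prod_encode (t, mso_encode \<phi>))"
| "mso_encode (All1 t \<phi>) = prod_encode (7, prod_encode (t, mso_encode \<phi>))"
| "mso_encode (Ex2 X \<phi>) = prod_encode (8, prod_encode (X, mso_encode \<phi>))"
| "mso_encode (All2 X \<phi>) = prod_encode (9, prod_encode (X, mso_encode \<phi>))"

lemma mso_encode_inject: "mso_encode \<phi> = mso_encode \<psi> \<longleftrightarrow> \<phi> = \<psi>"
proof
  show "mso_encode \<phi> = mso_encode \<psi> \<Longrightarrow> \<phi> = \<psi>"
    by (induction \<phi> arbitrary: \<psi>; case_tac \<psi>; simp)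
qed simp

fun spec_encode :: "nat \<times> nat \<times> mso \<Rightarrow> nat" where
  "spec_encode (m, n, \<Psi>) = prod_encode (m, prod_encode (n, mso_encode \<Psi>))"

lemma track_boolean_signal:
  assumes "X \<in> signals (bits k)" and "i < k"
  shows "track X i \<in> boolean_signals"
proof -
  obtain \<tau> :: "nat \<Rightarrow> real" where \<tau>: "\<tau> 0 = 0" "strict_mono \<tau>" "\<not> bdd_above (range \<tau>)"
    "\<And>j. X constant_on {\<tau> j<..<\<tau> (Suc j)}"
    using assms(1) unfolding signals_def finitely_variable_def by auto
  have "(\<lambda>t\<in>{0..}. t \<in> track X i) constant_on {\<tau> j<..<\<tau> (Suc j)}" for j
  proof -
    obtain c where c: "\<And>t. t \<in> {\<tau> j<..<\<tau> (Suc j)} \<Longrightarrow> X t = c"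
      using \<tau>(4)[of j] unfolding constant_on_def by auto
    have "0 \<le> \<tau> j"
      using \<tau>(1) strict_mono_less_eq[OF \<tau>(2), of 0 j] by simp
    then show ?thesis
      using c unfolding constant_on_def track_def by (intro exI[of _ "c ! i"]) auto
  qed
  then show ?thesis
    using \<tau> unfolding boolean_signals_def signals_def finitely_variable_def
    by (auto simp: track_def)
qed

end

theory Submission
  imports Defs
begin

text \<open>A formula is evaluated on a signal by means of finite semigroups of types (composition
  method): the type of a piece of a signal is the set of all types that an expansion of it by a
  quantified signal can have, and an infinite concatenation of pieces of types \<open>s, e, e, \<dots>\<close> with
  \<open>s e = s\<close> and \<open>e e = e\<close> satisfies the formula or not depending on \<open>(s, e)\<close> only.

  The existence of a causal operator is turned into a discrete game on the letters of the signals
  at points and on open intervals. Continuous time leaves one trace in it. Between two changes of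
  the input the operator may plan finitely many changes of the output, to be carried out within an
  arbitrarily short time; the input may interrupt this, but since the lengths of the interrupted
  plans can be made summable and the input is finitely variable, infinitely many plans will be
  completed. So the output player marks the end of a plan by a checkpoint and wins every play with
  infinitely many interrupts and finitely many checkpoints.

  The winning condition is recognised by a finite semigroup. Keeping track of the classes of
  positions that have merged, i.e. whose products up to now coincide, yields a deterministic parity
  automaton, so one of the players wins with finite memory. That a finite-memory strategy wins can be
  certified by a finite relation closed under composition, which contains all products along paths
  of the strategy. Searching for a certificate for either player is a decision procedure.\<close>

section \<open>Computable functions\<close>

text \<open>A causal operator sees the input on the closed interval up to now. So at a point it
  answers the input value there, and inside an open interval it already knows the value that the
  input took right after the left end: the output player moves second in both kinds of round. At a
  point it cannot know whether the input is about to change, hence the rule that an interrupt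
  leaving the input value unchanged leaves the output unchanged too. The obstacle is that rounds
  carry no times: infinitely many of them may fit into bounded time, and the winning condition has
  to say who is to blame. With finitely many interrupts and checkpoints the output is to blame and
  loses. The two translations of certificates confirm the split: an operator may start afresh with
  delay 1 after each checkpoint, whereas against a given operator the integer times serve as
  checkpoints, so that infinitely many of them make time diverge. Both directions rest on the fact
  that truth of a formula depends on the word of letters only and not on the times, since the type
  of an open interval with constant tracks is the same whatever its length.\<close>

definition pfst :: "nat \<Rightarrow> nat" where "pfst z = fst (prod_decode z)"
definition psnd :: "nat \<Rightarrow> nat" where "psnd z = snd (prod_decode z)"

lemma pfst_encode [simp]: "pfst (prod_encode (a, b)) = a"
  and psnd_encode [simp]: "psnd (prod_encode (a, b)) = b"
  by (simp_all add: pfst_def psnd_def)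

lemma prod_encode_pfst_psnd [simp]: "prod_encode (pfst z, psnd z) = z"
  by (simp add: pfst_def psnd_def)

text \<open>Arity one is the main notion: further arguments are packed by
  \<open>prod_encode\<close>, so that the closure rules collected below speak of terms with a single
  bound variable.\<close>

definition computable :: "(nat \<Rightarrow> nat) \<Rightarrow> bool" where
  "computable f \<longleftrightarrow> recursive 1 (\<lambda>xs. f (xs ! 0))"

definition computable2 :: "(nat \<Rightarrow> nat \<Rightarrow> nat) \<Rightarrow> bool" where
  "computable2 f \<longleftrightarrow> recursive 2 (\<lambda>xs. f (xs ! 0) (xs ! 1))"

definition computable3 :: "(nat \<Rightarrow> nat \<Rightarrow> nat \<Rightarrow> nat) \<Rightarrow> bool" where
  "computable3 f \<longleftrightarrow> recursive 3 (\<lambda>xs. f (xs ! 0) (xs ! 1) (xs ! 2))"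

lemma recursive_comp1:
  assumes "computable f" "recursive k g"
  shows "recursive k (\<lambda>xs. f (g xs))"
  using recursive.comp[of "[g]" "\<lambda>xs. f (xs ! 0)" k] assms by (simp add: computable_def)

lemma recursive_comp2:
  assumes "computable2 f" "recursive k g" "recursive k h"
  shows "recursive k (\<lambda>xs. f (g xs) (h xs))"
  using recursive.comp[of "[g, h]" "\<lambda>xs. f (xs ! 0) (xs ! 1)" k] assms
  by (simp add: computable2_def numeral_2_eq_2)

lemma computable2_comp:
  assumes "computable2 f" "computable g" "computable h"
  shows "computable (\<lambda>x. f (g x) (h x))"
  using recursive_comp2[OF assms(1)] assms(2,3) unfolding computable_def by simp

lemma computable_comp:
  assumes "computable f" "computable g"
  shows "computable (\<lambda>x. f (g x))"
  using recursive_comp1[OF assms(1)] assms(2) unfolding computable_def by simp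

lemma computable2_curried:
  assumes "computable f" "computable2 g"
  shows "computable2 (\<lambda>x y. f (g x y))"
  using recursive_comp1[OF assms(1)] assms(2) unfolding computable2_def by simp

lemma computable2_curried2:
  assumes "computable2 f" "computable2 g" "computable2 h"
  shows "computable2 (\<lambda>x y. f (g x y) (h x y))"
  using recursive_comp2[OF assms(1)] assms(2,3) unfolding computable2_def by simp

lemma computable3_curried2:
  assumes "computable2 f" "computable3 g" "computable3 h"
  shows "computable3 (\<lambda>x y z. f (g x y z) (h x y z))"
  using recursive_comp2[OF assms(1)] assms(2,3) unfolding computable3_def by simp

lemma computable3_curried:
  assumes "computable f" "computable3 g"
  shows "computable3 (\<lambda>x y z. f (g x y z))"
  using recursive_comp1[OF assms(1)] assms(2) unfolding computable3_def by simp

lemma computable_id: "computable (\<lambda>x. x)"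
  unfolding computable_def by (rule recursive.proj) simp

lemma computable2_proj: "computable2 (\<lambda>x y. x)" "computable2 (\<lambda>x y. y)"
  unfolding computable2_def using recursive.proj[of 0 2] recursive.proj[of 1 2] by simp_all

lemma computable3_proj: "computable3 (\<lambda>x y z. x)" "computable3 (\<lambda>x y z. y)"
    "computable3 (\<lambda>x y z. z)"
  unfolding computable3_def
  using recursive.proj[of 0 3] recursive.proj[of 1 3] recursive.proj[of 2 3] by simp_all

lemma computable_Suc: "computable Suc"
  unfolding computable_def by (rule recursive.succ)

lemma computable_const: "computable (\<lambda>x. c)"
proof (induction c)
  case 0
  show ?case unfolding computable_def by (rule recursive.zero)
next
  case (Suc c)
  show ?case using computable_comp[OF computable_Suc Suc] .
qed

lemma computable2_rec:
  assumes "computable f" "computable3 g"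
  shows "computable2 (\<lambda>n x. rec_nat (f x) (\<lambda>y r. g y r x) n)"
proof -
  have "recursive (Suc 1) (\<lambda>xs. rec_nat (f (tl xs ! 0))
      (\<lambda>y r. (\<lambda>xs. g (xs ! 0) (xs ! 1) (xs ! 2)) (y # r # tl xs)) (hd xs))"
    using recursive.prim_rec[of 1 "\<lambda>xs. f (xs ! 0)" "\<lambda>xs. g (xs ! 0) (xs ! 1) (xs ! 2)"]
      assms unfolding computable_def computable3_def by (simp add: numeral_3_eq_3)
  then show ?thesis
    unfolding computable2_def numeral_2_eq_2 One_nat_def
    by (rule recursive.ext) (auto simp: length_Suc_conv numeral_2_eq_2)
qed

lemma computable_rec_const:
  assumes "computable2 g"
  shows "computable (\<lambda>n. rec_nat c g n)"
proof -
  have "computable3 (\<lambda>y r x. g y r)"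
    using computable3_curried2[OF assms computable3_proj(1) computable3_proj(2)] .
  from computable2_comp[OF computable2_rec[OF computable_const[of c] this] computable_id computable_id]
  show ?thesis by simp
qed

lemma computable2_plus: "computable2 (+)"
proof -
  have "computable2 (\<lambda>n x. rec_nat x (\<lambda>y r. Suc r) n)"
    using computable2_rec[OF computable_id computable3_curried[OF computable_Suc computable3_proj(2)]] .
  moreover have "rec_nat x (\<lambda>y r. Suc r) n = n + x" for n x by (induction n) auto
  ultimately show ?thesis by simp
qed

lemma computable_pred: "computable (\<lambda>n. n - 1)"
proof -
  have "rec_nat 0 (\<lambda>y r. y) n = n - 1" for n by (cases n) auto
  then show ?thesis using computable_rec_const[OF computable2_proj(1), of 0] by simp
qed

lemma computable2_minus: "computable2 (-)"
proof -
  have "computable2 (\<lambda>n x. rec_nat x (\<lambda>y r. r - 1) n)"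
    using computable2_rec[OF computable_id computable3_curried[OF computable_pred computable3_proj(2)]] .
  moreover have "rec_nat x (\<lambda>y r. r - 1) n = x - n" for n x by (induction n) auto
  ultimately have "computable2 (\<lambda>n x. x - n)" by simp
  then show ?thesis
    using computable2_curried2[of "\<lambda>n x. x - n", OF _ computable2_proj(2) computable2_proj(1)] by simp
qed

lemma computable2_times: "computable2 (*)"
proof -
  have "computable2 (\<lambda>n x. rec_nat 0 (\<lambda>y r. x + r) n)"
    using computable2_rec[OF computable_const computable3_curried2[OF computable2_plus
      computable3_proj(3) computable3_proj(2)]] .
  moreover have "rec_nat 0 (\<lambda>y r. x + r) n = n * x" for n x by (induction n) auto
  ultimately show ?thesis by simp
qed

lemma computable_triangle: "computable triangle"
proof -
  have "computable2 (\<lambda>y r. r + Suc y)"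
    by (intro computable2_curried2[OF computable2_plus] computable2_proj
        computable2_curried[OF computable_Suc])
  from computable_rec_const[OF this, of 0]
  have "computable (\<lambda>n. rec_nat 0 (\<lambda>y r. r + Suc y) n)" .
  moreover have "rec_nat 0 (\<lambda>y r. r + Suc y) n = triangle n" for n by (induction n) auto
  ultimately show ?thesis by simp
qed

section \<open>Minimisation and the inverse of the pairing function\<close>

lemma computable_mu:
  assumes "computable2 h" "\<And>x. \<exists>y. h y x = 0"
  shows "computable (\<lambda>x. LEAST y. h y x = 0)"
proof -
  have "recursive 1 (\<lambda>xs. LEAST y. (\<lambda>xs. h (xs ! 0) (xs ! 1)) (y # xs) = 0)"
    by (rule recursive.mu) (use assms in \<open>auto simp: computable2_def numeral_2_eq_2\<close>)
  then show ?thesis unfolding computable_def by simp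
qed

text \<open>\<open>prod_encode\<close> enumerates pairs along the diagonals of constant sum,
  starting diagonal \<open>d\<close> at \<open>triangle d\<close>. This is the diagonal on which
  \<open>z\<close> lies, i.e. the sum of its two components; the projections then follow by
  subtraction.\<close>

definition diagonal :: "nat \<Rightarrow> nat" where
  "diagonal z = (LEAST d. Suc z - triangle (Suc d) = 0)"

lemma computable_diagonal: "computable diagonal"
  unfolding diagonal_def
proof (rule computable_mu)
  show "computable2 (\<lambda>d z. Suc z - triangle (Suc d))"
    by (intro computable2_curried2[OF computable2_minus] computable2_curried[OF computable_Suc]
        computable2_curried[OF computable_triangle] computable2_proj)
  have "z < triangle (Suc z)" for z by (induction z) auto
  then show "\<exists>d. Suc z - triangle (Suc d) = 0" for z by (metis Suc_leI diff_is_0_eq)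
qed

lemma triangle_mono: "a \<le> b \<Longrightarrow> triangle a \<le> triangle b"
  by (induction b) (auto simp: le_Suc_eq)

lemma diagonal_encode: "diagonal (prod_encode (a, b)) = a + b"
  unfolding diagonal_def
proof (rule Least_equality)
  show "Suc (prod_encode (a, b)) - triangle (Suc (a + b)) = 0"
    by (simp add: prod_encode_def)
  fix d assume d: "Suc (prod_encode (a, b)) - triangle (Suc d) = 0"
  show "a + b \<le> d"
  proof (rule ccontr)
    assume "\<not> a + b \<le> d"
    then have "triangle (Suc d) \<le> triangle (a + b)" by (intro triangle_mono) auto
    then show False using d by (simp add: prod_encode_def)
  qed
qed

lemma pfst_eq: "pfst z = z - triangle (diagonal z)"
proof -
  obtain a b where "z = prod_encode (a, b)" by (metis prod_encode_pfst_psnd)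
  then show ?thesis by (simp add: diagonal_encode) (simp add: prod_encode_def)
qed

lemma psnd_eq: "psnd z = diagonal z - pfst z"
proof -
  obtain a b where "z = prod_encode (a, b)" by (metis prod_encode_pfst_psnd)
  then show ?thesis by (simp add: diagonal_encode)
qed

section \<open>Closure rules for computable functions and decidable predicates of one
  variable\<close>

named_theorems computable_intros

lemma computable_plus [computable_intros]:
  "computable f \<Longrightarrow> computable g \<Longrightarrow> computable (\<lambda>x. f x + g x)"
  by (rule computable2_comp[OF computable2_plus])

lemma computable_minus [computable_intros]:
  "computable f \<Longrightarrow> computable g \<Longrightarrow> computable (\<lambda>x. f x - g x)"
  by (rule computable2_comp[OF computable2_minus])

lemma computable_times [computable_intros]:
  "computable f \<Longrightarrow> computable g \<Longrightarrow> computable (\<lambda>x. f x * g x)"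
  by (rule computable2_comp[OF computable2_times])

lemma computable_Suc_comp [computable_intros]:
  "computable f \<Longrightarrow> computable (\<lambda>x. Suc (f x))"
  by (rule computable_comp[OF computable_Suc])

lemma computable_triangle_comp:
  "computable f \<Longrightarrow> computable (\<lambda>x. triangle (f x))"
  by (rule computable_comp[OF computable_triangle])

lemma computable_pfst [computable_intros]:
  assumes "computable f" shows "computable (\<lambda>x. pfst (f x))"
proof -
  have "computable (\<lambda>z. z - triangle (diagonal z))"
    by (intro computable_minus computable_triangle_comp computable_diagonal computable_id)
  then have "computable (\<lambda>z. pfst z)" by (simp add: pfst_eq)
  from computable_comp[OF this assms] show ?thesis .
qed

lemma computable_psnd [computable_intros]:
  assumes "computable f" shows "computable (\<lambda>x. psnd (f x))"
proof -
  have "computable (\<lambda>z. diagonal z - pfst z)"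
    by (intro computable_minus computable_pfst computable_diagonal computable_id)
  then have "computable (\<lambda>z. psnd z)" by (simp add: psnd_eq)
  from computable_comp[OF this assms] show ?thesis .
qed

lemma computable_prod_encode [computable_intros]:
  "computable f \<Longrightarrow> computable g \<Longrightarrow> computable (\<lambda>x. prod_encode (f x, g x))"
  unfolding prod_encode_def by (simp, intro computable_plus computable_triangle_comp)

lemmas [computable_intros] = computable_const computable_id

text \<open>A rule for a binder asks that the body be computable in the pair of outer and bound
  variable. This turns such a hypothesis back into computability of the body at computed
  arguments.\<close>

lemma computable_curry:
  assumes "computable (\<lambda>z. f (pfst z) (psnd z))" "computable a" "computable b"
  shows "computable (\<lambda>x. f (a x) (b x))"
  using computable_comp[OF assms(1) computable_prod_encode[OF assms(2,3)]] by simp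

lemma computable2_uncurry:
  "computable2 f \<longleftrightarrow> computable (\<lambda>z. f (pfst z) (psnd z))"
proof
  assume "computable2 f"
  from computable2_comp[OF this computable_pfst computable_psnd] computable_id
  show "computable (\<lambda>z. f (pfst z) (psnd z))" by blast
next
  assume "computable (\<lambda>z. f (pfst z) (psnd z))"
  moreover have "computable2 (\<lambda>x y. triangle (x + y) + x)"
    by (intro computable2_curried2[OF computable2_plus] computable2_curried[OF computable_triangle]
        computable2_proj)
  then have "computable2 (\<lambda>x y. prod_encode (x, y))" by (simp add: prod_encode_def)
  ultimately show "computable2 f" using computable2_curried by fastforce
qed

lemma computable3_uncurry:
  assumes "computable (\<lambda>z. f (pfst z) (pfst (psnd z)) (psnd (psnd z)))"
  shows "computable3 f"
proof -
  have *: "computable2 (\<lambda>x y. prod_encode (x, y))"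
    unfolding computable2_uncurry by (intro computable_intros)
  have "computable3 (\<lambda>x y z. prod_encode (x, prod_encode (y, z)))"
    by (intro computable3_curried2[OF *] computable3_proj)
  from computable3_curried[OF assms this] show ?thesis by simp
qed

lemma computable_rec [computable_intros]:
  assumes "computable a" "computable n"
    "computable (\<lambda>z. g (pfst z) (pfst (psnd z)) (psnd (psnd z)))"
  shows "computable (\<lambda>x. rec_nat (a x) (\<lambda>y r. g y r x) (n x))"
proof -
  have "computable2 (\<lambda>n x. rec_nat (a x) (\<lambda>y r. g y r x) n)"
    by (rule computable2_rec[OF assms(1) computable3_uncurry[OF assms(3)]])
  from computable2_comp[OF this assms(2) computable_id] show ?thesis .
qed

lemma computable_power [computable_intros]:
  assumes "computable f" "computable g"
  shows "computable (\<lambda>x. f x ^ g x)"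
proof -
  have "computable (\<lambda>x. rec_nat 1 (\<lambda>y r. r * f x) (g x))"
    by (intro computable_intros computable_comp[OF assms(1)] assms)
  moreover have "rec_nat 1 (\<lambda>y r. r * a) b = a ^ b" for a b :: nat by (induction b) auto
  ultimately show ?thesis by simp
qed

definition decidable :: "(nat \<Rightarrow> bool) \<Rightarrow> bool" where
  "decidable P \<longleftrightarrow> computable (\<lambda>x. of_bool (P x))"

lemma computable_If [computable_intros]:
  assumes "decidable P" "computable f" "computable g"
  shows "computable (\<lambda>x. if P x then f x else g x)"
proof -
  have "computable (\<lambda>x. of_bool (P x) * f x + (1 - of_bool (P x)) * g x)"
    using assms(1) unfolding decidable_def by (intro computable_intros assms)
  moreover have "of_bool (P x) * f x + (1 - of_bool (P x)) * g x = (if P x then f x else g x)" for x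
    by simp
  ultimately show ?thesis by simp
qed

lemma computable_of_bool [computable_intros]:
  "decidable P \<Longrightarrow> computable (\<lambda>x. of_bool (P x))"
  by (simp add: decidable_def)

lemma decidable_not [computable_intros]: "decidable P \<Longrightarrow> decidable (\<lambda>x. \<not> P x)"
proof -
  assume "decidable P"
  then have "computable (\<lambda>x. 1 - of_bool (P x))"
    by (intro computable_intros)
  moreover have "1 - of_bool (P x) = (of_bool (\<not> P x) :: nat)" for x by simp
  ultimately show ?thesis by (simp only: decidable_def)
qed

lemma decidable_conj [computable_intros]:
  assumes "decidable P" "decidable Q" shows "decidable (\<lambda>x. P x \<and> Q x)"
proof -
  have "computable (\<lambda>x. of_bool (P x) * of_bool (Q x))"
    by (intro computable_intros assms)
  then show ?thesis by (simp only: decidable_def of_bool_conj)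
qed

lemma decidable_disj [computable_intros]:
  assumes "decidable P" "decidable Q" shows "decidable (\<lambda>x. P x \<or> Q x)"
  using decidable_not[OF decidable_conj[OF decidable_not[OF assms(1)] decidable_not[OF assms(2)]]]
  by simp

lemma decidable_imp [computable_intros]:
  assumes "decidable P" "decidable Q" shows "decidable (\<lambda>x. P x \<longrightarrow> Q x)"
  using decidable_disj[OF decidable_not[OF assms(1)] assms(2)] by (simp only: imp_conv_disj)

lemma decidable_le [computable_intros]:
  assumes "computable f" "computable g" shows "decidable (\<lambda>x. f x \<le> g x)"
proof -
  have "computable (\<lambda>x. 1 - (f x - g x))" by (intro computable_intros assms)
  moreover have "1 - (f x - g x) = of_bool (f x \<le> g x)" for x by simp
  ultimately show ?thesis by (simp only: decidable_def)
qed

lemma decidable_less [computable_intros]: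
  assumes "computable f" "computable g" shows "decidable (\<lambda>x. f x < g x)"
  using decidable_not[OF decidable_le[OF assms(2,1)]] by (simp add: not_le)

lemma decidable_eq [computable_intros]:
  assumes "computable f" "computable g" shows "decidable (\<lambda>x. f x = g x)"
  using decidable_conj[OF decidable_le[OF assms] decidable_le[OF assms(2,1)]]
  by (simp add: order_eq_iff)

lemma decidable_comp:
  assumes "decidable P" "computable f" shows "decidable (\<lambda>x. P (f x))"
  using computable_comp[OF assms(1)[unfolded decidable_def] assms(2)] by (simp add: decidable_def)

lemma decidable_curry:
  assumes "decidable (\<lambda>z. P (pfst z) (psnd z))" "computable a" "computable b"
  shows "decidable (\<lambda>x. P (a x) (b x))"
  using decidable_comp[OF assms(1) computable_prod_encode[OF assms(2,3)]] by simp

text \<open>Bounded search by primitive recursion: the accumulator becomes 1 as soon as a witness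
  has been met.\<close>

lemma decidable_ex_less [computable_intros]:
  assumes "computable b" "decidable (\<lambda>z. P (pfst z) (psnd z))"
  shows "decidable (\<lambda>x. \<exists>y<b x. P x y)"
proof -
  have *: "decidable (\<lambda>z. P (psnd (psnd z)) (pfst z))"
    by (intro decidable_curry[OF assms(2)] computable_intros)
  have "computable (\<lambda>x. rec_nat 0 (\<lambda>y r. if P x y then 1 else r) (b x))"
    by (intro computable_intros * assms)
  moreover have "rec_nat 0 (\<lambda>y r. if P x y then 1 else r) n = (of_bool (\<exists>y<n. P x y) :: nat)"
    for x n by (induction n) (auto simp: less_Suc_eq)
  ultimately show ?thesis by (simp only: decidable_def)
qed

lemma decidable_all_less [computable_intros]:
  assumes "computable b" "decidable (\<lambda>z. P (pfst z) (psnd z))"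
  shows "decidable (\<lambda>x. \<forall>y<b x. P x y)"
  using decidable_not[OF decidable_ex_less[OF assms(1) decidable_not[OF assms(2)]]] by simp

text \<open>\<open>recursive.mu\<close> applies to regular functions only, whence the demand for a
  witness at every \<open>x\<close>, including numbers that code nothing sensible.\<close>

lemma computable_Least [computable_intros]:
  assumes "decidable (\<lambda>z. P (pfst z) (psnd z))" "\<And>x. \<exists>y. P x y"
  shows "computable (\<lambda>x. LEAST y. P x y)"
proof -
  have "computable2 (\<lambda>y x. 1 - of_bool (P x y))"
    unfolding computable2_uncurry by (intro computable_intros decidable_curry[OF assms(1)])
  moreover have "1 - of_bool b = (0 :: nat) \<longleftrightarrow> b" for b by simp
  ultimately show ?thesis using computable_mu[of "\<lambda>y x. 1 - of_bool (P x y)"] assms(2) by simp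
qed

text \<open>The bit test is phrased without division: bit \<open>i\<close> of \<open>n\<close> is
  set iff \<open>n = (2 * q + 1) * 2 ^ i + r\<close> with \<open>r < 2 ^ i\<close>, where
  \<open>q\<close> and \<open>r\<close> are bounded by computable terms.\<close>

lemma decidable_mem_set_decode [computable_intros]:
  assumes "computable f" "computable g"
  shows "decidable (\<lambda>x. f x \<in> set_decode (g x))"
proof -
  have "i \<in> set_decode n \<longleftrightarrow> (\<exists>q<Suc n. \<exists>r<2 ^ i. n = (2 * q + 1) * 2 ^ i + r)" for i n
  proof
    assume "i \<in> set_decode n"
    then have "odd (n div 2 ^ i)" by (simp add: set_decode_def)
    then obtain q where q: "n div 2 ^ i = 2 * q + 1" by (elim oddE)
    have "n = (2 * q + 1) * 2 ^ i + n mod 2 ^ i" by (metis q div_mult_mod_eq)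
    moreover have "q < Suc n" using q div_le_dividend[of n "2 ^ i"] by linarith
    ultimately show "\<exists>q<Suc n. \<exists>r<2 ^ i. n = (2 * q + 1) * 2 ^ i + r"
      by (metis mod_less_divisor zero_less_numeral zero_less_power)
  next
    assume "\<exists>q<Suc n. \<exists>r<2 ^ i. n = (2 * q + 1) * 2 ^ i + r"
    then obtain q r where "r < 2 ^ i" "n = (2 * q + 1) * 2 ^ i + r" by blast
    then have "n div 2 ^ i = 2 * q + 1" by (intro div_nat_eqI) (auto simp: algebra_simps)
    then show "i \<in> set_decode n" by (simp add: set_decode_def)
  qed
  moreover have "decidable (\<lambda>x. \<exists>q<Suc (g x). \<exists>r<2 ^ f x. g x = (2 * q + 1) * 2 ^ f x + r)"
    by (intro computable_intros computable_comp[OF assms(1)] computable_comp[OF assms(2)] assms)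
  ultimately show ?thesis by simp
qed

text \<open>An element \<open>i\<close> contributes \<open>2 ^ i > i\<close> to the code.
  Quantifiers over coded sets thereby become bounded, and passing from a set to an element decreases
  codes, as course-of-values recursion requires.\<close>

lemma set_decode_less: "i \<in> set_decode n \<Longrightarrow> i < n"
proof -
  assume "i \<in> set_decode n"
  then have "n div 2 ^ i \<noteq> 0" by (auto simp: set_decode_def intro: odd_pos)
  then have "2 ^ i \<le> n" by (metis div_less not_le)
  then show ?thesis using less_exp[of i] by linarith
qed

lemma decidable_ex_set_decode [computable_intros]:
  assumes "computable b" "decidable (\<lambda>z. P (pfst z) (psnd z))"
  shows "decidable (\<lambda>x. \<exists>y\<in>set_decode (b x). P x y)"
proof -
  have "decidable (\<lambda>x. \<exists>y<b x. y \<in> set_decode (b x) \<and> P x y)"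
    by (intro computable_intros computable_comp[OF assms(1)] assms)
  moreover have "(\<exists>y\<in>set_decode (b x). P x y) = (\<exists>y<b x. y \<in> set_decode (b x) \<and> P x y)" for x
    using set_decode_less by blast
  ultimately show ?thesis by simp
qed

lemma decidable_all_set_decode [computable_intros]:
  assumes "computable b" "decidable (\<lambda>z. P (pfst z) (psnd z))"
  shows "decidable (\<lambda>x. \<forall>y\<in>set_decode (b x). P x y)"
  using decidable_not[OF decidable_ex_set_decode[OF assms(1) decidable_not[OF assms(2)]]] by simp

section \<open>Arithmetic of finite sets coded in binary\<close>

definition ins :: "nat \<Rightarrow> nat \<Rightarrow> nat" where
  "ins x s = (if x \<in> set_decode s then s else s + 2 ^ x)"

lemma set_decode_ins [simp]: "set_decode (ins x s) = insert x (set_decode s)"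
proof (cases "x \<in> set_decode s")
  case False
  have "set_encode (insert x (set_decode s)) = s + 2 ^ x"
    using False by (subst set_encode_insert) auto
  then show ?thesis using False
    by (metis finite.insertI finite_set_decode ins_def set_encode_inverse)
qed (auto simp: ins_def)

lemma computable_ins [computable_intros]:
  "computable f \<Longrightarrow> computable g \<Longrightarrow> computable (\<lambda>x. ins (f x) (g x))"
  unfolding ins_def by (intro computable_intros)

definition image_code :: "(nat \<Rightarrow> nat) \<Rightarrow> nat \<Rightarrow> nat" where
  "image_code g a = set_encode (g ` set_decode a)"

lemma set_decode_image_code [simp]: "set_decode (image_code g a) = g ` set_decode a"
  by (simp add: image_code_def)

lemma computable_image_code [computable_intros]:
  assumes "computable a" "computable (\<lambda>z. g (pfst z) (psnd z))"
  shows "computable (\<lambda>x. image_code (g x) (a x))"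
proof -
  have *: "computable (\<lambda>z. g (psnd (psnd z)) (pfst z))"
    by (intro computable_curry[OF assms(2)] computable_intros)
  have "computable (\<lambda>x. rec_nat 0 (\<lambda>y r. if y \<in> set_decode (a x) then ins (g x y) r else r) (a x))"
    by (intro computable_intros computable_comp[OF assms(1)] * assms)
  moreover have "rec_nat 0 (\<lambda>y r. if y \<in> set_decode (a x) then ins (g x y) r else r) (a x)
      = image_code (g x) (a x)" for x
  proof -
    have "set_decode (rec_nat 0 (\<lambda>y r. if y \<in> set_decode (a x) then ins (g x y) r else r) n)
      = g x ` (set_decode (a x) \<inter> {..<n})" for n
      by (induction n) (auto simp: less_Suc_eq)
    moreover have "set_decode (a x) \<inter> {..<a x} = set_decode (a x)"
      using set_decode_less by auto
    ultimately have "set_decode (rec_nat 0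
        (\<lambda>y r. if y \<in> set_decode (a x) then ins (g x y) r else r) (a x)) = g x ` set_decode (a x)"
      by (simp only:)
    from arg_cong[OF this, of set_encode] show ?thesis by (simp add: image_code_def)
  qed
  ultimately show ?thesis by simp
qed

definition union_code :: "(nat \<Rightarrow> nat) \<Rightarrow> nat \<Rightarrow> nat" where
  "union_code g a = set_encode (\<Union>y\<in>set_decode a. set_decode (g y))"

lemma set_decode_union_code [simp]:
  "set_decode (union_code g a) = (\<Union>y\<in>set_decode a. set_decode (g y))"
  by (simp add: union_code_def)

definition un :: "nat \<Rightarrow> nat \<Rightarrow> nat" where
  "un a b = set_encode (set_decode a \<union> set_decode b)"

lemma set_decode_un [simp]: "set_decode (un a b) = set_decode a \<union> set_decode b"
  by (simp add: un_def)

lemma computable_un [computable_intros]: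
  assumes "computable a" "computable b"
  shows "computable (\<lambda>x. un (a x) (b x))"
proof -
  have "computable (\<lambda>x. rec_nat (b x) (\<lambda>y r. if y \<in> set_decode (a x) then ins y r else r) (a x))"
    by (intro computable_intros computable_comp[OF assms(1)] assms)
  moreover have "rec_nat d (\<lambda>y r. if y \<in> set_decode c then ins y r else r) c = un c d" for c d
  proof -
    have "set_decode (rec_nat d (\<lambda>y r. if y \<in> set_decode c then ins y r else r) n)
      = set_decode c \<inter> {..<n} \<union> set_decode d" for n
      by (induction n) (simp_all add: lessThan_Suc Int_insert_right)
    moreover have "set_decode c \<inter> {..<c} = set_decode c"
      using set_decode_less by auto
    ultimately have "set_decode (rec_nat d
        (\<lambda>y r. if y \<in> set_decode c then ins y r else r) c) = set_decode c \<union> set_decode d"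
      by (simp only:)
    from arg_cong[OF this, of set_encode] show ?thesis by (simp add: un_def)
  qed
  ultimately show ?thesis by simp
qed

lemma computable_union_code [computable_intros]:
  assumes "computable a" "computable (\<lambda>z. g (pfst z) (psnd z))"
  shows "computable (\<lambda>x. union_code (g x) (a x))"
proof -
  have *: "computable (\<lambda>z. g (psnd (psnd z)) (pfst z))"
    by (intro computable_curry[OF assms(2)] computable_intros)
  have "computable (\<lambda>x. rec_nat 0 (\<lambda>y r. if y \<in> set_decode (a x) then un (g x y) r else r) (a x))"
    by (intro computable_intros computable_comp[OF assms(1)] * assms)
  moreover have "rec_nat 0 (\<lambda>y r. if y \<in> set_decode (a x) then un (g x y) r else r) (a x)
      = union_code (g x) (a x)" for x
  proof -
    have "set_decode (rec_nat 0 (\<lambda>y r. if y \<in> set_decode (a x) then un (g x y) r else r) n)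
      = (\<Union>y\<in>set_decode (a x) \<inter> {..<n}. set_decode (g x y))" for n
      by (induction n) (simp_all add: lessThan_Suc Int_insert_right)
    moreover have "set_decode (a x) \<inter> {..<a x} = set_decode (a x)"
      using set_decode_less by auto
    ultimately have "set_decode (rec_nat 0
        (\<lambda>y r. if y \<in> set_decode (a x) then un (g x y) r else r) (a x))
        = (\<Union>y\<in>set_decode (a x). set_decode (g x y))"
      by (simp only:)
    from arg_cong[OF this, of set_encode] show ?thesis by (simp add: union_code_def)
  qed
  ultimately show ?thesis by simp
qed

text \<open>The table \<open>cov_table H n\<close> codes the graph of \<open>cov_rec H\<close> below \<open>n\<close>.\<close>

primrec cov_table :: "(nat \<Rightarrow> nat \<Rightarrow> nat) \<Rightarrow> nat \<Rightarrow> nat" where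
  "cov_table H 0 = 0"
| "cov_table H (Suc n) = ins (prod_encode (n, H n (cov_table H n))) (cov_table H n)"

definition cov_rec :: "(nat \<Rightarrow> nat \<Rightarrow> nat) \<Rightarrow> nat \<Rightarrow> nat" where
  "cov_rec H n = H n (cov_table H n)"

text \<open>The alternative \<open>T \<le> v\<close> makes the search succeed for every table. It
  does not spoil a stored value: the code of the stored pair is an element of the set coded by
  \<open>T\<close>, so this code, and with it \<open>v\<close>, is smaller than
  \<open>T\<close>.\<close>

definition look :: "nat \<Rightarrow> nat \<Rightarrow> nat" where
  "look T y = (LEAST v. prod_encode (y, v) \<in> set_decode T \<or> T \<le> v)"

lemma computable_look [computable_intros]:
  assumes "computable f" "computable g"
  shows "computable (\<lambda>x. look (f x) (g x))"
  unfolding look_def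
proof (intro computable_intros)
  show "\<exists>v. prod_encode (g x, v) \<in> set_decode (f x) \<or> f x \<le> v" for x by blast
qed (intro computable_intros computable_comp[OF assms(1)] computable_comp[OF assms(2)])+

lemma set_decode_cov_table:
  "set_decode (cov_table H n) = (\<lambda>i. prod_encode (i, cov_rec H i)) ` {..<n}"
  by (induction n) (auto simp: lessThan_Suc cov_rec_def)

lemma prod_encode_ge: "a + b \<le> prod_encode (a, b)"
proof -
  have "n \<le> triangle n" for n by (induction n) auto
  from this[of "a + b"] show ?thesis by (simp add: prod_encode_def)
qed

lemma look_cov_table:
  assumes "i < n" shows "look (cov_table H n) i = cov_rec H i"
  unfolding look_def
proof (rule Least_equality)
  have *: "prod_encode (i, v) \<in> set_decode (cov_table H n) \<longleftrightarrow> v = cov_rec H i" for v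
    using assms unfolding set_decode_cov_table by auto
  show "prod_encode (i, cov_rec H i) \<in> set_decode (cov_table H n) \<or> cov_table H n \<le> cov_rec H i"
    using * by blast
  have "prod_encode (i, cov_rec H i) < cov_table H n" using * set_decode_less by blast
  then have "cov_rec H i < cov_table H n" using prod_encode_ge[of i "cov_rec H i"] by linarith
  then show "\<And>v. prod_encode (i, v) \<in> set_decode (cov_table H n) \<or> cov_table H n \<le> v \<Longrightarrow> cov_rec H i \<le> v"
    using * by auto
qed

lemma computable_cov_rec:
  assumes "computable (\<lambda>z. H (pfst z) (psnd z))"
  shows "computable (cov_rec H)"
proof -
  have 1: "computable (\<lambda>z. H (pfst z) (pfst (psnd z)))"
    by (intro computable_curry[OF assms] computable_intros)
  have "computable (\<lambda>n. rec_nat 0 (\<lambda>y r. ins (prod_encode (y, H y r)) r) n)"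
    by (intro computable_intros 1)
  moreover have "rec_nat 0 (\<lambda>y r. ins (prod_encode (y, H y r)) r) n = cov_table H n" for n
    by (induction n) auto
  ultimately have "computable (\<lambda>n. cov_table H n)" by simp
  then have "computable (\<lambda>n. prod_encode (n, cov_table H n))" by (intro computable_intros)
  from computable_comp[OF assms this] show ?thesis by (simp add: cov_rec_def[abs_def])
qed

text \<open>A pair on an earlier diagonal has a smaller code. Recursions on pairs may therefore let
  one component grow as long as the sum falls.\<close>

lemma prod_encode_less:
  assumes "a + b < c + d" shows "prod_encode (a, b) < prod_encode (c, d)"
proof -
  have "triangle (Suc (a + b)) \<le> triangle (c + d)" using assms by (intro triangle_mono) auto
  then show ?thesis by (simp add: prod_encode_def)
qed

section \<open>Determinization of semigroup conditions\<close>

primrec segn :: "(nat \<Rightarrow> nat \<Rightarrow> nat) \<Rightarrow> (nat \<Rightarrow> nat) \<Rightarrow> nat \<Rightarrow> nat \<Rightarrow> nat" where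
  "segn m w i 0 = w i"
| "segn m w i (Suc n) = m (segn m w i n) (w (i + Suc n))"

text \<open>The product \<open>w i \<cdot> \<dots> \<cdot> w (j - 1)\<close>; for \<open>j \<le> i\<close> it has the junk value \<open>w i\<close>.\<close>

definition seg :: "(nat \<Rightarrow> nat \<Rightarrow> nat) \<Rightarrow> (nat \<Rightarrow> nat) \<Rightarrow> nat \<Rightarrow> nat \<Rightarrow> nat" where
  "seg m w i j = segn m w i (j - i - 1)"

lemma seg_single [simp]: "seg m w i (Suc i) = w i"
  by (simp add: seg_def)

lemma seg_Suc: "i < j \<Longrightarrow> seg m w i (Suc j) = m (seg m w i j) (w j)"
proof -
  assume "i < j"
  then obtain n where n: "j = i + Suc n" using less_imp_Suc_add by auto
  show ?thesis by (simp add: seg_def n)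
qed

lemma seg_cong:
  assumes "i < j" "\<And>l. i \<le> l \<Longrightarrow> l < j \<Longrightarrow> w l = w' l"
  shows "seg m w i j = seg m w' i j"
  using assms
proof (induction j)
  case (Suc j)
  then show ?case by (cases "i = j") (auto simp: seg_Suc)
qed simp

lemma seg_closed:
  assumes "i < j" "\<And>a b. a \<in> S \<Longrightarrow> b \<in> S \<Longrightarrow> m a b \<in> S" "\<And>l. i \<le> l \<Longrightarrow> l < j \<Longrightarrow> w l \<in> S"
  shows "seg m w i j \<in> S"
  using assms(1,3)
proof (induction j)
  case (Suc j)
  then show ?case by (cases "i = j") (auto simp: seg_Suc assms(2))
qed simp

lemma seg_shift:
  assumes "i < j" shows "seg m (\<lambda>l. w (l + d)) i j = seg m w (i + d) (j + d)"
  using assms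
proof (induction j)
  case (Suc j)
  then show ?case by (cases "i = j") (auto simp: seg_Suc)
qed simp

text \<open>A Ramsey factorization of the word at cut points \<open>p\<close> whose values form a
  linked pair in the sense of the theory of finite semigroups. The demand \<open>0 < p 0\<close>
  keeps away from the junk value of \<open>seg\<close> on empty segments.\<close>

definition linked_fact ::
  "(nat \<Rightarrow> nat \<Rightarrow> nat) \<Rightarrow> (nat \<Rightarrow> nat) \<Rightarrow> (nat \<Rightarrow> nat) \<Rightarrow> nat \<Rightarrow> nat \<Rightarrow> bool" where
  "linked_fact m w p s e \<longleftrightarrow> strict_mono p \<and> 0 < p 0 \<and> seg m w 0 (p 0) = s \<and>
     (\<forall>r. seg m w (p r) (p (Suc r)) = e) \<and> m s e = s \<and> m e e = e"

locale assoc_op =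
  fixes m :: "nat \<Rightarrow> nat \<Rightarrow> nat"
  assumes assoc: "m (m a b) c = m a (m b c)"
begin

lemma seg_split:
  assumes "i < j" "j < k" shows "seg m w i k = m (seg m w i j) (seg m w j k)"
  using assms(2)
proof (induction k)
  case (Suc k)
  show ?case
  proof (cases "j = k")
    case True
    then show ?thesis using assms(1) by (simp add: seg_Suc)
  next
    case False
    then show ?thesis using Suc assms(1) by (simp add: seg_Suc assoc)
  qed
qed simp

lemma linked_fact_seg:
  assumes "linked_fact m w p s e" "a < b" shows "seg m w (p a) (p b) = e"
  using assms(2)
proof (induction b)
  case (Suc b)
  note p = assms(1)[unfolded linked_fact_def]
  show ?case
  proof (cases "a = b")
    case False
    then have "seg m w (p a) (p (Suc b)) = m (seg m w (p a) (p b)) (seg m w (p b) (p (Suc b)))"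
      using Suc.prems p by (intro seg_split) (auto simp: strict_mono_less)
    then show ?thesis using Suc False p by auto
  qed (use p in auto)
qed simp

lemma linked_fact_seg0:
  assumes "linked_fact m w p s e" shows "seg m w 0 (p a) = s"
proof (cases a)
  case (Suc b)
  note p = assms[unfolded linked_fact_def]
  have "seg m w 0 (p a) = m (seg m w 0 (p 0)) (seg m w (p 0) (p a))"
    using p Suc by (intro seg_split) (auto simp: strict_mono_less)
  then show ?thesis using p linked_fact_seg[OF assms, of 0 a] Suc by auto
qed (use assms in \<open>auto simp: linked_fact_def\<close>)

text \<open>The equations of a linked pair absorb blocks that are joined, so cut points may be
  thinned out at will; later they are chosen such that a given state recurs at all of them.\<close>

lemma linked_fact_subseq:
  assumes "linked_fact m w p s e" "strict_mono g"
  shows "linked_fact m w (p \<circ> g) s e"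
proof -
  note p = assms(1)[unfolded linked_fact_def]
  have "g r < g (Suc r)" for r using assms(2) by (simp add: strict_mono_less)
  then have "seg m w (p (g r)) (p (g (Suc r))) = e" for r
    using linked_fact_seg[OF assms(1)] by blast
  moreover have "0 < p (g 0)" using p by (metis gr0I less_nat_zero_code strict_mono_less)
  ultimately show ?thesis
    using p linked_fact_seg0[OF assms(1)] assms(2)
    unfolding linked_fact_def by (auto simp: strict_mono_def)
qed

text \<open>The positions before \<open>k\<close> that are not merged at \<open>k\<close> with a smaller one, where positions
  merge when the products up to \<open>k\<close> starting from them coincide.\<close>

definition alive :: "(nat \<Rightarrow> nat) \<Rightarrow> nat \<Rightarrow> nat list" where
  "alive w k = filter (\<lambda>i. \<forall>i'<i. seg m w i' k \<noteq> seg m w i k) [0..<k]"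

text \<open>Position \<open>k\<close> itself joins the live ones when letter \<open>k\<close> is
  read: from then on it starts the product \<open>w k\<close>.\<close>

definition cand :: "(nat \<Rightarrow> nat) \<Rightarrow> nat \<Rightarrow> nat list" where
  "cand w k = alive w k @ [k]"

lemma sorted_cand: "sorted_wrt (<) (cand w k)"
  by (auto simp: cand_def alive_def sorted_wrt_append intro: sorted_wrt_filter)

lemma cand_less_iff:
  assumes "t < length (cand w k)" "t' < length (cand w k)"
  shows "cand w k ! t < cand w k ! t' \<longleftrightarrow> t < t'"
  using sorted_wrt_nth_less[OF sorted_cand] assms
  by (metis linorder_neqE_nat less_asym less_irrefl)

lemma cand_le: "t < length (cand w k) \<Longrightarrow> cand w k ! t \<le> k"
  using nth_mem[of t "cand w k"] by (auto simp: cand_def alive_def)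

text \<open>Two products that coincide once are extended by the same factor, so merging is
  irreversible.\<close>

lemma seg_merge_mono:
  assumes "seg m w i k = seg m w i' k" "i < k" "i' < k" "k \<le> k'"
  shows "seg m w i k' = seg m w i' k'"
proof (cases "k = k'")
  case False
  then have "k < k'" using assms(4) by simp
  from seg_split[OF assms(2) this, of w] seg_split[OF assms(3) this, of w] show ?thesis
    by (simp only: assms(1))
qed (use assms(1) in simp)

text \<open>What survives the reading of a letter can be decided among the candidates alone, so the
  live positions can be updated without remembering the merged ones.\<close>

lemma alive_Suc:
  "alive w (Suc k) = map ((!) (cand w k))
     (filter (\<lambda>t. \<forall>t'<t. seg m w (cand w k ! t') (Suc k) \<noteq> seg m w (cand w k ! t) (Suc k))
       [0..<length (cand w k)])" (is "_ = map _ (filter ?Q _)")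
proof -
  let ?G = "cand w k"
  define P where "P = (\<lambda>i. \<forall>i'<i. seg m w i' (Suc k) \<noteq> seg m w i (Suc k))"
  have "P i \<Longrightarrow> \<forall>i'<i. seg m w i' k \<noteq> seg m w i k" if "i < k" for i
    using seg_merge_mono[of w _ k i "Suc k"] that unfolding P_def by (metis le_SucI less_trans order_refl)
  then have "filter P [0..<k] = filter P (alive w k)"
    unfolding alive_def filter_filter by (intro filter_cong) auto
  then have 1: "alive w (Suc k) = filter P ?G"
    by (simp add: alive_def[of w "Suc k"] cand_def P_def)
  have "filter P ?G = filter P (map ((!) ?G) [0..<length ?G])" by (simp add: map_nth)
  also have "\<dots> = map ((!) ?G) (filter (\<lambda>t. P (?G ! t)) [0..<length ?G])"
    by (simp add: filter_map comp_def)
  also have "filter (\<lambda>t. P (?G ! t)) [0..<length ?G] = filter ?Q [0..<length ?G]"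
  proof (rule filter_cong[OF refl])
    fix t assume "t \<in> set [0..<length ?G]"
    then have t: "t < length ?G" by simp
    show "P (?G ! t) \<longleftrightarrow> ?Q t"
    proof
      assume "P (?G ! t)"
      then show "?Q t" unfolding P_def using cand_less_iff[of _ w k t] t by auto
    next
      assume Q: "?Q t"
      show "P (?G ! t)"
      proof (rule ccontr)
        assume "\<not> P (?G ! t)"
        then obtain i where i: "i < ?G ! t" "seg m w i (Suc k) = seg m w (?G ! t) (Suc k)"
          unfolding P_def by blast
        \<comment> \<open>The witness \<open>i\<close> need not be a candidate any more; the least
          position of its class is one, because it is not merged with anything smaller.\<close>
        define l where "l = (LEAST l. seg m w l (Suc k) = seg m w (?G ! t) (Suc k))"
        have l: "seg m w l (Suc k) = seg m w (?G ! t) (Suc k)"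
          unfolding l_def by (rule LeastI[of _ i]) (rule i)
        have "l \<le> i" unfolding l_def by (rule Least_le) (rule i)
        have "P l" unfolding P_def l using not_less_Least l_def by blast
        moreover have "l < Suc k" using \<open>l \<le> i\<close> i(1) cand_le[OF t] by linarith
        ultimately have "l \<in> set (alive w (Suc k))"
          unfolding alive_def P_def set_filter set_upt by auto
        then have "l \<in> set ?G" using 1 by auto
        then obtain t' where t': "t' < length ?G" "l = ?G ! t'" by (metis in_set_conv_nth)
        then have "t' < t" using cand_less_iff[OF t'(1) t] \<open>l \<le> i\<close> i(1) by simp
        then show False using Q l t' by auto
      qed
    qed
  qed
  finally show ?thesis using 1 by simp
qed

text \<open>The state of a deterministic automaton: the product from each live position up to now,
  and the product between any two live positions. The positions themselves are forgotten, which
  leaves finitely many states over a finite semigroup.\<close>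

definition key :: "(nat \<Rightarrow> nat) \<Rightarrow> nat \<Rightarrow> nat list \<times> nat list list" where
  "key w k = (map (\<lambda>i. seg m w i k) (alive w k),
     map (\<lambda>i. map (\<lambda>j. if i < j then seg m w i j else 0) (alive w k)) (alive w k))"

text \<open>Index \<open>length (fst \<kappa>)\<close> stands for the new position, whose product
  consists of the letter \<open>a\<close> alone; \<open>entry\<close> follows the same
  convention.\<close>

definition newval :: "nat list \<times> nat list list \<Rightarrow> nat \<Rightarrow> nat \<Rightarrow> nat" where
  "newval \<kappa> a t = (if t < length (fst \<kappa>) then m (fst \<kappa> ! t) a else a)"

definition entry :: "nat list \<times> nat list list \<Rightarrow> nat \<Rightarrow> nat \<Rightarrow> nat" where
  "entry \<kappa> t t' = (if t' < length (fst \<kappa>) then snd \<kappa> ! t ! t' else fst \<kappa> ! t)"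

definition upd :: "nat list \<times> nat list list \<Rightarrow> nat \<Rightarrow> nat list \<times> nat list list" where
  "upd \<kappa> a = (let idx = filter (\<lambda>t. \<forall>t'<t. newval \<kappa> a t' \<noteq> newval \<kappa> a t) [0..<Suc (length (fst \<kappa>))]
     in (map (newval \<kappa> a) idx, map (\<lambda>t. map (\<lambda>t'. if t < t' then entry \<kappa> t t' else 0) idx) idx))"

lemma length_key [simp]: "length (fst (key w k)) = length (alive w k)"
  by (simp add: key_def)

lemma newval_key:
  assumes "t \<le> length (alive w k)"
  shows "newval (key w k) (w k) t = seg m w (cand w k ! t) (Suc k)"
proof (cases "t < length (alive w k)")
  case True
  then have "alive w k ! t < k" using nth_mem[OF True] by (auto simp: alive_def)
  then show ?thesis using True by (simp add: newval_def key_def cand_def nth_append seg_Suc)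
next
  case False
  then show ?thesis using assms by (simp add: newval_def cand_def nth_append)
qed

lemma entry_key:
  assumes "t < t'" "t' \<le> length (alive w k)"
  shows "entry (key w k) t t' = seg m w (cand w k ! t) (cand w k ! t')"
proof (cases "t' < length (alive w k)")
  case True
  then have "alive w k ! t < alive w k ! t'"
    using cand_less_iff[of t w k t'] assms by (simp add: cand_def nth_append)
  then show ?thesis using True assms by (simp add: entry_def key_def cand_def nth_append)
next
  case False
  then show ?thesis using assms by (simp add: entry_def key_def cand_def nth_append)
qed

lemma key_Suc: "key w (Suc k) = upd (key w k) (w k)"
proof -
  let ?G = "cand w k" and ?n = "Suc (length (alive w k))" and ?\<kappa> = "key w k"
  have n: "length ?G = ?n" by (simp add: cand_def)
  define idx where "idx = filter (\<lambda>t. \<forall>t'<t. newval ?\<kappa> (w k) t' \<noteq> newval ?\<kappa> (w k) t) [0..<?n]"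
  have idx: "t < ?n" if "t \<in> set idx" for t using that unfolding idx_def set_filter set_upt by simp
  have "idx = filter (\<lambda>t. \<forall>t'<t. seg m w (?G ! t') (Suc k) \<noteq> seg m w (?G ! t) (Suc k)) [0..<length ?G]"
    unfolding idx_def n by (rule filter_cong) (auto simp: newval_key)
  then have al: "alive w (Suc k) = map ((!) ?G) idx" by (simp only: alive_Suc)
  have 1: "map (\<lambda>i. seg m w i (Suc k)) (alive w (Suc k)) = map (newval ?\<kappa> (w k)) idx"
    using idx by (auto simp: al newval_key less_Suc_eq_le)
  have 2: "(if ?G ! t < ?G ! t' then seg m w (?G ! t) (?G ! t') else 0)
      = (if t < t' then entry ?\<kappa> t t' else 0)" if "t \<in> set idx" "t' \<in> set idx" for t t'
    using cand_less_iff[of t w k t'] idx[OF that(1)] idx[OF that(2)] n by (auto simp: entry_key)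
  have "upd ?\<kappa> (w k) = (map (newval ?\<kappa> (w k)) idx,
      map (\<lambda>t. map (\<lambda>t'. if t < t' then entry ?\<kappa> t t' else 0) idx) idx)"
    unfolding upd_def idx_def by (simp add: Let_def)
  moreover have "snd (key w (Suc k)) = map (\<lambda>t. map (\<lambda>t'. if t < t' then entry ?\<kappa> t t' else 0) idx) idx"
    using 2 by (simp add: key_def al)
  ultimately show ?thesis using 1 by (simp add: key_def)
qed

lemma key_0: "key w 0 = ([], [])"
  by (simp add: key_def alive_def)

lemma key_cong:
  "(\<And>l. l < k \<Longrightarrow> w l = w' l) \<Longrightarrow> key w k = key w' k"
  by (induction k) (auto simp: key_0 key_Suc)

text \<open>The merges caused by letter \<open>a\<close>: of the candidates \<open>t < t'\<close>
  the later one disappears, \<open>e\<close> is the product between them and \<open>s\<close> the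
  product of the whole word before the later one. The latter is available because position 0 is
  never merged away and always has index 0.\<close>

definition events :: "nat list \<times> nat list list \<Rightarrow> nat \<Rightarrow> (nat \<times> nat \<times> nat) set" where
  "events \<kappa> a = {(t, entry \<kappa> t t', entry \<kappa> 0 t') | t t'.
     t < t' \<and> t' \<le> length (fst \<kappa>) \<and> newval \<kappa> a t = newval \<kappa> a t'}"

lemma finite_events: "finite (events \<kappa> a)"
proof -
  have "events \<kappa> a \<subseteq> (\<lambda>(t, t'). (t, entry \<kappa> t t', entry \<kappa> 0 t'))
      ` ({..length (fst \<kappa>)} \<times> {..length (fst \<kappa>)})"
    by (force simp: events_def)
  then show ?thesis by (rule finite_subset) auto
qed

end

section \<open>The parity condition on keys over a finite semigroup\<close>

locale fin_semigroup = assoc_op +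
  fixes S :: "nat set"
  assumes finite_S: "finite S" and closed: "a \<in> S \<Longrightarrow> b \<in> S \<Longrightarrow> m a b \<in> S"
begin

lemma seg_in: "(\<And>k. w k \<in> S) \<Longrightarrow> i < j \<Longrightarrow> seg m w i j \<in> S"
  using seg_closed closed by blast

lemma length_alive:
  assumes "\<And>k. w k \<in> S" shows "length (alive w k) \<le> card S"
proof -
  have "inj_on (\<lambda>i. seg m w i k) (set (alive w k))"
    by (rule inj_onI) (auto simp: alive_def, metis linorder_neqE_nat)
  moreover have "(\<lambda>i. seg m w i k) ` set (alive w k) \<subseteq> S"
    using assms by (auto simp: alive_def intro!: seg_in)
  ultimately have "card (set (alive w k)) \<le> card S" using finite_S by (metis card_inj_on_le)
  moreover have "distinct (alive w k)" by (simp add: alive_def)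
  ultimately show ?thesis by (simp add: distinct_card)
qed

definition bound where "bound = Suc (Max S)"

lemma S_bound: "a \<in> S \<Longrightarrow> a < bound"
  using finite_S by (simp add: bound_def le_imp_less_Suc)

definition event_code :: "nat \<times> nat \<times> nat \<Rightarrow> nat" where
  "event_code = (\<lambda>(t, e, s). (t * bound + e) * bound + s)"

text \<open>The least priority seen infinitely often counts. Events are ordered by their index
  first, since below the least recurring index nothing merges any more and the occupants are stable;
  the last bit records acceptance. A step without event gets a value above those of all
  events.\<close>

definition prio :: "(nat \<Rightarrow> nat \<Rightarrow> bool) \<Rightarrow> nat list \<times> nat list list \<Rightarrow> nat \<Rightarrow> nat" where
  "prio acc \<kappa> a = (if events \<kappa> a = {} then 2 * (card S * bound * bound)
     else Min ((\<lambda>(t, e, s). 2 * event_code (t, e, s) + (if acc s e then 0 else 1)) ` events \<kappa> a))"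

lemma event_code_less:
  assumes "t < j" "e < bound" "s < bound"
  shows "event_code (t, e, s) < j * bound * bound"
proof -
  have "(t * bound + e) * bound + s < (t * bound + e) * bound + bound" using assms by simp
  also have "\<dots> = (t * bound + Suc e) * bound" by (simp add: algebra_simps)
  also have "\<dots> \<le> (Suc t * bound) * bound" using assms by (intro mult_right_mono) auto
  also have "\<dots> \<le> (j * bound) * bound" using assms by (intro mult_right_mono) auto
  finally show ?thesis by (simp add: event_code_def)
qed

lemma event_code_inj:
  assumes "event_code (t, e, s) = event_code (t', e', s')" "e < bound" "s < bound" "e' < bound" "s' < bound"
  shows "t = t' \<and> e = e' \<and> s = s'"
proof -
  have 1: "(a * bound + b) div bound = a" "(a * bound + b) mod bound = b" if "b < bound" for a b
    using that by auto
  have "s = s'" "t * bound + e = t' * bound + e'"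
    using arg_cong[OF assms(1), of "\<lambda>x. x mod bound"] arg_cong[OF assms(1), of "\<lambda>x. x div bound"] assms
    by (simp_all add: event_code_def 1)
  moreover from arg_cong[OF this(2), of "\<lambda>x. x mod bound"] arg_cong[OF this(2), of "\<lambda>x. x div bound"]
  have "e = e'" "t = t'" using assms by (simp_all add: 1)
  ultimately show ?thesis by simp
qed

lemma alive_nth_0: "0 < k \<Longrightarrow> alive w k \<noteq> [] \<and> alive w k ! 0 = 0"
proof -
  assume "0 < k"
  then have "[0..<k] = 0 # [1..<k]" by (simp add: upt_rec)
  then show ?thesis by (simp add: alive_def)
qed

text \<open>If the least index \<open>j\<close> occurring in infinitely many events is constantly occupied by the
  position \<open>c\<close>, then infinitely many positions \<open>p\<close> with \<open>w[c,p) = e\<close> are merged with \<open>c\<close>; suitably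
  thinned out, they cut \<open>w\<close> into factors equal to \<open>e\<close>.\<close>

theorem parity_linked_fact:
  fixes acc :: "nat \<Rightarrow> nat \<Rightarrow> bool"
  assumes w: "\<And>k. w k \<in> S"
  defines "pr \<equiv> \<lambda>k. prio acc (key w k) (w k)"
  defines "P \<equiv> (LEAST P. \<exists>\<^sub>\<infinity>k. pr k = P)"
  shows "\<exists>p s e. linked_fact m w p s e \<and> (even P \<longleftrightarrow> acc s e)"
proof -
  let ?B = "2 * (card S * bound * bound)"
  have ev: "(t, e, s) \<in> events (key w k) (w k) \<longleftrightarrow> (\<exists>t'. t < t' \<and> t' \<le> length (alive w k) \<and>
      e = seg m w (cand w k ! t) (cand w k ! t') \<and> s = seg m w 0 (cand w k ! t') \<and>
      seg m w (cand w k ! t) (Suc k) = seg m w (cand w k ! t') (Suc k))" for t e s k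
  proof -
    have "cand w k ! 0 = 0" if "0 < length (alive w k)"
      using that alive_nth_0[of k w] by (cases "k = 0") (auto simp: cand_def nth_append alive_def)
    then have 0: "entry (key w k) 0 t' = seg m w 0 (cand w k ! t')" if "0 < t'" "t' \<le> length (alive w k)" for t'
      using entry_key[OF that] that by (cases "alive w k = []") auto
    have "(t, e, s) \<in> events (key w k) (w k) \<longleftrightarrow> (\<exists>t'. t < t' \<and> t' \<le> length (alive w k) \<and>
      e = entry (key w k) t t' \<and> s = entry (key w k) 0 t' \<and>
      newval (key w k) (w k) t = newval (key w k) (w k) t')"
      by (auto simp: events_def)
    also have "\<dots> \<longleftrightarrow> (\<exists>t'. t < t' \<and> t' \<le> length (alive w k) \<and>
      e = seg m w (cand w k ! t) (cand w k ! t') \<and> s = seg m w 0 (cand w k ! t') \<and>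
      seg m w (cand w k ! t) (Suc k) = seg m w (cand w k ! t') (Suc k))"
      by (intro ex_cong1 conj_cong refl) (simp_all add: newval_key entry_key[of t] 0)
    finally show ?thesis .
  qed
  have inS: "t < card S" "e \<in> S" "s \<in> S" if "(t, e, s) \<in> events (key w k) (w k)" for t e s k
  proof -
    from that ev obtain t' where t': "t < t'" "t' \<le> length (alive w k)"
      "e = seg m w (cand w k ! t) (cand w k ! t')" "s = seg m w 0 (cand w k ! t')" by blast
    show "t < card S" using t' length_alive[of w k, OF w] by linarith
    have "cand w k ! t < cand w k ! t'" using t' cand_less_iff[of t w k t'] by (simp add: cand_def)
    then show "e \<in> S" "s \<in> S" unfolding t' by (auto intro!: seg_in w)
  qed
  have pr_le: "pr k \<le> 2 * event_code (t, e, s) + (if acc s e then 0 else 1)"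
    if "(t, e, s) \<in> events (key w k) (w k)" for k t e s
  proof -
    let ?f = "\<lambda>(t, e, s). 2 * event_code (t, e, s) + (if acc s e then 0 else 1)"
    have "events (key w k) (w k) \<noteq> {}" using that by blast
    then have "pr k = Min (?f ` events (key w k) (w k))" by (simp add: pr_def prio_def)
    also have "\<dots> \<le> ?f (t, e, s)"
      by (intro Min_le finite_imageI finite_events imageI that)
    finally show ?thesis by simp
  qed
  have pr_ev: "\<exists>t e s. (t, e, s) \<in> events (key w k) (w k) \<and>
      pr k = 2 * event_code (t, e, s) + (if acc s e then 0 else 1)"
    if "events (key w k) (w k) \<noteq> {}" for k
  proof -
    let ?f = "\<lambda>(t, e, s). 2 * event_code (t, e, s) + (if acc s e then 0 else 1)"
    have "Min (?f ` events (key w k) (w k)) \<in> ?f ` events (key w k) (w k)"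
      using that finite_events by (intro Min_in) auto
    then obtain x where x: "x \<in> events (key w k) (w k)" "Min (?f ` events (key w k) (w k)) = ?f x"
      by blast
    obtain t e s where "x = (t, e, s)" by (cases x) auto
    moreover have "pr k = Min (?f ` events (key w k) (w k))" using that by (simp add: pr_def prio_def)
    ultimately show ?thesis using x by (intro exI[of _ t] exI[of _ e] exI[of _ s]) simp
  qed
  have pr_less: "pr k < ?B" if ne: "events (key w k) (w k) \<noteq> {}" for k
  proof -
    from pr_ev[OF ne] obtain t e s where *: "(t, e, s) \<in> events (key w k) (w k)"
      "pr k = 2 * event_code (t, e, s) + (if acc s e then 0 else 1)" by blast
    show ?thesis using event_code_less[of t "card S" e s] inS[OF *(1)] S_bound *(2) by auto
  qed
  \<comment> \<open>Without merges the list of live positions would grow in every step, but its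
    length is bounded by \<open>card S\<close>.\<close>
  have inf_ev: "\<exists>\<^sub>\<infinity>k. events (key w k) (w k) \<noteq> {}"
  proof (rule ccontr)
    assume "\<not> ?thesis"
    then obtain K where K: "\<And>k. k \<ge> K \<Longrightarrow> events (key w k) (w k) = {}"
      by (auto simp: not_INFM MOST_nat_le)
    have len: "length (alive w (Suc k)) = Suc (length (alive w k))" if "k \<ge> K" for k
    proof -
      have lc: "length (cand w k) = Suc (length (alive w k))" by (simp add: cand_def)
      have "\<not> (\<exists>t t'. t < t' \<and> t' \<le> length (alive w k) \<and>
          seg m w (cand w k ! t) (Suc k) = seg m w (cand w k ! t') (Suc k))"
        using K[OF that] ev by blast
      then have "filter (\<lambda>t. \<forall>t'<t. seg m w (cand w k ! t') (Suc k) \<noteq> seg m w (cand w k ! t) (Suc k))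
        [0..<length (cand w k)] = [0..<length (cand w k)]"
        by (intro filter_True) (unfold set_upt, auto simp: lc less_Suc_eq_le)
      then show ?thesis by (simp only: alive_Suc length_map length_upt lc)
    qed
    have "length (alive w (K + n)) \<ge> n" for n by (induction n) (auto simp: len)
    from this[of "Suc (card S)"] length_alive[of w "K + Suc (card S)", OF w] show False by simp
  qed
  have "\<exists>P<?B. \<exists>\<^sub>\<infinity>k. pr k = P"
  proof (rule ccontr)
    assume "\<not> ?thesis"
    then have "\<forall>P\<in>{..<?B}. \<forall>\<^sub>\<infinity>k. pr k \<noteq> P" by (simp add: not_INFM)
    then have "\<forall>\<^sub>\<infinity>k. \<forall>P\<in>{..<?B}. pr k \<noteq> P" by (simp add: eventually_ball_finite_distrib)
    then have "\<forall>\<^sub>\<infinity>k. \<not> pr k < ?B" by (rule MOST_mono) auto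
    moreover have "\<exists>\<^sub>\<infinity>k. pr k < ?B" using inf_ev by (rule INFM_mono) (rule pr_less)
    ultimately show False unfolding frequently_def by blast
  qed
  then obtain P0 where P0: "P0 < ?B" "\<exists>\<^sub>\<infinity>k. pr k = P0" by blast
  have P_inf: "\<exists>\<^sub>\<infinity>k. pr k = P" unfolding P_def by (rule LeastI[of _ P0]) (rule P0)
  have "P \<le> P0" unfolding P_def by (rule Least_le) (rule P0)
  then have PB: "P < ?B" using P0 by simp
  have "\<forall>Q\<in>{..<P}. \<forall>\<^sub>\<infinity>k. pr k \<noteq> Q" 
    using not_less_Least[of _ "\<lambda>P. \<exists>\<^sub>\<infinity>k. pr k = P"] by (auto simp: P_def not_INFM)
  then have "\<forall>\<^sub>\<infinity>k. \<forall>Q\<in>{..<P}. pr k \<noteq> Q" by (simp add: eventually_ball_finite_distrib)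
  then obtain K where K: "\<And>k. k \<ge> K \<Longrightarrow> P \<le> pr k"
    by (auto simp: MOST_nat_le not_less[symmetric])
  have P_ev: "\<exists>t e s. (t, e, s) \<in> events (key w k) (w k) \<and>
      P = 2 * event_code (t, e, s) + (if acc s e then 0 else 1)" if "pr k = P" for k
  proof -
    have "events (key w k) (w k) \<noteq> {}" using that PB by (auto simp: pr_def prio_def)
    from pr_ev[OF this] that show ?thesis by simp
  qed
  from P_inf obtain k1 where k1: "k1 \<ge> K" "pr k1 = P" unfolding INFM_nat_le by blast
  from P_ev[OF k1(2)] obtain j e s where jes: "(j, e, s) \<in> events (key w k1) (w k1)"
    "P = 2 * event_code (j, e, s) + (if acc s e then 0 else 1)" by blast
  note jesS = inS[OF jes(1)]
  have evP: "(j, e, s) \<in> events (key w k) (w k)" if k: "pr k = P" for k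
  proof -
    from P_ev[OF k] obtain t e' s' where t: "(t, e', s') \<in> events (key w k) (w k)"
      "P = 2 * event_code (t, e', s') + (if acc s' e' then 0 else 1)" by blast
    have "event_code (j, e, s) = P div 2" "event_code (t, e', s') = P div 2"
      unfolding jes(2) using t(2) unfolding jes(2) by (auto split: if_splits)
    then have "event_code (t, e', s') = event_code (j, e, s)" by simp
    then have "t = j \<and> e' = e \<and> s' = s"
      by (rule event_code_inj) (use inS[OF t(1)] jesS S_bound in auto)
    then show ?thesis using t by simp
  qed
  \<comment> \<open>From \<open>K\<close> on no event has a smaller index, as its priority would lie
    below \<open>P\<close>.\<close>
  have ge_j: "j \<le> t" if k: "k \<ge> K" and t: "(t, e', s') \<in> events (key w k) (w k)" for k t e' s'
  proof (rule ccontr)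
    assume "\<not> j \<le> t"
    then have "event_code (t, e', s') < j * bound * bound"
      using event_code_less inS[OF t] S_bound by auto
    also have "\<dots> \<le> event_code (j, e, s)" by (simp add: event_code_def algebra_simps)
    finally have "2 * event_code (t, e', s') + 1 < P" unfolding jes(2) by auto
    moreover have "pr k \<le> 2 * event_code (t, e', s') + 1" using pr_le[OF t] by (auto split: if_splits)
    ultimately show False using K[OF k] by simp
  qed
  \<comment> \<open>A candidate with index at most \<open>j\<close> could vanish only by an event
    with an index below \<open>j\<close>. Hence index \<open>j\<close> keeps its position for ever;
    this position is called \<open>c\<close> below.\<close>
  have stable: "j < length (alive w (Suc k)) \<and> alive w (Suc k) ! j = alive w k ! j"
    if k: "k \<ge> K" and j: "j < length (alive w k)" for k
  proof -
    let ?G = "cand w k"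
    let ?Q = "\<lambda>t. \<forall>t'<t. seg m w (?G ! t') (Suc k) \<noteq> seg m w (?G ! t) (Suc k)"
    have Q: "?Q t" if "t \<le> j" for t
    proof (intro allI impI notI)
      fix t' assume "t' < t" "seg m w (?G ! t') (Suc k) = seg m w (?G ! t) (Suc k)"
      then have "(t', seg m w (?G ! t') (?G ! t), seg m w 0 (?G ! t)) \<in> events (key w k) (w k)"
        unfolding ev using j that by auto
      from ge_j[OF k this] show False using \<open>t' < t\<close> that by simp
    qed
    have jG: "Suc j \<le> length ?G" using j by (simp add: cand_def)
    then have "[0..<length ?G] = [0..<Suc j] @ [Suc j..<length ?G]"
      by (metis le_add_diff_inverse upt_add_eq_append zero_le)
    then have "filter ?Q [0..<length ?G] = [0..<Suc j] @ filter ?Q [Suc j..<length ?G]"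
      by (simp only: filter_append) (simp add: Q filter_id_conv)
    then have al: "alive w (Suc k) = map ((!) ?G) ([0..<Suc j] @ filter ?Q [Suc j..<length ?G])"
      by (simp only: alive_Suc)
    have "map ((!) ?G) ([0..<Suc j] @ ys) ! j = ?G ! j" for ys
      by (simp add: nth_append)
    then have "alive w (Suc k) ! j = ?G ! j" unfolding al .
    then show ?thesis using j unfolding al by (simp add: cand_def nth_append)
  qed
  have jk1: "j < length (alive w k1)" using jes(1) unfolding ev by auto
  define c where "c = alive w k1 ! j"
  have st: "j < length (alive w (k1 + n)) \<and> alive w (k1 + n) ! j = c" for n
    by (induction n) (use jk1 stable k1(1) c_def in auto)
  define p where "p k = (SOME p. c < p \<and> p \<le> k \<and> p \<in> set (cand w k) \<and> seg m w c p = e \<and>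
    seg m w 0 p = s \<and> seg m w c (Suc k) = seg m w p (Suc k))" for k
  have p: "c < p k \<and> p k \<le> k \<and> p k \<in> set (cand w k) \<and> seg m w c (p k) = e \<and>
    seg m w 0 (p k) = s \<and> seg m w c (Suc k) = seg m w (p k) (Suc k)" if k: "k \<ge> k1" "pr k = P" for k
  proof -
    have c: "cand w k ! j = c" using st[of "k - k1"] k(1) by (simp add: cand_def nth_append)
    from evP[OF k(2)] obtain t' where t': "j < t'" "t' \<le> length (alive w k)"
      "e = seg m w (cand w k ! j) (cand w k ! t')" "s = seg m w 0 (cand w k ! t')"
      "seg m w (cand w k ! j) (Suc k) = seg m w (cand w k ! t') (Suc k)" unfolding ev by blast
    have len: "t' < length (cand w k)" using t' by (simp add: cand_def)
    show ?thesis unfolding p_def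
      by (rule someI[of _ "cand w k ! t'"])
        (use t' c len cand_less_iff[of j w k t'] cand_le[OF len] nth_mem[OF len] in auto)
  qed
  let ?A = "{k. k \<ge> k1 \<and> pr k = P}"
  have infA: "infinite ?A"
  proof
    assume "finite ?A"
    then obtain n where "\<forall>k\<in>?A. k < n" using finite_nat_set_iff_bounded by blast
    then show False using P_inf unfolding INFM_nat_le
      by (metis (mono_tags, lifting) leD le_trans linear mem_Collect_eq)
  qed
  \<comment> \<open>Once merged with the smaller \<open>c\<close>, a position is dead and cannot be
    a candidate again, so different events concern different positions.\<close>
  have "p k \<noteq> p k'" if "k \<in> ?A" "k' \<in> ?A" "k < k'" for k k'
  proof
    assume eq: "p k = p k'"
    have pk: "c < p k" "p k \<le> k" "seg m w c (Suc k) = seg m w (p k) (Suc k)" using p that by auto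
    have "p k \<in> set (cand w k')" using p[of k'] that eq by auto
    then have "p k \<in> set (alive w k')" using pk that by (auto simp: cand_def)
    moreover have "seg m w c k' = seg m w (p k) k'"
      using seg_merge_mono[OF pk(3), of k'] pk that by auto
    ultimately show False using pk(1) by (auto simp: alive_def)
  qed
  then have "inj_on p ?A" by (intro inj_onI) (metis linorder_neqE_nat)
  then have inf_p: "infinite (p ` ?A)" using infA finite_image_iff by blast
  have ex: "\<exists>k. k \<in> ?A \<and> p k > L" for L
  proof (rule ccontr)
    assume "\<not> ?thesis"
    then have "p ` ?A \<subseteq> {..L}" by fastforce
    then show False using inf_p finite_subset by blast
  qed
  define nx where "nx L = (SOME k. k \<in> ?A \<and> p k > L)" for L
  have nx: "nx L \<ge> k1" "pr (nx L) = P" "p (nx L) > L" for L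
    using someI_ex[OF ex[of L]] unfolding nx_def by auto
  \<comment> \<open>Each chosen position lies beyond the time at which the previous one has merged
    with \<open>c\<close>.\<close>
  define g where "g = rec_nat (nx 0) (\<lambda>_ k. nx (Suc k))"
  have g0: "g 0 = nx 0" and gS: "g (Suc r) = nx (Suc (g r))" for r by (simp_all add: g_def)
  have g: "g r \<ge> k1" "pr (g r) = P" for r by (cases r; simp add: g0 gS nx)+
  have lt: "Suc (g r) < p (g (Suc r))" for r using nx(3)[of "Suc (g r)"] by (simp add: gS)
  \<comment> \<open>After the merge the start \<open>p (g a)\<close> may be exchanged for
    \<open>c\<close>, from where the product up to \<open>p (g b)\<close> is
    \<open>e\<close>.\<close>
  have segr: "seg m w (p (g a)) (p (g b)) = e" if "Suc (g a) < p (g b)" for a b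
  proof -
    note pa = p[OF g, of a] and pb = p[OF g, of b]
    have "seg m w (p (g a)) (p (g b)) = m (seg m w (p (g a)) (Suc (g a))) (seg m w (Suc (g a)) (p (g b)))"
      using pa that by (intro seg_split) auto
    also have "\<dots> = m (seg m w c (Suc (g a))) (seg m w (Suc (g a)) (p (g b)))" using pa by simp
    also have "\<dots> = seg m w c (p (g b))" using pa that by (intro seg_split[symmetric]) auto
    finally show ?thesis using pb by simp
  qed
  have lt2: "p (g r) < p (g (Suc r))" for r using lt[of r] p[OF g, of r] by linarith
  have segr1: "seg m w (p (g r)) (p (g (Suc r))) = e" for r by (rule segr) (rule lt)
  \<comment> \<open>Two consecutive blocks together also have product \<open>e\<close>, which makes
    \<open>e\<close> idempotent.\<close>
  have "seg m w (p (g 0)) (p (g 2)) = e"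
    using lt[of 0] lt2[of 1] by (intro segr) (simp add: numeral_2_eq_2)
  moreover have "seg m w (p (g 0)) (p (g 2)) = m (seg m w (p (g 0)) (p (g 1))) (seg m w (p (g 1)) (p (g 2)))"
    using lt2[of 0] lt2[of 1] by (intro seg_split) (auto simp: numeral_2_eq_2)
  ultimately have ee: "m e e = e" using segr1[of 0] segr1[of 1] by (simp add: numeral_2_eq_2)
  have "seg m w 0 (p (g 1)) = m (seg m w 0 (p (g 0))) (seg m w (p (g 0)) (p (g 1)))"
    using lt2[of 0] p[OF g, of 0] by (intro seg_split) auto
  then have se: "m s e = s" using p[OF g, of 0] p[OF g, of 1] segr1[of 0] by simp
  have "linked_fact m w (p \<circ> g) s e"
    unfolding linked_fact_def using lt2 segr1 ee se p[OF g, of 0]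
    by (auto simp: strict_mono_Suc_iff)
  moreover have "even P \<longleftrightarrow> acc s e" using jes(2) by simp
  ultimately show "\<exists>p s e. linked_fact m w p s e \<and> (even P \<longleftrightarrow> acc s e)" by blast
qed

lemma linked_fact_exists:
  assumes "\<And>k. w k \<in> S" obtains p s e where "linked_fact m w p s e"
  using parity_linked_fact[of w "\<lambda>_ _. True", OF assms] that by blast

end

section \<open>Positional determinacy of finite parity games\<close>

locale parity_game =
  fixes own :: "'v \<Rightarrow> bool" and E :: "('v \<times> 'v) set" and pr :: "'v \<Rightarrow> nat"
begin

definition limp :: "(nat \<Rightarrow> 'v) \<Rightarrow> nat" where
  "limp \<pi> = (LEAST P. \<exists>\<^sub>\<infinity>k. pr (\<pi> k) = P)"

text \<open>Players are booleans and \<open>own v\<close> names the owner of \<open>v\<close>;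
  player \<open>True\<close> aims at an even value.\<close>

definition pwin :: "bool \<Rightarrow> (nat \<Rightarrow> 'v) \<Rightarrow> bool" where
  "pwin b \<pi> \<longleftrightarrow> (even (limp \<pi>) \<longleftrightarrow> b)"

lemma INFM_shift: "(\<exists>\<^sub>\<infinity>k. P (k + n)) \<longleftrightarrow> (\<exists>\<^sub>\<infinity>k::nat. P k)"
proof
  assume *: "\<exists>\<^sub>\<infinity>k. P (k + n)"
  show "\<exists>\<^sub>\<infinity>k. P k" unfolding INFM_nat_le
  proof
    fix l
    from * obtain k where "k \<ge> l" "P (k + n)" unfolding INFM_nat_le by blast
    then show "\<exists>k\<ge>l. P k" by (intro exI[of _ "k + n"]) auto
  qed
next
  assume *: "\<exists>\<^sub>\<infinity>k. P k"
  show "\<exists>\<^sub>\<infinity>k. P (k + n)" unfolding INFM_nat_le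
  proof
    fix l
    from * obtain k where "k \<ge> l + n" "P k" unfolding INFM_nat_le by blast
    then show "\<exists>k\<ge>l. P (k + n)" by (intro exI[of _ "k - n"]) auto
  qed
qed

lemma pwin_shift: "pwin b (\<lambda>k. \<pi> (k + n)) \<longleftrightarrow> pwin b \<pi>"
  unfolding pwin_def limp_def using INFM_shift[of "\<lambda>k. pr (\<pi> k) = _"] by simp

section \<open>Winning regions and attractors\<close>

definition follows :: "bool \<Rightarrow> 'v set \<Rightarrow> ('v \<Rightarrow> 'v) \<Rightarrow> (nat \<Rightarrow> 'v) \<Rightarrow> bool" where
  "follows b U \<sigma> \<pi> \<longleftrightarrow> (\<forall>k. \<pi> k \<in> U \<and> (\<pi> k, \<pi> (Suc k)) \<in> E \<and>
     (own (\<pi> k) = b \<longrightarrow> \<pi> (Suc k) = \<sigma> (\<pi> k)))"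

text \<open>The arena \<open>V\<close> is a parameter because the determinacy proof passes to
  subarenas of the same graph: the opponent is only kept from leaving \<open>U\<close> for other
  vertices of \<open>V\<close>.\<close>

definition wins :: "bool \<Rightarrow> 'v set \<Rightarrow> 'v set \<Rightarrow> ('v \<Rightarrow> 'v) \<Rightarrow> bool" where
  "wins b V U \<sigma> \<longleftrightarrow> U \<subseteq> V \<and> (\<forall>v\<in>U. own v = b \<longrightarrow> (v, \<sigma> v) \<in> E \<and> \<sigma> v \<in> U) \<and>
     (\<forall>v\<in>U. own v \<noteq> b \<longrightarrow> (\<forall>u\<in>V. (v, u) \<in> E \<longrightarrow> u \<in> U)) \<and>
     (\<forall>\<pi>. follows b U \<sigma> \<pi> \<longrightarrow> pwin b \<pi>)"

definition total :: "'v set \<Rightarrow> bool" where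
  "total V \<longleftrightarrow> (\<forall>v\<in>V. \<exists>u\<in>V. (v, u) \<in> E)"

primrec stage :: "bool \<Rightarrow> 'v set \<Rightarrow> 'v set \<Rightarrow> nat \<Rightarrow> 'v set" where
  "stage b V T 0 = T"
| "stage b V T (Suc n) = stage b V T n \<union>
     {v \<in> V. if own v = b then \<exists>u\<in>stage b V T n. (v, u) \<in> E
        else \<forall>u\<in>V. (v, u) \<in> E \<longrightarrow> u \<in> stage b V T n}"

definition attr :: "bool \<Rightarrow> 'v set \<Rightarrow> 'v set \<Rightarrow> 'v set" where
  "attr b V T = (\<Union>n. stage b V T n)"

lemma stage_mono: "n \<le> n' \<Longrightarrow> stage b V T n \<subseteq> stage b V T n'"
  by (rule lift_Suc_mono_le) auto

lemma stage_subset: "T \<subseteq> V \<Longrightarrow> stage b V T n \<subseteq> V"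
  by (induction n) auto

lemma attr_subset: "T \<subseteq> V \<Longrightarrow> attr b V T \<subseteq> V"
  unfolding attr_def by (rule UN_least) (rule stage_subset)

lemma subset_attr: "T \<subseteq> attr b V T"
  unfolding attr_def using UN_upper[of 0 UNIV "stage b V T"] by simp

lemma attr_own:
  assumes "v \<in> V - attr b V T" "own v = b" "u \<in> attr b V T" shows "(v, u) \<notin> E"
proof
  assume e: "(v, u) \<in> E"
  from assms(3) obtain n where "u \<in> stage b V T n" by (auto simp: attr_def)
  then have "v \<in> stage b V T (Suc n)" using assms e by auto
  then show False using assms(1) unfolding attr_def by blast
qed

text \<open>Otherwise all successors in \<open>V\<close> lie in the attractor and, being finitely
  many, already in one stage; then \<open>v\<close> would enter at the next stage.\<close>

lemma attr_opp:
  assumes "finite V" "v \<in> V - attr b V T" "own v \<noteq> b"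
  shows "\<exists>u\<in>V - attr b V T. (v, u) \<in> E"
proof (rule ccontr)
  assume neg: "\<not> ?thesis"
  let ?N = "{u \<in> V. (v, u) \<in> E}"
  have "\<forall>u\<in>?N. \<exists>n. u \<in> stage b V T n" using neg by (auto simp: attr_def)
  then obtain f where f: "\<forall>u\<in>?N. u \<in> stage b V T (f u)" by metis
  have "\<exists>N. \<forall>u\<in>?N. f u \<le> N"
    using finite_nat_set_iff_bounded_le[of "f ` ?N"] assms(1) by auto
  then obtain N where N: "\<forall>u\<in>?N. f u \<le> N" ..
  have "\<forall>u\<in>?N. u \<in> stage b V T N" using f N stage_mono by blast
  then have "v \<in> stage b V T (Suc N)" using assms by simp
  then show False using assms(2) unfolding attr_def by blast
qed

text \<open>Outside the attractor player \<open>b\<close> has no edge into it and the opponent has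
  an edge avoiding it, so what remains is again a game without dead ends.\<close>

lemma total_minus_attr:
  assumes "finite V" "total V" shows "total (V - attr b V T)"
  unfolding total_def
proof
  fix v assume v: "v \<in> V - attr b V T"
  show "\<exists>u\<in>V - attr b V T. (v, u) \<in> E"
  proof (cases "own v = b")
    case True
    obtain u where "u \<in> V" "(v, u) \<in> E" using assms v by (auto simp: total_def)
    then show ?thesis using attr_own[OF v True] by blast
  qed (use attr_opp[OF assms(1) v] in blast)
qed

text \<open>The rank is the first stage that contains a vertex. Before \<open>T\<close> is reached,
  player \<open>b\<close> can decrease it, and every move of the opponent decreases it.\<close>

lemma attr_strategy:
  assumes "T \<subseteq> V"
  shows "\<exists>\<sigma> rk.
    (\<forall>v. v \<in> attr b V T - T \<longrightarrow> own v = b \<longrightarrow>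
      (v, \<sigma> v) \<in> E \<and> \<sigma> v \<in> attr b V T \<and> rk (\<sigma> v) < (rk v :: nat)) \<and>
    (\<forall>v u. v \<in> attr b V T - T \<longrightarrow> own v \<noteq> b \<longrightarrow> u \<in> V \<longrightarrow> (v, u) \<in> E \<longrightarrow>
       u \<in> attr b V T \<and> rk u < rk v)"
proof -
  define rk where "rk v = (LEAST n. v \<in> stage b V T n)" for v
  define \<sigma> where "\<sigma> v = (SOME u. (v, u) \<in> E \<and> u \<in> stage b V T (rk v - 1))" for v
  have 1: "v \<in> stage b V T (rk v)" if "v \<in> attr b V T" for v
    using that LeastI_ex[of "\<lambda>n. v \<in> stage b V T n"] by (auto simp: attr_def rk_def)
  have 2: "rk u \<le> n" if "u \<in> stage b V T n" for u n
    unfolding rk_def using that by (rule Least_le)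
  have 3: "0 < rk v \<and> v \<notin> stage b V T (rk v - 1)" if "v \<in> attr b V T - T" for v
  proof -
    have "rk v \<noteq> 0" using 1[of v] that by (metis Diff_iff stage.simps(1))
    moreover have "v \<notin> stage b V T (rk v - 1)" using 2[of v "rk v - 1"] calculation by force
    ultimately show ?thesis by simp
  qed
  have 4: "if own v = b then \<exists>u\<in>stage b V T (rk v - 1). (v, u) \<in> E
        else \<forall>u\<in>V. (v, u) \<in> E \<longrightarrow> u \<in> stage b V T (rk v - 1)" if v: "v \<in> attr b V T - T" for v
  proof -
    obtain n where n: "rk v = Suc n" using 3[OF v] gr0_implies_Suc by blast
    then show ?thesis using 1[of v] 3[OF v] v by (auto split: if_splits)
  qed
  have 5: "u \<in> attr b V T \<and> rk u < rk v" if "v \<in> attr b V T - T" "u \<in> stage b V T (rk v - 1)" for u v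
    using 2[OF that(2)] 3[OF that(1)] that(2) unfolding attr_def by force
  show ?thesis
  proof (intro exI[of _ \<sigma>] exI[of _ rk] conjI[of "All _" "All _"] allI impI)
    fix v assume v: "v \<in> attr b V T - T" "own v = b"
    then have "\<exists>u. (v, u) \<in> E \<and> u \<in> stage b V T (rk v - 1)"
      using 4[OF v(1)] by (simp only: v(2) if_True) blast
    from someI_ex[OF this] show "(v, \<sigma> v) \<in> E \<and> \<sigma> v \<in> attr b V T \<and> rk (\<sigma> v) < rk v"
      using 5[OF v(1)] unfolding \<sigma>_def by blast
  next
    fix v u assume "v \<in> attr b V T - T" "own v \<noteq> b" "u \<in> V" "(v, u) \<in> E"
    then show "u \<in> attr b V T \<and> rk u < rk v" using 4[of v] 5[of v u] by (simp only: if_False)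
  qed
qed

lemma eventually_in_target:
  assumes "\<pi> k \<in> A" "\<And>k. \<pi> k \<in> A - T \<Longrightarrow> \<pi> (Suc k) \<in> A \<and> (rk (\<pi> (Suc k)) :: nat) < rk (\<pi> k)"
  shows "\<exists>k'\<ge>k. \<pi> k' \<in> T"
  using assms(1)
proof (induction "rk (\<pi> k)" arbitrary: k rule: less_induct)
  case less
  show ?case
  proof (cases "\<pi> k \<in> T")
    case False
    then have "\<pi> (Suc k) \<in> A" "rk (\<pi> (Suc k)) < rk (\<pi> k)" using assms(2) less.prems by auto
    from less.hyps[OF this(2,1)] show ?thesis using Suc_leD by blast
  qed auto
qed

text \<open>Zielonka's recursion on the size of the arena. Player \<open>b\<close> likes the least
  priority \<open>d\<close>; removing the attractor \<open>A\<close> of the vertices of priority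
  \<open>d\<close> leaves a smaller game. If the opponent wins nowhere in it, \<open>b\<close> wins
  everywhere in \<open>V\<close>. Otherwise the opponent's attractor \<open>B\<close> of its region
  there is removed from \<open>V\<close> instead, and a second recursive call splits what
  remains.\<close>

theorem zielonka:
  assumes "finite V" "total V"
  shows "\<exists>U \<sigma> \<tau>. wins True V U \<sigma> \<and> wins False V (V - U) \<tau>"
  using assms
proof (induction "card V" arbitrary: V rule: less_induct)
  case less
  note IH = less.hyps
  note fin = less.prems(1) and tot = less.prems(2)
  have sym: "\<exists>U \<sigma> \<tau>. wins b V U \<sigma> \<and> wins (\<not> b) V (V - U) \<tau>"
    if ex: "\<exists>U \<sigma> \<tau>. wins True V U \<sigma> \<and> wins False V (V - U) \<tau>" for V b
  proof -
    obtain U \<sigma> \<tau> where *: "wins True V U \<sigma>" "wins False V (V - U) \<tau>" using ex by blast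
    show ?thesis
    proof (cases b)
      case True then show ?thesis using * by auto
    next
      case False
      have "V - (V - U) = U" using *(1) by (auto simp: wins_def)
      then show ?thesis using False * by (intro exI[of _ "V - U"] exI[of _ \<tau>] exI[of _ \<sigma>]) auto
    qed
  qed
  show ?case
  proof (cases "V = {}")
    case True
    then show ?thesis by (auto simp: wins_def follows_def)
  next
    case False
    define d where "d = Min (pr ` V)"
    define b where "b = even d"
    define T where "T = {v \<in> V. pr v = d}"
    define A where "A = attr b V T"
    define V' where "V' = V - A"
    have d_le: "d \<le> pr v" if "v \<in> V" for v unfolding d_def using fin that by auto
    have "d \<in> pr ` V" unfolding d_def using fin False by (intro Min_in) auto
    then have T: "T \<noteq> {}" "T \<subseteq> V" by (auto simp: T_def)
    have A: "T \<subseteq> A" "A \<subseteq> V" unfolding A_def using subset_attr attr_subset[OF T(2)] by auto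
    then have "V' \<subset> V" using T by (auto simp: V'_def)
    then have "card V' < card V" by (rule psubset_card_mono[OF fin])
    moreover have fin': "finite V'" "total V'"
      unfolding V'_def A_def using fin total_minus_attr[OF fin tot] by auto
    ultimately obtain U' \<sigma>' \<tau>' where w': "wins b V' U' \<sigma>'" "wins (\<not> b) V' (V' - U') \<tau>'"
      using sym[of V' b] IH by blast
    from attr_strategy[OF T(2), of b, folded A_def] obtain \<sigma>A rkA where sA0:
      "\<forall>v. v \<in> A - T \<longrightarrow> own v = b \<longrightarrow> (v, \<sigma>A v) \<in> E \<and> \<sigma>A v \<in> A \<and> rkA (\<sigma>A v) < (rkA v :: nat)"
      "\<forall>v u. v \<in> A - T \<longrightarrow> own v \<noteq> b \<longrightarrow> u \<in> V \<longrightarrow> (v, u) \<in> E \<longrightarrow> u \<in> A \<and> rkA u < rkA v"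
      by (elim exE conjE)
    note sA = sA0[rule_format]
    have "\<exists>U \<sigma> \<tau>. wins b V U \<sigma> \<and> wins (\<not> b) V (V - U) \<tau>"
    proof (cases "V' - U' = {}")
      case True
      then have U': "U' = V'" using w'(1) by (auto simp: wins_def)
      have "\<forall>v\<in>V. \<exists>u. u \<in> V \<and> (v, u) \<in> E" using tot by (auto simp: total_def)
      then obtain sc where sc: "\<And>v. v \<in> V \<Longrightarrow> sc v \<in> V \<and> (v, sc v) \<in> E" by metis
      define \<sigma> where "\<sigma> v = (if v \<in> T then sc v else if v \<in> A then \<sigma>A v else \<sigma>' v)" for v
      have "wins b V V \<sigma>"
        unfolding wins_def
      proof (intro conjI ballI impI allI)
        fix v assume v: "v \<in> V" "own v = b"
        have *: "v \<in> T \<or> v \<in> A - T \<or> v \<in> V'" using v by (auto simp: V'_def)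
        show "(v, \<sigma> v) \<in> E" "\<sigma> v \<in> V"
          using * sc[OF v(1)] sA(1)[of v] v A w'(1) unfolding \<sigma>_def wins_def U'
          by (auto simp: V'_def)
      next
        fix \<pi> assume f: "follows b V \<sigma> \<pi>"
        have inV: "\<pi> k \<in> V" "(\<pi> k, \<pi> (Suc k)) \<in> E" "own (\<pi> k) = b \<Longrightarrow> \<pi> (Suc k) = \<sigma> (\<pi> k)" for k
          using f by (auto simp: follows_def)
        have step: "\<pi> (Suc k) \<in> A \<and> rkA (\<pi> (Suc k)) < rkA (\<pi> k)" if "\<pi> k \<in> A - T" for k
          using sA(1)[OF that] sA(2)[OF that] inV[of k] inV(1)[of "Suc k"] that
          by (cases "own (\<pi> k) = b") (auto simp: \<sigma>_def)
        \<comment> \<open>Each visit to \<open>A\<close> is followed by one to \<open>T\<close>,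
          where the priority is the least possible \<open>d\<close>; a play that eventually avoids
          \<open>A\<close> follows the strategy for the subarena.\<close>
        show "pwin b \<pi>"
        proof (cases "\<exists>\<^sub>\<infinity>k. \<pi> k \<in> A")
          case True
          have "\<exists>\<^sub>\<infinity>k. \<pi> k \<in> T" unfolding INFM_nat_le
          proof
            fix l
            from True obtain k where k: "k \<ge> l" "\<pi> k \<in> A" unfolding INFM_nat_le by blast
            from eventually_in_target[OF k(2) step] obtain k' where "k' \<ge> k" "\<pi> k' \<in> T" by blast
            then show "\<exists>k\<ge>l. \<pi> k \<in> T" using k by (intro exI[of _ k']) auto
          qed
          then have "\<exists>\<^sub>\<infinity>k. pr (\<pi> k) = d" by (rule INFM_mono) (simp add: T_def)
          then have "limp \<pi> = d" unfolding limp_def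
            by (rule Least_equality) (use d_le inV INFM_EX in blast)
          then show ?thesis by (simp add: pwin_def b_def)
        next
          case False
          then obtain n where n: "\<And>k. k \<ge> n \<Longrightarrow> \<pi> k \<notin> A" by (auto simp: frequently_def MOST_nat_le)
          have "follows b U' \<sigma>' (\<lambda>k. \<pi> (k + n))"
            unfolding follows_def U' using n inV A(1) by (auto simp: V'_def \<sigma>_def)
          then have "pwin b (\<lambda>k. \<pi> (k + n))" using w'(1) by (simp add: wins_def)
          then show ?thesis by (simp add: pwin_shift)
        qed
      qed auto
      moreover have "wins (\<not> b) V (V - V) \<tau>'" by (auto simp: wins_def follows_def)
      ultimately show ?thesis by blast
    next
      case False
      define W where "W = V' - U'"
      define B where "B = attr (\<not> b) V W"
      define V'' where "V'' = V - B"
      have WV: "W \<noteq> {}" "W \<subseteq> V" using False by (auto simp: W_def V'_def)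
      have B: "W \<subseteq> B" "B \<subseteq> V" unfolding B_def using subset_attr attr_subset[OF WV(2)] by auto
      then have "V'' \<subset> V" using WV by (auto simp: V''_def)
      then have "card V'' < card V" by (rule psubset_card_mono[OF fin])
      moreover have "finite V''" "total V''"
        unfolding V''_def B_def using fin total_minus_attr[OF fin tot] by auto
      ultimately obtain U \<sigma>2 \<tau>2 where w2: "wins b V'' U \<sigma>2" "wins (\<not> b) V'' (V'' - U) \<tau>2"
        using sym[of V'' b] IH by blast
      from attr_strategy[OF WV(2), of "\<not> b", folded B_def] obtain \<sigma>B rkB where sB0:
        "\<forall>v. v \<in> B - W \<longrightarrow> own v = (\<not> b) \<longrightarrow> (v, \<sigma>B v) \<in> E \<and> \<sigma>B v \<in> B \<and> rkB (\<sigma>B v) < (rkB v :: nat)"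
        "\<forall>v u. v \<in> B - W \<longrightarrow> own v \<noteq> (\<not> b) \<longrightarrow> u \<in> V \<longrightarrow> (v, u) \<in> E \<longrightarrow> u \<in> B \<and> rkB u < rkB v"
        by (elim exE conjE)
      note sB = sB0[rule_format]
      have UV: "U \<subseteq> V''" using w2 by (simp add: wins_def)
      \<comment> \<open>The opponent's vertices outside its attractor \<open>B\<close> have no edge
        into \<open>B\<close>, so \<open>U\<close> stays closed in the larger arena.\<close>
      have "wins b V U \<sigma>2"
        unfolding wins_def
      proof (intro conjI ballI impI)
        fix v u assume v: "v \<in> U" "own v \<noteq> b" "u \<in> V" "(v, u) \<in> E"
        have "v \<in> V - attr (\<not> b) V W" using v UV by (auto simp: V''_def B_def)
        from attr_own[OF this] v have "u \<notin> B" unfolding B_def by blast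
        then have "u \<in> V''" using v by (simp add: V''_def)
        then show "u \<in> U" using v w2(1) by (auto simp: wins_def)
      qed (use w2(1) UV in \<open>auto simp: wins_def V''_def\<close>)
      moreover
      define \<tau> where "\<tau> v = (if v \<in> W then \<tau>' v else if v \<in> B then \<sigma>B v else \<tau>2 v)" for v
      \<comment> \<open>\<open>W\<close> was a winning region inside \<open>V'\<close> only. It
        cannot be left in \<open>V\<close> either: vertices of player \<open>b\<close> outside its
        own attractor \<open>A\<close> have no edge into \<open>A\<close>.\<close>
      have Wstay: "u \<in> W" if "v \<in> W" "u \<in> V" "(v, u) \<in> E" "own v = (\<not> b) \<Longrightarrow> u = \<tau> v" for u v
      proof (cases "own v = b")
        case True
        have "v \<in> V - attr b V T" using that by (auto simp: W_def V'_def A_def)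
        from attr_own[OF this True] that have "u \<notin> A" unfolding A_def by blast
        then have "u \<in> V'" using that by (simp add: V'_def)
        then show ?thesis using w'(2) that True by (auto simp: wins_def W_def)
      next
        case False
        then have "u = \<tau>' v" using that by (auto simp: \<tau>_def)
        then show ?thesis using w'(2) that False by (auto simp: wins_def W_def)
      qed
      have VU: "V - U = B \<union> (V'' - U)" using UV B by (auto simp: V''_def)
      have "wins (\<not> b) V (V - U) \<tau>"
        unfolding wins_def
      proof (intro conjI ballI impI allI)
        fix v assume v: "v \<in> V - U" "own v = (\<not> b)"
        then consider "v \<in> W" | "v \<in> B - W" | "v \<in> V'' - U" "v \<notin> B" using VU by (auto simp: V''_def)
        then have "(v, \<tau> v) \<in> E \<and> \<tau> v \<in> B \<union> (V'' - U)"
        proof cases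
          case 1
          then show ?thesis using w'(2) v B by (auto simp: wins_def W_def \<tau>_def)
        next
          case 2
          then show ?thesis using sB(1)[OF 2] v by (auto simp: \<tau>_def)
        next
          case 3
          then show ?thesis using w2(2) v B by (auto simp: wins_def \<tau>_def)
        qed
        then show "(v, \<tau> v) \<in> E" "\<tau> v \<in> V - U" using VU by auto
      next
        fix v u assume v: "v \<in> V - U" "own v \<noteq> (\<not> b)" "u \<in> V" "(v, u) \<in> E"
        then consider "v \<in> W" | "v \<in> B - W" | "v \<in> V'' - U" using VU by auto
        then have "u \<in> B \<union> (V'' - U)"
        proof cases
          case 1
          then show ?thesis using Wstay[of v u] v B by auto
        next
          case 2
          then show ?thesis using sB(2)[OF 2] v by auto
        next
          case 3
          have "u \<in> B \<or> u \<in> V''" using v by (auto simp: V''_def)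
          then show ?thesis using w2(2) v 3 by (auto simp: wins_def)
        qed
        then show "u \<in> V - U" using VU by auto
      next
        fix \<pi> assume f: "follows (\<not> b) (V - U) \<tau> \<pi>"
        have inV: "\<pi> k \<in> V - U" "(\<pi> k, \<pi> (Suc k)) \<in> E" "own (\<pi> k) = (\<not> b) \<Longrightarrow> \<pi> (Suc k) = \<tau> (\<pi> k)" for k
          using f by (auto simp: follows_def)
        show "pwin (\<not> b) \<pi>"
        proof (cases "\<exists>k. \<pi> k \<in> B")
          case True
          then obtain k where k: "\<pi> k \<in> B" ..
          have step: "\<pi> (Suc k) \<in> B \<and> rkB (\<pi> (Suc k)) < rkB (\<pi> k)" if "\<pi> k \<in> B - W" for k
            using sB(1)[OF that] sB(2)[OF that] inV[of k] inV(1)[of "Suc k"] that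
            by (cases "own (\<pi> k) = (\<not> b)") (auto simp: \<tau>_def)
          from eventually_in_target[OF k step] obtain n where n: "\<pi> n \<in> W" by blast
          have W: "\<pi> (k + n) \<in> W" for k
          proof (induction k)
            case (Suc k)
            then show ?case using Wstay[OF Suc, of "\<pi> (Suc (k + n))"] inV[of "k + n"] inV(1)[of "Suc (k + n)"]
              by auto
          qed (use n in simp)
          have "follows (\<not> b) (V' - U') \<tau>' (\<lambda>k. \<pi> (k + n))"
            unfolding follows_def using W inV W_def by (auto simp: \<tau>_def)
          then have "pwin (\<not> b) (\<lambda>k. \<pi> (k + n))" using w'(2) by (simp add: wins_def)
          then show ?thesis by (simp add: pwin_shift)
        next
          case False
          then have "follows (\<not> b) (V'' - U) \<tau>2 \<pi>"
            unfolding follows_def using inV B by (auto simp: \<tau>_def V''_def)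
          then show ?thesis using w2(2) by (simp add: wins_def)
        qed
      qed auto
      ultimately show ?thesis by blast
    qed
    then show ?thesis
    proof (elim exE conjE)
      fix U \<sigma> \<tau> assume *: "wins b V U \<sigma>" "wins (\<not> b) V (V - U) \<tau>"
      show ?thesis
      proof (cases b)
        case True then show ?thesis using * by auto
      next
        case False
        have "V - (V - U) = U" using *(1) by (auto simp: wins_def)
        then show ?thesis using False * by (intro exI[of _ "V - U"] exI[of _ \<tau>] exI[of _ \<sigma>]) auto
      qed
    qed
  qed
qed

end

section \<open>Certificates for games with a semigroup condition\<close>

definition cert_states :: "nat \<Rightarrow> (nat \<times> nat \<times> nat) set \<Rightarrow> nat set" where
  "cert_states z0 R = insert z0 {z'. \<exists>z s. (z, s, z') \<in> R}"

text \<open>Acceptance is tested on lassos only: a stem of value \<open>s\<close> from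
  \<open>z0\<close> to \<open>z\<close> and a loop of value \<open>e\<close> at \<open>z\<close>. As
  \<open>R\<close> contains the values of all composite paths, this covers every infinite
  path.\<close>

definition cert_ok :: "(nat \<Rightarrow> nat \<Rightarrow> nat) \<Rightarrow> nat \<Rightarrow> (nat \<times> nat \<times> nat) set \<Rightarrow> (nat \<Rightarrow> nat \<Rightarrow> bool) \<Rightarrow> bool" where
  "cert_ok m z0 R A \<longleftrightarrow> finite R \<and>
     (\<forall>z s z' t z''. (z, s, z') \<in> R \<longrightarrow> (z', t, z'') \<in> R \<longrightarrow> (z, m s t, z'') \<in> R) \<and>
     (\<forall>s z e. (z0, s, z) \<in> R \<longrightarrow> (z, e, z) \<in> R \<longrightarrow> m s e = s \<longrightarrow> m e e = e \<longrightarrow> A s e)"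

text \<open>Closure puts the value of every segment into \<open>R\<close>. The states at the cut
  points of a factorization come from a finite set, so one of them recurs and the cut points can be
  thinned out to its occurrences; the result is a lasso of \<open>R\<close>.\<close>

lemma (in fin_semigroup) cert_ok_path:
  assumes ok: "cert_ok m z0 R A" and z0: "z 0 = z0" and w: "\<And>k. w k \<in> S"
    and st: "\<And>k. (z k, w k, z (Suc k)) \<in> R"
  shows "\<exists>p s e. linked_fact m w p s e \<and> A s e"
proof -
  have R: "(z i, seg m w i j, z j) \<in> R" if "i < j" for i j
    using that
  proof (induction j)
    case (Suc j)
    show ?case
    proof (cases "i = j")
      case False
      then have "(z i, seg m w i j, z j) \<in> R" using Suc by simp
      with st[of j] ok have "(z i, m (seg m w i j) (w j), z (Suc j)) \<in> R"
        unfolding cert_ok_def by blast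
      then show ?thesis using Suc.prems False by (simp add: seg_Suc)
    qed (use st in simp)
  qed simp
  obtain p s e where lf: "linked_fact m w p s e" using linked_fact_exists[of w, OF w] by blast
  have "finite (range (\<lambda>r. z (p r)))"
  proof (rule finite_subset)
    have "z k \<in> insert z0 ((snd \<circ> snd) ` R)" for k
    proof (cases k)
      case (Suc j)
      then show ?thesis using imageI[OF st[of j], of "snd \<circ> snd"] by simp
    qed (use z0 in simp)
    then show "range (\<lambda>r. z (p r)) \<subseteq> insert z0 ((snd \<circ> snd) ` R)" by auto
    show "finite (insert z0 ((snd \<circ> snd) ` R))" using ok by (simp add: cert_ok_def)
  qed
  then obtain r0 where inf: "infinite {r. z (p r) = z (p r0)}"
    using pigeonhole_infinite[of UNIV "\<lambda>r. z (p r)"] by auto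
  define g where "g = enumerate {r. z (p r) = z (p r0)}"
  have g: "strict_mono g" unfolding g_def using inf by (rule strict_mono_enumerate)
  have zg: "z (p (g r)) = z (p r0)" for r
    using enumerate_in_set[OF inf, of r] by (simp add: g_def)
  have lf': "linked_fact m w (p \<circ> g) s e" by (rule linked_fact_subseq[OF lf g])
  then have "0 < p (g 0)" "p (g 0) < p (g (Suc 0))"
    by (auto simp: linked_fact_def strict_mono_Suc_iff)
  from R[OF this(1)] R[OF this(2)] lf' have "(z0, s, z (p r0)) \<in> R" "(z (p r0), e, z (p r0)) \<in> R"
    by (auto simp: linked_fact_def zg z0)
  then have "A s e" using ok lf unfolding cert_ok_def linked_fact_def by blast
  then show ?thesis using lf by blast
qed

definition paths :: "(nat \<Rightarrow> nat \<Rightarrow> nat) \<Rightarrow> (nat \<times> nat \<times> nat) set \<Rightarrow> (nat \<times> nat \<times> nat) set" where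
  "paths m Tr = {(z, s, z'). \<exists>n a l. 0 < n \<and> a 0 = z \<and> a n = z' \<and>
     (\<forall>i<n. (a i, l i, a (Suc i)) \<in> Tr) \<and> seg m l 0 n = s}"

lemma paths_base: "(z, s, z') \<in> Tr \<Longrightarrow> (z, s, z') \<in> paths m Tr"
  unfolding paths_def
  by (intro CollectI case_prodI exI[of _ 1] exI[of _ "\<lambda>i. if i = 0 then z else z'"] exI[of _ "\<lambda>_. s"])
    (auto simp: seg_def)

lemma paths_target: "(z, s, z') \<in> paths m Tr \<Longrightarrow> \<exists>u l. (u, l, z') \<in> Tr"
proof -
  assume "(z, s, z') \<in> paths m Tr"
  then obtain n a l where "0 < n" "a n = z'" "\<forall>i<n. (a i, l i, a (Suc i)) \<in> Tr"
    unfolding paths_def by blast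
  then have "(a (n - 1), l (n - 1), z') \<in> Tr" by (metis Suc_pred' diff_less zero_less_one)
  then show ?thesis by blast
qed

text \<open>The converse: the values of all finite paths in a finite labelled graph form a
  certificate, because a stem and a loop in it unfold to an infinite path, to which the hypothesis
  applies.\<close>

lemma (in fin_semigroup) cert_ok_paths:
  assumes fin: "finite Tr" and lab: "\<And>z l z'. (z, l, z') \<in> Tr \<Longrightarrow> l \<in> S"
    and H: "\<And>a l p s e. a 0 = z0 \<Longrightarrow> (\<And>i. (a i, l i, a (Suc i)) \<in> Tr) \<Longrightarrow>
       linked_fact m l p s e \<Longrightarrow> A s e"
  shows "cert_ok m z0 (paths m Tr) A"
  unfolding cert_ok_def
proof (intro conjI allI impI)
  have "paths m Tr \<subseteq> fst ` Tr \<times> S \<times> (snd \<circ> snd) ` Tr"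
  proof
    fix x assume "x \<in> paths m Tr"
    then obtain z s z' n a l where x: "x = (z, s, z')" and *: "0 < n" "a 0 = z" "a n = z'"
      "\<forall>i<n. (a i, l i, a (Suc i)) \<in> Tr" "seg m l 0 n = s" unfolding paths_def by blast
    have "(z, l 0, a (Suc 0)) \<in> Tr" using * by auto
    moreover obtain u t where "(u, t, z') \<in> Tr"
      using paths_target \<open>x \<in> paths m Tr\<close> unfolding x by blast
    moreover have "s \<in> S" unfolding *(5)[symmetric] using *(1,4) closed lab by (intro seg_closed) auto
    ultimately show "x \<in> fst ` Tr \<times> S \<times> (snd \<circ> snd) ` Tr" unfolding x by force
  qed
  then show "finite (paths m Tr)" by (rule finite_subset) (use fin finite_S in auto)
next
  fix z s z' t z'' assume "(z, s, z') \<in> paths m Tr" "(z', t, z'') \<in> paths m Tr"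
  then obtain n1 a1 l1 n2 a2 l2 where 1: "0 < n1" "a1 0 = z" "a1 n1 = z'"
      "\<forall>i<n1. (a1 i, l1 i, a1 (Suc i)) \<in> Tr" "seg m l1 0 n1 = s"
    and 2: "0 < n2" "a2 0 = z'" "a2 n2 = z''"
      "\<forall>i<n2. (a2 i, l2 i, a2 (Suc i)) \<in> Tr" "seg m l2 0 n2 = t" unfolding paths_def by blast
  define a where "a i = (if i < n1 then a1 i else a2 (i - n1))" for i
  define l where "l i = (if i < n1 then l1 i else l2 (i - n1))" for i
  have "(a i, l i, a (Suc i)) \<in> Tr" if i: "i < n1 + n2" for i
  proof (cases "i < n1")
    case True
    have "a (Suc i) = a1 (Suc i)"
    proof (cases "Suc i < n1")
      case False
      then have "Suc i = n1" using True by simp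
      then show ?thesis using 1 2 by (simp add: a_def)
    qed (simp add: a_def)
    then show ?thesis using True 1 by (simp add: a_def l_def)
  next
    case False
    then show ?thesis using i 2 by (simp add: a_def l_def Suc_diff_le)
  qed
  moreover have "seg m l 0 (n1 + n2) = m s t"
  proof -
    have "seg m l 0 (n1 + n2) = m (seg m l 0 n1) (seg m l n1 (n1 + n2))"
      using 1 2 by (intro seg_split) auto
    moreover have "seg m l 0 n1 = seg m l1 0 n1" using 1 by (intro seg_cong) (auto simp: l_def)
    moreover have "seg m l n1 (n1 + n2) = seg m (\<lambda>i. l (i + n1)) 0 n2"
      using seg_shift[OF 2(1), of m l n1] by (simp add: add.commute)
    moreover have "seg m (\<lambda>i. l (i + n1)) 0 n2 = seg m l2 0 n2"
      using 2 by (intro seg_cong) (auto simp: l_def)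
    ultimately show ?thesis using 1 2 by simp
  qed
  moreover have "a 0 = z" "a (n1 + n2) = z''" using 1 2 by (auto simp: a_def)
  ultimately show "(z, m s t, z'') \<in> paths m Tr"
    unfolding paths_def using 1(1) by (intro CollectI case_prodI exI[of _ "n1 + n2"] exI[of _ a] exI[of _ l]) auto
next
  fix s z e assume se: "(z0, s, z) \<in> paths m Tr" "(z, e, z) \<in> paths m Tr" and le: "m s e = s" "m e e = e"
  from se(1) obtain n1 a1 l1 where 1: "0 < n1" "a1 0 = z0" "a1 n1 = z"
      "\<forall>i<n1. (a1 i, l1 i, a1 (Suc i)) \<in> Tr" "seg m l1 0 n1 = s"
    unfolding paths_def mem_Collect_eq case_prod_conv by (elim exE conjE)
  from se(2) obtain n2 a2 l2 where 2: "0 < n2" "a2 0 = z" "a2 n2 = z"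
      "\<forall>i<n2. (a2 i, l2 i, a2 (Suc i)) \<in> Tr" "seg m l2 0 n2 = e"
    unfolding paths_def mem_Collect_eq case_prod_conv by (elim exE conjE)
  \<comment> \<open>Run through the stem once and then round the loop for ever.\<close>
  define a where "a i = (if i < n1 then a1 i else a2 ((i - n1) mod n2))" for i
  define l where "l i = (if i < n1 then l1 i else l2 ((i - n1) mod n2))" for i
  have "(a i, l i, a (Suc i)) \<in> Tr" for i
  proof (cases "i < n1")
    case True
    have "a (Suc i) = a1 (Suc i)"
    proof (cases "Suc i < n1")
      case False
      then have "Suc i = n1" using True by simp
      then show ?thesis using 1 2 by (simp add: a_def)
    qed (simp add: a_def)
    then show ?thesis using True 1 by (simp add: a_def l_def)
  next
    case False
    define j where "j = (i - n1) mod n2"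
    have j: "j < n2" using 2 by (simp add: j_def)
    have "(Suc i - n1) mod n2 = (if Suc j = n2 then 0 else Suc j)"
      using False by (simp add: Suc_diff_le mod_Suc j_def)
    then have "a (Suc i) = a2 (Suc j)" using False 2 by (auto simp: a_def)
    then show ?thesis using False 2 j by (simp add: a_def l_def j_def)
  qed
  moreover have "linked_fact m l (\<lambda>r. n1 + r * n2) s e"
    unfolding linked_fact_def
  proof (intro conjI allI le)
    show "strict_mono (\<lambda>r. n1 + r * n2)" using 2 by (auto simp: strict_mono_def)
    show "0 < n1 + 0 * n2" using 1 by simp
    have "seg m l 0 n1 = seg m l1 0 n1" using 1 by (intro seg_cong) (auto simp: l_def)
    then show "seg m l 0 (n1 + 0 * n2) = s" using 1 by simp
    fix r
    have "seg m l (n1 + r * n2) (n1 + Suc r * n2) = seg m (\<lambda>i. l (i + (n1 + r * n2))) 0 n2"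
      using seg_shift[OF 2(1), of m l "n1 + r * n2"] by (simp add: algebra_simps)
    also have "\<dots> = seg m l2 0 n2" using 2 by (intro seg_cong) (auto simp: l_def)
    finally show "seg m l (n1 + r * n2) (n1 + Suc r * n2) = e" using 2 by simp
  qed
  moreover have "a 0 = z0" using 1 by (simp add: a_def)
  ultimately show "A s e" using H by blast
qed

text \<open>A state \<open>z\<close> of a certificate pairs a game position, \<open>pfst z\<close>,
  with the memory of the strategy, \<open>psnd z\<close>. The strategy itself is not stored: it is
  enough that some answer leads along a triple of \<open>R\<close>.\<close>

definition Ycert where
  "Ycert m LX LY dl lb z0 acc R \<longleftrightarrow> cert_ok m z0 R acc \<and>
     (\<forall>z\<in>cert_states z0 R. \<forall>x\<in>LX (pfst z). \<exists>y\<in>LY (pfst z) x. \<exists>z'.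
        pfst z' = dl (pfst z) x y \<and> (z, lb (pfst z) x y, z') \<in> R)"

definition Xcert where
  "Xcert m LX LY dl lb z0 acc R \<longleftrightarrow> cert_ok m z0 R (\<lambda>s e. \<not> acc s e) \<and>
     (\<forall>z\<in>cert_states z0 R. \<exists>x\<in>LX (pfst z). \<forall>y\<in>LY (pfst z) x. \<exists>z'.
        pfst z' = dl (pfst z) x y \<and> (z, lb (pfst z) x y, z') \<in> R)"

section \<open>Product of the game with the automaton of keys\<close>

datatype vert = VX nat "nat list \<times> nat list list" nat | VY nat "nat list \<times> nat list list" nat nat

text \<open>The condition \<open>consistent\<close> says that acceptance is a property of the play,
  whichever factorization is inspected; the automaton finds one of its own, which may differ from a
  given one.\<close>

locale sg_game = fin_semigroup +
  fixes LX :: "nat \<Rightarrow> nat set" and LY :: "nat \<Rightarrow> nat \<Rightarrow> nat set"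
    and dl lb :: "nat \<Rightarrow> nat \<Rightarrow> nat \<Rightarrow> nat" and q0 :: nat and Q :: "nat set"
    and acc :: "nat \<Rightarrow> nat \<Rightarrow> bool"
  assumes finite_Q: "finite Q" and q0: "q0 \<in> Q"
    and LX: "q \<in> Q \<Longrightarrow> finite (LX q) \<and> LX q \<noteq> {}"
    and LY: "q \<in> Q \<Longrightarrow> x \<in> LX q \<Longrightarrow> LY q x \<noteq> {}"
    and step: "q \<in> Q \<Longrightarrow> x \<in> LX q \<Longrightarrow> y \<in> LY q x \<Longrightarrow> dl q x y \<in> Q \<and> lb q x y \<in> S"
    and consistent: "\<lbrakk>qs 0 = q0; \<And>k. qs (Suc k) = dl (qs k) (xs k) (ys k);
      \<And>k. xs k \<in> LX (qs k); \<And>k. ys k \<in> LY (qs k) (xs k);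
      linked_fact m (\<lambda>k. lb (qs k) (xs k) (ys k)) p s e;
      linked_fact m (\<lambda>k. lb (qs k) (xs k) (ys k)) p' s' e'\<rbrakk> \<Longrightarrow> acc s e \<longleftrightarrow> acc s' e'"
begin

definition keys where "keys = {key w k | w k. \<forall>i. w i \<in> S}"

lemma finite_keys: "finite keys"
proof -
  let ?L1 = "{xs. set xs \<subseteq> insert 0 S \<and> length xs \<le> card S}"
  have "keys \<subseteq> ?L1 \<times> {xs. set xs \<subseteq> ?L1 \<and> length xs \<le> card S}"
  proof
    fix \<kappa> assume "\<kappa> \<in> keys"
    then obtain w k where \<kappa>: "\<kappa> = key w k" and w: "\<And>i. w i \<in> S" by (auto simp: keys_def)
    have "seg m w i k \<in> S" if "i \<in> set (alive w k)" for i
      using that w by (auto simp: alive_def intro!: seg_in)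
    moreover have "seg m w i j \<in> S" if "i < j" for i j using that w by (intro seg_in)
    ultimately show "\<kappa> \<in> ?L1 \<times> {xs. set xs \<subseteq> ?L1 \<and> length xs \<le> card S}"
      using length_alive[of w k, OF w] by (auto simp: \<kappa> key_def)
  qed
  moreover have "finite ?L1" using finite_S by (intro finite_lists_length_le) simp
  ultimately show ?thesis
    by (elim finite_subset) (intro finite_cartesian_product finite_lists_length_le finite.insertI finite_S)
qed

lemma keys_upd: "\<kappa> \<in> keys \<Longrightarrow> a \<in> S \<Longrightarrow> upd \<kappa> a \<in> keys"
proof -
  assume "\<kappa> \<in> keys" and a: "a \<in> S"
  then obtain w k where \<kappa>: "\<kappa> = key w k" and w: "\<And>i. w i \<in> S" by (auto simp: keys_def)
  have "key (w(k := a)) (Suc k) = upd \<kappa> a"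
    unfolding \<kappa> key_Suc using key_cong[of k "w(k := a)" w] by simp
  moreover have "\<forall>i. (w(k := a)) i \<in> S" using w a by simp
  ultimately show ?thesis unfolding keys_def by (smt (verit) mem_Collect_eq)
qed

lemma keys_Nil: "([], []) \<in> keys"
proof -
  obtain x where x: "x \<in> LX q0" using LX[OF q0] by blast
  obtain y where "y \<in> LY q0 x" using LY[OF q0 x] by blast
  then have "lb q0 x y \<in> S" using step[OF q0 x] by blast
  then show ?thesis unfolding keys_def
    by (intro CollectI exI[of _ "\<lambda>_. lb q0 x y"] exI[of _ 0]) (simp add: key_0)
qed

definition prios where "prios = insert 0 ((\<lambda>(\<kappa>, a). prio acc \<kappa> a) ` (keys \<times> S))"

definition vown :: "vert \<Rightarrow> bool" where
  "vown v = (case v of VX q \<kappa> p \<Rightarrow> False | VY q \<kappa> x p \<Rightarrow> True)"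

definition vpr :: "vert \<Rightarrow> nat" where
  "vpr v = (case v of VX q \<kappa> p \<Rightarrow> p | VY q \<kappa> x p \<Rightarrow> p)"

text \<open>A round consists of a move at a \<open>VX\<close> and one at a \<open>VY\<close> vertex.
  The priority belongs to the letter just completed and is therefore stored in the vertices of the
  following round.\<close>

definition vE :: "(vert \<times> vert) set" where
  "vE = {(VX q \<kappa> p, VY q \<kappa> x p) | q \<kappa> p x. x \<in> LX q} \<union>
    {(VY q \<kappa> x p, VX (dl q x y) (upd \<kappa> (lb q x y)) (prio acc \<kappa> (lb q x y))) | q \<kappa> x p y. y \<in> LY q x}"

definition vV :: "vert set" where
  "vV = {VX q \<kappa> p | q \<kappa> p. q \<in> Q \<and> \<kappa> \<in> keys \<and> p \<in> prios} \<union>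
    {VY q \<kappa> x p | q \<kappa> x p. q \<in> Q \<and> \<kappa> \<in> keys \<and> x \<in> LX q \<and> p \<in> prios}"

lemma vV_simps [simp]:
  "VX q \<kappa> p \<in> vV \<longleftrightarrow> q \<in> Q \<and> \<kappa> \<in> keys \<and> p \<in> prios"
  "VY q \<kappa> x p \<in> vV \<longleftrightarrow> q \<in> Q \<and> \<kappa> \<in> keys \<and> x \<in> LX q \<and> p \<in> prios"
  unfolding vV_def by blast+

lemma vE_simps [simp]:
  "(VX q \<kappa> p, v) \<in> vE \<longleftrightarrow> (\<exists>x\<in>LX q. v = VY q \<kappa> x p)"
  "(VY q \<kappa> x p, v) \<in> vE \<longleftrightarrow>
     (\<exists>y\<in>LY q x. v = VX (dl q x y) (upd \<kappa> (lb q x y)) (prio acc \<kappa> (lb q x y)))"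
  unfolding vE_def by blast+

lemma vown_simps [simp]: "vown (VX q \<kappa> p) = False" "vown (VY q \<kappa> x p) = True"
  by (simp_all add: vown_def)

lemma prio_in_prios: "\<kappa> \<in> keys \<Longrightarrow> a \<in> S \<Longrightarrow> prio acc \<kappa> a \<in> prios"
  unfolding prios_def by force

lemma finite_vV: "finite vV"
proof -
  have "finite prios" unfolding prios_def using finite_keys finite_S by simp
  moreover have "finite (\<Union>q\<in>Q. LX q)" using finite_Q LX by blast
  ultimately have "finite ((\<lambda>(q, \<kappa>, p). VX q \<kappa> p) ` (Q \<times> keys \<times> prios) \<union>
    (\<lambda>(q, \<kappa>, x, p). VY q \<kappa> x p) ` (Q \<times> keys \<times> (\<Union>q\<in>Q. LX q) \<times> prios))"
    using finite_Q finite_keys by blast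
  then show ?thesis
  proof (rule rev_finite_subset, intro subsetI)
    fix v assume v: "v \<in> vV"
    show "v \<in> (\<lambda>(q, \<kappa>, p). VX q \<kappa> p) ` (Q \<times> keys \<times> prios) \<union>
      (\<lambda>(q, \<kappa>, x, p). VY q \<kappa> x p) ` (Q \<times> keys \<times> (\<Union>q\<in>Q. LX q) \<times> prios)"
    proof (cases v)
      case (VX q \<kappa> p)
      then show ?thesis using v by (intro UnI1 image_eqI[of _ _ "(q, \<kappa>, p)"]) auto
    next
      case (VY q \<kappa> x p)
      then show ?thesis using v by (intro UnI2 image_eqI[of _ _ "(q, \<kappa>, x, p)"]) auto
    qed
  qed
qed

lemma vE_Y:
  assumes "VY q \<kappa> x p \<in> vV" "y \<in> LY q x"
  shows "VX (dl q x y) (upd \<kappa> (lb q x y)) (prio acc \<kappa> (lb q x y)) \<in> vV"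
  using assms step[of q x y] keys_upd[of \<kappa> "lb q x y"] prio_in_prios[of \<kappa> "lb q x y"] by simp

sublocale pg: parity_game vown vE vpr .

lemma total_vV: "pg.total vV"
  unfolding pg.total_def
proof
  fix v assume v: "v \<in> vV"
  show "\<exists>u\<in>vV. (v, u) \<in> vE"
  proof (cases v)
    case (VX q \<kappa> p)
    then obtain x where "x \<in> LX q" using v LX by auto
    then show ?thesis using v VX by (intro bexI[of _ "VY q \<kappa> x p"]) auto
  next
    case (VY q \<kappa> x p)
    then obtain y where y: "y \<in> LY q x" using v LY by fastforce
    then show ?thesis using vE_Y[of q \<kappa> x p y] v VY by (intro bexI) auto
  qed
qed

text \<open>Every priority is shown twice, by both vertices of a round, and one round late; neither
  changes which priorities recur.\<close>

lemma path_parity: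
  assumes q: "q 0 = q0" "\<And>k. q (Suc k) = dl (q k) (x k) (y k)"
    and x: "\<And>k. x k \<in> LX (q k)" and y: "\<And>k. y k \<in> LY (q k) (x k)"
    and \<kappa>: "\<kappa> 0 = ([], [])" "\<And>k. \<kappa> (Suc k) = upd (\<kappa> k) (lb (q k) (x k) (y k))"
    and p: "\<And>k. p (Suc k) = prio acc (\<kappa> k) (lb (q k) (x k) (y k))"
    and lf: "linked_fact m (\<lambda>k. lb (q k) (x k) (y k)) pp s e"
  defines "\<pi> \<equiv> \<lambda>k. if even k then VX (q (k div 2)) (\<kappa> (k div 2)) (p (k div 2))
      else VY (q (k div 2)) (\<kappa> (k div 2)) (x (k div 2)) (p (k div 2))"
  shows "pg.pwin True \<pi> \<longleftrightarrow> acc s e"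
proof -
  let ?w = "\<lambda>k. lb (q k) (x k) (y k)"
  have qQ: "q k \<in> Q" for k by (induction k) (use q q0 step x y in auto)
  have w: "?w k \<in> S" for k using step[OF qQ x y] by blast
  have key: "\<kappa> k = key ?w k" for k by (induction k) (auto simp: \<kappa> key_0 key_Suc)
  have "vpr (\<pi> k) = p (k div 2)" for k by (simp add: \<pi>_def vpr_def)
  then have "pg.limp \<pi> = (LEAST P. \<exists>\<^sub>\<infinity>k. p (k div 2) = P)" by (simp add: pg.limp_def)
  moreover have "(\<exists>\<^sub>\<infinity>k. p (k div 2) = P) \<longleftrightarrow> (\<exists>\<^sub>\<infinity>k. prio acc (key ?w k) (?w k) = P)" for P
  proof -
    have "(\<exists>\<^sub>\<infinity>k. p (k div 2) = P) \<longleftrightarrow> (\<exists>\<^sub>\<infinity>k. p k = P)"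
    proof
      assume *: "\<exists>\<^sub>\<infinity>k. p (k div 2) = P"
      show "\<exists>\<^sub>\<infinity>k. p k = P" unfolding INFM_nat_le
      proof
        fix l
        from * obtain k where "k \<ge> 2 * l" "p (k div 2) = P" unfolding INFM_nat_le by blast
        then show "\<exists>k\<ge>l. p k = P" by (intro exI[of _ "k div 2"]) auto
      qed
    next
      assume *: "\<exists>\<^sub>\<infinity>k. p k = P"
      show "\<exists>\<^sub>\<infinity>k. p (k div 2) = P" unfolding INFM_nat_le
      proof
        fix l
        from * obtain k where "k \<ge> l" "p k = P" unfolding INFM_nat_le by blast
        then show "\<exists>k\<ge>l. p (k div 2) = P" by (intro exI[of _ "2 * k"]) auto
      qed
    qed
    also have "\<dots> \<longleftrightarrow> (\<exists>\<^sub>\<infinity>k. p (k + 1) = P)" using pg.INFM_shift[of "\<lambda>k. p k = P" 1] by simp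
    finally show ?thesis by (simp add: p key)
  qed
  ultimately have "pg.limp \<pi> = (LEAST P. \<exists>\<^sub>\<infinity>k. prio acc (key ?w k) (?w k) = P)" by simp
  moreover obtain p' s' e' where lf': "linked_fact m ?w p' s' e'"
    "even (LEAST P. \<exists>\<^sub>\<infinity>k. prio acc (key ?w k) (?w k) = P) \<longleftrightarrow> acc s' e'"
    using parity_linked_fact[of ?w acc, OF w] by blast
  moreover have "acc s e \<longleftrightarrow> acc s' e'"
    by (rule consistent[of q x y, OF q x y lf lf'(1)])
  ultimately show ?thesis by (simp add: pg.pwin_def)
qed

text \<open>The start vertex must get memory 0, as certificates start in
  \<open>prod_encode (q0, 0)\<close>; this explains the case distinction and the
  \<open>Suc\<close>.\<close>

definition vcode :: "vert \<Rightarrow> nat" where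
  "vcode v = (case v of VX q \<kappa> p \<Rightarrow> prod_encode (q, if \<kappa> = ([], []) \<and> p = 0 then 0 else Suc (to_nat (\<kappa>, p)))
     | _ \<Rightarrow> 0)"

lemma vcode_inj: "vcode (VX q \<kappa> p) = vcode (VX q' \<kappa>' p') \<longleftrightarrow> q = q' \<and> \<kappa> = \<kappa>' \<and> p = p'"
  by (auto simp: vcode_def split: if_splits)

lemma pfst_vcode [simp]: "pfst (vcode (VX q \<kappa> p)) = q"
  by (simp add: vcode_def)

text \<open>One player wins the parity game from \<open>v0\<close>. The moves that agree with the
  positional strategy and stay in the winning region form a finite graph, and its path values are
  the certificate.\<close>

theorem cert_exists:
  "(\<exists>R. Ycert m LX LY dl lb (prod_encode (q0, 0)) acc R) \<or>
   (\<exists>R. Xcert m LX LY dl lb (prod_encode (q0, 0)) acc R)"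
proof -
  obtain U \<sigma> \<tau> where U: "pg.wins True vV U \<sigma>" and W: "pg.wins False vV (vV - U) \<tau>"
    using pg.zielonka[OF finite_vV total_vV] by blast
  define v0 where "v0 = VX q0 ([], []) 0"
  let ?z0 = "prod_encode (q0, 0)"
  have z0: "?z0 = vcode v0" by (simp add: vcode_def v0_def)
  have v0: "v0 \<in> vV" using q0 keys_Nil by (simp add: v0_def prios_def)
  let ?nx = "\<lambda>q \<kappa> x y. VX (dl q x y) (upd \<kappa> (lb q x y)) (prio acc \<kappa> (lb q x y))"
  \<comment> \<open>A path in the coded graph is the trace of a play: injectivity of
    \<open>vcode\<close> makes consecutive triples fit together.\<close>
  have decode: "\<exists>q x y \<kappa> p. q 0 = q0 \<and> (\<forall>k. q (Suc k) = dl (q k) (x k) (y k)) \<and> \<kappa> 0 = ([], []) \<and>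
      (\<forall>k. \<kappa> (Suc k) = upd (\<kappa> k) (l k)) \<and> (\<forall>k. p (Suc k) = prio acc (\<kappa> k) (l k)) \<and>
      (\<forall>k. l k = lb (q k) (x k) (y k)) \<and> (\<forall>k. C (q k) (\<kappa> k) (p k) (x k) (y k))"
    if a0: "a 0 = ?z0" and a: "\<And>i. (a i, l i, a (Suc i)) \<in> {(vcode (VX q \<kappa> p), lb q x y, vcode (?nx q \<kappa> x y))
      | q \<kappa> p x y. C q \<kappa> p x y}" for a l :: "nat \<Rightarrow> nat" and C
  proof -
    have "\<forall>i. \<exists>q \<kappa> p x y. a i = vcode (VX q \<kappa> p) \<and> l i = lb q x y \<and> a (Suc i) = vcode (?nx q \<kappa> x y) \<and> C q \<kappa> p x y"
      using a by blast
    then obtain q \<kappa> p x y where *: "\<And>i. a i = vcode (VX (q i) (\<kappa> i) (p i))" "\<And>i. l i = lb (q i) (x i) (y i)"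
      "\<And>i. a (Suc i) = vcode (?nx (q i) (\<kappa> i) (x i) (y i))" "\<And>i. C (q i) (\<kappa> i) (p i) (x i) (y i)"
      by metis
    have "vcode (VX (q (Suc i)) (\<kappa> (Suc i)) (p (Suc i))) = vcode (?nx (q i) (\<kappa> i) (x i) (y i))" for i
      using *(1)[of "Suc i"] *(3)[of i] by simp
    then have 1: "q (Suc i) = dl (q i) (x i) (y i) \<and> \<kappa> (Suc i) = upd (\<kappa> i) (l i) \<and>
      p (Suc i) = prio acc (\<kappa> i) (l i)" for i
      unfolding vcode_inj *(2) .
    have "vcode (VX (q 0) (\<kappa> 0) (p 0)) = vcode v0" using *(1)[of 0] a0 z0 by simp
    then have "q 0 = q0 \<and> \<kappa> 0 = ([], [])" unfolding v0_def vcode_inj by blast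
    then show ?thesis using 1 *(2,4)
      by (intro exI[of _ q] exI[of _ x] exI[of _ y] exI[of _ \<kappa>] exI[of _ p]) blast
  qed
  show ?thesis
  proof (cases "v0 \<in> U")
    case True
    define C where "C q \<kappa> p x y \<longleftrightarrow> VX q \<kappa> p \<in> U \<and> VY q \<kappa> x p \<in> U \<and> x \<in> LX q \<and> y \<in> LY q x \<and>
      \<sigma> (VY q \<kappa> x p) = ?nx q \<kappa> x y \<and> ?nx q \<kappa> x y \<in> U" for q \<kappa> p x y
    define Tr where "Tr = {(vcode (VX q \<kappa> p), lb q x y, vcode (?nx q \<kappa> x y)) | q \<kappa> p x y. C q \<kappa> p x y}"
    have UV: "U \<subseteq> vV" using U by (simp add: pg.wins_def)
    have lab: "l \<in> S" if "(z, l, z') \<in> Tr" for z l z'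
      using that step UV by (auto simp: Tr_def C_def)
    have "Tr \<subseteq> vcode ` vV \<times> S \<times> vcode ` vV"
    proof
      fix t assume t: "t \<in> Tr"
      then obtain q \<kappa> p x y where *: "t = (vcode (VX q \<kappa> p), lb q x y, vcode (?nx q \<kappa> x y))" "C q \<kappa> p x y"
        unfolding Tr_def by blast
      then have "VX q \<kappa> p \<in> vV" "?nx q \<kappa> x y \<in> vV" using UV by (auto simp: C_def)
      then show "t \<in> vcode ` vV \<times> S \<times> vcode ` vV" using t lab unfolding *(1) by blast
    qed
    then have finTr: "finite Tr" by (rule finite_subset) (use finite_vV finite_S in auto)
    have "cert_ok m ?z0 (paths m Tr) acc"
    proof (rule cert_ok_paths[OF finTr lab])
      fix a l pp s e
      assume a: "a 0 = ?z0" "\<And>i. (a i, l i, a (Suc i)) \<in> Tr" and lf: "linked_fact m l pp s e"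
      from decode[OF a[unfolded Tr_def]] obtain q x y \<kappa> p where
        q: "q 0 = q0" "\<And>k. q (Suc k) = dl (q k) (x k) (y k)" and
        \<kappa>: "\<kappa> 0 = ([], [])" "\<And>k. \<kappa> (Suc k) = upd (\<kappa> k) (l k)" "\<And>k. p (Suc k) = prio acc (\<kappa> k) (l k)" and
        l: "\<And>k. l k = lb (q k) (x k) (y k)" and C: "\<And>k. C (q k) (\<kappa> k) (p k) (x k) (y k)"
        by (elim exE conjE) blast
      have leq: "l = (\<lambda>k. lb (q k) (x k) (y k))" using l by blast
      let ?\<pi> = "\<lambda>k. if even k then VX (q (k div 2)) (\<kappa> (k div 2)) (p (k div 2))
        else VY (q (k div 2)) (\<kappa> (k div 2)) (x (k div 2)) (p (k div 2))"
      have pw: "pg.pwin True ?\<pi> \<longleftrightarrow> acc s e"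
        by (rule path_parity[OF q _ _ \<kappa>[unfolded l] lf[unfolded leq]]) (use C in \<open>auto simp: C_def\<close>)
      have "pg.follows True U \<sigma> ?\<pi>"
        unfolding pg.follows_def
      proof
        fix k
        show "?\<pi> k \<in> U \<and> (?\<pi> k, ?\<pi> (Suc k)) \<in> vE \<and> (vown (?\<pi> k) = True \<longrightarrow> ?\<pi> (Suc k) = \<sigma> (?\<pi> k))"
        proof (cases "even k")
          case True
          then show ?thesis using C[of "k div 2"] by (auto simp: C_def)
        next
          case False
          then have "Suc k div 2 = Suc (k div 2)" by (auto elim: oddE)
          then show ?thesis using False C[of "k div 2"] q(2) \<kappa>(2,3) l
            by (auto simp: C_def)
        qed
      qed
      then show "acc s e" using pw U by (simp add: pg.wins_def)
    qed
    moreover have "\<exists>y\<in>LY (pfst z) x. \<exists>z'. pfst z' = dl (pfst z) x y \<and> (z, lb (pfst z) x y, z') \<in> paths m Tr"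
      if z: "z \<in> cert_states ?z0 (paths m Tr)" and x: "x \<in> LX (pfst z)" for z x
    proof -
      have "\<exists>q \<kappa> p. z = vcode (VX q \<kappa> p) \<and> VX q \<kappa> p \<in> U"
      proof (cases "z = ?z0")
        case True
        then show ?thesis using \<open>v0 \<in> U\<close> z0 unfolding v0_def by blast
      next
        case False
        then obtain u0 s0 where "(u0, s0, z) \<in> paths m Tr" using z by (auto simp: cert_states_def)
        then obtain u l where "(u, l, z) \<in> Tr" using paths_target by blast
        then show ?thesis unfolding Tr_def C_def by blast
      qed
      then obtain q \<kappa> p where zq: "z = vcode (VX q \<kappa> p)" "VX q \<kappa> p \<in> U" by blast
      then have xq: "x \<in> LX q" using x by simp
      have "VY q \<kappa> x p \<in> vV" using zq(2) UV xq by auto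
      moreover have "(VX q \<kappa> p, VY q \<kappa> x p) \<in> vE" using xq by auto
      moreover have "vown (VX q \<kappa> p) \<noteq> True" by simp
      ultimately have Y: "VY q \<kappa> x p \<in> U" using U zq(2) unfolding pg.wins_def by blast
      have "vown (VY q \<kappa> x p) = True" by simp
      then have s: "(VY q \<kappa> x p, \<sigma> (VY q \<kappa> x p)) \<in> vE" "\<sigma> (VY q \<kappa> x p) \<in> U"
        using U Y unfolding pg.wins_def by blast+
      from s(1) obtain y where y: "y \<in> LY q x" "\<sigma> (VY q \<kappa> x p) = ?nx q \<kappa> x y" by auto
      have "C q \<kappa> p x y" using y s Y zq xq by (simp add: C_def)
      then have "(z, lb q x y, vcode (?nx q \<kappa> x y)) \<in> Tr" unfolding Tr_def zq(1) by blast
      then have "(z, lb q x y, vcode (?nx q \<kappa> x y)) \<in> paths m Tr" by (rule paths_base)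
      then show ?thesis using y(1) zq(1)
        by (intro bexI[of _ y] exI[of _ "vcode (?nx q \<kappa> x y)"]) auto
    qed
    ultimately show ?thesis unfolding Ycert_def by blast
  next
    case False
    define W' where "W' = vV - U"
    have W: "pg.wins False vV W' \<tau>" using W by (simp add: W'_def)
    have v0W: "v0 \<in> W'" using False v0 by (simp add: W'_def)
    define C where "C q \<kappa> p x y \<longleftrightarrow> VX q \<kappa> p \<in> W' \<and> VY q \<kappa> x p \<in> W' \<and> x \<in> LX q \<and> y \<in> LY q x \<and>
      \<tau> (VX q \<kappa> p) = VY q \<kappa> x p \<and> ?nx q \<kappa> x y \<in> W'" for q \<kappa> p x y
    define Tr where "Tr = {(vcode (VX q \<kappa> p), lb q x y, vcode (?nx q \<kappa> x y)) | q \<kappa> p x y. C q \<kappa> p x y}"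
    have UV: "W' \<subseteq> vV" using W by (simp add: pg.wins_def)
    have lab: "l \<in> S" if "(z, l, z') \<in> Tr" for z l z'
      using that step UV by (auto simp: Tr_def C_def)
    have "Tr \<subseteq> vcode ` vV \<times> S \<times> vcode ` vV"
    proof
      fix t assume t: "t \<in> Tr"
      then obtain q \<kappa> p x y where *: "t = (vcode (VX q \<kappa> p), lb q x y, vcode (?nx q \<kappa> x y))" "C q \<kappa> p x y"
        unfolding Tr_def by blast
      then have "VX q \<kappa> p \<in> vV" "?nx q \<kappa> x y \<in> vV" using UV by (auto simp: C_def)
      then show "t \<in> vcode ` vV \<times> S \<times> vcode ` vV" using t lab unfolding *(1) by blast
    qed
    then have finTr: "finite Tr" by (rule finite_subset) (use finite_vV finite_S in auto)
    have "cert_ok m ?z0 (paths m Tr) (\<lambda>s e. \<not> acc s e)"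
    proof (rule cert_ok_paths[OF finTr lab])
      fix a l pp s e
      assume a: "a 0 = ?z0" "\<And>i. (a i, l i, a (Suc i)) \<in> Tr" and lf: "linked_fact m l pp s e"
      from decode[OF a[unfolded Tr_def]] obtain q x y \<kappa> p where
        q: "q 0 = q0" "\<And>k. q (Suc k) = dl (q k) (x k) (y k)" and
        \<kappa>: "\<kappa> 0 = ([], [])" "\<And>k. \<kappa> (Suc k) = upd (\<kappa> k) (l k)" "\<And>k. p (Suc k) = prio acc (\<kappa> k) (l k)" and
        l: "\<And>k. l k = lb (q k) (x k) (y k)" and C: "\<And>k. C (q k) (\<kappa> k) (p k) (x k) (y k)"
        by (elim exE conjE) blast
      have leq: "l = (\<lambda>k. lb (q k) (x k) (y k))" using l by blast
      let ?\<pi> = "\<lambda>k. if even k then VX (q (k div 2)) (\<kappa> (k div 2)) (p (k div 2))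
        else VY (q (k div 2)) (\<kappa> (k div 2)) (x (k div 2)) (p (k div 2))"
      have pw: "pg.pwin True ?\<pi> \<longleftrightarrow> acc s e"
        by (rule path_parity[OF q _ _ \<kappa>[unfolded l] lf[unfolded leq]]) (use C in \<open>auto simp: C_def\<close>)
      have "pg.follows False W' \<tau> ?\<pi>"
        unfolding pg.follows_def
      proof
        fix k
        show "?\<pi> k \<in> W' \<and> (?\<pi> k, ?\<pi> (Suc k)) \<in> vE \<and> (vown (?\<pi> k) = False \<longrightarrow> ?\<pi> (Suc k) = \<tau> (?\<pi> k))"
        proof (cases "even k")
          case True
          then show ?thesis using C[of "k div 2"] by (auto simp: C_def)
        next
          case False
          then have "Suc k div 2 = Suc (k div 2)" by (auto elim: oddE)
          then show ?thesis using False C[of "k div 2"] q(2) \<kappa>(2,3) l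
            by (auto simp: C_def)
        qed
      qed
      then have "pg.pwin False ?\<pi>" using W unfolding pg.wins_def by blast
      then show "\<not> acc s e" using pw by (simp add: pg.pwin_def)
    qed
    moreover have "\<exists>x\<in>LX (pfst z). \<forall>y\<in>LY (pfst z) x. \<exists>z'. pfst z' = dl (pfst z) x y \<and>
        (z, lb (pfst z) x y, z') \<in> paths m Tr"
      if z: "z \<in> cert_states ?z0 (paths m Tr)" for z
    proof -
      have "\<exists>q \<kappa> p. z = vcode (VX q \<kappa> p) \<and> VX q \<kappa> p \<in> W'"
      proof (cases "z = ?z0")
        case True
        then show ?thesis using v0W z0 unfolding v0_def by blast
      next
        case False
        then obtain u0 s0 where "(u0, s0, z) \<in> paths m Tr" using z by (auto simp: cert_states_def)
        then obtain u l where "(u, l, z) \<in> Tr" using paths_target by blast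
        then show ?thesis unfolding Tr_def C_def by blast
      qed
      then obtain q \<kappa> p where zq: "z = vcode (VX q \<kappa> p)" "VX q \<kappa> p \<in> W'" by blast
      have "vown (VX q \<kappa> p) = False" by simp
      then have s: "(VX q \<kappa> p, \<tau> (VX q \<kappa> p)) \<in> vE" "\<tau> (VX q \<kappa> p) \<in> W'"
        using W zq(2) unfolding pg.wins_def by blast+
      from s(1) obtain x where x: "x \<in> LX q" "\<tau> (VX q \<kappa> p) = VY q \<kappa> x p" by auto
      have "\<exists>z'. pfst z' = dl q x y \<and> (z, lb q x y, z') \<in> paths m Tr" if y: "y \<in> LY q x" for y
      proof -
        have "?nx q \<kappa> x y \<in> vV" using vE_Y[of q \<kappa> x p y] s(2) x(2) y UV by auto
        moreover have "(VY q \<kappa> x p, ?nx q \<kappa> x y) \<in> vE" using y by auto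
        moreover have "vown (VY q \<kappa> x p) \<noteq> False" by simp
        ultimately have "?nx q \<kappa> x y \<in> W'" using W s(2) x(2) unfolding pg.wins_def by metis
        then have "C q \<kappa> p x y" using zq x y s by (simp add: C_def)
        then have "(z, lb q x y, vcode (?nx q \<kappa> x y)) \<in> Tr" unfolding Tr_def zq(1) by blast
        then have "(z, lb q x y, vcode (?nx q \<kappa> x y)) \<in> paths m Tr" by (rule paths_base)
        then show ?thesis by (intro exI[of _ "vcode (?nx q \<kappa> x y)"]) auto
      qed
      then show ?thesis using x(1) zq(1) by (intro bexI[of _ x]) auto
    qed
    ultimately show ?thesis unfolding Xcert_def by blast
  qed
qed

end

section \<open>Finitely variable signals\<close>

lemma constant_on_iff: "f constant_on A \<longleftrightarrow> (\<forall>x\<in>A. \<forall>y\<in>A. f x = f y)"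
  unfolding constant_on_def by (cases "A = {}") auto

lemma constant_on_cong:
  assumes "\<And>x. x \<in> A \<Longrightarrow> f x = g x" shows "f constant_on A \<longleftrightarrow> g constant_on A"
  unfolding constant_on_def using assms by simp

text \<open>Finite variability is a local property: it says that one-sided limits exist in the discrete
  topology.\<close>

definition locally_fv :: "(real \<Rightarrow> 'a) \<Rightarrow> bool" where
  "locally_fv f \<longleftrightarrow> (\<forall>t\<ge>0. (\<exists>\<epsilon>>0. f constant_on {t<..<t + \<epsilon>}) \<and>
     (t > 0 \<longrightarrow> (\<exists>\<epsilon>>0. f constant_on {t - \<epsilon><..<t})))"

lemma locally_fv_right:
  assumes "locally_fv f" "t \<ge> 0" obtains \<epsilon> where "\<epsilon> > 0" "f constant_on {t<..<t + \<epsilon>}"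
  using assms unfolding locally_fv_def by blast

lemma locally_fv_left:
  assumes "locally_fv f" "t > 0" obtains \<epsilon> where "\<epsilon> > 0" "\<epsilon> \<le> t" "f constant_on {t - \<epsilon><..<t}"
proof -
  from assms obtain \<epsilon> where e: "\<epsilon> > 0" "f constant_on {t - \<epsilon><..<t}"
    unfolding locally_fv_def by (meson less_imp_le)
  show thesis
  proof (rule that[of "min \<epsilon> t"])
    show "f constant_on {t - min \<epsilon> t<..<t}"
      by (rule constant_on_subset[OF e(2)]) auto
  qed (use e assms in auto)
qed

lemma finitely_variable_imp_locally_fv:
  assumes "finitely_variable f" shows "locally_fv f"
proof -
  obtain \<tau> :: "nat \<Rightarrow> real" where \<tau>: "\<tau> 0 = 0" "strict_mono \<tau>" "\<not> bdd_above (range \<tau>)"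
    "\<And>i. f constant_on {\<tau> i<..<\<tau> (Suc i)}"
    using assms unfolding finitely_variable_def by auto
  have ex: "\<exists>n. t < \<tau> n" for t
    using \<tau>(3) unfolding bdd_above_def by (auto simp: not_le)
  show ?thesis unfolding locally_fv_def
  proof (intro allI impI conjI)
    fix t :: real assume t: "t \<ge> 0"
    define n where "n = (LEAST n. t < \<tau> n)"
    have n: "t < \<tau> n" unfolding n_def using LeastI_ex[OF ex] .
    then obtain k where k: "n = Suc k" using t \<tau>(1) by (cases n) auto
    have "\<not> t < \<tau> k" using not_less_Least[of k "\<lambda>n. t < \<tau> n"] k n_def by simp
    then have "f constant_on {t<..<t + (\<tau> n - t)}"
      by (intro constant_on_subset[OF \<tau>(4)[of k]]) (auto simp: k)
    then show "\<exists>\<epsilon>>0. f constant_on {t<..<t + \<epsilon>}" using n by (intro exI[of _ "\<tau> n - t"]) auto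
  next
    fix t :: real assume t: "t > 0"
    have ex': "\<exists>n. t \<le> \<tau> n" using ex less_imp_le by blast
    define n where "n = (LEAST n. t \<le> \<tau> n)"
    have n: "t \<le> \<tau> n" unfolding n_def using LeastI_ex[OF ex'] .
    then obtain k where k: "n = Suc k" using t \<tau>(1) by (cases n) auto
    have k2: "\<not> t \<le> \<tau> k" using not_less_Least[of k "\<lambda>n. t \<le> \<tau> n"] k n_def by simp
    have "f constant_on {t - (t - \<tau> k)<..<t}"
      by (intro constant_on_subset[OF \<tau>(4)[of k]]) (use n k in auto)
    then show "\<exists>\<epsilon>>0. f constant_on {t - \<epsilon><..<t}" using k2 by (intro exI[of _ "t - \<tau> k"]) auto
  qed
qed

text \<open>The end of the longest interval of constancy that starts right after \<open>t\<close>,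
  of length at most \<open>D\<close>. The value at \<open>t\<close> itself is disregarded, and so is
  the one at the end.\<close>

definition nextt :: "(real \<Rightarrow> 'a) \<Rightarrow> real \<Rightarrow> real \<Rightarrow> real" where
  "nextt f t D = Sup {c. t < c \<and> c \<le> t + D \<and> f constant_on {t<..<c}}"

lemma nextt:
  assumes "locally_fv f" "t \<ge> 0" "D > 0"
  shows "t < nextt f t D" "nextt f t D \<le> t + D" "f constant_on {t<..<nextt f t D}"
    "\<And>c. nextt f t D < c \<Longrightarrow> c \<le> t + D \<Longrightarrow> \<not> f constant_on {t<..<c}"
proof -
  let ?C = "{c. t < c \<and> c \<le> t + D \<and> f constant_on {t<..<c}}"
  obtain \<epsilon> where e: "\<epsilon> > 0" "f constant_on {t<..<t + \<epsilon>}" using locally_fv_right[OF assms(1,2)] .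
  define c0 where "c0 = t + min \<epsilon> D"
  have "f constant_on {t<..<c0}" by (rule constant_on_subset[OF e(2)]) (auto simp: c0_def)
  then have c0: "c0 \<in> ?C" using e assms by (auto simp: c0_def)
  have bdd: "bdd_above ?C" by (rule bdd_aboveI[of _ "t + D"]) auto
  have ge: "c \<le> nextt f t D" if "c \<in> ?C" for c
    unfolding nextt_def by (rule cSup_upper[OF that bdd])
  show "t < nextt f t D" using ge[OF c0] c0 by auto
  show "nextt f t D \<le> t + D" unfolding nextt_def by (rule cSup_least) (use c0 in auto)
  show "f constant_on {t<..<nextt f t D}"
    unfolding constant_on_iff
  proof (intro ballI)
    fix x y assume xy: "x \<in> {t<..<nextt f t D}" "y \<in> {t<..<nextt f t D}"
    then have "max x y < Sup ?C" by (auto simp: nextt_def)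
    then obtain c where "c \<in> ?C" "max x y < c" using less_cSupD[of ?C "max x y"] c0 by blast
    then show "f x = f y" using xy unfolding constant_on_iff by auto
  qed
  show "\<not> f constant_on {t<..<c}" if "nextt f t D < c" "c \<le> t + D" for c
    using ge[of c] that \<open>t < nextt f t D\<close> by auto
qed

text \<open>A bounded increasing sequence accumulates at its supremum, where \<open>f\<close> has a
  left limit. The arguments against infinitely many rounds in bounded time start from here.\<close>

lemma bounded_strict_mono_constant:
  fixes \<tau> :: "nat \<Rightarrow> real"
  assumes "locally_fv f" "\<tau> 0 \<ge> 0" "strict_mono \<tau>" "bdd_above (range \<tau>)"
  shows "\<exists>N. \<forall>n\<ge>N. f constant_on {\<tau> n<..<Sup (range \<tau>)} \<and> \<tau> n < Sup (range \<tau>) \<and> Sup (range \<tau>) < \<tau> n + 1"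
proof -
  let ?L = "Sup (range \<tau>)"
  have le: "\<tau> n \<le> ?L" for n using assms(4) by (intro cSup_upper) auto
  have lt: "\<tau> n < ?L" for n
    using le[of "Suc n"] assms(3) strict_mono_Suc_iff[of \<tau>] by (meson less_le_trans)
  have "?L > 0" using lt[of 0] assms(2) by linarith
  then obtain \<epsilon> where e: "\<epsilon> > 0" "f constant_on {?L - \<epsilon><..<?L}"
    using locally_fv_left[OF assms(1)] by metis
  have "range \<tau> \<noteq> {}" "?L - min \<epsilon> 1 < ?L" using e by simp_all
  from less_cSupD[OF this] obtain N where N: "?L - min \<epsilon> 1 < \<tau> N" by blast
  show ?thesis
  proof (intro exI allI impI conjI)
    fix n assume "n \<ge> N"
    then have "\<tau> N \<le> \<tau> n" using assms(3) by (simp add: strict_mono_less_eq)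
    then show "f constant_on {\<tau> n<..<?L}" "?L < \<tau> n + 1"
      using N by (auto intro!: constant_on_subset[OF e(2)])
  qed (rule lt)
qed

text \<open>The breakpoints are found greedily, in steps of at most 1. If they were bounded,
  \<open>f\<close> would be constant from some breakpoint to their supremum, and the next breakpoint
  would have been chosen at least as late as the supremum.\<close>

lemma locally_fv_imp_finitely_variable:
  assumes "locally_fv f" shows "finitely_variable f"
proof -
  define \<tau> where "\<tau> = rec_nat (0 :: real) (\<lambda>_ t. nextt f t 1)"
  have \<tau>S: "\<tau> (Suc n) = nextt f (\<tau> n) 1" and \<tau>0: "\<tau> 0 = 0" for n by (simp_all add: \<tau>_def)
  have nn: "0 \<le> \<tau> n" for n
  proof (induction n)
    case (Suc n)
    then show ?case using nextt(1)[OF assms Suc, of 1] by (simp add: \<tau>S)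
  qed (simp add: \<tau>0)
  note nx = nextt[OF assms nn zero_less_one, folded \<tau>S]
  have sm: "strict_mono \<tau>" unfolding strict_mono_Suc_iff using nx(1) by blast
  have "\<not> bdd_above (range \<tau>)"
  proof
    assume "bdd_above (range \<tau>)"
    from bounded_strict_mono_constant[OF assms _ sm this] \<tau>0 obtain N where
      N: "f constant_on {\<tau> n<..<Sup (range \<tau>)} \<and> \<tau> n < Sup (range \<tau>) \<and> Sup (range \<tau>) < \<tau> n + 1" if "n \<ge> N" for n
      by fastforce
    show False using nx(4)[of N "Sup (range \<tau>)"] N[of N] N[of "Suc N"] by auto
  qed
  then show ?thesis unfolding finitely_variable_def using sm \<tau>0 nx(3)
    by (intro exI[of _ \<tau>]) simp
qed

lemma finitely_variable_iff: "finitely_variable f \<longleftrightarrow> locally_fv f"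
  using finitely_variable_imp_locally_fv locally_fv_imp_finitely_variable by blast

text \<open>Each bounded interval may have a witness of its own. This yields finite variability of
  limits of approximations that become final on longer and longer intervals.\<close>

lemma locally_fvI:
  assumes "\<And>T. \<exists>g. locally_fv g \<and> (\<forall>t\<in>{0..T}. f t = g t)"
  shows "locally_fv f"
  unfolding locally_fv_def
proof (intro allI impI conjI)
  fix t :: real assume t: "t \<ge> 0"
  obtain g where g: "locally_fv g" "\<forall>s\<in>{0..t + 1}. f s = g s" using assms by blast
  obtain \<epsilon> where e: "\<epsilon> > 0" "g constant_on {t<..<t + \<epsilon>}" using locally_fv_right[OF g(1) t] .
  have "f constant_on {t<..<t + min \<epsilon> 1}"
    using e(2) g(2) t unfolding constant_on_iff by auto
  then show "\<exists>\<epsilon>>0. f constant_on {t<..<t + \<epsilon>}" using e by (intro exI[of _ "min \<epsilon> 1"]) auto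
next
  fix t :: real assume t: "t > 0"
  obtain g where g: "locally_fv g" "\<forall>s\<in>{0..t}. f s = g s" using assms by blast
  obtain \<epsilon> where e: "\<epsilon> > 0" "\<epsilon> \<le> t" "g constant_on {t - \<epsilon><..<t}" using locally_fv_left[OF g(1) t] .
  have "f constant_on {t - \<epsilon><..<t} \<longleftrightarrow> g constant_on {t - \<epsilon><..<t}"
    using g(2) e(2) by (intro constant_on_cong) auto
  then have "f constant_on {t - \<epsilon><..<t}" using e(3) by blast
  then show "\<exists>\<epsilon>>0. f constant_on {t - \<epsilon><..<t}" using e by blast
qed

lemma locally_fv_cong:
  assumes "\<And>t. t \<ge> 0 \<Longrightarrow> f t = g t" shows "locally_fv f \<longleftrightarrow> locally_fv g"
proof
  assume "locally_fv f"
  then show "locally_fv g"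
    by (intro locally_fvI) (use assms in \<open>auto intro!: exI[of _ f]\<close>)
next
  assume "locally_fv g"
  then show "locally_fv f"
    by (intro locally_fvI) (use assms in \<open>auto intro!: exI[of _ g]\<close>)
qed

lemma locally_fv_comp2:
  assumes "locally_fv f" "locally_fv g" shows "locally_fv (\<lambda>t. h (f t) (g t))"
  unfolding locally_fv_def
proof (intro allI impI conjI)
  fix t :: real assume t: "t \<ge> 0"
  obtain \<epsilon> where e: "\<epsilon> > 0" "f constant_on {t<..<t + \<epsilon>}" using locally_fv_right[OF assms(1) t] .
  obtain \<delta> where d: "\<delta> > 0" "g constant_on {t<..<t + \<delta>}" using locally_fv_right[OF assms(2) t] .
  have "(\<lambda>t. h (f t) (g t)) constant_on {t<..<t + min \<epsilon> \<delta>}"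
    using e(2) d(2) unfolding constant_on_iff by (intro ballI arg_cong2[of _ _ _ _ h]) auto
  then show "\<exists>\<epsilon>>0. (\<lambda>t. h (f t) (g t)) constant_on {t<..<t + \<epsilon>}" using e d
    by (intro exI[of _ "min \<epsilon> \<delta>"]) auto
next
  fix t :: real assume t: "t > 0"
  obtain \<epsilon> where e: "\<epsilon> > 0" "f constant_on {t - \<epsilon><..<t}" using locally_fv_left[OF assms(1) t] .
  obtain \<delta> where d: "\<delta> > 0" "g constant_on {t - \<delta><..<t}" using locally_fv_left[OF assms(2) t] .
  have "(\<lambda>t. h (f t) (g t)) constant_on {t - min \<epsilon> \<delta><..<t}"
    using e(2) d(2) unfolding constant_on_iff by (intro ballI arg_cong2[of _ _ _ _ h]) auto
  then show "\<exists>\<epsilon>>0. (\<lambda>t. h (f t) (g t)) constant_on {t - \<epsilon><..<t}" using e d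
    by (intro exI[of _ "min \<epsilon> \<delta>"]) auto
qed

lemma locally_fv_const: "locally_fv (\<lambda>t. c)"
  unfolding locally_fv_def constant_on_iff by (auto intro: exI[of _ 1])

lemma locally_fv_comp: "locally_fv f \<Longrightarrow> locally_fv (\<lambda>t. h (f t))"
  by (rule locally_fv_comp2[of f "\<lambda>_. ()" "\<lambda>x _. h x"]) (auto intro: locally_fv_const)

lemma locally_fv_less: "locally_fv (\<lambda>t. t < a)"
  unfolding locally_fv_def constant_on_iff
proof (intro allI impI conjI)
  fix t :: real
  show "\<exists>\<epsilon>>0. \<forall>x\<in>{t<..<t + \<epsilon>}. \<forall>y\<in>{t<..<t + \<epsilon>}. (x < a) = (y < a)"
    by (intro exI[of _ "if t < a then a - t else 1"]) auto
  show "\<exists>\<epsilon>>0. \<forall>x\<in>{t - \<epsilon><..<t}. \<forall>y\<in>{t - \<epsilon><..<t}. (x < a) = (y < a)"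
    by (intro exI[of _ "if t \<le> a then 1 else t - a"]) auto
qed

lemma locally_fv_le: "locally_fv (\<lambda>t. t \<le> a)"
  unfolding locally_fv_def constant_on_iff
proof (intro allI impI conjI)
  fix t :: real
  show "\<exists>\<epsilon>>0. \<forall>x\<in>{t<..<t + \<epsilon>}. \<forall>y\<in>{t<..<t + \<epsilon>}. (x \<le> a) = (y \<le> a)"
    by (intro exI[of _ "if t < a then a - t else 1"]) auto
  show "\<exists>\<epsilon>>0. \<forall>x\<in>{t - \<epsilon><..<t}. \<forall>y\<in>{t - \<epsilon><..<t}. (x \<le> a) = (y \<le> a)"
    by (intro exI[of _ "if t \<le> a then 1 else t - a"]) auto
qed

section \<open>Signals as functions and boolean signals as sets\<close>

lemma signals_iff: "f \<in> signals \<Sigma> \<longleftrightarrow> f \<in> {0..} \<rightarrow>\<^sub>E \<Sigma> \<and> locally_fv f"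
  by (simp add: signals_def finitely_variable_iff)

lemma boolean_signals_iff: "S \<in> boolean_signals \<longleftrightarrow> S \<subseteq> {0..} \<and> locally_fv (\<lambda>t. t \<in> S)"
proof -
  have "locally_fv (\<lambda>t\<in>{0..}. t \<in> S) \<longleftrightarrow> locally_fv (\<lambda>t. t \<in> S)"
    by (rule locally_fv_cong) simp
  then show ?thesis unfolding boolean_signals_def signals_iff by auto
qed

lemma boolean_signals_empty: "{} \<in> boolean_signals"
  using locally_fv_const[of False] by (simp add: boolean_signals_iff)

lemma boolean_signals_Un: "S \<in> boolean_signals \<Longrightarrow> T \<in> boolean_signals \<Longrightarrow> S \<union> T \<in> boolean_signals"
  using locally_fv_comp2[of "\<lambda>t. t \<in> S" "\<lambda>t. t \<in> T" "(\<or>)"] by (simp add: boolean_signals_iff)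

lemma boolean_signals_Int: "S \<in> boolean_signals \<Longrightarrow> T \<in> boolean_signals \<Longrightarrow> S \<inter> T \<in> boolean_signals"
  using locally_fv_comp2[of "\<lambda>t. t \<in> S" "\<lambda>t. t \<in> T" "(\<and>)"] by (auto simp: boolean_signals_iff)

lemma boolean_signals_UN:
  assumes "finite A" "\<And>a. a \<in> A \<Longrightarrow> S a \<in> boolean_signals"
  shows "(\<Union>a\<in>A. S a) \<in> boolean_signals"
  using assms by (induction A) (auto intro: boolean_signals_empty boolean_signals_Un)

lemma boolean_signals_singleton: "0 \<le> p \<Longrightarrow> {p} \<in> boolean_signals"
proof -
  have "(\<lambda>t. t \<in> {p}) = (\<lambda>t. t \<le> p \<and> \<not> t < p)" by auto
  then show "0 \<le> p \<Longrightarrow> {p} \<in> boolean_signals"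
    using locally_fv_comp2[OF locally_fv_le[of p] locally_fv_less[of p], of "\<lambda>x y. x \<and> \<not> y"]
    by (simp add: boolean_signals_iff)
qed

lemma boolean_signals_interval: "0 \<le> a \<Longrightarrow> {a<..<b} \<in> boolean_signals"
  using locally_fv_comp2[OF locally_fv_less[of b] locally_fv_le[of a], of "\<lambda>x y. \<not> y \<and> x"]
  by (auto simp: boolean_signals_iff not_le)

lemma boolean_signals_local:
  assumes "S \<subseteq> {0..}" "\<And>T. \<exists>S'\<in>boolean_signals. \<forall>t\<in>{0..T}. t \<in> S \<longleftrightarrow> t \<in> S'"
  shows "S \<in> boolean_signals"
  unfolding boolean_signals_iff
proof (intro conjI assms(1) locally_fvI)
  fix T
  obtain S' where "S' \<in> boolean_signals" "\<forall>t\<in>{0..T}. t \<in> S \<longleftrightarrow> t \<in> S'" using assms(2) by blast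
  then show "\<exists>g. locally_fv g \<and> (\<forall>t\<in>{0..T}. (t \<in> S) = g t)"
    by (intro exI[of _ "\<lambda>t. t \<in> S'"]) (simp add: boolean_signals_iff)
qed

section \<open>Types of signals\<close>

lemma unbounded_range_ex: "\<not> bdd_above (range (\<tau> :: nat \<Rightarrow> real)) \<Longrightarrow> \<exists>n. b < \<tau> n"
  unfolding bdd_above_def by (auto simp: not_le)

text \<open>Only set variables are left: first-order variables become singletons, which is why the
  atoms are interpreted by existence of elements. \<open>Exq True\<close> is the quantifier over
  singletons.\<close>

datatype core = Lt nat nat | Inn nat nat | Nand core core | Exq bool nat core

fun satc :: "core \<Rightarrow> (nat \<Rightarrow> real set) \<Rightarrow> bool" where
  "satc (Lt i j) M \<longleftrightarrow> (\<exists>p\<in>M i. \<exists>q\<in>M j. p < q)"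
| "satc (Inn i j) M \<longleftrightarrow> M i \<inter> M j \<noteq> {}"
| "satc (Nand \<phi> \<psi>) M \<longleftrightarrow> \<not> (satc \<phi> M \<and> satc \<psi> M)"
| "satc (Exq b i \<phi>) M \<longleftrightarrow> (\<exists>S\<in>boolean_signals. (b \<longrightarrow> (\<exists>p. S = {p})) \<and> satc \<phi> (M(i := S)))"

text \<open>Cardinality up to the distinction between none, one and more, which is what recognising
  singletons requires.\<close>

definition cnt :: "real set \<Rightarrow> nat" where
  "cnt A = (if finite A then min 2 (card A) else 2)"

definition enc3 :: "nat \<Rightarrow> nat \<Rightarrow> nat \<Rightarrow> nat" where
  "enc3 a b c = prod_encode (a, prod_encode (b, c))"

definition qm :: "(nat \<Rightarrow> nat \<Rightarrow> nat) \<Rightarrow> nat \<Rightarrow> nat \<Rightarrow> nat" where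
  "qm f a c = prod_encode (min 2 (pfst a + pfst c), f (psnd a) (psnd c))"

text \<open>The type of a concatenation. For \<open>Lt\<close> the three bits say whether track
  \<open>i\<close> is met, whether track \<open>j\<close> is met and whether an ordered pair has
  been found; a new pair may have its first point in the left and its second in the right piece,
  which is the \<open>min\<close>. For \<open>Exq\<close> all choices on the left and on the right
  are combined.\<close>

fun mul :: "core \<Rightarrow> nat \<Rightarrow> nat \<Rightarrow> nat" where
  "mul (Lt i j) x y = enc3 (max (pfst x) (pfst y)) (max (pfst (psnd x)) (pfst (psnd y)))
     (max (psnd (psnd x)) (max (psnd (psnd y)) (min (pfst x) (pfst (psnd y)))))"
| "mul (Inn i j) x y = max x y"
| "mul (Nand \<phi> \<psi>) x y = prod_encode (mul \<phi> (pfst x) (pfst y), mul \<psi> (psnd x) (psnd y))"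
| "mul (Exq b i \<phi>) x y = union_code (\<lambda>a. image_code (qm (mul \<phi>) a) y) x"

fun ty :: "core \<Rightarrow> (nat \<Rightarrow> real set) \<Rightarrow> real set \<Rightarrow> nat" where
  "ty (Lt i j) M I = enc3 (of_bool (M i \<inter> I \<noteq> {})) (of_bool (M j \<inter> I \<noteq> {}))
     (of_bool (\<exists>p\<in>M i \<inter> I. \<exists>q\<in>M j \<inter> I. p < q))"
| "ty (Inn i j) M I = of_bool (M i \<inter> M j \<inter> I \<noteq> {})"
| "ty (Nand \<phi> \<psi>) M I = prod_encode (ty \<phi> M I, ty \<psi> M I)"
| "ty (Exq b i \<phi>) M I = set_encode ((\<lambda>S. prod_encode (cnt (S \<inter> I), ty \<phi> (M(i := S)) I)) ` boolean_signals)"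

fun car :: "core \<Rightarrow> nat set" where
  "car (Lt i j) = (\<lambda>(a, b, c). enc3 a b c) ` ({..1} \<times> {..1} \<times> {..1})"
| "car (Inn i j) = {..1}"
| "car (Nand \<phi> \<psi>) = prod_encode ` (car \<phi> \<times> car \<psi>)"
| "car (Exq b i \<phi>) = set_encode ` Pow (prod_encode ` ({..2} \<times> car \<phi>))"

lemma pfst_enc3 [simp]: "pfst (enc3 a b c) = a" and psnd_enc3 [simp]: "psnd (enc3 a b c) = prod_encode (b, c)"
  by (simp_all add: enc3_def)

lemma enc3_car: "a \<le> 1 \<Longrightarrow> b \<le> 1 \<Longrightarrow> c \<le> 1 \<Longrightarrow> enc3 a b c \<in> car (Lt i j)"
  by (simp, intro image_eqI[of _ _ "(a, b, c)"]) auto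

lemma finite_car: "finite (car \<phi>)"
  by (induction \<phi>) auto

lemma set_decode_inject: "set_decode x = set_decode y \<Longrightarrow> x = y"
  by (metis set_decode_inverse)

lemma pfst_qm [simp]: "pfst (qm f a c) = min 2 (pfst a + pfst c)"
  and psnd_qm [simp]: "psnd (qm f a c) = f (psnd a) (psnd c)"
  by (simp_all add: qm_def)

lemma qm_assoc:
  assumes "\<And>x y z. f (f x y) z = f x (f y z)"
  shows "qm f (qm f x y) z = qm f x (qm f y z)"
  by (simp add: qm_def assms min_def)

lemma mul_assoc: "mul \<phi> (mul \<phi> x y) z = mul \<phi> x (mul \<phi> y z)"
proof (induction \<phi> arbitrary: x y z)
  case (Lt i j)
  show ?case by (simp add: enc3_def max_def min_def)
next
  case (Exq b i \<phi>)
  show ?case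
    by (rule set_decode_inject) (auto simp: qm_assoc[of "mul \<phi>", OF Exq.IH] intro!: bexI; metis Exq.IH qm_assoc)
qed (auto simp: max.assoc)

definition qcar :: "core \<Rightarrow> nat set" where "qcar \<phi> = prod_encode ` ({..2} \<times> car \<phi>)"

lemma finite_qcar: "finite (qcar \<phi>)"
  by (simp add: qcar_def finite_car)

lemma qcar_iff: "x \<in> qcar \<phi> \<longleftrightarrow> pfst x \<le> 2 \<and> psnd x \<in> car \<phi>"
proof
  assume "pfst x \<le> 2 \<and> psnd x \<in> car \<phi>"
  then show "x \<in> qcar \<phi>" unfolding qcar_def by (intro image_eqI[of _ _ "(pfst x, psnd x)"]) auto
qed (auto simp: qcar_def)

lemma car_Exq_iff: "x \<in> car (Exq b i \<phi>) \<longleftrightarrow> set_decode x \<subseteq> qcar \<phi>"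
proof
  assume "set_decode x \<subseteq> qcar \<phi>"
  then show "x \<in> car (Exq b i \<phi>)"
    by (simp add: qcar_def) (metis PowI image_eqI set_decode_inverse)
next
  assume "x \<in> car (Exq b i \<phi>)"
  then obtain A where "x = set_encode A" "A \<subseteq> qcar \<phi>" by (auto simp: qcar_def)
  then show "set_decode x \<subseteq> qcar \<phi>" using finite_qcar by (metis finite_subset set_encode_inverse)
qed

lemma mul_car: "x \<in> car \<phi> \<Longrightarrow> y \<in> car \<phi> \<Longrightarrow> mul \<phi> x y \<in> car \<phi>"
proof (induction \<phi> arbitrary: x y)
  case (Lt i j)
  then obtain a b c a' b' c' where *: "x = enc3 a b c" "y = enc3 a' b' c'" "a \<le> 1" "b \<le> 1" "c \<le> 1"
    "a' \<le> 1" "b' \<le> 1" "c' \<le> 1" by auto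
  show ?case unfolding *(1,2) car.simps
    by (intro image_eqI[of _ _ "(max a a', max b b', max c (max c' (min a b')))"]) (use * in auto)
next
  case (Exq b i \<phi>)
  have "qm (mul \<phi>) a c \<in> qcar \<phi>" if "a \<in> qcar \<phi>" "c \<in> qcar \<phi>" for a c
    using that Exq.IH by (simp add: qcar_iff)
  then show ?case using Exq.prems unfolding car_Exq_iff by auto
qed auto

lemma cnt_le: "cnt A \<le> 2" by (simp add: cnt_def)

lemma ty_car: "ty \<phi> M I \<in> car \<phi>"
proof (induction \<phi> arbitrary: M)
  case (Lt i j)
  show ?case unfolding ty.simps by (rule enc3_car) simp_all
next
  case (Exq b i \<phi>)
  have "(\<lambda>S. prod_encode (cnt (S \<inter> I), ty \<phi> (M(i := S)) I)) ` boolean_signals \<subseteq> qcar \<phi>"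
    using Exq.IH cnt_le by (auto simp: qcar_iff)
  then show ?case by (simp add: qcar_def)
qed auto

lemma set_decode_ty_Exq [simp]:
  "set_decode (ty (Exq b i \<phi>) M I) = (\<lambda>S. prod_encode (cnt (S \<inter> I), ty \<phi> (M(i := S)) I)) ` boolean_signals"
proof -
  have "(\<lambda>S. prod_encode (cnt (S \<inter> I), ty \<phi> (M(i := S)) I)) ` boolean_signals \<subseteq> qcar \<phi>"
    using ty_car cnt_le by (auto simp: qcar_iff)
  then show ?thesis using finite_qcar by (simp add: finite_subset)
qed

lemma ty_local:
  assumes "\<And>i. M i \<inter> I = M' i \<inter> I" shows "ty \<phi> M I = ty \<phi> M' I"
  using assms
proof (induction \<phi> arbitrary: M M')
  case (Inn i j)
  have "M i \<inter> M j \<inter> I = M' i \<inter> M' j \<inter> I" using Inn[of i] Inn[of j] by auto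
  then show ?case by simp
next
  case (Exq b i \<phi>)
  have "ty \<phi> (M(i := S)) I = ty \<phi> (M'(i := S)) I" for S by (rule Exq.IH) (use Exq.prems in simp)
  then show ?case by simp
next
  case (Nand \<phi> \<psi>)
  then show ?case by (metis ty.simps(3))
qed simp

lemma cnt_Un:
  assumes "A \<inter> B = {}" shows "cnt (A \<union> B) = min 2 (cnt A + cnt B)"
  using assms by (auto simp: cnt_def card_Un_disjoint min_def)

text \<open>The composition theorem. Its core is that choices of the quantified signal on the two
  pieces are independent: any two of them can be glued, and a type looks only at the part of a
  signal inside its piece.\<close>

lemma ty_Un:
  assumes "I \<in> boolean_signals" "J \<in> boolean_signals" and lt: "\<And>a b. a \<in> I \<Longrightarrow> b \<in> J \<Longrightarrow> a < b"
  shows "ty \<phi> M (I \<union> J) = mul \<phi> (ty \<phi> M I) (ty \<phi> M J)"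
proof (induction \<phi> arbitrary: M)
  case (Lt i j)
  have "(\<exists>p\<in>M i \<inter> (I \<union> J). \<exists>q\<in>M j \<inter> (I \<union> J). p < q) \<longleftrightarrow>
    (\<exists>p\<in>M i \<inter> I. \<exists>q\<in>M j \<inter> I. p < q) \<or> (\<exists>p\<in>M i \<inter> J. \<exists>q\<in>M j \<inter> J. p < q) \<or>
    (M i \<inter> I \<noteq> {} \<and> M j \<inter> J \<noteq> {})" (is "?L \<longleftrightarrow> ?R1 \<or> ?R2 \<or> ?R3")
  proof
    assume ?L
    then obtain p q where pq: "p \<in> M i" "q \<in> M j" "p \<in> I \<union> J" "q \<in> I \<union> J" "p < q" by blast
    then show "?R1 \<or> ?R2 \<or> ?R3" using lt[of q p] by auto
  next
    assume "?R1 \<or> ?R2 \<or> ?R3"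
    then show ?L using lt by auto
  qed
  moreover have "M k \<inter> (I \<union> J) \<noteq> {} \<longleftrightarrow> M k \<inter> I \<noteq> {} \<or> M k \<inter> J \<noteq> {}" for k by auto
  moreover have "of_bool (P \<or> Q) = max (of_bool P) (of_bool Q :: nat)"
    "of_bool (P \<and> Q) = min (of_bool P) (of_bool Q :: nat)" for P Q by auto
  ultimately show ?case by (simp only: ty.simps mul.simps pfst_enc3 psnd_enc3 pfst_encode psnd_encode)
next
  case (Inn i j)
  have "M i \<inter> M j \<inter> (I \<union> J) \<noteq> {} \<longleftrightarrow> M i \<inter> M j \<inter> I \<noteq> {} \<or> M i \<inter> M j \<inter> J \<noteq> {}" by blast
  then show ?case by (simp add: max_def)
next
  case (Exq b i \<phi>)
  have disj: "I \<inter> J = {}" using lt by fastforce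
  show ?case
  proof (rule set_decode_inject, rule set_eqI)
    fix x
    have cntS: "cnt (S \<inter> (I \<union> J)) = min 2 (cnt (S \<inter> I) + cnt (S \<inter> J))" for S
      using cnt_Un[of "S \<inter> I" "S \<inter> J"] disj by (simp add: Int_Un_distrib) blast
    have "x \<in> set_decode (ty (Exq b i \<phi>) M (I \<union> J)) \<longleftrightarrow> (\<exists>S\<in>boolean_signals.
      x = qm (mul \<phi>) (prod_encode (cnt (S \<inter> I), ty \<phi> (M(i := S)) I))
        (prod_encode (cnt (S \<inter> J), ty \<phi> (M(i := S)) J)))"
      unfolding set_decode_ty_Exq image_iff by (simp only: qm_def cntS Exq.IH pfst_encode psnd_encode)
    also have "\<dots> \<longleftrightarrow> (\<exists>S\<in>boolean_signals. \<exists>T\<in>boolean_signals.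
      x = qm (mul \<phi>) (prod_encode (cnt (S \<inter> I), ty \<phi> (M(i := S)) I))
        (prod_encode (cnt (T \<inter> J), ty \<phi> (M(i := T)) J)))" (is "?L \<longleftrightarrow> ?R")
    proof
      assume ?R
      then obtain S T where ST: "S \<in> boolean_signals" "T \<in> boolean_signals"
        "x = qm (mul \<phi>) (prod_encode (cnt (S \<inter> I), ty \<phi> (M(i := S)) I))
        (prod_encode (cnt (T \<inter> J), ty \<phi> (M(i := T)) J))" by blast
      define U where "U = (S \<inter> I) \<union> (T \<inter> J)"
      have U: "U \<in> boolean_signals"
        unfolding U_def by (intro boolean_signals_Un boolean_signals_Int ST assms)
      have "U \<inter> I = S \<inter> I" "U \<inter> J = T \<inter> J" using disj by (auto simp: U_def)
      moreover have "ty \<phi> (M(i := U)) I = ty \<phi> (M(i := S)) I" "ty \<phi> (M(i := U)) J = ty \<phi> (M(i := T)) J"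
        by (rule ty_local; use calculation in simp)+
      ultimately show ?L using U ST(3) by (intro bexI[of _ U]) simp_all
    qed blast
    also have "\<dots> \<longleftrightarrow> x \<in> set_decode (mul (Exq b i \<phi>) (ty (Exq b i \<phi>) M I) (ty (Exq b i \<phi>) M J))"
      by (simp only: mul.simps set_decode_union_code set_decode_image_code set_decode_ty_Exq) blast
    finally show "x \<in> set_decode (ty (Exq b i \<phi>) M (I \<union> J)) \<longleftrightarrow>
      x \<in> set_decode (mul (Exq b i \<phi>) (ty (Exq b i \<phi>) M I) (ty (Exq b i \<phi>) M J))" .
  qed
qed simp

text \<open>Values of words \<open>u v u v ... u\<close> that begin and end with a letter of
  \<open>U\<close>: an open interval cut at finitely many points splits into open pieces and points
  in this alternation.\<close>

inductive_set op_closure :: "(nat \<Rightarrow> nat \<Rightarrow> nat) \<Rightarrow> nat set \<Rightarrow> nat set \<Rightarrow> nat set"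
  for m :: "nat \<Rightarrow> nat \<Rightarrow> nat" and U V :: "nat set" where
  base: "u \<in> U \<Longrightarrow> u \<in> op_closure m U V"
| step: "c \<in> op_closure m U V \<Longrightarrow> v \<in> V \<Longrightarrow> u \<in> U \<Longrightarrow> m (m c v) u \<in> op_closure m U V"

fun pt :: "core \<Rightarrow> nat set \<Rightarrow> nat" where
  "pt (Lt i j) A = enc3 (of_bool (i \<in> A)) (of_bool (j \<in> A)) 0"
| "pt (Inn i j) A = of_bool (i \<in> A \<and> j \<in> A)"
| "pt (Nand \<phi> \<psi>) A = prod_encode (pt \<phi> A, pt \<psi> A)"
| "pt (Exq b i \<phi>) A = set_encode {prod_encode (0, pt \<phi> (A - {i})), prod_encode (1, pt \<phi> (insert i A))}"

text \<open>On an interval where all tracks are constant the track \<open>i\<close> of a quantified signal may still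
  change finitely often; this is what the closure describes.\<close>

fun op :: "core \<Rightarrow> nat set \<Rightarrow> nat" where
  "op (Lt i j) B = enc3 (of_bool (i \<in> B)) (of_bool (j \<in> B)) (of_bool (i \<in> B \<and> j \<in> B))"
| "op (Inn i j) B = of_bool (i \<in> B \<and> j \<in> B)"
| "op (Nand \<phi> \<psi>) B = prod_encode (op \<phi> B, op \<psi> B)"
| "op (Exq b i \<phi>) B = set_encode (op_closure (qm (mul \<phi>))
     {prod_encode (0, op \<phi> (B - {i})), prod_encode (2, op \<phi> (insert i B))}
     {prod_encode (0, pt \<phi> (B - {i})), prod_encode (1, pt \<phi> (insert i B))})"

lemma pt_car: "pt \<phi> A \<in> car \<phi>"
proof (induction \<phi> arbitrary: A)
  case (Lt i j)
  show ?case unfolding pt.simps by (rule enc3_car) simp_all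
next
  case (Exq b i \<phi>)
  have "{prod_encode (0, pt \<phi> (A - {i})), prod_encode (1, pt \<phi> (insert i A))} \<subseteq> qcar \<phi>"
    using Exq.IH by (simp add: qcar_iff)
  then show ?case unfolding pt.simps car.simps qcar_def by blast
qed auto

lemma op_closure_subset:
  assumes "U \<subseteq> C" "V \<subseteq> C" "\<And>a b. a \<in> C \<Longrightarrow> b \<in> C \<Longrightarrow> m a b \<in> C"
  shows "op_closure m U V \<subseteq> C"
proof
  fix x assume "x \<in> op_closure m U V"
  then show "x \<in> C" by induction (use assms(1,2) in \<open>auto intro!: assms(3)\<close>)
qed

lemma qm_qcar: "a \<in> qcar \<phi> \<Longrightarrow> c \<in> qcar \<phi> \<Longrightarrow> qm (mul \<phi>) a c \<in> qcar \<phi>"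
  using mul_car by (simp add: qcar_iff)

lemma op_car: "op \<phi> B \<in> car \<phi>"
proof (induction \<phi> arbitrary: B)
  case (Lt i j)
  show ?case unfolding op.simps by (rule enc3_car) simp_all
next
  case (Exq b i \<phi>)
  have "op_closure (qm (mul \<phi>))
     {prod_encode (0, op \<phi> (B - {i})), prod_encode (2, op \<phi> (insert i B))}
     {prod_encode (0, pt \<phi> (B - {i})), prod_encode (1, pt \<phi> (insert i B))} \<subseteq> qcar \<phi>"
    by (rule op_closure_subset) (use Exq.IH pt_car qm_qcar in \<open>auto simp: qcar_iff\<close>)
  then show ?case unfolding op.simps car.simps qcar_def by blast
qed auto

lemma set_decode_op_Exq [simp]:
  "set_decode (op (Exq b i \<phi>) B) = op_closure (qm (mul \<phi>))
     {prod_encode (0, op \<phi> (B - {i})), prod_encode (2, op \<phi> (insert i B))}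
     {prod_encode (0, pt \<phi> (B - {i})), prod_encode (1, pt \<phi> (insert i B))}"
proof -
  have "op_closure (qm (mul \<phi>))
     {prod_encode (0, op \<phi> (B - {i})), prod_encode (2, op \<phi> (insert i B))}
     {prod_encode (0, pt \<phi> (B - {i})), prod_encode (1, pt \<phi> (insert i B))} \<subseteq> qcar \<phi>"
    by (rule op_closure_subset) (use op_car pt_car qm_qcar in \<open>auto simp: qcar_iff\<close>)
  then show ?thesis using finite_qcar by (simp add: finite_subset)
qed

lemma set_decode_pt_Exq [simp]:
  "set_decode (pt (Exq b i \<phi>) A) = {prod_encode (0, pt \<phi> (A - {i})), prod_encode (1, pt \<phi> (insert i A))}"
  unfolding pt.simps by (rule set_encode_inverse) simp

lemma ty_point:
  assumes "0 \<le> p" "\<And>i. p \<in> M i \<longleftrightarrow> i \<in> A"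
  shows "ty \<phi> M {p} = pt \<phi> A"
  using assms(2)
proof (induction \<phi> arbitrary: M A)
  case (Lt i j)
  then show ?case by (simp add: Int_insert_right)
next
  case (Inn i j)
  then show ?case by (simp add: Int_insert_right)
next
  case (Nand \<phi> \<psi>)
  then show ?case by (metis ty.simps(3) pt.simps(3))
next
  case (Exq b i \<phi>)
  have 1: "ty \<phi> (M(i := S)) {p} = pt \<phi> (if p \<in> S then insert i A else A - {i})" for S
    by (rule Exq.IH) (use Exq.prems in auto)
  have 2: "cnt (S \<inter> {p}) = of_bool (p \<in> S)" for S by (simp add: cnt_def Int_insert_right)
  have "(\<lambda>S. prod_encode (cnt (S \<inter> {p}), ty \<phi> (M(i := S)) {p})) ` boolean_signals
    = {prod_encode (0, pt \<phi> (A - {i})), prod_encode (1, pt \<phi> (insert i A))}" (is "?f ` _ = _")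
  proof
    show "?f ` boolean_signals \<subseteq> {prod_encode (0, pt \<phi> (A - {i})), prod_encode (1, pt \<phi> (insert i A))}"
      by (auto simp: 1 2 split: if_splits)
    have "?f {} = prod_encode (0, pt \<phi> (A - {i}))" "?f {p} = prod_encode (1, pt \<phi> (insert i A))"
      by (simp_all add: 1 cnt_def)
    then show "{prod_encode (0, pt \<phi> (A - {i})), prod_encode (1, pt \<phi> (insert i A))} \<subseteq> ?f ` boolean_signals"
      using imageI[OF boolean_signals_empty, of ?f] imageI[OF boolean_signals_singleton[OF assms(1)], of ?f]
      by simp
  qed
  then show ?case by (simp only: ty.simps pt.simps)
qed

text \<open>The type does not depend on the length of the interval, because any alternation of the
  quantified track that is possible at all can be squeezed into it. This makes the game insensitive
  to the times of events.\<close>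

lemma ty_open:
  assumes "0 \<le> a" "a < b" "\<And>t i. a < t \<Longrightarrow> t < b \<Longrightarrow> t \<in> M i \<longleftrightarrow> i \<in> B"
  shows "ty \<phi> M {a<..<b} = op \<phi> B"
  using assms
proof (induction \<phi> arbitrary: M B a b)
  case (Lt i j)
  have *: "M k \<inter> {a<..<b} = (if k \<in> B then {a<..<b} else {})" for k using Lt.prems by auto
  obtain p q where "p \<in> {a<..<b}" "q \<in> {a<..<b}" "p < q"
    using dense[OF Lt.prems(2)] dense by (metis greaterThanLessThan_iff less_trans)
  then have "\<exists>p\<in>{a<..<b}. \<exists>q\<in>{a<..<b}. p < q" by blast
  then show ?case using Lt.prems(2) by (cases "i \<in> B"; cases "j \<in> B") (simp_all add: *)
next
  case (Inn i j)
  have "M i \<inter> M j \<inter> {a<..<b} = (if i \<in> B \<and> j \<in> B then {a<..<b} else {})" using Inn.prems by auto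
  then show ?case using Inn.prems by simp
next
  case (Nand \<phi> \<psi>)
  show ?case using Nand.IH[OF Nand.prems] by simp
next
  case (Exq bb i \<phi>)
  let ?O = "{prod_encode (0, op \<phi> (B - {i})), prod_encode (2, op \<phi> (insert i B))}"
  let ?P = "{prod_encode (0, pt \<phi> (B - {i})), prod_encode (1, pt \<phi> (insert i B))}"
  let ?C = "op_closure (qm (mul \<phi>)) ?O ?P"
  define v where "v S I = prod_encode (cnt (S \<inter> I), ty \<phi> (M(i := S)) I)" for S I
  have vUn: "v S (I \<union> J) = qm (mul \<phi>) (v S I) (v S J)"
    if "I \<in> boolean_signals" "J \<in> boolean_signals" "\<And>a b. a \<in> I \<Longrightarrow> b \<in> J \<Longrightarrow> a < b" for S I J
  proof -
    have "(S \<inter> I) \<inter> (S \<inter> J) = {}" using that(3) by fastforce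
    from cnt_Un[OF this] show ?thesis using ty_Un[OF that, of \<phi> "M(i := S)"]
      by (simp add: v_def qm_def Int_Un_distrib)
  qed
  have split: "v S {c<..<d} = qm (mul \<phi>) (qm (mul \<phi>) (v S {c<..<e}) (v S {e})) (v S {e<..<d})"
    if "0 \<le> c" "c < e" "e < d" for S c d e
  proof -
    have "{c<..<d} = ({c<..<e} \<union> {e}) \<union> {e<..<d}" using that by auto
    then have "v S {c<..<d} = qm (mul \<phi>) (v S ({c<..<e} \<union> {e})) (v S {e<..<d})"
      using that by (simp only:) (intro vUn boolean_signals_Un boolean_signals_interval
          boolean_signals_singleton; auto)
    moreover have "v S ({c<..<e} \<union> {e}) = qm (mul \<phi>) (v S {c<..<e}) (v S {e})"
      using that by (intro vUn boolean_signals_interval boolean_signals_singleton) auto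
    ultimately show ?thesis by simp
  qed
  have vpt: "v S {e} = (if e \<in> S then prod_encode (1, pt \<phi> (insert i B)) else prod_encode (0, pt \<phi> (B - {i})))"
    if "a < e" "e < b" for S e
  proof -
    have "ty \<phi> (M(i := S)) {e} = pt \<phi> (if e \<in> S then insert i B else B - {i})"
      by (rule ty_point) (use that Exq.prems in auto)
    then show ?thesis by (simp add: v_def cnt_def Int_insert_right)
  qed
  have inf: "infinite {c<..<d}" if "c < d" for c d :: real using that by simp
  have vop: "v S {c<..<d} = (if T then prod_encode (2, op \<phi> (insert i B)) else prod_encode (0, op \<phi> (B - {i})))"
    if "a \<le> c" "c < d" "d \<le> b" "\<And>t. c < t \<Longrightarrow> t < d \<Longrightarrow> t \<in> S \<longleftrightarrow> T" for S c d T
  proof -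
    have "ty \<phi> (M(i := S)) {c<..<d} = op \<phi> (if T then insert i B else B - {i})"
      by (rule Exq.IH) (use that Exq.prems in auto)
    moreover have "S \<inter> {c<..<d} = (if T then {c<..<d} else {})" using that(4) by auto
    moreover have "cnt {c<..<d} = 2" using inf[OF that(2)] unfolding cnt_def by (simp only: if_False)
    moreover have "cnt {} = 0" by (simp add: cnt_def)
    ultimately show ?thesis by (simp add: v_def)
  qed
  \<comment> \<open>Induction over the breakpoints of the quantified signal, the interval being
    extended to the right piece by piece.\<close>
  have sub: "v S {a<..<b} \<in> ?C" if S: "S \<in> boolean_signals" for S
  proof -
    have "finitely_variable (\<lambda>t. t \<in> S)" using S by (simp add: boolean_signals_iff finitely_variable_iff)
    then obtain \<tau> :: "nat \<Rightarrow> real" where \<tau>: "\<tau> 0 = 0" "\<not> bdd_above (range \<tau>)"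
      "\<And>k. (\<lambda>t. t \<in> S) constant_on {\<tau> k<..<\<tau> (Suc k)}" unfolding finitely_variable_def by auto
    have "v S {a<..<c} \<in> ?C" if "a < c" "c \<le> b" "c \<le> \<tau> n" for n c
      using that
    proof (induction n arbitrary: c)
      case 0
      then show ?case using \<tau>(1) Exq.prems by simp
    next
      case (Suc n)
      show ?case
      proof (cases "c \<le> \<tau> n")
        case True
        then show ?thesis using Suc by simp
      next
        case False
        obtain T where T0: "\<forall>t\<in>{\<tau> n<..<\<tau> (Suc n)}. (t \<in> S) = T"
          using \<tau>(3)[of n] unfolding constant_on_def by blast
        have T: "t \<in> S \<longleftrightarrow> T" if "\<tau> n < t" "t < c" for t
          using bspec[OF T0, of t] that Suc.prems(3) by auto
        show ?thesis
        proof (cases "\<tau> n \<le> a")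
          case True
          have "v S {a<..<c} = (if T then prod_encode (2, op \<phi> (insert i B)) else prod_encode (0, op \<phi> (B - {i})))"
            by (rule vop) (use Suc.prems True T in auto)
          then show ?thesis by (auto intro: op_closure.base)
        next
          case a: False
          have "v S {a<..<c} = qm (mul \<phi>) (qm (mul \<phi>) (v S {a<..<\<tau> n}) (v S {\<tau> n})) (v S {\<tau> n<..<c})"
            by (rule split) (use a False Exq.prems in auto)
          moreover have "v S {a<..<\<tau> n} \<in> ?C" by (rule Suc.IH) (use a False Suc.prems in auto)
          moreover have "v S {\<tau> n} \<in> ?P" using vpt[of "\<tau> n" S] a False Suc.prems by auto
          moreover have "v S {\<tau> n<..<c} \<in> ?O"
            using vop[of "\<tau> n" c S T] T a False Suc.prems by auto
          ultimately show ?thesis by (auto intro: op_closure.step)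
        qed
      qed
    qed
    moreover obtain n where "b < \<tau> n" using unbounded_range_ex[OF \<tau>(2)] by blast
    ultimately show ?thesis using Exq.prems(2) by (meson less_imp_le order_refl)
  qed
  \<comment> \<open>Half of the interval is as good as the whole: the shorter word is realised left
    of the midpoint, the last point at the midpoint and the last open piece right of it.\<close>
  have sup: "\<exists>S\<in>boolean_signals. v S {c<..<d} = x"
    if "x \<in> ?C" "a \<le> c" "c < d" "d \<le> b" for x c d
    using that
  proof (induction arbitrary: c d)
    case (base u)
    have "v {} {c<..<d} = (if False then prod_encode (2, op \<phi> (insert i B)) else prod_encode (0, op \<phi> (B - {i})))"
      "v {c<..<d} {c<..<d} = (if True then prod_encode (2, op \<phi> (insert i B)) else prod_encode (0, op \<phi> (B - {i})))"
      by (rule vop; use base in auto)+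
    moreover have "{c<..<d} \<in> boolean_signals" using base Exq.prems by (intro boolean_signals_interval) auto
    ultimately show ?case using base(1) boolean_signals_empty by auto
  next
    case (step x p u)
    define e where "e = (c + d) / 2"
    have e: "c < e" "e < d" "0 \<le> c" using step.prems Exq.prems by (auto simp: e_def)
    obtain S where S: "S \<in> boolean_signals" "v S {c<..<e} = x"
      using step.IH[of c e] step.prems e by auto
    define S' where "S' = (S \<inter> {c<..<e}) \<union> ((if pfst p = 1 then {e} else {}) \<union>
      (if pfst u = 2 then {e<..<d} else {}))"
    have "(if pfst p = 1 then {e} else {}) \<in> boolean_signals" "(if pfst u = 2 then {e<..<d} else {}) \<in> boolean_signals"
      using e by (auto intro: boolean_signals_empty boolean_signals_singleton boolean_signals_interval)
    then have S': "S' \<in> boolean_signals"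
      unfolding S'_def using S e by (intro boolean_signals_Un boolean_signals_Int boolean_signals_interval) auto
    have "S' \<inter> {c<..<e} = S \<inter> {c<..<e}" by (auto simp: S'_def)
    moreover have "ty \<phi> (M(i := S')) {c<..<e} = ty \<phi> (M(i := S)) {c<..<e}"
      by (rule ty_local) (use calculation in simp)
    ultimately have "v S' {c<..<e} = x" using S(2) by (simp add: v_def)
    moreover have "v S' {e} = p"
    proof -
      have "e \<in> S' \<longleftrightarrow> pfst p = 1" by (auto simp: S'_def)
      then show ?thesis using vpt[of e S'] e step.prems step.hyps by auto
    qed
    moreover have "v S' {e<..<d} = u"
    proof -
      have "v S' {e<..<d} = (if pfst u = 2 then prod_encode (2, op \<phi> (insert i B)) else prod_encode (0, op \<phi> (B - {i})))"
        by (rule vop) (use e step.prems in \<open>auto simp: S'_def\<close>)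
      then show ?thesis using step.hyps by auto
    qed
    ultimately have "v S' {c<..<d} = qm (mul \<phi>) (qm (mul \<phi>) x p) u" using split[of c e d S'] e by simp
    then show ?case using S' by blast
  qed
  have "(\<lambda>S. v S {a<..<b}) ` boolean_signals = ?C"
    using sub sup[of _ a b] Exq.prems by (auto simp: image_iff)
  then show ?case by (simp only: ty.simps op.simps v_def)
qed

text \<open>For the atoms the prefix suffices, since all longer prefixes that end at a cut have
  value \<open>s\<close> as well. For a quantifier, a linked pair of the expanded signal is guessed
  inside the sets \<open>s\<close> and \<open>e\<close>; a singleton must have count 1 in the prefix
  and 0 in the repeated part.\<close>

fun acc :: "core \<Rightarrow> nat \<Rightarrow> nat \<Rightarrow> bool" where
  "acc (Lt i j) s e \<longleftrightarrow> psnd (psnd s) \<noteq> 0"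
| "acc (Inn i j) s e \<longleftrightarrow> s \<noteq> 0"
| "acc (Nand \<phi> \<psi>) s e \<longleftrightarrow> \<not> (acc \<phi> (pfst s) (pfst e) \<and> acc \<psi> (psnd s) (psnd e))"
| "acc (Exq b i \<phi>) s e \<longleftrightarrow> (\<exists>x\<in>set_decode s. \<exists>y\<in>set_decode e.
     mul \<phi> (psnd x) (psnd y) = psnd x \<and> mul \<phi> (psnd y) (psnd y) = psnd y \<and>
     (b \<longrightarrow> pfst x = 1 \<and> pfst y = 0) \<and> acc \<phi> (psnd x) (psnd y))"

section \<open>Ordered partitions of the half-line\<close>

definition pieces :: "(nat \<Rightarrow> real set) \<Rightarrow> bool" where
  "pieces I \<longleftrightarrow> (\<forall>r. I r \<in> boolean_signals) \<and> (\<forall>r r' a b. r < r' \<longrightarrow> a \<in> I r \<longrightarrow> b \<in> I r' \<longrightarrow> a < b) \<and>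
     (\<forall>T. \<exists>N. {0..T} \<subseteq> (\<Union>r<N. I r))"

lemma piecesD:
  assumes "pieces I"
  shows "I r \<in> boolean_signals" "r < r' \<Longrightarrow> a \<in> I r \<Longrightarrow> b \<in> I r' \<Longrightarrow> a < b"
  using assms unfolding pieces_def by blast+

lemma pieces_cover: "pieces I \<Longrightarrow> \<exists>N. {0..T} \<subseteq> (\<Union>r<N. I r)"
  unfolding pieces_def by blast

lemma pieces_in: "pieces I \<Longrightarrow> t \<ge> 0 \<Longrightarrow> \<exists>r. t \<in> I r"
  using pieces_cover[of I t] by fastforce

lemma pieces_disjoint: "pieces I \<Longrightarrow> r \<noteq> r' \<Longrightarrow> I r \<inter> I r' = {}"
  using piecesD(2)[of I r r'] piecesD(2)[of I r' r] by (fastforce simp: nat_neq_iff)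

lemma pieces_UN: "pieces I \<Longrightarrow> (\<Union>r\<in>{i..<j}. I r) \<in> boolean_signals"
  by (intro boolean_signals_UN piecesD) auto

lemma pieces_UN_Suc: "i < j \<Longrightarrow> (\<Union>r\<in>{i..<Suc j}. I r) = (\<Union>r\<in>{i..<j}. I r) \<union> I j"
  by (simp add: atLeastLessThanSuc) auto

lemma ty_pieces_Suc:
  assumes "pieces I" "i < j"
  shows "ty \<phi> M (\<Union>r\<in>{i..<Suc j}. I r) = mul \<phi> (ty \<phi> M (\<Union>r\<in>{i..<j}. I r)) (ty \<phi> M (I j))"
  unfolding pieces_UN_Suc[OF assms(2)]
proof (rule ty_Un[OF pieces_UN[OF assms(1)] piecesD(1)[OF assms(1)]])
  fix a b assume "a \<in> (\<Union>r\<in>{i..<j}. I r)" "b \<in> I j"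
  then show "a < b" using piecesD(2)[OF assms(1)] by auto
qed

lemma ty_pieces_linked:
  assumes "pieces I" "ty \<phi> M (I 0) = s" "\<And>r. ty \<phi> M (I (Suc r)) = e"
    "mul \<phi> s e = s" "mul \<phi> e e = e" "a < c"
  shows "ty \<phi> M (\<Union>r\<in>{a..<c}. I r) = (if a = 0 then s else e)"
  using assms(6)
proof (induction c)
  case (Suc c)
  show ?case
  proof (cases "a = c")
    case True
    then show ?thesis using assms(2,3) by (cases c) simp_all
  next
    case False
    then have ac: "a < c" using Suc.prems by simp
    then obtain c' where c': "c = Suc c'" by (cases c) auto
    have "ty \<phi> M (\<Union>r\<in>{a..<Suc c}. I r) = mul \<phi> (if a = 0 then s else e) e"
      unfolding ty_pieces_Suc[OF assms(1) ac] Suc.IH[OF ac] using assms(3)[of c'] by (simp only: c')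
    then show ?thesis using assms(4,5) by simp
  qed
qed simp

lemma ty_pieces:
  assumes "pieces I" "i < j"
  shows "ty \<phi> M (\<Union>r\<in>{i..<j}. I r) = seg (mul \<phi>) (\<lambda>r. ty \<phi> M (I r)) i j"
  using assms(2)
proof (induction j)
  case (Suc j)
  show ?case
  proof (cases "i = j")
    case False
    then have ij: "i < j" using Suc.prems by simp
    have "ty \<phi> M (\<Union>r\<in>{i..<Suc j}. I r) = mul \<phi> (ty \<phi> M (\<Union>r\<in>{i..<j}. I r)) (ty \<phi> M (I j))"
      by (rule ty_pieces_Suc[OF assms(1) ij])
    then show ?thesis using Suc.IH[OF ij] by (simp add: seg_Suc[OF ij])
  qed simp
qed simp

lemma val_pieces:
  assumes "pieces I" "i < j"
  shows "prod_encode (cnt (S \<inter> (\<Union>r\<in>{i..<j}. I r)), ty \<phi> M (\<Union>r\<in>{i..<j}. I r))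
    = seg (qm (mul \<phi>)) (\<lambda>r. prod_encode (cnt (S \<inter> I r), ty \<phi> M (I r))) i j"
  using assms(2)
proof (induction j)
  case (Suc j)
  show ?case
  proof (cases "i = j")
    case False
    then have ij: "i < j" using Suc.prems by simp
    have "ty \<phi> M (\<Union>r\<in>{i..<Suc j}. I r) = mul \<phi> (ty \<phi> M (\<Union>r\<in>{i..<j}. I r)) (ty \<phi> M (I j))"
      by (rule ty_pieces_Suc[OF assms(1) ij])
    moreover have "I r \<inter> I j = {}" if "r \<in> {i..<j}" for r
      using pieces_disjoint[OF assms(1), of r j] that by simp
    then have "(S \<inter> (\<Union>r\<in>{i..<j}. I r)) \<inter> (S \<inter> I j) = {}" by blast
    from cnt_Un[OF this] have "cnt (S \<inter> (\<Union>r\<in>{i..<Suc j}. I r)) = min 2 (cnt (S \<inter> (\<Union>r\<in>{i..<j}. I r)) + cnt (S \<inter> I j))"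
      unfolding pieces_UN_Suc[OF ij] by (simp add: Int_Un_distrib)
    ultimately show ?thesis using Suc.IH[OF ij, symmetric] by (simp add: seg_Suc[OF ij] qm_def)
  qed simp
qed simp

definition coarsen :: "(nat \<Rightarrow> real set) \<Rightarrow> (nat \<Rightarrow> nat) \<Rightarrow> nat \<Rightarrow> real set" where
  "coarsen I p k = (\<Union>r\<in>{(if k = 0 then 0 else p (k - 1))..<p k}. I r)"

lemma coarsen_cover:
  fixes p :: "nat \<Rightarrow> nat"
  assumes "strict_mono p" "r < p n" shows "\<exists>k\<le>n. r \<in> {(if k = 0 then 0 else p (k - 1))..<p k}"
  using assms(2)
proof (induction n)
  case (Suc n)
  show ?case
  proof (cases "r < p n")
    case True
    then show ?thesis using Suc.IH le_Suc_eq by blast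
  next
    case False
    then show ?thesis using Suc.prems by (intro exI[of _ "Suc n"]) auto
  qed
qed auto

lemma pieces_coarsen:
  assumes "pieces I" "strict_mono p" shows "pieces (coarsen I p)"
  unfolding pieces_def
proof (intro conjI allI impI)
  show "coarsen I p k \<in> boolean_signals" for k unfolding coarsen_def by (rule pieces_UN[OF assms(1)])
next
  fix k k' a b assume kk: "k < k'" and a: "a \<in> coarsen I p k" and b: "b \<in> coarsen I p k'"
  from a obtain r where r: "a \<in> I r" "r < p k" by (auto simp: coarsen_def)
  from b kk obtain r' where r': "b \<in> I r'" "p (k' - 1) \<le> r'" by (auto simp: coarsen_def)
  have "p k \<le> p (k' - 1)" using kk assms(2) by (simp add: strict_mono_less_eq)
  then show "a < b" using piecesD(2)[OF assms(1) _ r(1) r'(1)] r r' by simp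
next
  fix T
  obtain N where N: "{0..T} \<subseteq> (\<Union>r<N. I r)" using pieces_cover[OF assms(1)] by blast
  have "t \<in> (\<Union>k<Suc N. coarsen I p k)" if "t \<in> {0..T}" for t
  proof -
    obtain r where r: "r < N" "t \<in> I r" using N \<open>t \<in> {0..T}\<close> by blast
    have "N \<le> p N" using assms(2) by (rule strict_mono_imp_increasing)
    then have "r < p N" using r by simp
    from coarsen_cover[OF assms(2) this] obtain k where "k \<le> N" "r \<in> {(if k = 0 then 0 else p (k - 1))..<p k}"
      by blast
    moreover from this have "t \<in> coarsen I p k" unfolding coarsen_def using r by (intro UN_I[of r])
    ultimately show ?thesis by (intro UN_I[of k]) auto
  qed
  then show "\<exists>N. {0..T} \<subseteq> (\<Union>k<N. coarsen I p k)" by blast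
qed

lemma fin_semigroup_qm: "fin_semigroup (qm (mul \<phi>)) (qcar \<phi>)"
  by unfold_locales (use qm_assoc[of "mul \<phi>", OF mul_assoc] finite_qcar qm_qcar in auto)

lemma cnt_eq_0: "cnt A = 0 \<longleftrightarrow> A = {}"
  by (auto simp: cnt_def min_def split: if_splits)

lemma cnt_eq_1: "cnt A = 1 \<longleftrightarrow> (\<exists>p. A = {p})"
proof
  assume "cnt A = 1"
  then have "card A = 1" by (auto simp: cnt_def min_def split: if_splits)
  then show "\<exists>p. A = {p}" by (rule card_1_singletonE) blast
qed (auto simp: cnt_def)

text \<open>For a quantifier, a given signal colours the pieces by counts and types. A Ramsey
  factorization of this word makes the pieces coarser, and \<open>s\<close> and \<open>e\<close> are
  unchanged by that because they are linked. Conversely, signals witnessing the guessed pair are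
  chosen on each piece separately and pasted together.\<close>

theorem satc_iff_acc:
  assumes "pieces I" "\<And>i. M i \<subseteq> {0..}" "ty \<phi> M (I 0) = s" "\<And>r. ty \<phi> M (I (Suc r)) = e"
    "mul \<phi> s e = s" "mul \<phi> e e = e"
  shows "satc \<phi> M \<longleftrightarrow> acc \<phi> s e"
  using assms
proof (induction \<phi> arbitrary: M I s e)
  case (Lt i j)
  have ty: "ty (Lt i j) M (\<Union>r\<in>{0..<Suc n}. I r) = s" for n
    using ty_pieces_linked[OF Lt.prems(1,3-6), of 0 "Suc n"] by simp
  have "satc (Lt i j) M \<longleftrightarrow> (\<exists>n. \<exists>p\<in>M i \<inter> (\<Union>r\<in>{0..<Suc n}. I r). \<exists>q\<in>M j \<inter> (\<Union>r\<in>{0..<Suc n}. I r). p < q)"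
  proof
    assume "satc (Lt i j) M"
    then obtain p q where pq: "p \<in> M i" "q \<in> M j" "p < q" by auto
    obtain N where "{0..q} \<subseteq> (\<Union>r<N. I r)" using pieces_cover[OF Lt.prems(1)] by blast
    moreover have "0 \<le> p" "0 \<le> q" using Lt.prems(2) pq by auto
    moreover from this have "p \<in> {0..q}" "q \<in> {0..q}" using pq(3) by auto
    ultimately have "p \<in> (\<Union>r<N. I r)" "q \<in> (\<Union>r<N. I r)" by blast+
    then have "p \<in> (\<Union>r\<in>{0..<Suc N}. I r)" "q \<in> (\<Union>r\<in>{0..<Suc N}. I r)" by auto
    then show "\<exists>n. \<exists>p\<in>M i \<inter> (\<Union>r\<in>{0..<Suc n}. I r). \<exists>q\<in>M j \<inter> (\<Union>r\<in>{0..<Suc n}. I r). p < q"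
      using pq by blast
  qed auto
  also have "\<dots> \<longleftrightarrow> (\<exists>n. psnd (psnd (ty (Lt i j) M (\<Union>r\<in>{0..<Suc n}. I r))) \<noteq> 0)"
    by (intro ex_cong1) simp
  finally show ?case unfolding ty by simp
next
  case (Inn i j)
  have ty: "ty (Inn i j) M (\<Union>r\<in>{0..<Suc n}. I r) = s" for n
    using ty_pieces_linked[OF Inn.prems(1,3-6), of 0 "Suc n"] by simp
  have "satc (Inn i j) M \<longleftrightarrow> (\<exists>n. M i \<inter> M j \<inter> (\<Union>r\<in>{0..<Suc n}. I r) \<noteq> {})"
  proof
    assume "satc (Inn i j) M"
    then obtain p where p: "p \<in> M i" "p \<in> M j" by auto
    then have "0 \<le> p" using Inn.prems(2) by auto
    from pieces_in[OF Inn.prems(1) this] obtain n where "p \<in> I n" by blast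
    then have "p \<in> (\<Union>r\<in>{0..<Suc n}. I r)" by auto
    then show "\<exists>n. M i \<inter> M j \<inter> (\<Union>r\<in>{0..<Suc n}. I r) \<noteq> {}" using p by blast
  qed auto
  also have "\<dots> \<longleftrightarrow> (\<exists>n. ty (Inn i j) M (\<Union>r\<in>{0..<Suc n}. I r) \<noteq> 0)"
    by (intro ex_cong1) simp
  finally show ?case unfolding ty by simp
next
  case (Nand \<phi> \<psi>)
  have e: "e = prod_encode (ty \<phi> M (I 1), ty \<psi> M (I 1))" using Nand.prems(4)[of 0] by simp
  have s: "s = prod_encode (ty \<phi> M (I 0), ty \<psi> M (I 0))" using Nand.prems(3) by simp
  have "satc \<phi> M \<longleftrightarrow> acc \<phi> (pfst s) (pfst e)"
    by (rule Nand.IH(1)[OF Nand.prems(1,2)]) (use Nand.prems(4,5,6) s e in auto)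
  moreover have "satc \<psi> M \<longleftrightarrow> acc \<psi> (psnd s) (psnd e)"
    by (rule Nand.IH(2)[OF Nand.prems(1,2)]) (use Nand.prems(4,5,6) s e in auto)
  ultimately show ?case by simp
next
  case (Exq b i \<phi>)
  let ?\<phi> = "Exq b i \<phi>"
  define v where "v S A = prod_encode (cnt (S \<inter> A), ty \<phi> (M(i := S)) A)" for S A
  have dec: "set_decode (ty ?\<phi> M A) = (\<lambda>S. v S A) ` boolean_signals" for A
    unfolding set_decode_ty_Exq v_def ..
  have tye: "ty ?\<phi> M (\<Union>r\<in>{a..<c}. I r) = (if a = 0 then s else e)" if "a < c" for a c
    by (rule ty_pieces_linked[OF Exq.prems(1,3-6) that])
  show ?case
  proof
    assume "satc ?\<phi> M"
    then obtain S where S: "S \<in> boolean_signals" "b \<Longrightarrow> \<exists>p. S = {p}" "satc \<phi> (M(i := S))" by auto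
    let ?w = "\<lambda>r. v S (I r)"
    interpret fin_semigroup "qm (mul \<phi>)" "qcar \<phi>" by (rule fin_semigroup_qm)
    have "?w r \<in> qcar \<phi>" for r using ty_car cnt_le by (simp add: qcar_iff v_def)
    from linked_fact_exists[of ?w, OF this] obtain p x y where lf: "linked_fact (qm (mul \<phi>)) ?w p x y" .
    note lf' = lf[unfolded linked_fact_def]
    have sm: "strict_mono p" and p0: "0 < p 0" using lf' by auto
    let ?J = "coarsen I p"
    have pJ: "pieces ?J" by (rule pieces_coarsen[OF Exq.prems(1) sm])
    have J0: "v S (?J 0) = x"
      using val_pieces[OF Exq.prems(1) p0, of S \<phi> "M(i := S)"] lf' by (simp add: v_def coarsen_def)
    have JS: "v S (?J (Suc r)) = y" for r
    proof -
      have "p r < p (Suc r)" using sm by (simp add: strict_mono_less)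
      from val_pieces[OF Exq.prems(1) this, of S \<phi> "M(i := S)"] show ?thesis
        using lf' by (simp add: v_def coarsen_def)
    qed
    have xs: "x \<in> set_decode s"
      using dec[of "?J 0"] tye[OF p0] J0 S(1) by (auto simp: coarsen_def)
    have "p 0 < p 1" using sm by (simp add: strict_mono_less)
    from tye[OF this] have ye: "y \<in> set_decode e"
      using dec[of "?J 1"] JS[of 0] S(1) p0 by (auto simp: coarsen_def)
    have xy: "mul \<phi> (psnd x) (psnd y) = psnd x" "mul \<phi> (psnd y) (psnd y) = psnd y"
      using lf' psnd_qm by metis+
    have "satc \<phi> (M(i := S)) \<longleftrightarrow> acc \<phi> (psnd x) (psnd y)"
    proof (rule Exq.IH[OF pJ])
      show "(M(i := S)) k \<subseteq> {0..}" for k using Exq.prems(2) S(1) by (auto simp: boolean_signals_iff)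
      show "ty \<phi> (M(i := S)) (?J 0) = psnd x" using J0 by (auto simp: v_def)
      show "ty \<phi> (M(i := S)) (?J (Suc r)) = psnd y" for r using JS[of r] by (auto simp: v_def)
    qed (rule xy)+
    then have "acc \<phi> (psnd x) (psnd y)" using S(3) by simp
    moreover have "pfst x = 1 \<and> pfst y = 0" if b
    proof -
      from S(2)[OF that] obtain t where t: "S = {t}" by blast
      have yc: "pfst y = cnt (S \<inter> ?J (Suc r))" for r using JS[of r] by (auto simp: v_def)
      \<comment> \<open>Idempotence under truncated addition leaves 0 or 2 for the count, and a
        singleton has at most 1.\<close>
      have "pfst y = min 2 (pfst y + pfst y)" using lf' pfst_qm by metis
      moreover have "pfst y \<le> 1" unfolding yc[of 0] t by (simp add: cnt_def Int_insert_left)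
      ultimately have y0: "pfst y = 0" by (auto simp: min_def split: if_splits)
      have "t \<ge> 0" using S(1) t by (auto simp: boolean_signals_iff)
      from pieces_in[OF pJ this] obtain k where k: "t \<in> ?J k" by blast
      have "k = 0"
      proof (rule ccontr)
        assume "k \<noteq> 0"
        then obtain r where "k = Suc r" by (cases k) auto
        then show False using yc[of r] y0 k t by (auto simp: cnt_eq_0)
      qed
      then have "S \<inter> ?J 0 = {t}" using k t by auto
      then have "pfst x = 1" using J0 by (auto simp: v_def cnt_def)
      then show ?thesis using y0 by simp
    qed
    ultimately show "acc ?\<phi> s e" using xs ye xy by auto
  next
    assume "acc ?\<phi> s e"
    then obtain x y where xy: "x \<in> set_decode s" "y \<in> set_decode e"
      "mul \<phi> (psnd x) (psnd y) = psnd x" "mul \<phi> (psnd y) (psnd y) = psnd y"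
      "b \<Longrightarrow> pfst x = 1 \<and> pfst y = 0" "acc \<phi> (psnd x) (psnd y)" by auto
    have "\<exists>S\<in>boolean_signals. v S (I r) = (if r = 0 then x else y)" for r
      using xy(1,2) dec[of "I r"] Exq.prems(3,4) by (cases r) (auto simp: image_iff)
    then obtain S where S: "\<And>r. S r \<in> boolean_signals" "\<And>r. v (S r) (I r) = (if r = 0 then x else y)"
      by metis
    define U where "U = (\<Union>r. S r \<inter> I r)"
    have uniq: "a = c" if "t \<in> I a" "t \<in> I c" for t a c
      using pieces_disjoint[OF Exq.prems(1), of a c] that by blast
    have UI: "U \<inter> I r = S r \<inter> I r" for r
      unfolding U_def using uniq by blast
    have vU: "v U (I r) = (if r = 0 then x else y)" for r
    proof -
      have "ty \<phi> (M(i := U)) (I r) = ty \<phi> (M(i := S r)) (I r)" by (rule ty_local) (use UI in simp)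
      then show ?thesis using S(2)[of r] UI by (simp add: v_def)
    qed
    \<comment> \<open>Finitely many pieces cover each bounded interval, so the pasted set is
      finitely variable although infinitely many choices were made.\<close>
    have Ubs: "U \<in> boolean_signals"
    proof (rule boolean_signals_local)
      show "U \<subseteq> {0..}" using S(1) by (force simp: U_def boolean_signals_iff)
      fix T
      obtain N where N: "{0..T} \<subseteq> (\<Union>r<N. I r)" using pieces_cover[OF Exq.prems(1)] by blast
      have "(\<Union>r\<in>{..<N}. S r \<inter> I r) \<in> boolean_signals"
        by (intro boolean_signals_UN boolean_signals_Int S piecesD(1)[OF Exq.prems(1)]) auto
      moreover have "\<forall>t\<in>{0..T}. t \<in> U \<longleftrightarrow> t \<in> (\<Union>r\<in>{..<N}. S r \<inter> I r)"
      proof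
        fix t assume "t \<in> {0..T}"
        then obtain r where r: "r < N" "t \<in> I r" using N by blast
        then show "t \<in> U \<longleftrightarrow> t \<in> (\<Union>r\<in>{..<N}. S r \<inter> I r)" using UI[of r] by (auto simp: U_def)
      qed
      ultimately show "\<exists>S'\<in>boolean_signals. \<forall>t\<in>{0..T}. t \<in> U \<longleftrightarrow> t \<in> S'" by blast
    qed
    have "satc \<phi> (M(i := U)) \<longleftrightarrow> acc \<phi> (psnd x) (psnd y)"
    proof (rule Exq.IH[OF Exq.prems(1)])
      show "(M(i := U)) k \<subseteq> {0..}" for k using Exq.prems(2) Ubs by (auto simp: boolean_signals_iff)
      show "ty \<phi> (M(i := U)) (I 0) = psnd x" using vU[of 0] by (auto simp: v_def)
      show "ty \<phi> (M(i := U)) (I (Suc r)) = psnd y" for r using vU[of "Suc r"] by (auto simp: v_def)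
    qed (rule xy)+
    moreover have "\<exists>p. U = {p}" if b
    proof -
      have c: "pfst x = 1" "pfst y = 0" using xy(5)[OF that] by auto
      have cv: "cnt (U \<inter> I r) = pfst (v U (I r))" for r by (simp add: v_def)
      have e: "U \<inter> I (Suc r) = {}" for r
        using cv[of "Suc r"] vU[of "Suc r"] c unfolding cnt_eq_0[symmetric] by simp
      have "cnt (U \<inter> I 0) = 1" using cv[of 0] vU[of 0] c by simp
      then obtain p where p: "U \<inter> I 0 = {p}" unfolding cnt_eq_1 by blast
      have "t = p" if "t \<in> U" for t
      proof -
        obtain r where r: "t \<in> I r" using \<open>t \<in> U\<close> by (auto simp: U_def)
        show ?thesis
        proof (cases r)
          case 0
          then show ?thesis using p r that by blast
        next
          case (Suc r')
          then show ?thesis using e[of r'] r that by blast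
        qed
      qed
      then have "U = {p}" using p by blast
      then show ?thesis by blast
    qed
    ultimately show "satc ?\<phi> M" using Ubs xy(6) by auto
  qed
qed

text \<open>The signal is read as a word in which the letters at even places are points and those at
  odd places the open intervals between them. The letters do not mention the values of the
  breakpoints.\<close>

theorem satc_word:
  fixes \<tau> :: "nat \<Rightarrow> real"
  assumes \<tau>: "\<tau> 0 = 0" "strict_mono \<tau>" "\<not> bdd_above (range \<tau>)" and M: "\<And>i. M i \<subseteq> {0..}"
    and A: "\<And>k i. \<tau> k \<in> M i \<longleftrightarrow> i \<in> A k"
    and B: "\<And>k t i. \<tau> k < t \<Longrightarrow> t < \<tau> (Suc k) \<Longrightarrow> t \<in> M i \<longleftrightarrow> i \<in> B k"
    and lf: "linked_fact (mul \<phi>) (\<lambda>l. if even l then pt \<phi> (A (l div 2)) else op \<phi> (B (l div 2))) p s e"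
  shows "satc \<phi> M \<longleftrightarrow> acc \<phi> s e"
proof -
  define I where "I l = (if even l then {\<tau> (l div 2)} else {\<tau> (l div 2)<..<\<tau> (Suc (l div 2))})" for l
  have nn: "0 \<le> \<tau> k" for k using \<tau>(1,2) by (metis strict_mono_less_eq zero_le)
  have up: "t \<le> \<tau> (Suc l div 2)" "\<tau> (l div 2) \<le> t" if "t \<in> I l" for t l
    using that by (cases "even l"; auto simp: I_def)+
  have I: "pieces I" unfolding pieces_def
  proof (intro conjI allI impI)
    show "I l \<in> boolean_signals" for l
      using nn by (simp add: I_def boolean_signals_singleton boolean_signals_interval)
  next
    fix l l' a b assume *: "l < l'" "a \<in> I l" "b \<in> I l'"
    have "Suc l div 2 \<le> l' div 2" using *(1) by (intro div_le_mono) simp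
    then have le: "\<tau> (Suc l div 2) \<le> \<tau> (l' div 2)" using \<tau>(2) by (simp add: strict_mono_less_eq)
    show "a < b"
    proof (cases "even l \<and> even l'")
      case True
      then have "l div 2 < l' div 2" using *(1) by (auto elim!: evenE)
      then show ?thesis using True * \<tau>(2) by (simp add: I_def strict_mono_less)
    next
      case False
      then have "a < \<tau> (Suc l div 2) \<or> \<tau> (l' div 2) < b" using *(2,3) by (auto simp: I_def)
      then show ?thesis using up[OF *(2)] up[OF *(3)] le by linarith
    qed
  next
    fix T
    obtain n where n: "T < \<tau> n" using unbounded_range_ex[OF \<tau>(3)] by blast
    have "t \<in> (\<Union>l<2 * n. I l)" if "0 \<le> t" "t < \<tau> n" for t n
      using that
    proof (induction n)
      case (Suc n)
      show ?case
      proof (cases "t < \<tau> n")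
        case True
        then show ?thesis using Suc by auto
      next
        case False
        show ?thesis
        proof (cases "t = \<tau> n")
          case True
          then show ?thesis by (intro UN_I[of "2 * n"]) (auto simp: I_def)
        next
          case False
          then show ?thesis using Suc.prems \<open>\<not> t < \<tau> n\<close> by (intro UN_I[of "2 * n + 1"]) (auto simp: I_def)
        qed
      qed
    qed (use \<tau>(1) in simp)
    then show "\<exists>N. {0..T} \<subseteq> (\<Union>l<N. I l)" using n by (intro exI[of _ "2 * n"]) auto
  qed
  have ty: "ty \<phi> M (I l) = (if even l then pt \<phi> (A (l div 2)) else op \<phi> (B (l div 2)))" for l
  proof (cases "even l")
    case True
    then show ?thesis using ty_point[OF nn, of "l div 2" M "A (l div 2)" \<phi>] A by (simp add: I_def)
  next
    case False
    then show ?thesis using ty_open[OF nn, of "l div 2" "\<tau> (Suc (l div 2))" M "B (l div 2)" \<phi>] B \<tau>(2)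
      by (simp add: I_def strict_mono_Suc_iff)
  qed
  note lf' = lf[folded ty, unfolded linked_fact_def]
  have sm: "strict_mono p" and p0: "0 < p 0" using lf' by auto
  show ?thesis
  proof (rule satc_iff_acc[OF pieces_coarsen[OF I sm] M])
    show "ty \<phi> M (coarsen I p 0) = s"
      using ty_pieces[OF I p0, of \<phi> M] lf' by (simp add: coarsen_def)
    show "ty \<phi> M (coarsen I p (Suc r)) = e" for r
    proof -
      have "p r < p (Suc r)" using sm by (simp add: strict_mono_less)
      from ty_pieces[OF I this, of \<phi> M] show ?thesis using lf' by (simp add: coarsen_def)
    qed
  qed (use lf' in auto)
qed

section \<open>The synthesis game\<close>

text \<open>A letter is a number coding the set of tracks that hold. The tracks of \<open>X\<close>
  are the even numbers below \<open>2 * m\<close>, and in \<open>YS\<close> those of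
  \<open>Y\<close> follow; odd numbers are reserved for first-order variables. As the bits are
  disjoint, the joint letter is the sum of the two.\<close>

definition XS :: "nat \<Rightarrow> nat set" where
  "XS m = {x. \<forall>i\<in>set_decode x. even i \<and> i < 2 * m}"

definition YS :: "nat \<Rightarrow> nat \<Rightarrow> nat set" where
  "YS m n = {y. \<forall>i\<in>set_decode y. even i \<and> 2 * m \<le> i \<and> i < 2 * (m + n)}"

text \<open>The states are \<open>0\<close> (the start), \<open>(1, p)\<close> (values on an open interval are to be chosen, the
  previous input value being \<open>p\<close>) and \<open>(2, b, c)\<close> (values at the right end of an interval with
  values \<open>b\<close>, \<open>c\<close> are to be chosen). An input move \<open>(0, b)\<close> lets the change planned by the output
  player happen, \<open>(1, x)\<close> interrupts the interval before that; in the latter case, with \<open>x = b\<close>,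
  the output cannot react yet. An output move \<open>(1, y)\<close> is a checkpoint.\<close>

definition gLX :: "nat \<Rightarrow> nat \<Rightarrow> nat set" where
  "gLX m q = {x. psnd x \<in> XS m \<and> (pfst x = 1 \<or> pfst x = 0 \<and> pfst q = 2 \<and> psnd x = pfst (psnd q))}"

definition gLY :: "nat \<Rightarrow> nat \<Rightarrow> nat \<Rightarrow> nat \<Rightarrow> nat set" where
  "gLY m n q x = {y. psnd y \<in> YS m n \<and> pfst y \<le> 1 \<and> (pfst y = 1 \<longrightarrow> pfst x = 0) \<and>
     (pfst q = 2 \<and> pfst x = 1 \<and> psnd x = pfst (psnd q) \<longrightarrow> psnd y = psnd (psnd q))}"

definition gdl :: "nat \<Rightarrow> nat \<Rightarrow> nat \<Rightarrow> nat" where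
  "gdl q x y = (if pfst q = 1 then prod_encode (2, prod_encode (psnd x, psnd y))
     else prod_encode (1, if pfst q = 2 then pfst (psnd q) else 0))"

text \<open>A letter carries the type of its point or interval, the checkpoint bit and the interrupt
  bit. On an interval the latter records that the input has a new value right after the point;
  before the first interval the value 0 is assumed.\<close>

definition glb :: "core \<Rightarrow> nat \<Rightarrow> nat \<Rightarrow> nat \<Rightarrow> nat" where
  "glb \<phi> q x y = (if pfst q = 1
     then enc3 (op \<phi> (set_decode (psnd x + psnd y))) 0 (of_bool (psnd x \<noteq> psnd q))
     else enc3 (pt \<phi> (set_decode (psnd x + psnd y))) (pfst y) (pfst x))"

definition gmul :: "core \<Rightarrow> nat \<Rightarrow> nat \<Rightarrow> nat" where
  "gmul \<phi> a b = enc3 (mul \<phi> (pfst a) (pfst b)) (max (pfst (psnd a)) (pfst (psnd b)))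
     (max (psnd (psnd a)) (psnd (psnd b)))"

text \<open>Infinitely many interrupts but only finitely many checkpoints can be made to take place in
  finite time, so the output player need not care about such plays.\<close>

definition gacc :: "core \<Rightarrow> nat \<Rightarrow> nat \<Rightarrow> bool" where
  "gacc \<phi> s e \<longleftrightarrow> (if pfst (psnd e) \<noteq> 0 then acc \<phi> (pfst s) (pfst e) else psnd (psnd e) \<noteq> 0)"

definition gS :: "core \<Rightarrow> nat set" where
  "gS \<phi> = (\<lambda>(a, b, c). enc3 a b c) ` (car \<phi> \<times> {..1} \<times> {..1})"

lemma gS_iff: "x \<in> gS \<phi> \<longleftrightarrow> pfst x \<in> car \<phi> \<and> pfst (psnd x) \<le> 1 \<and> psnd (psnd x) \<le> 1"
proof
  assume "pfst x \<in> car \<phi> \<and> pfst (psnd x) \<le> 1 \<and> psnd (psnd x) \<le> 1"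
  then show "x \<in> gS \<phi>" unfolding gS_def
    by (intro image_eqI[of _ _ "(pfst x, pfst (psnd x), psnd (psnd x))"]) (auto simp: enc3_def)
qed (auto simp: gS_def)

lemma fin_semigroup_gmul: "fin_semigroup (gmul \<phi>) (gS \<phi>)"
proof
  show "gmul \<phi> (gmul \<phi> a b) c = gmul \<phi> a (gmul \<phi> b c)" for a b c
    by (simp add: gmul_def mul_assoc max.assoc)
  show "finite (gS \<phi>)" by (simp add: gS_def finite_car)
  show "a \<in> gS \<phi> \<Longrightarrow> b \<in> gS \<phi> \<Longrightarrow> gmul \<phi> a b \<in> gS \<phi>" for a b
    by (simp add: gS_iff gmul_def mul_car)
qed

lemma seg_gmul:
  assumes "i < j"
  shows "pfst (seg (gmul \<phi>) w i j) = seg (mul \<phi>) (\<lambda>k. pfst (w k)) i j \<and>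
    (pfst (psnd (seg (gmul \<phi>) w i j)) \<noteq> 0 \<longleftrightarrow> (\<exists>k. i \<le> k \<and> k < j \<and> pfst (psnd (w k)) \<noteq> 0)) \<and>
    (psnd (psnd (seg (gmul \<phi>) w i j)) \<noteq> 0 \<longleftrightarrow> (\<exists>k. i \<le> k \<and> k < j \<and> psnd (psnd (w k)) \<noteq> 0))"
  using assms
proof (induction j)
  case (Suc j)
  show ?case
  proof (cases "i = j")
    case True
    then show ?thesis by (auto simp: less_Suc_eq)
  next
    case False
    then have ij: "i < j" using Suc.prems by simp
    have *: "(\<exists>k. i \<le> k \<and> k < Suc j \<and> P k) \<longleftrightarrow> (\<exists>k. i \<le> k \<and> k < j \<and> P k) \<or> P j" for P
      using ij less_Suc_eq by (metis less_imp_le)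
    have mx: "max a b \<noteq> 0 \<longleftrightarrow> a \<noteq> 0 \<or> b \<noteq> 0" for a b :: nat by (auto simp: max_def)
    show ?thesis using Suc.IH[OF ij]
      unfolding seg_Suc[OF ij] gmul_def pfst_enc3 psnd_enc3 pfst_encode psnd_encode mx * by simp
  qed
qed simp

lemma linked_fact_INFM:
  assumes "strict_mono p" "0 < p 0"
    and "\<And>r. e \<longleftrightarrow> (\<exists>k. p r \<le> k \<and> k < p (Suc r) \<and> P k)"
  shows "e \<longleftrightarrow> (\<exists>\<^sub>\<infinity>k. P (k :: nat))"
proof
  assume e: e
  show "\<exists>\<^sub>\<infinity>k. P k" unfolding INFM_nat_le
  proof
    fix l
    have "l \<le> p l" using assms(1) by (rule strict_mono_imp_increasing)
    then show "\<exists>k\<ge>l. P k" using e assms(3)[of l] le_trans by blast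
  qed
next
  assume "\<exists>\<^sub>\<infinity>k. P k"
  then obtain k where k: "k \<ge> p 0" "P k" unfolding INFM_nat_le by blast
  have "k < p (Suc k)" using strict_mono_imp_increasing[OF assms(1), of "Suc k"] by simp
  from coarsen_cover[OF assms(1) this] obtain j where j: "k \<in> {(if j = 0 then 0 else p (j - 1))..<p j}" by blast
  then have "j \<noteq> 0" using k by (cases "j = 0") auto
  then obtain r where "j = Suc r" by (cases j) auto
  then show e using j k assms(3)[of r] by auto
qed

text \<open>Flags are joined by \<open>max\<close>, so a flag of the repeated factor
  \<open>e\<close> tells whether it is set infinitely often.\<close>

lemma linked_fact_gmul:
  assumes "linked_fact (gmul \<phi>) w p s e"
  shows "linked_fact (mul \<phi>) (\<lambda>k. pfst (w k)) p (pfst s) (pfst e)"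
    "pfst (psnd e) \<noteq> 0 \<longleftrightarrow> (\<exists>\<^sub>\<infinity>k. pfst (psnd (w k)) \<noteq> 0)"
    "psnd (psnd e) \<noteq> 0 \<longleftrightarrow> (\<exists>\<^sub>\<infinity>k. psnd (psnd (w k)) \<noteq> 0)"
proof -
  note lf = assms[unfolded linked_fact_def]
  have sm: "strict_mono p" and p0: "0 < p 0" using lf by auto
  have pr: "p r < p (Suc r)" for r using sm by (simp add: strict_mono_less)
  have e: "seg (gmul \<phi>) w (p r) (p (Suc r)) = e" for r using lf by blast
  have "seg (mul \<phi>) (\<lambda>k. pfst (w k)) (p r) (p (Suc r)) = pfst e" for r
    using seg_gmul[OF pr, of \<phi> w r] e by metis
  moreover have "seg (mul \<phi>) (\<lambda>k. pfst (w k)) 0 (p 0) = pfst s"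
    using seg_gmul[OF p0, of \<phi> w] lf by metis
  moreover have "mul \<phi> (pfst s) (pfst e) = pfst s" "mul \<phi> (pfst e) (pfst e) = pfst e"
    using lf unfolding gmul_def by (metis pfst_enc3)+
  ultimately show "linked_fact (mul \<phi>) (\<lambda>k. pfst (w k)) p (pfst s) (pfst e)"
    using sm p0 by (simp add: linked_fact_def)
  show "pfst (psnd e) \<noteq> 0 \<longleftrightarrow> (\<exists>\<^sub>\<infinity>k. pfst (psnd (w k)) \<noteq> 0)"
    by (rule linked_fact_INFM[OF sm p0]) (use seg_gmul[OF pr, of \<phi> w] e in metis)
  show "psnd (psnd e) \<noteq> 0 \<longleftrightarrow> (\<exists>\<^sub>\<infinity>k. psnd (psnd (w k)) \<noteq> 0)"
    by (rule linked_fact_INFM[OF sm p0]) (use seg_gmul[OF pr, of \<phi> w] e in metis)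
qed

section \<open>Finiteness of the arena\<close>

lemma finite_XS: "finite (XS m)"
proof (rule finite_subset)
  show "XS m \<subseteq> set_encode ` Pow {..<2 * m}"
  proof
    fix x assume "x \<in> XS m"
    then have "set_decode x \<in> Pow {..<2 * m}" by (auto simp: XS_def)
    then show "x \<in> set_encode ` Pow {..<2 * m}" by (metis image_eqI set_decode_inverse)
  qed
qed simp

lemma finite_YS: "finite (YS m n)"
proof (rule finite_subset)
  show "YS m n \<subseteq> set_encode ` Pow {..<2 * (m + n)}"
  proof
    fix x assume "x \<in> YS m n"
    then have "set_decode x \<in> Pow {..<2 * (m + n)}" by (auto simp: YS_def)
    then show "x \<in> set_encode ` Pow {..<2 * (m + n)}" by (metis image_eqI set_decode_inverse)
  qed
qed simp

lemma zero_XS: "0 \<in> XS m" and zero_YS: "0 \<in> YS m n"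
  by (simp_all add: XS_def YS_def)

definition gQ :: "nat \<Rightarrow> nat \<Rightarrow> nat set" where
  "gQ m n = insert 0 (prod_encode ` ({1} \<times> XS m) \<union> prod_encode ` ({2} \<times> prod_encode ` (XS m \<times> YS m n)))"

lemma prod_encode_0: "prod_encode (0, 0) = 0"
  by (simp add: prod_encode_def)

lemma pfst_0 [simp]: "pfst 0 = 0" and psnd_0 [simp]: "psnd 0 = 0"
  using pfst_encode[of 0 0] psnd_encode[of 0 0] by (simp_all only: prod_encode_0)

lemma gQ_cases:
  assumes "q \<in> gQ m n"
  obtains "q = 0" | p where "q = prod_encode (1, p)" "p \<in> XS m"
    | b c where "q = prod_encode (2, prod_encode (b, c))" "b \<in> XS m" "c \<in> YS m n"
  using assms unfolding gQ_def by blast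

definition Mof :: "(real \<Rightarrow> nat) \<Rightarrow> nat \<Rightarrow> real set" where
  "Mof L i = {t. 0 \<le> t \<and> i \<in> set_decode (L t)}"

text \<open>Any increasing and unbounded times starting with 0 may be assigned to a play: the truth
  of the formula is read off from a linked pair of its letters.\<close>

theorem satc_play:
  fixes \<tau> :: "nat \<Rightarrow> real"
  assumes \<tau>: "\<tau> 0 = 0" "strict_mono \<tau>" "\<not> bdd_above (range \<tau>)"
    and q: "\<And>k. pfst (q k) = 1 \<longleftrightarrow> odd k"
    and A: "\<And>k. L (\<tau> k) = psnd (x (2 * k)) + psnd (y (2 * k))"
    and B: "\<And>k t. \<tau> k < t \<Longrightarrow> t < \<tau> (Suc k) \<Longrightarrow> L t = psnd (x (2 * k + 1)) + psnd (y (2 * k + 1))"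
    and lf: "linked_fact (gmul \<phi>) (\<lambda>k. glb \<phi> (q k) (x k) (y k)) p s e"
  shows "satc \<phi> (Mof L) \<longleftrightarrow> acc \<phi> (pfst s) (pfst e)"
proof -
  let ?L = "\<lambda>k. set_decode (psnd (x k) + psnd (y k))"
  have nn: "0 \<le> \<tau> k" for k using \<tau>(1,2) by (metis strict_mono_less_eq zero_le)
  have "pfst (glb \<phi> (q k) (x k) (y k)) = (if even k then pt \<phi> (?L (2 * (k div 2))) else op \<phi> (?L (2 * (k div 2) + 1)))" for k
    using q[of k] by (auto simp: glb_def)
  then have lf': "linked_fact (mul \<phi>) (\<lambda>k. if even k then pt \<phi> (?L (2 * (k div 2)))
      else op \<phi> (?L (2 * (k div 2) + 1))) p (pfst s) (pfst e)"
    using linked_fact_gmul(1)[OF lf] by simp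
  show ?thesis
  proof (rule satc_word[OF \<tau>, of _ "\<lambda>k. ?L (2 * k)" "\<lambda>k. ?L (2 * k + 1)", OF _ _ _ lf'])
    show "Mof L i \<subseteq> {0..}" for i by (auto simp: Mof_def)
    show "\<tau> k \<in> Mof L i \<longleftrightarrow> i \<in> ?L (2 * k)" for k i using nn A by (simp add: Mof_def)
    show "t \<in> Mof L i \<longleftrightarrow> i \<in> ?L (2 * k + 1)" if "\<tau> k < t" "t < \<tau> (Suc k)" for k t i
      using nn[of k] B[OF that] that by (simp add: Mof_def)
  qed
qed

lemma play_parity:
  assumes "q 0 = 0" "\<And>k. q (Suc k) = gdl (q k) (x k) (y k)"
  shows "pfst (q k) = 1 \<longleftrightarrow> odd k"
  by (induction k) (auto simp: assms gdl_def)

text \<open>Consistency is obtained by realising the play with its points at the integers: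
  acceptance of any factorization then expresses the truth of the formula in this one signal, and
  the flags express what happens infinitely often.\<close>

theorem sg_game_gmul: "sg_game (gmul \<phi>) (gS \<phi>) (gLX m) (gLY m n) gdl (glb \<phi>) 0 (gQ m n) (gacc \<phi>)"
proof -
  interpret fin_semigroup "gmul \<phi>" "gS \<phi>" by (rule fin_semigroup_gmul)
  show ?thesis
  proof unfold_locales
    show "finite (gQ m n)" using finite_XS finite_YS by (simp add: gQ_def)
    show "0 \<in> gQ m n" by (simp add: gQ_def)
  next
    fix q assume "q \<in> gQ m n"
    have "gLX m q \<subseteq> prod_encode ` ({..1} \<times> XS m)"
    proof
      fix x assume "x \<in> gLX m q"
      then show "x \<in> prod_encode ` ({..1} \<times> XS m)"
        by (intro image_eqI[of _ _ "(pfst x, psnd x)"]) (auto simp: gLX_def)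
    qed
    then have "finite (gLX m q)" by (rule finite_subset) (simp add: finite_XS)
    moreover have "prod_encode (1, 0) \<in> gLX m q" by (simp add: gLX_def zero_XS)
    ultimately show "finite (gLX m q) \<and> gLX m q \<noteq> {}" by blast
  next
    fix q x assume q: "q \<in> gQ m n" and x: "x \<in> gLX m q"
    have "\<exists>c\<in>YS m n. pfst q = 2 \<longrightarrow> c = psnd (psnd q)"
      using q by (cases rule: gQ_cases) (auto intro: zero_YS)
    then obtain c where "c \<in> YS m n" "pfst q = 2 \<longrightarrow> c = psnd (psnd q)" by blast
    then have "prod_encode (0, c) \<in> gLY m n q x" by (simp add: gLY_def)
    then show "gLY m n q x \<noteq> {}" by blast
  next
    fix q x y assume q: "q \<in> gQ m n" and x: "x \<in> gLX m q" and y: "y \<in> gLY m n q x"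
    have "gdl q x y \<in> gQ m n"
      using q x y by (cases rule: gQ_cases) (auto simp: gdl_def gQ_def gLX_def gLY_def zero_XS)
    moreover have "glb \<phi> q x y \<in> gS \<phi>"
      using x y pt_car op_car by (auto simp: glb_def gS_iff gLX_def gLY_def)
    ultimately show "gdl q x y \<in> gQ m n \<and> glb \<phi> q x y \<in> gS \<phi>" by blast
  next
    fix q x y p s e p' s' e'
    assume q: "q 0 = 0" "\<And>k. q (Suc k) = gdl (q k) (x k) (y k)"
      and lf: "linked_fact (gmul \<phi>) (\<lambda>k. glb \<phi> (q k) (x k) (y k)) p s e"
        "linked_fact (gmul \<phi>) (\<lambda>k. glb \<phi> (q k) (x k) (y k)) p' s' e'"
    define L where "L t = (let k = nat \<lfloor>t\<rfloor>; l = (if t = real k then 2 * k else 2 * k + 1)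
      in psnd (x l) + psnd (y l))" for t :: real
    have A: "L (real k) = psnd (x (2 * k)) + psnd (y (2 * k))" for k by (simp add: L_def Let_def)
    have B: "L t = psnd (x (2 * k + 1)) + psnd (y (2 * k + 1))" if "real k < t" "t < real (Suc k)" for k t
    proof -
      have "\<lfloor>t\<rfloor> = int k" using that by (intro floor_unique) auto
      then show ?thesis using that by (simp add: L_def Let_def)
    qed
    have un: "\<not> bdd_above (range real)"
    proof
      assume "bdd_above (range real)"
      then obtain b where "\<And>n. real n \<le> b" by (auto simp: bdd_above_def)
      then show False by (meson not_le reals_Archimedean2)
    qed
    have "satc \<phi> (Mof L) \<longleftrightarrow> acc \<phi> (pfst s) (pfst e)"
      by (rule satc_play[of real q L x y, OF _ _ un play_parity[OF q] A B lf(1)])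
        (auto simp: strict_mono_def)
    moreover have "satc \<phi> (Mof L) \<longleftrightarrow> acc \<phi> (pfst s') (pfst e')"
      by (rule satc_play[of real q L x y, OF _ _ un play_parity[OF q] A B lf(2)])
        (auto simp: strict_mono_def)
    moreover have "pfst (psnd e) \<noteq> 0 \<longleftrightarrow> pfst (psnd e') \<noteq> 0" "psnd (psnd e) \<noteq> 0 \<longleftrightarrow> psnd (psnd e') \<noteq> 0"
      using linked_fact_gmul(2,3)[OF lf(1)] linked_fact_gmul(2,3)[OF lf(2)] by blast+
    ultimately show "gacc \<phi> s e \<longleftrightarrow> gacc \<phi> s' e'" unfolding gacc_def by simp
  qed
qed

section \<open>From certificates of the output player to operators\<close>

lemma not_INFM_le:
  fixes N :: nat assumes "\<And>l. N \<le> l \<Longrightarrow> \<not> P l" shows "\<not> (\<exists>\<^sub>\<infinity>l. P l)"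
  unfolding INFM_nat_le using assms by blast

lemma constant_onD: "f constant_on A \<Longrightarrow> x \<in> A \<Longrightarrow> y \<in> A \<Longrightarrow> f x = f y"
  unfolding constant_on_iff by blast

text \<open>The value right after \<open>t\<close>. The midpoint of the interval of constancy is one
  convenient place to read it off.\<close>

definition rlim :: "(real \<Rightarrow> 'a) \<Rightarrow> real \<Rightarrow> 'a" where
  "rlim f t = f ((t + nextt f t 1) / 2)"

lemma rlim:
  assumes "locally_fv f" "0 \<le> t" "f constant_on {t<..<c}" "t < s" "s < c"
  shows "f s = rlim f t"
proof -
  note nx = nextt[OF assms(1,2) zero_less_one]
  have mid: "t < (t + nextt f t 1) / 2" "(t + nextt f t 1) / 2 < nextt f t 1" using nx(1) by auto
  show ?thesis
  proof (cases "s < nextt f t 1")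
    case True
    then show ?thesis unfolding rlim_def using mid assms by (intro constant_onD[OF nx(3)]) auto
  next
    case False
    then have "(t + nextt f t 1) / 2 < c" using mid assms by linarith
    then show ?thesis unfolding rlim_def using mid assms(4,5) by (intro constant_onD[OF assms(3)]) auto
  qed
qed

lemma rlim_in:
  assumes "f \<in> {0..} \<rightarrow> A" "locally_fv f" "0 \<le> t" shows "rlim f t \<in> A"
proof -
  have "0 \<le> (t + nextt f t 1) / 2" using nextt(1)[OF assms(2,3) zero_less_one] assms(3) by simp
  then show ?thesis unfolding rlim_def using assms(1) by auto
qed

lemma rlim_cong:
  assumes "locally_fv f" "locally_fv g" "0 \<le> t" "t < c" "\<And>s. t < s \<Longrightarrow> s < c \<Longrightarrow> f s = g s"
  shows "rlim f t = rlim g t"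
proof -
  note nf = nextt[OF assms(1,3) zero_less_one] and ng = nextt[OF assms(2,3) zero_less_one]
  define a where "a = min c (min (nextt f t 1) (nextt g t 1))"
  have a: "t < a" "a \<le> c" "a \<le> nextt f t 1" "a \<le> nextt g t 1"
    using nf(1) ng(1) assms(4) by (auto simp: a_def)
  define s where "s = (t + a) / 2"
  have s: "t < s" "s < c" "s < nextt f t 1" "s < nextt g t 1"
    using a by (auto simp: s_def)
  have "rlim f t = f s" using rlim[OF assms(1,3) nf(3) s(1,3)] by simp
  also have "\<dots> = g s" using assms(5) s by blast
  also have "\<dots> = rlim g t" by (rule rlim[OF assms(2,3) ng(3) s(1,4)])
  finally show ?thesis .
qed

lemma nextt_eqI:
  assumes "locally_fv f" "0 \<le> t" "0 < D" "t < c" "c \<le> t + D" "f constant_on {t<..<c}"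
    "\<And>c'. c < c' \<Longrightarrow> c' \<le> t + D \<Longrightarrow> \<not> f constant_on {t<..<c'}"
  shows "nextt f t D = c"
proof (rule linorder_cases[of "nextt f t D" c])
  assume "nextt f t D < c"
  then show ?thesis using nextt(4)[OF assms(1-3)] assms(5,6) by blast
next
  assume "c < nextt f t D"
  then show ?thesis using nextt(2,3)[OF assms(1-3)] assms(7) by blast
qed

lemma nextt_ge:
  assumes "locally_fv f" "0 \<le> t" "0 < D" "c \<le> t + D" "f constant_on {t<..<c}"
  shows "c \<le> nextt f t D"
  using nextt(4)[OF assms(1-3)] assms(4,5) by (meson not_le)

text \<open>The output player follows the certificate and plans its next change with a delay that is
  halved in every round until a checkpoint is reached.\<close>

locale y_machine =
  fixes m n :: nat and \<phi> :: core and R :: "(nat \<times> nat \<times> nat) set" and fy fz :: "nat \<Rightarrow> nat \<Rightarrow> nat"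
  assumes ok: "cert_ok (gmul \<phi>) 0 R (gacc \<phi>)"
    and fy: "z \<in> cert_states 0 R \<Longrightarrow> x \<in> gLX m (pfst z) \<Longrightarrow> fy z x \<in> gLY m n (pfst z) x"
    and fz: "z \<in> cert_states 0 R \<Longrightarrow> x \<in> gLX m (pfst z) \<Longrightarrow>
      pfst (fz z x) = gdl (pfst z) x (fy z x) \<and> (z, glb \<phi> (pfst z) x (fy z x), fz z x) \<in> R"
begin

text \<open>A state of the machine consists of the time of the current point, whether this point was
  reached by completing a plan, the certificate state and the exponent of the delay. The input has
  passed only if the plan was completed and the input value is still that of the preceding
  interval.\<close>

definition mv1 :: "(real \<Rightarrow> nat) \<Rightarrow> real \<times> bool \<times> nat \<times> nat \<Rightarrow> nat" where
  "mv1 X s = (case s of (\<tau>, ps, z, c) \<Rightarrow>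
     prod_encode (if pfst (pfst z) = 2 \<and> X \<tau> = pfst (psnd (pfst z)) \<and> ps then 0 else 1, X \<tau>))"

definition mv2 :: "(real \<Rightarrow> nat) \<Rightarrow> real \<times> bool \<times> nat \<times> nat \<Rightarrow> nat" where
  "mv2 X s = prod_encode (1, rlim X (fst s))"

text \<open>The next point is the deadline of the plan or, if earlier, the first change of the input
  to the right of the current point. Whether the deadline was reached is recorded: at the next point
  it tells a completed plan from an interrupted one.\<close>

definition nxt :: "(real \<Rightarrow> nat) \<Rightarrow> real \<times> bool \<times> nat \<times> nat \<Rightarrow> real \<times> bool \<times> nat \<times> nat" where
  "nxt X s = (case s of (\<tau>, ps, z, c) \<Rightarrow>
     let c' = (if pfst (fy z (mv1 X s)) = 1 then 0 else Suc c); \<tau>' = nextt X \<tau> ((1 / 2) ^ c')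
     in (\<tau>', \<tau>' = \<tau> + (1 / 2) ^ c', fz (fz z (mv1 X s)) (mv2 X s), c'))"

primrec st :: "(real \<Rightarrow> nat) \<Rightarrow> nat \<Rightarrow> real \<times> bool \<times> nat \<times> nat" where
  "st X 0 = (0, False, 0, 0)"
| "st X (Suc k) = nxt X (st X k)"

definition T where "T X k = fst (st X k)"
definition PS where "PS X k = fst (snd (st X k))"
definition Z where "Z X k = fst (snd (snd (st X k)))"
definition C where "C X k = snd (snd (snd (st X k)))"
definition x1 where "x1 X k = mv1 X (st X k)"
definition y1 where "y1 X k = fy (Z X k) (x1 X k)"
definition Z1 where "Z1 X k = fz (Z X k) (x1 X k)"
definition x2 where "x2 X k = mv2 X (st X k)"
definition y2 where "y2 X k = fy (Z1 X k) (x2 X k)"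

definition G :: "(real \<Rightarrow> nat) \<Rightarrow> real \<Rightarrow> nat" where
  "G X = (\<lambda>t\<in>{0..}. let k = (LEAST k. t < T X (Suc k)) in
     if t = T X k then psnd (y1 X k) else psnd (y2 X k))"

lemma st_eq: "st X k = (T X k, PS X k, Z X k, C X k)"
  by (simp add: T_def PS_def Z_def C_def)

lemma T_0: "T X 0 = 0" and Z_0: "Z X 0 = 0"
  by (simp_all add: T_def Z_def)

lemma C_Suc: "C X (Suc k) = (if pfst (y1 X k) = 1 then 0 else Suc (C X k))"
  by (simp add: C_def y1_def x1_def Z_def nxt_def case_prod_beta Let_def)

lemma T_Suc: "T X (Suc k) = nextt X (T X k) ((1 / 2) ^ C X (Suc k))"
  by (simp add: T_def C_def nxt_def case_prod_beta Let_def)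

lemma PS_Suc: "PS X (Suc k) \<longleftrightarrow> T X (Suc k) = T X k + (1 / 2) ^ C X (Suc k)"
  by (simp add: PS_def T_def C_def nxt_def case_prod_beta Let_def)

lemma Z_Suc: "Z X (Suc k) = fz (Z1 X k) (x2 X k)"
  by (simp add: Z1_def x1_def x2_def Z_def nxt_def case_prod_beta Let_def)

lemma x1_eq: "x1 X k = prod_encode (if pfst (pfst (Z X k)) = 2 \<and> X (T X k) = pfst (psnd (pfst (Z X k))) \<and> PS X k
    then 0 else 1, X (T X k))"
  by (simp add: x1_def mv1_def case_prod_beta T_def PS_def Z_def)

lemma x2_eq: "x2 X k = prod_encode (1, rlim X (T X k))"
  by (simp add: x2_def mv2_def T_def)

context
  fixes X assumes X: "X \<in> signals (XS m)"
begin

lemma lfv: "locally_fv X" and XS: "t \<ge> 0 \<Longrightarrow> X t \<in> XS m" and Xfun: "X \<in> {0..} \<rightarrow> XS m"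
  using X by (auto simp: signals_iff)

lemma T_nonneg: "0 \<le> T X k"
proof (induction k)
  case (Suc k)
  then show ?case using nextt(1)[OF lfv Suc, of "(1 / 2) ^ C X (Suc k)"] by (simp add: T_Suc)
qed (simp add: T_0)

lemmas nx = nextt[OF lfv T_nonneg, of "(1 / 2) ^ C X (Suc k)" k for k, folded T_Suc, simplified]

lemma strict_mono_T: "strict_mono (T X)"
  unfolding strict_mono_Suc_iff using nx(1) by blast

lemma X_open: "T X k < t \<Longrightarrow> t < T X (Suc k) \<Longrightarrow> X t = rlim X (T X k)"
  by (rule rlim[OF lfv T_nonneg nx(3)])

lemma invariant:
  "Z X k \<in> cert_states 0 R \<and> pfst (pfst (Z X k)) = (if k = 0 then 0 else 2) \<and>
   (k > 0 \<longrightarrow> psnd (pfst (Z X k)) = prod_encode (rlim X (T X (k - 1)), psnd (y2 X (k - 1))))"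
  "x1 X k \<in> gLX m (pfst (Z X k))" "Z1 X k \<in> cert_states 0 R"
  "pfst (Z1 X k) = prod_encode (1, if k = 0 then 0 else rlim X (T X (k - 1)))"
  "x2 X k \<in> gLX m (pfst (Z1 X k))"
proof -
  have a: "x1 X k \<in> gLX m (pfst (Z X k)) \<and> Z1 X k \<in> cert_states 0 R \<and>
     pfst (Z1 X k) = prod_encode (1, if k = 0 then 0 else rlim X (T X (k - 1))) \<and>
     x2 X k \<in> gLX m (pfst (Z1 X k))"
    if "Z X k \<in> cert_states 0 R \<and> pfst (pfst (Z X k)) = (if k = 0 then 0 else 2) \<and>
      (k > 0 \<longrightarrow> psnd (pfst (Z X k)) = prod_encode (rlim X (T X (k - 1)), psnd (y2 X (k - 1))))" for k
  proof -
    have 1: "x1 X k \<in> gLX m (pfst (Z X k))"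
      unfolding x1_eq gLX_def using XS[OF T_nonneg[of k]] by auto
    note z = fz[OF _ 1] 
    have 2: "Z1 X k \<in> cert_states 0 R" using z that unfolding Z1_def cert_states_def by blast
    have 3: "pfst (Z1 X k) = prod_encode (1, if k = 0 then 0 else rlim X (T X (k - 1)))"
      using z that unfolding Z1_def by (auto simp: gdl_def)
    have "x2 X k \<in> gLX m (pfst (Z1 X k))"
      unfolding x2_eq gLX_def using rlim_in[OF Xfun lfv T_nonneg[of k]] by auto
    then show ?thesis using 1 2 3 by blast
  qed
  have b: "Z X k \<in> cert_states 0 R \<and> pfst (pfst (Z X k)) = (if k = 0 then 0 else 2) \<and>
      (k > 0 \<longrightarrow> psnd (pfst (Z X k)) = prod_encode (rlim X (T X (k - 1)), psnd (y2 X (k - 1))))" for k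
  proof (induction k)
    case 0
    show ?case by (simp add: Z_0 cert_states_def)
  next
    case (Suc k)
    note a = a[OF Suc]
    then have "(Z1 X k, glb \<phi> (pfst (Z1 X k)) (x2 X k) (y2 X k), Z X (Suc k)) \<in> R"
      "pfst (Z X (Suc k)) = gdl (pfst (Z1 X k)) (x2 X k) (y2 X k)"
      using fz[of "Z1 X k" "x2 X k"] unfolding Z_Suc y2_def by blast+
    then show ?case using a by (auto simp: cert_states_def gdl_def x2_eq)
  qed
  show "Z X k \<in> cert_states 0 R \<and> pfst (pfst (Z X k)) = (if k = 0 then 0 else 2) \<and>
   (k > 0 \<longrightarrow> psnd (pfst (Z X k)) = prod_encode (rlim X (T X (k - 1)), psnd (y2 X (k - 1))))" by (rule b)
  show "x1 X k \<in> gLX m (pfst (Z X k))" "Z1 X k \<in> cert_states 0 R"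
    "pfst (Z1 X k) = prod_encode (1, if k = 0 then 0 else rlim X (T X (k - 1)))"
    "x2 X k \<in> gLX m (pfst (Z1 X k))" using a[OF b[of k]] by blast+
qed

lemma y1_in: "y1 X k \<in> gLY m n (pfst (Z X k)) (x1 X k)"
  unfolding y1_def using invariant[of k] by (intro fy) auto

lemma y2_in: "y2 X k \<in> gLY m n (pfst (Z1 X k)) (x2 X k)"
  unfolding y2_def using invariant[of k] by (intro fy) auto

definition zz where "zz l = (if even l then Z X (l div 2) else Z1 X (l div 2))"
definition xx where "xx l = (if even l then x1 X (l div 2) else x2 X (l div 2))"
definition yy where "yy l = (if even l then y1 X (l div 2) else y2 X (l div 2))"
definition ww where "ww l = glb \<phi> (pfst (zz l)) (xx l) (yy l)"

lemma zz_R: "(zz l, ww l, zz (Suc l)) \<in> R"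
proof (cases "even l")
  case True
  then show ?thesis using fz[of "Z X (l div 2)" "x1 X (l div 2)"] invariant[of "l div 2"]
    by (simp add: zz_def ww_def xx_def yy_def y1_def Z1_def)
next
  case False
  then show ?thesis using fz[of "Z1 X (l div 2)" "x2 X (l div 2)"] invariant[of "l div 2"]
    by (simp add: zz_def ww_def xx_def yy_def y2_def Z_Suc)
qed

lemma zz_odd: "pfst (pfst (zz l)) = 1 \<longleftrightarrow> odd l"
  using invariant[of "l div 2"] by (auto simp: zz_def)

lemma ww_even: "ww (2 * k) = enc3 (pt \<phi> (set_decode (psnd (x1 X k) + psnd (y1 X k)))) (pfst (y1 X k)) (pfst (x1 X k))"
  using zz_odd[of "2 * k"] by (simp add: ww_def glb_def xx_def yy_def)

lemma ww_odd: "ww (2 * k + 1) = enc3 (op \<phi> (set_decode (psnd (x2 X k) + psnd (y2 X k)))) 0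
    (of_bool (rlim X (T X k) \<noteq> (if k = 0 then 0 else rlim X (T X (k - 1)))))"
  using zz_odd[of "2 * k + 1"] invariant(4)[of k] by (simp add: ww_def glb_def xx_def yy_def zz_def x2_eq)

lemma winning: "\<exists>p s e. linked_fact (gmul \<phi>) ww p s e \<and> gacc \<phi> s e"
proof -
  interpret fin_semigroup "gmul \<phi>" "gS \<phi>" by (rule fin_semigroup_gmul)
  have "ww l \<in> gS \<phi>" for l
  proof (cases "even l")
    case True
    then obtain k where "l = 2 * k" by (elim evenE)
    then show ?thesis using ww_even[of k] pt_car y1_in[of k] by (auto simp: gS_iff gLY_def x1_eq)
  next
    case False
    then obtain k where "l = 2 * k + 1" by (elim oddE)
    then show ?thesis using ww_odd[of k] op_car by (auto simp: gS_iff)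
  qed
  then show ?thesis using cert_ok_path[of 0 R "gacc \<phi>" zz ww, OF ok _ _ zz_R] by (simp add: zz_def Z_0)
qed

text \<open>Near the supremum of the times the input is constant. From then on every plan is
  completed and nothing interrupts, and a checkpoint is excluded because the following plan would
  have delay 1 and lead beyond the supremum.\<close>

lemma no_flags:
  assumes "bdd_above (range (T X))"
  shows "\<exists>N. \<forall>l\<ge>N. pfst (psnd (ww l)) = 0 \<and> psnd (psnd (ww l)) = 0"
proof -
  let ?S = "Sup (range (T X))"
  obtain N where N: "\<forall>k\<ge>N. X constant_on {T X k<..<?S} \<and> T X k < ?S \<and> ?S < T X k + 1"
    using bounded_strict_mono_constant[OF lfv _ strict_mono_T assms] T_0 by fastforce
  have lim: "X t = rlim X (T X k)" if "k \<ge> N" "T X k < t" "t < ?S" for k t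
    using rlim[OF lfv T_nonneg] N that by blast
  have r: "rlim X (T X (Suc k)) = rlim X (T X k)" if k: "k \<ge> N" for k
  proof -
    have "T X (Suc k) < ?S" using N k le_SucI by blast
    then obtain t where t: "T X (Suc k) < t" "t < ?S" using dense by blast
    then show ?thesis using lim[of "Suc k" t] lim[of k t] k nx(1)[of k] by simp
  qed
  have ps: "PS X (Suc k)" if k: "k \<ge> N" for k
  proof (rule ccontr)
    assume "\<not> ?thesis"
    then have lt: "T X (Suc k) < T X k + (1 / 2) ^ C X (Suc k)"
      using nx(2)[of k] unfolding PS_Suc by linarith
    let ?c = "min ?S (T X k + (1 / 2) ^ C X (Suc k))"
    have "T X (Suc k) < ?c" using N k lt by auto
    moreover have "X constant_on {T X k<..<?c}"
      by (rule constant_on_subset[of _ "{T X k<..<?S}"]) (use N k in auto)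
    ultimately show False using nx(4)[of k ?c] by simp
  qed
  have c0: "pfst (y1 X k) = 0" if k: "k \<ge> N" for k
  proof (rule ccontr)
    assume "pfst (y1 X k) \<noteq> 0"
    then have "pfst (y1 X k) = 1" using y1_in[of k] by (auto simp: gLY_def)
    then have "T X (Suc k) = T X k + 1" using ps[OF k] unfolding PS_Suc by (simp add: C_Suc)
    then show False using N k by (metis le_Suc_eq less_asym)
  qed
  have "pfst (psnd (ww l)) = 0 \<and> psnd (psnd (ww l)) = 0" if l: "l \<ge> 2 * Suc N" for l
  proof -
    define k where "k = l div 2 - 1"
    have k: "l div 2 = Suc k" "k \<ge> N" using l by (auto simp: k_def)
    show ?thesis
    proof (cases "even l")
      case True
      then have "l = 2 * Suc k" using k by auto
      moreover have "X (T X (Suc k)) = rlim X (T X k)" using lim[of k "T X (Suc k)"] k nx(1)[of k] N by auto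
      then have "pfst (x1 X (Suc k)) = 0" using ps[of k] k invariant(1)[of "Suc k"] by (simp add: x1_eq)
      ultimately show ?thesis using ww_even[of "Suc k"] c0[of "Suc k"] k by simp
    next
      case False
      then have "l = 2 * Suc k + 1" using k by (metis odd_two_times_div_two_succ)
      then show ?thesis using ww_odd[of "Suc k"] r[of k] k by simp
    qed
  qed
  then show ?thesis by blast
qed

text \<open>The certificate enforces \<open>gacc\<close>, which demands infinitely many checkpoints
  or infinitely many interrupts; bounded times would allow neither.\<close>

lemma unbounded_T: "\<not> bdd_above (range (T X))"
proof
  assume "bdd_above (range (T X))"
  from no_flags[OF this] obtain N where N: "\<forall>l\<ge>N. pfst (psnd (ww l)) = 0 \<and> psnd (psnd (ww l)) = 0" ..
  obtain p s e where lf: "linked_fact (gmul \<phi>) ww p s e" "gacc \<phi> s e" using winning by blast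
  have "\<not> (\<exists>\<^sub>\<infinity>k. pfst (psnd (ww k)) \<noteq> 0)" "\<not> (\<exists>\<^sub>\<infinity>k. psnd (psnd (ww k)) \<noteq> 0)"
    by (rule not_INFM_le[of N]; use N in simp)+
  then have "pfst (psnd e) = 0" "psnd (psnd e) = 0" using linked_fact_gmul(2,3)[OF lf(1)] by blast+
  then show False using lf(2) by (simp add: gacc_def)
qed

lemma piece_ex:
  assumes "0 \<le> t" obtains k where "T X k \<le> t" "t < T X (Suc k)"
proof -
  obtain n where n: "t < T X n" using unbounded_range_ex[OF unbounded_T] by blast
  define l where "l = (LEAST n. t < T X n)"
  have l: "t < T X l" unfolding l_def using n by (rule LeastI)
  then obtain k where k: "l = Suc k" using assms T_0[of X] by (cases l) auto
  have "\<not> t < T X k" using not_less_Least[of k "\<lambda>n. t < T X n"] k l_def by simp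
  then show thesis using that[of k] l k by simp
qed

lemma G_eq:
  assumes "T X k \<le> t" "t < T X (Suc k)"
  shows "G X t = (if t = T X k then psnd (y1 X k) else psnd (y2 X k))"
proof -
  have "(LEAST k. t < T X (Suc k)) = k"
  proof (rule Least_equality)
    fix k' assume "t < T X (Suc k')"
    then have "T X k < T X (Suc k')" using assms by simp
    then show "k \<le> k'" using strict_mono_T by (simp add: strict_mono_less)
  qed (rule assms)
  moreover have "0 \<le> t" using assms T_nonneg[of k] by simp
  ultimately show ?thesis by (simp add: G_def)
qed

lemma G_signal: "G X \<in> signals (YS m n)"
  unfolding signals_def
proof (intro CollectI conjI)
  show "G X \<in> {0..} \<rightarrow>\<^sub>E YS m n"
  proof (rule PiE_I)
    fix t :: real assume "t \<in> {0..}"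
    then obtain k where "T X k \<le> t" "t < T X (Suc k)" using piece_ex by auto
    then show "G X t \<in> YS m n" using G_eq y1_in[of k] y2_in[of k] by (auto simp: gLY_def)
  qed (simp add: G_def)
  show "finitely_variable (G X)" unfolding finitely_variable_def
  proof (intro exI[of _ "T X"] conjI allI T_0 strict_mono_T unbounded_T)
    fix k
    show "G X constant_on {T X k<..<T X (Suc k)}"
      unfolding constant_on_def by (intro exI[of _ "psnd (y2 X k)"]) (auto simp: G_eq[of k])
  qed
qed

lemma G_correct: "satc \<phi> (Mof (\<lambda>t. X t + G X t))"
proof -
  obtain p s e where lf: "linked_fact (gmul \<phi>) ww p s e" and acc: "gacc \<phi> s e" using winning by blast
  \<comment> \<open>Without further checkpoints the delays would be bounded by a geometric series
    and the times by its sum. So checkpoints recur, and then \<open>gacc\<close> amounts to the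
    formula itself.\<close>
  have c: "\<exists>\<^sub>\<infinity>l. pfst (psnd (ww l)) \<noteq> 0"
  proof (rule ccontr)
    assume "\<not> ?thesis"
    then obtain N where N: "\<And>l. l \<ge> N \<Longrightarrow> pfst (psnd (ww l)) = 0" unfolding INFM_nat_le by blast
    have "pfst (y1 X k) = 0" if "k \<ge> N" for k using N[of "2 * k"] ww_even[of k] that by simp
    then have CS: "C X (Suc k) = Suc (C X k)" if "k \<ge> N" for k using that by (simp add: C_Suc)
    have C: "j \<le> C X (N + j)" for j by (induction j) (auto simp: CS)
    have b: "T X (N + j) \<le> T X N + 1 - (1 / 2) ^ j" for j
    proof (induction j)
      case (Suc j)
      have "T X (N + Suc j) \<le> T X (N + j) + (1 / 2) ^ C X (N + Suc j)" using nx(2)[of "N + j"] by simp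
      also have "(1 / 2 :: real) ^ C X (N + Suc j) \<le> (1 / 2) ^ Suc j" 
        using C[of "Suc j"] by (intro power_decreasing) auto
      finally show ?case using Suc by simp
    qed simp
    have "T X j \<le> T X N + 1" for j
    proof -
      have "0 \<le> (1 / 2 :: real) ^ j" by simp
      moreover have "T X j \<le> T X (N + j)" using strict_mono_T by (simp add: strict_mono_less_eq)
      ultimately show ?thesis using b[of j] by linarith
    qed
    then have "bdd_above (range (T X))" by (intro bdd_aboveI[of _ "T X N + 1"]) auto
    then show False using unbounded_T by blast
  qed
  have "satc \<phi> (Mof (\<lambda>t. X t + G X t)) \<longleftrightarrow> acc \<phi> (pfst s) (pfst e)"
  proof (rule satc_play[OF T_0 strict_mono_T unbounded_T, of "\<lambda>l. pfst (zz l)" _ xx yy])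
    show "pfst (pfst (zz l)) = 1 \<longleftrightarrow> odd l" for l by (rule zz_odd)
    show "X (T X k) + G X (T X k) = psnd (xx (2 * k)) + psnd (yy (2 * k))" for k
      using G_eq[of k "T X k"] nx(1)[of k] by (simp add: xx_def yy_def x1_eq)
    show "X t + G X t = psnd (xx (2 * k + 1)) + psnd (yy (2 * k + 1))"
      if "T X k < t" "t < T X (Suc k)" for k t
      using G_eq[of k t] X_open[OF that] that by (simp add: xx_def yy_def x2_eq)
    show "linked_fact (gmul \<phi>) (\<lambda>l. glb \<phi> (pfst (zz l)) (xx l) (yy l)) p s e"
      using lf unfolding ww_def[abs_def] .
  qed
  moreover have "pfst (psnd e) \<noteq> 0" using linked_fact_gmul(2)[OF lf] c by blast
  ultimately show ?thesis using acc by (simp add: gacc_def)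
qed

end

text \<open>At a point strictly before \<open>t\<close> even the right limit of the input is
  determined by the input up to \<open>t\<close>; hence so is the state of the machine
  there.\<close>

lemma causal_st:
  assumes X: "X \<in> signals (XS m)" "X' \<in> signals (XS m)" and eq: "\<And>s. 0 \<le> s \<Longrightarrow> s \<le> t \<Longrightarrow> X s = X' s"
  shows "T X k < t \<Longrightarrow> st X' k = st X k"
proof (induction k)
  case (Suc k)
  note l = lfv[OF X(1)] lfv[OF X(2)]
  have Tk: "T X k < t" using Suc.prems nx(1)[OF X(1), of k] by simp
  then have s: "st X' k = st X k" by (rule Suc.IH)
  have T: "T X' k = T X k" using s by (simp add: T_def)
  note nn = T_nonneg[OF X(1), of k]
  have "x1 X' k = x1 X k" using eq[of "T X k"] nn Tk s T unfolding x1_eq by (simp add: Z_def PS_def)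
  moreover have "x2 X' k = x2 X k" unfolding x2_eq T
    using rlim_cong[OF l nn Tk] eq nn by simp
  ultimately have y: "y1 X' k = y1 X k" "Z X' (Suc k) = Z X (Suc k)"
    unfolding Z_Suc Z1_def y1_def using s by (simp_all add: Z_def)
  then have C: "C X' (Suc k) = C X (Suc k)" unfolding C_Suc using s by (simp add: C_def)
  note n1 = nx[OF X(1), of k]
  have TS: "T X' (Suc k) = T X (Suc k)"
    unfolding T_Suc[of X'] C T
  proof (rule nextt_eqI[OF l(2) nn _ n1(1,2)])
    show "X' constant_on {T X k<..<T X (Suc k)}"
      using n1(3) nn Suc.prems eq by (subst constant_on_cong[of _ X' X]) auto
    \<comment> \<open>The change of \<open>X\<close> that ended the round is visible already before
      \<open>t\<close>, so the interval may be cut at \<open>t\<close>, where both inputs still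
      agree.\<close>
    fix c assume c: "T X (Suc k) < c" "c \<le> T X k + (1 / 2) ^ C X (Suc k)"
    have "\<not> X constant_on {T X k<..<min c t}" using n1(4)[of "min c t"] c Suc.prems by auto
    moreover have "X constant_on {T X k<..<min c t} \<longleftrightarrow> X' constant_on {T X k<..<min c t}"
      using nn eq by (intro constant_on_cong) auto
    ultimately show "\<not> X' constant_on {T X k<..<c}"
      by (meson constant_on_subset greaterThanLessThan_subseteq_greaterThanLessThan min.cobounded1 order_refl)
  qed simp
  then have "PS X' (Suc k) = PS X (Suc k)" unfolding PS_Suc C T by simp
  then show ?case unfolding st_eq[of X' "Suc k"] st_eq[of X "Suc k"] using TS C y(2) by simp
qed simp

text \<open>The first run has a point at \<open>t\<close>, the second has not. Both planned the same
  delay, so the first run was interrupted before its deadline, and by a change to the right of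
  \<open>t\<close>, since both inputs still have the old value at \<open>t\<close>. This is the case
  in which the rules of the game forbid the output to react.\<close>

lemma causal_interrupt:
  assumes X: "X \<in> signals (XS m)" "X' \<in> signals (XS m)" and eq: "\<And>s. 0 \<le> s \<Longrightarrow> s \<le> t \<Longrightarrow> X s = X' s"
    and s: "T X k < t" "t = T X (Suc k)" "t < T X' (Suc k)" 
  shows "G X t = G X' t"
proof -
  note l = lfv[OF X(1)] lfv[OF X(2)]
  have st: "st X' k = st X k" by (rule causal_st[OF X eq s(1)])
  have T: "T X' k = T X k" using st by (simp add: T_def)
  note nn = T_nonneg[OF X(1), of k]
  have x1: "x1 X' k = x1 X k" using eq[of "T X k"] nn s st T unfolding x1_eq by (simp add: Z_def PS_def)
  have rl: "rlim X' (T X k) = rlim X (T X k)" using rlim_cong[OF l nn s(1)] eq nn by simp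
  then have x2: "x2 X' k = x2 X k" unfolding x2_eq T by simp
  have y: "y2 X' k = y2 X k" "y1 X' k = y1 X k"
    using x1 x2 st unfolding y2_def Z1_def y1_def by (simp_all add: Z_def)
  then have C: "C X' (Suc k) = C X (Suc k)" unfolding C_Suc using st by (simp add: C_def)
  have "T X' (Suc k) \<le> T X k + (1 / 2) ^ C X (Suc k)" using nx(2)[OF X(2), of k] by (simp add: T C)
  then have ps: "\<not> PS X (Suc k)" unfolding PS_Suc using s by auto
  have "X' t = rlim X (T X k)" using X_open[OF X(2), of k t] s T rl by simp
  then have "X (T X (Suc k)) = rlim X (T X k)" using eq[of t] s nn by simp
  then have "psnd (y1 X (Suc k)) = psnd (y2 X k)"
    using y1_in[OF X(1), of "Suc k"] invariant(1)[OF X(1), of "Suc k"] ps by (simp add: gLY_def x1_eq)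
  then show ?thesis using G_eq[OF X(1), of "Suc k" t] G_eq[OF X(2), of k t] s T y nx(1)[OF X(1), of "Suc k"]
    by auto
qed

lemma causal:
  assumes X: "X \<in> signals (XS m)" "X' \<in> signals (XS m)" and t: "0 \<le> t"
    and eq: "\<And>s. 0 \<le> s \<Longrightarrow> s \<le> t \<Longrightarrow> X s = X' s"
  shows "G X t = G X' t"
proof (cases "t = 0")
  case True
  have "x1 X 0 = x1 X' 0" using eq[of 0] t by (simp add: x1_eq T_0 Z_0)
  then have "y1 X 0 = y1 X' 0" by (simp add: y1_def Z_0)
  then show ?thesis using G_eq[OF X(1), of 0 0] G_eq[OF X(2), of 0 0] nx(1)[OF X(1), of 0] nx(1)[OF X(2), of 0] True
    by (simp add: T_0)
next
  case False
  obtain j where j: "T X j \<le> t" "t < T X (Suc j)" using piece_ex[OF X(1) t] .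
  \<comment> \<open>The point has to be strictly before \<open>t\<close> for its right limit to be
    known; if \<open>t\<close> is itself a point, the preceding round is taken.\<close>
  obtain k where k: "T X k < t" "t \<le> T X (Suc k)"
  proof (cases "t = T X j")
    case True
    then obtain i where "j = Suc i" using False T_0[of X] by (cases j) auto
    then show thesis using that[of i] True nx(1)[OF X(1), of i] by simp
  qed (use that[of j] j in simp)
  note l = lfv[OF X(1)] lfv[OF X(2)]
  note nn = T_nonneg[OF X(1), of k]
  have st: "st X' k = st X k" by (rule causal_st[OF X eq k(1)])
  have T: "T X' k = T X k" using st by (simp add: T_def)
  have x1: "x1 X' k = x1 X k" using eq[of "T X k"] nn k st T unfolding x1_eq by (simp add: Z_def PS_def)
  have x2: "x2 X' k = x2 X k" unfolding x2_eq T using rlim_cong[OF l nn k(1)] eq nn by simp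
  have y: "y2 X' k = y2 X k" "y1 X' k = y1 X k" "Z X' (Suc k) = Z X (Suc k)"
    using x1 x2 st unfolding y2_def Z_Suc Z1_def y1_def by (simp_all add: Z_def)
  then have C: "C X' (Suc k) = C X (Suc k)" unfolding C_Suc using st by (simp add: C_def)
  have "X constant_on {T X k<..<t} \<longleftrightarrow> X' constant_on {T X k<..<t}"
    using nn eq by (intro constant_on_cong) auto
  moreover have "X constant_on {T X k<..<t}"
    by (rule constant_on_subset[OF nx(3)[OF X(1)]]) (use k in auto)
  ultimately have le: "t \<le> T X' (Suc k)"
    unfolding T_Suc[of X'] C T using k(2) nx(2)[OF X(1), of k] l nn by (intro nextt_ge) auto
  consider "t < T X (Suc k)" "t < T X' (Suc k)" | "t = T X (Suc k)" "t < T X' (Suc k)"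
    | "t < T X (Suc k)" "t = T X' (Suc k)" | "t = T X (Suc k)" "t = T X' (Suc k)"
    using le k(2) by linarith
  then show ?thesis
  proof cases
    case 1
    then show ?thesis using G_eq[OF X(1), of k t] G_eq[OF X(2), of k t] k T y by simp
  next
    case 2
    then show ?thesis using causal_interrupt[OF X eq k(1)] by blast
  next
    case 3
    have "G X' t = G X t"
      by (rule causal_interrupt[OF X(2,1), of t k]) (use 3 eq k T in auto)
    then show ?thesis by simp
  next
    case 4
    then have "PS X' (Suc k) = PS X (Suc k)" unfolding PS_Suc C T by simp
    then have "x1 X' (Suc k) = x1 X (Suc k)" using 4 eq[of t] t y by (simp add: x1_eq)
    then have "y1 X' (Suc k) = y1 X (Suc k)" using y by (simp add: y1_def)
    then show ?thesis using G_eq[OF X(1), of "Suc k" t] G_eq[OF X(2), of "Suc k" t] 4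
      nx(1)[OF X(1), of "Suc k"] nx(1)[OF X(2), of "Suc k"] by simp
  qed
qed

theorem operator: "C_operator (XS m) (YS m n) G"
  unfolding C_operator_def
proof (intro conjI allI impI ballI)
  show "G \<in> signals (XS m) \<rightarrow> signals (YS m n)" using G_signal by blast
  fix t X X' assume "0 \<le> t" "X \<in> signals (XS m)" "X' \<in> signals (XS m)" and eq: "\<forall>s\<in>{0..t}. X s = X' s"
  then show "G X t = G X' t" by (intro causal) (use eq in simp_all)
qed

end

theorem Ycert_imp_operator:
  assumes "Ycert (gmul \<phi>) (gLX m) (gLY m n) gdl (glb \<phi>) 0 (gacc \<phi>) R"
  shows "\<exists>G. C_operator (XS m) (YS m n) G \<and> (\<forall>X\<in>signals (XS m). satc \<phi> (Mof (\<lambda>t. X t + G X t)))"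
proof -
  have ok: "cert_ok (gmul \<phi>) 0 R (gacc \<phi>)" using assms by (simp add: Ycert_def)
  have "\<forall>z x. \<exists>y z'. z \<in> cert_states 0 R \<longrightarrow> x \<in> gLX m (pfst z) \<longrightarrow> y \<in> gLY m n (pfst z) x \<and>
     pfst z' = gdl (pfst z) x y \<and> (z, glb \<phi> (pfst z) x y, z') \<in> R"
    using assms unfolding Ycert_def by blast
  then obtain fy fz where f: "\<And>z x. z \<in> cert_states 0 R \<Longrightarrow> x \<in> gLX m (pfst z) \<Longrightarrow> fy z x \<in> gLY m n (pfst z) x \<and>
     pfst (fz z x) = gdl (pfst z) x (fy z x) \<and> (z, glb \<phi> (pfst z) x (fy z x), fz z x) \<in> R"
    by metis
  interpret y_machine m n \<phi> R fy fz
    by unfold_locales (use ok f in auto)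
  show ?thesis using operator G_correct by blast
qed

section \<open>From certificates of the input player to inputs\<close>

lemma cut_signal:
  assumes X: "X \<in> signals A" and "a \<in> A" "b \<in> A"
  shows "(\<lambda>t\<in>{0..}. if t < c then X t else if t = c then a else b) \<in> signals A"
  unfolding signals_iff
proof
  show "(\<lambda>t\<in>{0..}. if t < c then X t else if t = c then a else b) \<in> {0..} \<rightarrow>\<^sub>E A"
    using assms by (auto simp: signals_iff)
  have "locally_fv X" using X by (simp add: signals_iff)
  from locally_fv_comp2[OF this locally_fv_comp2[OF locally_fv_less[of c] locally_fv_le[of c], of Pair],
      of "\<lambda>x p. if fst p then x else if snd p then a else b"]
  have "locally_fv (\<lambda>t. if t < c then X t else if t \<le> c then a else b)"
    by (simp only: fst_conv snd_conv)
  moreover have "locally_fv (\<lambda>t\<in>{0..}. if t < c then X t else if t = c then a else b) \<longleftrightarrow>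
      locally_fv (\<lambda>t. if t < c then X t else if t \<le> c then a else b)"
    by (rule locally_fv_cong) auto
  ultimately show "locally_fv (\<lambda>t\<in>{0..}. if t < c then X t else if t = c then a else b)" by blast
qed

text \<open>An input signal defeating \<open>F\<close> is built by letting the certificate play against \<open>F\<close>: on a pass
  the next event is the next change of the output or the next integer time, which counts as a
  checkpoint; interrupts take place before that.\<close>

locale x_machine =
  fixes m n :: nat and \<phi> :: core and R :: "(nat \<times> nat \<times> nat) set"
    and gx :: "nat \<Rightarrow> nat" and gz :: "nat \<Rightarrow> nat \<Rightarrow> nat" and F :: "(real \<Rightarrow> nat) \<Rightarrow> real \<Rightarrow> nat"
  assumes ok: "cert_ok (gmul \<phi>) 0 R (\<lambda>s e. \<not> gacc \<phi> s e)"
    and gx: "z \<in> cert_states 0 R \<Longrightarrow> gx z \<in> gLX m (pfst z)"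
    and gz: "z \<in> cert_states 0 R \<Longrightarrow> y \<in> gLY m n (pfst z) (gx z) \<Longrightarrow>
      pfst (gz z y) = gdl (pfst z) (gx z) y \<and> (z, glb \<phi> (pfst z) (gx z) y, gz z y) \<in> R"
    and F: "C_operator (XS m) (YS m n) F"
    and correct: "X \<in> signals (XS m) \<Longrightarrow> satc \<phi> (Mof (\<lambda>t. X t + F X t))"
begin

text \<open>The next change of the output if the input continues as \<open>X\<close>, but at the
  latest the first integer after \<tau>.\<close>

definition \<nu> :: "real \<Rightarrow> (real \<Rightarrow> nat) \<Rightarrow> real" where
  "\<nu> \<tau> X = nextt (F X) \<tau> (of_int (\<lfloor>\<tau>\<rfloor> + 1) - \<tau>)"

text \<open>An interrupt may come at any time before the planned change; the midpoint is
  taken.\<close>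

definition tm :: "real \<times> (real \<Rightarrow> nat) \<times> nat \<Rightarrow> real" where
  "tm s = (case s of (\<tau>, X, z) \<Rightarrow> if pfst (pfst z) = 0 then 0
     else if pfst (gx z) = 0 then \<nu> \<tau> X else (\<tau> + \<nu> \<tau> X) / 2)"

text \<open>\<open>F\<close> has to be given a complete signal before its value at the new point can
  be asked for, so the input played so far is continued arbitrarily; by causality the value is
  independent of the continuation. The repeated branch matches the form of
  \<open>cut_signal\<close>.\<close>

definition Xa :: "real \<times> (real \<Rightarrow> nat) \<times> nat \<Rightarrow> real \<Rightarrow> nat" where
  "Xa s = (case s of (\<tau>, X, z) \<Rightarrow> \<lambda>t\<in>{0..}. if t < tm s then X t else if t = tm s then psnd (gx z) else psnd (gx z))"

definition yv1 :: "real \<times> (real \<Rightarrow> nat) \<times> nat \<Rightarrow> nat" where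
  "yv1 s = prod_encode (of_bool (pfst (gx (snd (snd s))) = 0 \<and> tm s \<in> \<int>), F (Xa s) (tm s))"

definition zm :: "real \<times> (real \<Rightarrow> nat) \<times> nat \<Rightarrow> nat" where
  "zm s = gz (snd (snd s)) (yv1 s)"

text \<open>Continued by the input value of the new interval, this is the signal from which the
  behaviour of \<open>F\<close> up to the next event is read off.\<close>

definition Xb :: "real \<times> (real \<Rightarrow> nat) \<times> nat \<Rightarrow> real \<Rightarrow> nat" where
  "Xb s = (case s of (\<tau>, X, z) \<Rightarrow> \<lambda>t\<in>{0..}. if t < tm s then X t else if t = tm s then psnd (gx z) else psnd (gx (zm s)))"

definition yv2 :: "real \<times> (real \<Rightarrow> nat) \<times> nat \<Rightarrow> nat" where
  "yv2 s = prod_encode (0, rlim (F (Xb s)) (tm s))"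

primrec st :: "nat \<Rightarrow> real \<times> (real \<Rightarrow> nat) \<times> nat" where
  "st 0 = (0, \<lambda>t\<in>{0..}. 0, 0)"
| "st (Suc k) = (tm (st k), Xb (st k), gz (zm (st k)) (yv2 (st k)))"

definition T where "T k = tm (st k)"
definition Xp where "Xp k = fst (snd (st k))"
definition X where "X k = Xb (st k)"
definition Z where "Z k = snd (snd (st k))"
definition Z1 where "Z1 k = zm (st k)"
definition y1 where "y1 k = yv1 (st k)"
definition y2 where "y2 k = yv2 (st k)"
definition a where "a k = psnd (gx (Z k))"
definition b where "b k = psnd (gx (Z1 k))"

lemma Z_0: "Z 0 = 0" and Z_Suc: "Z (Suc k) = gz (Z1 k) (y2 k)" and Z1_eq: "Z1 k = gz (Z k) (y1 k)"
  and Xp_Suc: "Xp (Suc k) = X k"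
  by (simp_all add: Z_def Z1_def y1_def y2_def zm_def Xp_def X_def)

lemma T_0: "T 0 = 0"
  by (simp add: T_def tm_def)

lemma tm_eq: "tm s = (if pfst (pfst (snd (snd s))) = 0 then 0
    else if pfst (gx (snd (snd s))) = 0 then \<nu> (fst s) (fst (snd s)) else (fst s + \<nu> (fst s) (fst (snd s))) / 2)"
  by (simp add: tm_def case_prod_beta)

lemma T_Suc: "pfst (pfst (Z (Suc k))) \<noteq> 0 \<Longrightarrow>
    T (Suc k) = (if pfst (gx (Z (Suc k))) = 0 then \<nu> (T k) (X k) else (T k + \<nu> (T k) (X k)) / 2)"
  unfolding T_def tm_eq[of "st (Suc k)"] by (simp add: Z_def X_def)

lemma X_eq: "X k t = (if 0 \<le> t then if t < T k then Xp k t else if t = T k then a k else b k else undefined)"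
  by (simp add: X_def Xb_def case_prod_beta T_def Xp_def a_def b_def Z_def Z1_def)

lemma Xa_eq: "Xa (st k) t = (if 0 \<le> t then if t < T k then Xp k t else a k else undefined)"
  by (simp add: Xa_def case_prod_beta T_def Xp_def a_def Z_def)

lemma X_fun: "X k = (\<lambda>t\<in>{0..}. if t < T k then Xp k t else if t = T k then a k else b k)"
  by (simp add: fun_eq_iff X_eq)

lemma Xa_fun: "Xa (st k) = (\<lambda>t\<in>{0..}. if t < T k then Xp k t else if t = T k then a k else a k)"
  by (simp add: fun_eq_iff Xa_eq)

lemma y1_eq: "y1 k = prod_encode (of_bool (pfst (gx (Z k)) = 0 \<and> T k \<in> \<int>), F (Xa (st k)) (T k))"
  by (simp add: y1_def yv1_def Z_def T_def)

lemma y2_eq: "y2 k = prod_encode (0, rlim (F (X k)) (T k))"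
  by (simp add: y2_def yv2_def X_def T_def)

lemma F_signal: "U \<in> signals (XS m) \<Longrightarrow> F U \<in> signals (YS m n)"
  using F by (auto simp: C_operator_def)

lemma F_causal:
  assumes "U \<in> signals (XS m)" "V \<in> signals (XS m)" "0 \<le> t" "\<And>s. 0 \<le> s \<Longrightarrow> s \<le> t \<Longrightarrow> U s = V s"
  shows "F U t = F V t"
  using F assms unfolding C_operator_def by (meson atLeastAtMost_iff)

lemma F_lfv: "U \<in> signals (XS m) \<Longrightarrow> locally_fv (F U)"
  using F_signal by (auto simp: signals_iff)

lemma \<nu>:
  assumes "U \<in> signals (XS m)" "0 \<le> t"
  shows "t < \<nu> t U" "\<nu> t U \<le> of_int (\<lfloor>t\<rfloor> + 1)" "F U constant_on {t<..<\<nu> t U}"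
    "\<And>c. \<nu> t U < c \<Longrightarrow> c \<le> of_int (\<lfloor>t\<rfloor> + 1) \<Longrightarrow> \<not> F U constant_on {t<..<c}"
proof -
  have "t < of_int (\<lfloor>t\<rfloor> + 1)" by linarith
  then have D: "0 < of_int (\<lfloor>t\<rfloor> + 1) - t" by simp
  note nx = nextt[OF F_lfv[OF assms(1)] assms(2) D, folded \<nu>_def]
  show "t < \<nu> t U" "F U constant_on {t<..<\<nu> t U}" by (rule nx)+
  show "\<nu> t U \<le> of_int (\<lfloor>t\<rfloor> + 1)" using nx(2) by simp
  show "\<And>c. \<nu> t U < c \<Longrightarrow> c \<le> of_int (\<lfloor>t\<rfloor> + 1) \<Longrightarrow> \<not> F U constant_on {t<..<c}" using nx(4) by simp
qed

lemma invariant: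
  "Z k \<in> cert_states 0 R" "pfst (pfst (Z k)) = (if k = 0 then 0 else 2)"
  "k > 0 \<Longrightarrow> psnd (pfst (Z k)) = prod_encode (b (k - 1), psnd (y2 (k - 1)))"
  "Xp k \<in> signals (XS m)" "0 \<le> T k" "k > 0 \<Longrightarrow> T (k - 1) < T k \<and> T k \<le> \<nu> (T (k - 1)) (X (k - 1))"
  "Xa (st k) \<in> signals (XS m)" "X k \<in> signals (XS m)"
  "y1 k \<in> gLY m n (pfst (Z k)) (gx (Z k))" "Z1 k \<in> cert_states 0 R"
  "pfst (Z1 k) = prod_encode (1, if k = 0 then 0 else b (k - 1))"
  "y2 k \<in> gLY m n (pfst (Z1 k)) (gx (Z1 k))"
proof -
  let ?A = "\<lambda>k. Z k \<in> cert_states 0 R \<and> pfst (pfst (Z k)) = (if k = 0 then 0 else 2) \<and>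
    (k > 0 \<longrightarrow> psnd (pfst (Z k)) = prod_encode (b (k - 1), psnd (y2 (k - 1)))) \<and>
    Xp k \<in> signals (XS m) \<and> 0 \<le> T k \<and> (k > 0 \<longrightarrow> T (k - 1) < T k \<and> T k \<le> \<nu> (T (k - 1)) (X (k - 1)))"
  let ?B = "\<lambda>k. Xa (st k) \<in> signals (XS m) \<and> X k \<in> signals (XS m) \<and>
    y1 k \<in> gLY m n (pfst (Z k)) (gx (Z k)) \<and> Z1 k \<in> cert_states 0 R \<and>
    pfst (Z1 k) = prod_encode (1, if k = 0 then 0 else b (k - 1)) \<and>
    y2 k \<in> gLY m n (pfst (Z1 k)) (gx (Z1 k))"
  have step: "?B k" if A: "?A k" and prev: "k > 0 \<Longrightarrow> 0 \<le> T (k - 1) \<and> X (k - 1) \<in> signals (XS m)" for k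
  proof -
    have x: "gx (Z k) \<in> gLX m (pfst (Z k))" using A gx by blast
    have aXS: "a k \<in> XS m" using x by (simp add: a_def gLX_def)
    have Xas: "Xa (st k) \<in> signals (XS m)"
      unfolding Xa_fun by (rule cut_signal) (use A aXS in auto)
    have FXa: "F (Xa (st k)) (T k) \<in> YS m n" using F_signal[OF Xas] A by (auto simp: signals_iff)
    have y1: "y1 k \<in> gLY m n (pfst (Z k)) (gx (Z k))"
      unfolding gLY_def
    proof (intro CollectI conjI impI)
      \<comment> \<open>An interrupt that keeps the input value: the new signal agrees with the
        previous one up to the new point, which lies strictly before the change of the output, so
        \<open>F\<close> obeys the rule that the output stays.\<close>
      assume h: "pfst (pfst (Z k)) = 2 \<and> pfst (gx (Z k)) = 1 \<and> psnd (gx (Z k)) = pfst (psnd (pfst (Z k)))"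
      then have k: "k > 0" using A by (cases k) auto
      then obtain j where j: "k = Suc j" by (cases k) auto
      note p = prev[OF k, unfolded j diff_Suc_1]
      have ab: "a k = b j" using h A j by (simp add: a_def)
      note nu = \<nu>[of "X j" "T j"]
      have Tk: "T k = (T j + \<nu> (T j) (X j)) / 2" using T_Suc[of j] h j by simp
      have Tk2: "T j < T k" "T k < \<nu> (T j) (X j)" using nu(1) p unfolding Tk by auto
      have "F (Xa (st k)) (T k) = F (X j) (T k)"
      proof (rule F_causal[OF Xas])
        fix s assume "0 \<le> s" "s \<le> T k"
        then show "Xa (st k) s = X j s" using ab Tk2(1) unfolding Xa_eq j by (auto simp: Xp_Suc X_eq[of j])
      qed (use p A in auto)
      also have "\<dots> = rlim (F (X j)) (T j)"
        by (rule rlim[OF F_lfv _ nu(3) Tk2]) (use p in auto)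
      finally show "psnd (y1 k) = psnd (psnd (pfst (Z k)))" using A j by (simp add: y1_eq y2_eq)
    qed (use FXa in \<open>auto simp: y1_eq of_bool_def split: if_splits\<close>)
    have z1: "pfst (Z1 k) = gdl (pfst (Z k)) (gx (Z k)) (y1 k)" "(Z k, glb \<phi> (pfst (Z k)) (gx (Z k)) (y1 k), Z1 k) \<in> R"
      using gz[OF _ y1] A unfolding Z1_eq by auto
    then have Z1c: "Z1 k \<in> cert_states 0 R" by (auto simp: cert_states_def)
    have Z1p: "pfst (Z1 k) = prod_encode (1, if k = 0 then 0 else b (k - 1))"
      using z1(1) A by (auto simp: gdl_def)
    have bXS: "b k \<in> XS m" using gx[OF Z1c] by (simp add: b_def gLX_def)
    have Xs: "X k \<in> signals (XS m)"
      unfolding X_fun by (rule cut_signal) (use A aXS bXS in auto)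
    have "rlim (F (X k)) (T k) \<in> YS m n"
      by (rule rlim_in[OF _ F_lfv[OF Xs]]) (use F_signal[OF Xs] A in \<open>auto simp: signals_iff\<close>)
    then have "y2 k \<in> gLY m n (pfst (Z1 k)) (gx (Z1 k))" using Z1p by (simp add: gLY_def y2_eq)
    then show ?thesis using Xas y1 Z1c Z1p Xs by blast
  qed
  have AB: "?A k \<and> ?B k" for k
  proof (induction k)
    case 0
    have "locally_fv (\<lambda>t\<in>{0..}. 0 :: nat) \<longleftrightarrow> locally_fv (\<lambda>t. 0 :: nat)"
      by (rule locally_fv_cong) simp
    then have "(\<lambda>t\<in>{0..}. 0) \<in> signals (XS m)"
      unfolding signals_iff using zero_XS locally_fv_const[of "0 :: nat"] by auto
    then have A: "?A 0" by (simp add: Z_0 T_0 cert_states_def Xp_def)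
    then show ?case using step[of 0] by blast
  next
    case (Suc k)
    then have A: "?A k" and B: "?B k" by blast+
    have z: "pfst (Z (Suc k)) = gdl (pfst (Z1 k)) (gx (Z1 k)) (y2 k)"
      "(Z1 k, glb \<phi> (pfst (Z1 k)) (gx (Z1 k)) (y2 k), Z (Suc k)) \<in> R"
      using gz[of "Z1 k" "y2 k"] B unfolding Z_Suc by auto
    have pz: "pfst (Z (Suc k)) = prod_encode (2, prod_encode (b k, psnd (y2 k)))"
      using z(1) B by (simp add: gdl_def b_def)
    have Xs: "X k \<in> signals (XS m)" and T0: "0 \<le> T k" using A B by blast+
    have "T k < T (Suc k) \<and> T (Suc k) \<le> \<nu> (T k) (X k)"
      using T_Suc[of k] pz \<nu>(1)[OF Xs T0] by auto
    then have A': "?A (Suc k)" using z(2) pz Xs T0 by (auto simp: cert_states_def Xp_Suc)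
    have "?B (Suc k)" by (rule step[OF A']) (use Xs T0 in simp_all)
    then show ?case using A' by blast
  qed
  show "Z k \<in> cert_states 0 R" "pfst (pfst (Z k)) = (if k = 0 then 0 else 2)"
    "k > 0 \<Longrightarrow> psnd (pfst (Z k)) = prod_encode (b (k - 1), psnd (y2 (k - 1)))"
    "Xp k \<in> signals (XS m)" "0 \<le> T k" "k > 0 \<Longrightarrow> T (k - 1) < T k \<and> T k \<le> \<nu> (T (k - 1)) (X (k - 1))"
    "Xa (st k) \<in> signals (XS m)" "X k \<in> signals (XS m)"
    "y1 k \<in> gLY m n (pfst (Z k)) (gx (Z k))" "Z1 k \<in> cert_states 0 R"
    "pfst (Z1 k) = prod_encode (1, if k = 0 then 0 else b (k - 1))"
    "y2 k \<in> gLY m n (pfst (Z1 k)) (gx (Z1 k))"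
    using AB[of k] by blast+
qed

lemma T_step: "T k < T (Suc k)" "T (Suc k) \<le> \<nu> (T k) (X k)"
  using invariant(6)[of "Suc k"] by auto

lemma strict_mono_T: "strict_mono T"
  unfolding strict_mono_Suc_iff using T_step by blast

lemma X_stable: "t < T (Suc k) \<Longrightarrow> X (k + j) t = X k t"
proof (induction j)
  case (Suc j)
  have "T (Suc k) \<le> T (Suc (k + j))" using strict_mono_T by (simp add: strict_mono_less_eq)
  then have "X (Suc (k + j)) t = X (k + j) t"
    using Suc.prems X_eq[of "Suc (k + j)" t] X_eq[of "k + j" t] by (auto simp: Xp_Suc)
  then show ?case using Suc by simp
qed simp

definition zz where "zz l = (if even l then Z (l div 2) else Z1 (l div 2))"
definition yy where "yy l = (if even l then y1 (l div 2) else y2 (l div 2))"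
definition ww where "ww l = glb \<phi> (pfst (zz l)) (gx (zz l)) (yy l)"

lemma zz_R: "(zz l, ww l, zz (Suc l)) \<in> R"
proof (cases "even l")
  case True
  then show ?thesis using gz[OF invariant(1,9)[of "l div 2"]]
    by (simp add: zz_def ww_def yy_def Z1_eq)
next
  case False
  then show ?thesis using gz[OF invariant(10,12)[of "l div 2"]]
    by (simp add: zz_def ww_def yy_def Z_Suc)
qed

lemma zz_odd: "pfst (pfst (zz l)) = 1 \<longleftrightarrow> odd l"
  using invariant(2,11)[of "l div 2"] by (auto simp: zz_def)

lemma ww_even: "ww (2 * k) = enc3 (pt \<phi> (set_decode (a k + psnd (y1 k)))) (pfst (y1 k)) (pfst (gx (Z k)))"
  using zz_odd[of "2 * k"] by (simp add: ww_def glb_def yy_def zz_def a_def)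

lemma ww_odd: "ww (2 * k + 1) = enc3 (op \<phi> (set_decode (b k + psnd (y2 k)))) 0
    (of_bool (b k \<noteq> (if k = 0 then 0 else b (k - 1))))"
  using zz_odd[of "2 * k + 1"] invariant(11)[of k] by (simp add: ww_def glb_def yy_def zz_def b_def)

lemma losing: "\<exists>p s e. linked_fact (gmul \<phi>) ww p s e \<and> \<not> gacc \<phi> s e"
proof -
  interpret fin_semigroup "gmul \<phi>" "gS \<phi>" by (rule fin_semigroup_gmul)
  have "ww l \<in> gS \<phi>" for l
  proof (cases "even l")
    case True
    then obtain k where "l = 2 * k" by (elim evenE)
    then show ?thesis using ww_even[of k] pt_car invariant(9)[of k] gx[OF invariant(1)[of k]]
      by (auto simp: gS_iff gLY_def gLX_def)
  next
    case False
    then obtain k where "l = 2 * k + 1" by (elim oddE)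
    then show ?thesis using ww_odd[of k] op_car by (auto simp: gS_iff)
  qed
  then show ?thesis using cert_ok_path[of 0 R "\<lambda>s e. \<not> gacc \<phi> s e" zz ww, OF ok _ _ zz_R]
    by (simp add: zz_def Z_0)
qed

text \<open>Checkpoints are announced at integer times only, and two different integers are at least
  1 apart, which is too much near a supremum.\<close>

lemma checkpoints_unbounded:
  assumes "\<exists>\<^sub>\<infinity>l. pfst (psnd (ww l)) \<noteq> 0" shows "\<not> bdd_above (range T)"
proof
  assume "bdd_above (range T)"
  from bounded_strict_mono_constant[OF locally_fv_const[of "()"] _ strict_mono_T this]
  obtain N where N: "\<forall>k\<ge>N. T k < Sup (range T) \<and> Sup (range T) < T k + 1" using T_0 by auto
  have ex: "\<exists>k\<ge>K. T k \<in> \<int>" for K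
  proof -
    obtain l where l: "l \<ge> 2 * K" "pfst (psnd (ww l)) \<noteq> 0" using assms unfolding INFM_nat_le by blast
    have "even l"
    proof (rule ccontr)
      assume "odd l"
      then obtain k where "l = 2 * k + 1" by (elim oddE)
      then show False using l ww_odd[of k] by simp
    qed
    then obtain k where k: "l = 2 * k" by (elim evenE)
    then have "pfst (y1 k) \<noteq> 0" using l ww_even[of k] by simp
    then have "T k \<in> \<int>" by (auto simp: y1_eq split: if_splits)
    then show ?thesis using l k by (intro exI[of _ k]) auto
  qed
  obtain k where k: "k \<ge> N" "T k \<in> \<int>" using ex by blast
  obtain k' where k': "k' \<ge> Suc k" "T k' \<in> \<int>" using ex by blast
  obtain i i' where i: "T k = of_int i" "T k' = of_int i'" using k k' by (auto elim!: Ints_cases)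
  have "T k < T k'" using k' strict_mono_T by (simp add: strict_mono_less)
  then have "i < i'" using i by simp
  then have "real_of_int i + 1 \<le> real_of_int i'" by linarith
  then have "T k + 1 \<le> T k'" using i by simp
  moreover have "T k' < Sup (range T)" "Sup (range T) < T k + 1" using N k k' by auto
  ultimately show False by simp
qed

text \<open>Otherwise the input is one fixed signal from some round on, and all later points are
  changes of the output of \<open>F\<close> on it that accumulate at or below an integer. This
  contradicts the finite variability of that output.\<close>

lemma flags_infinite: "(\<exists>\<^sub>\<infinity>l. pfst (psnd (ww l)) \<noteq> 0) \<or> (\<exists>\<^sub>\<infinity>l. psnd (psnd (ww l)) \<noteq> 0)"
proof (rule ccontr)
  assume neg: "\<not> ?thesis"
  then obtain N1 N2 where N1: "\<And>l. l \<ge> N1 \<Longrightarrow> pfst (psnd (ww l)) = 0" and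
    N2: "\<And>l. l \<ge> N2 \<Longrightarrow> psnd (psnd (ww l)) = 0" unfolding INFM_nat_le by blast
  define N where "N = Suc (N1 + N2)"
  have c: "pfst (y1 k) = 0" and pass: "pfst (gx (Z k)) = 0" if "k \<ge> N" for k
    using N1[of "2 * k"] N2[of "2 * k"] ww_even[of k] that by (simp_all add: N_def)
  have bb: "b k = b (k - 1)" if "k \<ge> N" for k
    using N2[of "2 * k + 1"] ww_odd[of k] that by (auto simp: N_def split: if_splits)
  have X_eq_N: "X (N + j) = X N" for j
  proof (induction j)
    case (Suc j)
    let ?k = "N + j"
    have "gx (Z (Suc ?k)) \<in> gLX m (pfst (Z (Suc ?k)))" by (rule gx[OF invariant(1)])
    then have "a (Suc ?k) = b ?k"
      using pass[of "Suc ?k"] invariant(2,3)[of "Suc ?k"] by (simp add: gLX_def a_def)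
    moreover have "b (Suc ?k) = b ?k" using bb[of "Suc ?k"] by simp
    ultimately have "X (Suc ?k) t = X ?k t" for t
      using T_step(1)[of ?k] X_eq[of "Suc ?k" t] X_eq[of ?k t] by (auto simp: Xp_Suc)
    then have "X (Suc ?k) = X ?k" by blast
    then show ?case using Suc by simp
  qed simp
  have XN: "X k = X N" if "k \<ge> N" for k using X_eq_N[of "k - N"] that by simp
  have TS: "T (Suc k) = \<nu> (T k) (X N) \<and> T (Suc k) \<notin> \<int>" if k: "k \<ge> N" for k
  proof -
    have "T (Suc k) = \<nu> (T k) (X N)" using T_Suc[of k] invariant(2)[of "Suc k"] pass[of "Suc k"] XN[OF k] k by simp
    moreover have "T (Suc k) \<notin> \<int>" using c[of "Suc k"] pass[of "Suc k"] k by (auto simp: y1_eq split: if_splits)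
    ultimately show ?thesis by blast
  qed
  note nu = \<nu>[OF invariant(8)[of N] invariant(5)]
  let ?b = "of_int (\<lfloor>T N\<rfloor> + 1) :: real"
  have fl: "\<lfloor>T (N + j)\<rfloor> = \<lfloor>T N\<rfloor>" for j
  proof (induction j)
    case (Suc j)
    have t: "T (Suc (N + j)) = \<nu> (T (N + j)) (X N)" "T (Suc (N + j)) \<notin> \<int>" using TS[of "N + j"] by auto
    have "T (Suc (N + j)) \<le> ?b" using nu(2)[of "N + j"] t(1) Suc by simp
    moreover have "T (Suc (N + j)) \<noteq> ?b" using t(2) Ints_of_int by metis
    ultimately have "T (Suc (N + j)) < ?b" by simp
    moreover have "of_int \<lfloor>T N\<rfloor> \<le> T (Suc (N + j))" using Suc T_step(1)[of "N + j"] by linarith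
    ultimately show ?case by (simp add: floor_eq_iff)
  qed simp
  have Tb: "T k \<le> ?b" for k
  proof -
    have "T k \<le> T (N + k)" using strict_mono_T by (simp add: strict_mono_less_eq)
    also have "\<dots> \<le> of_int (\<lfloor>T (N + k)\<rfloor> + 1)" by linarith
    finally show ?thesis using fl[of k] by simp
  qed
  have bdd: "bdd_above (range T)" by (rule bdd_aboveI[of _ ?b]) (use Tb in auto)
  have lf: "locally_fv (F (X N))" by (rule F_lfv[OF invariant(8)])
  obtain M where M: "\<And>k. k \<ge> M \<Longrightarrow> F (X N) constant_on {T k<..<Sup (range T)} \<and> T k < Sup (range T)"
    using bounded_strict_mono_constant[OF lf _ strict_mono_T bdd] T_0 by force
  let ?k = "N + M"
  have "\<nu> (T ?k) (X N) < Sup (range T)" using TS[of ?k] M[of "Suc ?k"] by simp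
  moreover have "Sup (range T) \<le> of_int (\<lfloor>T ?k\<rfloor> + 1)"
    unfolding fl by (rule cSup_least) (use Tb in auto)
  ultimately show False using nu(4)[of ?k "Sup (range T)"] M[of ?k] by simp
qed

text \<open>The limit of the approximations: \<open>X k\<close> is final before the point
  \<open>T (Suc k)\<close>.\<close>

definition Xo :: "real \<Rightarrow> nat" where
  "Xo = (\<lambda>t\<in>{0..}. X (LEAST k. t < T (Suc k)) t)"

lemma Xo_eq:
  assumes "0 \<le> t" "t < T (Suc k)" shows "Xo t = X k t"
proof -
  define l where "l = (LEAST k. t < T (Suc k))"
  have l: "t < T (Suc l)" unfolding l_def by (rule LeastI) (rule assms)
  have "l \<le> k" unfolding l_def by (rule Least_le) (rule assms)
  then show ?thesis using X_stable[OF l, of "k - l"] assms(1) by (simp add: Xo_def l_def)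
qed

text \<open>In a play lost by the output the checkpoints recur: otherwise, by
  \<open>flags_infinite\<close>, the interrupts would recur and the output would have won. So time
  diverges, the approximations converge to an input signal, and on it the formula fails.\<close>

theorem contradiction: False
proof -
  obtain p s e where lf: "linked_fact (gmul \<phi>) ww p s e" and nacc: "\<not> gacc \<phi> s e" using losing by blast
  have c: "pfst (psnd e) \<noteq> 0"
  proof (rule ccontr)
    assume 0: "\<not> ?thesis"
    then have "psnd (psnd e) = 0" using nacc by (simp add: gacc_def)
    then show False using 0 linked_fact_gmul(2,3)[OF lf] flags_infinite by blast
  qed
  then have un: "\<not> bdd_above (range T)" using linked_fact_gmul(2)[OF lf] checkpoints_unbounded by blast
  have piece: "\<exists>k. t < T (Suc k)" for t
  proof -
    obtain k where "t < T k" using unbounded_range_ex[OF un] by blast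
    then show ?thesis using T_step(1)[of k] less_trans by blast
  qed
  have Xos: "Xo \<in> signals (XS m)"
    unfolding signals_iff
  proof
    show "Xo \<in> {0..} \<rightarrow>\<^sub>E XS m"
    proof (rule PiE_I)
      fix t :: real assume t: "t \<in> {0..}"
      obtain k where "t < T (Suc k)" using piece by blast
      then have "Xo t = X k t" using Xo_eq t by simp
      then show "Xo t \<in> XS m" using invariant(8)[of k] t by (auto simp: signals_iff)
    qed (simp add: Xo_def)
    show "locally_fv Xo"
    proof (rule locally_fvI)
      fix t
      obtain k where "t < T (Suc k)" using piece by blast
      then show "\<exists>g. locally_fv g \<and> (\<forall>s\<in>{0..t}. Xo s = g s)"
        using invariant(8)[of k] Xo_eq[of _ k] by (intro exI[of _ "X k"]) (auto simp: signals_iff)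
    qed
  qed
  have XT: "Xo (T k) = a k" for k
    using Xo_eq[of "T k" k] invariant(5)[of k] T_step(1)[of k] by (simp add: X_eq)
  have Xopen: "Xo t = b k" if "T k < t" "t < T (Suc k)" for k t
    using Xo_eq[of t k] invariant(5)[of k] that by (simp add: X_eq)
  have FT: "F Xo (T k) = psnd (y1 k)" for k
  proof -
    have "F Xo (T k) = F (Xa (st k)) (T k)"
    proof (rule F_causal[OF Xos invariant(7,5)])
      fix s assume s: "0 \<le> s" "s \<le> T k"
      then have "Xo s = X k s" using Xo_eq[of s k] T_step(1)[of k] by simp
      then show "Xo s = Xa (st k) s" using s by (simp add: X_eq Xa_eq)
    qed
    then show ?thesis by (simp add: y1_eq)
  qed
  have Fopen: "F Xo t = psnd (y2 k)" if t: "T k < t" "t < T (Suc k)" for k t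
  proof -
    have "F Xo t = F (X k) t"
    proof (rule F_causal[OF Xos invariant(8)])
      show "0 \<le> t" using t invariant(5)[of k] by simp
      fix s assume s: "0 \<le> s" "s \<le> t"
      then show "Xo s = X k s" using Xo_eq[of s k] t by simp
    qed
    also have "\<dots> = rlim (F (X k)) (T k)"
      by (rule rlim[OF F_lfv[OF invariant(8)] invariant(5) \<nu>(3)[OF invariant(8) invariant(5)] t(1)])
        (use t T_step(2)[of k] in simp)
    finally show ?thesis by (simp add: y2_eq)
  qed
  have "satc \<phi> (Mof (\<lambda>t. Xo t + F Xo t)) \<longleftrightarrow> acc \<phi> (pfst s) (pfst e)"
  proof (rule satc_play[OF T_0 strict_mono_T un, of "\<lambda>l. pfst (zz l)" _ "\<lambda>l. gx (zz l)" yy])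
    show "pfst (pfst (zz l)) = 1 \<longleftrightarrow> odd l" for l by (rule zz_odd)
    show "Xo (T k) + F Xo (T k) = psnd (gx (zz (2 * k))) + psnd (yy (2 * k))" for k
      using XT FT by (simp add: zz_def yy_def a_def)
    show "Xo t + F Xo t = psnd (gx (zz (2 * k + 1))) + psnd (yy (2 * k + 1))"
      if "T k < t" "t < T (Suc k)" for k t
      using Xopen[OF that] Fopen[OF that] by (simp add: zz_def yy_def b_def)
    show "linked_fact (gmul \<phi>) (\<lambda>l. glb \<phi> (pfst (zz l)) (gx (zz l)) (yy l)) p s e"
      using lf unfolding ww_def[abs_def] .
  qed
  then show False using correct[OF Xos] nacc c by (simp add: gacc_def)
qed

end

theorem Xcert_imp_no_operator:
  assumes "Xcert (gmul \<phi>) (gLX m) (gLY m n) gdl (glb \<phi>) 0 (gacc \<phi>) R"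
    "C_operator (XS m) (YS m n) F" "\<And>X. X \<in> signals (XS m) \<Longrightarrow> satc \<phi> (Mof (\<lambda>t. X t + F X t))"
  shows False
proof -
  have ok: "cert_ok (gmul \<phi>) 0 R (\<lambda>s e. \<not> gacc \<phi> s e)" using assms(1) by (simp add: Xcert_def)
  have "\<forall>z. \<exists>x. z \<in> cert_states 0 R \<longrightarrow> x \<in> gLX m (pfst z) \<and> (\<forall>y\<in>gLY m n (pfst z) x. \<exists>z'.
     pfst z' = gdl (pfst z) x y \<and> (z, glb \<phi> (pfst z) x y, z') \<in> R)"
    using assms(1) unfolding Xcert_def by blast
  then obtain gx where gx: "\<And>z. z \<in> cert_states 0 R \<Longrightarrow> gx z \<in> gLX m (pfst z)" and
    ex: "\<And>z. z \<in> cert_states 0 R \<Longrightarrow> \<forall>y\<in>gLY m n (pfst z) (gx z). \<exists>z'.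
     pfst z' = gdl (pfst z) (gx z) y \<and> (z, glb \<phi> (pfst z) (gx z) y, z') \<in> R"
    by metis
  have "\<forall>z y. \<exists>z'. z \<in> cert_states 0 R \<longrightarrow> y \<in> gLY m n (pfst z) (gx z) \<longrightarrow>
     pfst z' = gdl (pfst z) (gx z) y \<and> (z, glb \<phi> (pfst z) (gx z) y, z') \<in> R"
    using ex by blast
  then obtain gz where gz: "\<And>z y. z \<in> cert_states 0 R \<Longrightarrow> y \<in> gLY m n (pfst z) (gx z) \<Longrightarrow>
     pfst (gz z y) = gdl (pfst z) (gx z) y \<and> (z, glb \<phi> (pfst z) (gx z) y, gz z y) \<in> R"
    by metis
  interpret x_machine m n \<phi> R gx gz F
    by unfold_locales (use ok gx gz assms in auto)
  show False by (rule contradiction)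
qed

section \<open>Computing types\<close>

lemma computable_max [computable_intros]:
  "computable f \<Longrightarrow> computable g \<Longrightarrow> computable (\<lambda>x. max (f x) (g x))"
  unfolding max_def by (intro computable_intros)

lemma computable_min [computable_intros]:
  "computable f \<Longrightarrow> computable g \<Longrightarrow> computable (\<lambda>x. min (f x) (g x))"
  unfolding min_def by (intro computable_intros)

lemma computable_enc3 [computable_intros]:
  "computable f \<Longrightarrow> computable g \<Longrightarrow> computable h \<Longrightarrow> computable (\<lambda>x. enc3 (f x) (g x) (h x))"
  unfolding enc3_def by (intro computable_intros)

lemma prod_encode_mono: "a \<le> c \<Longrightarrow> b \<le> d \<Longrightarrow> prod_encode (a, b) \<le> prod_encode (c, d)"
  using triangle_mono[of "a + b" "c + d"] by (simp add: prod_encode_def)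

lemma pfst_le: "pfst x \<le> x" and psnd_le: "psnd x \<le> x"
  using prod_encode_ge[of "pfst x" "psnd x"] by simp_all

lemma union_code_cong: "(\<And>a. a \<in> set_decode x \<Longrightarrow> g a = h a) \<Longrightarrow> union_code g x = union_code h x"
  by (simp add: union_code_def)

lemma image_code_cong: "(\<And>a. a \<in> set_decode x \<Longrightarrow> g a = h a) \<Longrightarrow> image_code g x = image_code h x"
  by (simp add: image_code_def)

text \<open>The code of a quantifier also contains \<open>2 ^ i\<close>, so that adding the variable \<open>i\<close> to a letter
  while passing to the body decreases the code of the pair: this makes the recursions below
  instances of course-of-values recursion.\<close>

fun cenc :: "core \<Rightarrow> nat" where
  "cenc (Lt i j) = prod_encode (0, prod_encode (i, j))"
| "cenc (Inn i j) = prod_encode (1, prod_encode (i, j))"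
| "cenc (Nand \<phi> \<psi>) = prod_encode (2, prod_encode (cenc \<phi>, cenc \<psi>))"
| "cenc (Exq b i \<phi>) = prod_encode (3 + of_bool b, prod_encode (i, prod_encode (2 ^ i, cenc \<phi>)))"

lemma cenc_less:
  "cenc \<phi> < cenc (Nand \<phi> \<psi>)" "cenc \<psi> < cenc (Nand \<phi> \<psi>)" "cenc \<phi> + 2 ^ i < cenc (Exq b i \<phi>)"
  using prod_encode_ge[of "cenc \<phi>" "cenc \<psi>"] prod_encode_ge[of 2 "prod_encode (cenc \<phi>, cenc \<psi>)"]
    prod_encode_ge[of "3 + of_bool b" "prod_encode (i, prod_encode (2 ^ i, cenc \<phi>))"]
    prod_encode_ge[of i "prod_encode (2 ^ i, cenc \<phi>)"] prod_encode_ge[of "2 ^ i" "cenc \<phi>"]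
  by auto

lemma cenc_less': "cenc \<phi> < cenc (Exq b i \<phi>)"
  using cenc_less(3)[of \<phi> i b] by linarith

text \<open>One step of course-of-values recursion: \<open>z\<close> packs the code of a formula
  with the two factors, and the values for subformulas are looked up in the table \<open>T\<close>.
  The tags 0, 1 and 2 are those of \<open>Lt\<close>, \<open>Inn\<close> and
  \<open>Nand\<close>.\<close>

definition mulH :: "nat \<Rightarrow> nat \<Rightarrow> nat" where
  "mulH z T = (
     if pfst (pfst z) = 0 then
       enc3 (max (pfst (pfst (psnd z))) (pfst (psnd (psnd z))))
         (max (pfst (psnd (pfst (psnd z)))) (pfst (psnd (psnd (psnd z)))))
         (max (psnd (psnd (pfst (psnd z)))) (max (psnd (psnd (psnd (psnd z))))
           (min (pfst (pfst (psnd z))) (pfst (psnd (psnd (psnd z)))))))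
     else if pfst (pfst z) = 1 then max (pfst (psnd z)) (psnd (psnd z))
     else if pfst (pfst z) = 2 then
       prod_encode (look T (prod_encode (pfst (psnd (pfst z)), prod_encode (pfst (pfst (psnd z)), pfst (psnd (psnd z))))),
         look T (prod_encode (psnd (psnd (pfst z)), prod_encode (psnd (pfst (psnd z)), psnd (psnd (psnd z))))))
     else union_code (\<lambda>a. image_code (\<lambda>c. prod_encode (min 2 (pfst a + pfst c),
         look T (prod_encode (psnd (psnd (psnd (pfst z))), prod_encode (psnd a, psnd c))))) (psnd (psnd z))) (pfst (psnd z)))"

definition mulN :: "nat \<Rightarrow> nat \<Rightarrow> nat \<Rightarrow> nat" where
  "mulN p x y = cov_rec mulH (prod_encode (p, prod_encode (x, y)))"

lemma computable_mulH: "computable (\<lambda>z. mulH (pfst z) (psnd z))"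
  unfolding mulH_def by (intro computable_intros)

lemma computable_mulN [computable_intros]:
  "computable f \<Longrightarrow> computable g \<Longrightarrow> computable h \<Longrightarrow> computable (\<lambda>x. mulN (f x) (g x) (h x))"
  unfolding mulN_def by (intro computable_comp[OF computable_cov_rec[OF computable_mulH]] computable_intros)

lemma mulN_cenc: "mulN (cenc \<phi>) x y = mul \<phi> x y"
proof (induction \<phi> arbitrary: x y)
  case (Lt i j)
  show ?case by (simp add: mulN_def cov_rec_def mulH_def)
next
  case (Inn i j)
  show ?case by (simp add: mulN_def cov_rec_def mulH_def)
next
  case (Nand \<phi> \<psi>)
  have le: "prod_encode (pfst x, pfst y) \<le> prod_encode (x, y)" "prod_encode (psnd x, psnd y) \<le> prod_encode (x, y)"
    by (intro prod_encode_mono pfst_le psnd_le)+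
  have "prod_encode (cenc \<phi>, prod_encode (pfst x, pfst y)) < prod_encode (cenc (Nand \<phi> \<psi>), prod_encode (x, y))"
    "prod_encode (cenc \<psi>, prod_encode (psnd x, psnd y)) < prod_encode (cenc (Nand \<phi> \<psi>), prod_encode (x, y))"
    by (intro prod_encode_less add_less_le_mono cenc_less le)+
  note * = this[THEN look_cov_table[of _ _ mulH], folded mulN_def, unfolded Nand.IH]
  show ?case unfolding mulN_def cov_rec_def
    by (subst mulH_def) (use * in simp)
next
  case (Exq b i \<phi>)
  let ?z = "prod_encode (cenc (Exq b i \<phi>), prod_encode (x, y))"
  have *: "look (cov_table mulH ?z) (prod_encode (cenc \<phi>, prod_encode (psnd a, psnd c))) = mul \<phi> (psnd a) (psnd c)"
    if "a \<in> set_decode x" "c \<in> set_decode y" for a c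
  proof -
    have "psnd a \<le> x" "psnd c \<le> y"
      using set_decode_less[OF that(1)] set_decode_less[OF that(2)] psnd_le[of a] psnd_le[of c] by auto
    then have "prod_encode (cenc \<phi>, prod_encode (psnd a, psnd c)) < ?z"
      by (intro prod_encode_less add_less_le_mono cenc_less' prod_encode_mono)
    from look_cov_table[OF this, of mulH, folded mulN_def, unfolded Exq.IH] show ?thesis .
  qed
  have "mulN (cenc (Exq b i \<phi>)) x y = union_code (\<lambda>a. image_code (\<lambda>c. prod_encode (min 2 (pfst a + pfst c),
         look (cov_table mulH ?z) (prod_encode (cenc \<phi>, prod_encode (psnd a, psnd c))))) y) x"
    unfolding mulN_def cov_rec_def by (subst mulH_def) simp
  also have "\<dots> = mul (Exq b i \<phi>) x y"
    unfolding mul.simps qm_def by (intro union_code_cong image_code_cong) (simp only: *)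
  finally show ?case .
qed

definition del :: "nat \<Rightarrow> nat \<Rightarrow> nat" where
  "del i a = (if i \<in> set_decode a then a - 2 ^ i else a)"

lemma set_decode_del [simp]: "set_decode (del i a) = set_decode a - {i}"
proof (cases "i \<in> set_decode a")
  case True
  then have "set_encode (set_decode a) = 2 ^ i + set_encode (set_decode a - {i})"
    using set_encode_insert[of "set_decode a - {i}" i] by (simp add: insert_absorb)
  then have "set_encode (set_decode a - {i}) = a - 2 ^ i" by simp
  then show ?thesis using True by (metis del_def finite_Diff finite_set_decode set_encode_inverse)
qed (simp add: del_def)

lemma computable_del [computable_intros]:
  "computable f \<Longrightarrow> computable g \<Longrightarrow> computable (\<lambda>x. del (f x) (g x))"
  unfolding del_def by (intro computable_intros)

lemma ins_le: "ins i a \<le> a + 2 ^ i" and del_le: "del i a \<le> a"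
  by (auto simp: ins_def del_def)

lemma letter_less:
  "prod_encode (cenc \<phi>, ins i a) < prod_encode (cenc (Exq b i \<phi>), a)"
  "prod_encode (cenc \<phi>, del i a) < prod_encode (cenc (Exq b i \<phi>), a)"
  "prod_encode (cenc \<phi>, a) < prod_encode (cenc (Nand \<phi> \<psi>), a)"
  "prod_encode (cenc \<psi>, a) < prod_encode (cenc (Nand \<phi> \<psi>), a)"
  using cenc_less(3)[of \<phi> i b] cenc_less(1,2)[where \<phi> = \<phi> and \<psi> = \<psi>] ins_le[of i a] del_le[of i a]
  by (intro prod_encode_less; linarith)+

definition ptH :: "nat \<Rightarrow> nat \<Rightarrow> nat" where
  "ptH z T = (
     if pfst (pfst z) = 0 then enc3 (of_bool (pfst (psnd (pfst z)) \<in> set_decode (psnd z)))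
       (of_bool (psnd (psnd (pfst z)) \<in> set_decode (psnd z))) 0
     else if pfst (pfst z) = 1 then
       of_bool (pfst (psnd (pfst z)) \<in> set_decode (psnd z) \<and> psnd (psnd (pfst z)) \<in> set_decode (psnd z))
     else if pfst (pfst z) = 2 then
       prod_encode (look T (prod_encode (pfst (psnd (pfst z)), psnd z)), look T (prod_encode (psnd (psnd (pfst z)), psnd z)))
     else ins (prod_encode (0, look T (prod_encode (psnd (psnd (psnd (pfst z))), del (pfst (psnd (pfst z))) (psnd z)))))
       (ins (prod_encode (1, look T (prod_encode (psnd (psnd (psnd (pfst z))), ins (pfst (psnd (pfst z))) (psnd z))))) 0))"

definition ptN :: "nat \<Rightarrow> nat \<Rightarrow> nat" where
  "ptN p a = cov_rec ptH (prod_encode (p, a))"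

lemma computable_ptN [computable_intros]:
  assumes "computable f" "computable g" shows "computable (\<lambda>x. ptN (f x) (g x))"
proof -
  have "computable (\<lambda>z. ptH (pfst z) (psnd z))" unfolding ptH_def by (intro computable_intros)
  then show ?thesis unfolding ptN_def by (intro computable_comp[OF computable_cov_rec] computable_intros assms)
qed

lemma ptN_cenc: "ptN (cenc \<phi>) a = pt \<phi> (set_decode a)"
proof (induction \<phi> arbitrary: a)
  case (Nand \<phi> \<psi>)
  note * = letter_less(3)[of \<phi> a \<psi>, THEN look_cov_table[of _ _ ptH], folded ptN_def, unfolded Nand.IH]
    letter_less(4)[of \<psi> a \<phi>, THEN look_cov_table[of _ _ ptH], folded ptN_def, unfolded Nand.IH]
  show ?case unfolding ptN_def cov_rec_def
    by (subst ptH_def) (use * in simp)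
next
  case (Exq b i \<phi>)
  note * = letter_less(1)[of \<phi> i a b, THEN look_cov_table[of _ _ ptH], folded ptN_def, unfolded Exq.IH]
    letter_less(2)[of \<phi> i a b, THEN look_cov_table[of _ _ ptH], folded ptN_def, unfolded Exq.IH]
  have eq: "ptN (cenc (Exq b i \<phi>)) a = ins (prod_encode (0, pt \<phi> (set_decode a - {i})))
      (ins (prod_encode (1, pt \<phi> (insert i (set_decode a)))) 0)"
    unfolding ptN_def cov_rec_def by (subst ptH_def) (use * in simp)
  show ?case
  proof (rule set_decode_inject)
    show "set_decode (ptN (cenc (Exq b i \<phi>)) a) = set_decode (pt (Exq b i \<phi>) (set_decode a))"
      unfolding eq set_decode_pt_Exq by simp
  qed
qed (simp_all add: ptN_def cov_rec_def ptH_def)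

text \<open>A bound for the number of types, following the clauses of \<open>car\<close>: 8 triples
  of bits, 2 bits, products, and sets of pairs of a count up to 2 and a type. It serves as a number
  of rounds after which a closure is complete.\<close>

definition sizeH :: "nat \<Rightarrow> nat \<Rightarrow> nat" where
  "sizeH p T = (if pfst p = 0 then 8 else if pfst p = 1 then 2
     else if pfst p = 2 then look T (pfst (psnd p)) * look T (psnd (psnd p))
     else 2 ^ (3 * look T (psnd (psnd (psnd p)))))"

definition sizeN :: "nat \<Rightarrow> nat" where "sizeN = cov_rec sizeH"

lemma computable_sizeN [computable_intros]:
  assumes "computable f" shows "computable (\<lambda>x. sizeN (f x))"
proof -
  have "computable (\<lambda>z. sizeH (pfst z) (psnd z))" unfolding sizeH_def by (intro computable_intros)
  then show ?thesis unfolding sizeN_def by (intro computable_comp[OF computable_cov_rec] assms)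
qed

lemma card_qcar: "card (qcar \<phi>) \<le> 3 * card (car \<phi>)"
proof -
  have "card (qcar \<phi>) \<le> card ({..2 :: nat} \<times> car \<phi>)"
    unfolding qcar_def by (rule card_image_le) (simp add: finite_car)
  then show ?thesis by (simp add: card_cartesian_product)
qed

lemma card_car_le: "card (car \<phi>) \<le> sizeN (cenc \<phi>)"
proof (induction \<phi>)
  case (Lt i j)
  have "card (car (Lt i j)) \<le> card ({..1 :: nat} \<times> {..1 :: nat} \<times> {..1 :: nat})"
    unfolding car.simps by (rule card_image_le) simp
  then show ?case by (simp add: card_cartesian_product sizeN_def cov_rec_def sizeH_def)
next
  case (Inn i j)
  show ?case by (simp add: sizeN_def cov_rec_def sizeH_def)
next
  case (Nand \<phi> \<psi>)
  have "card (car (Nand \<phi> \<psi>)) \<le> card (car \<phi> \<times> car \<psi>)"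
    unfolding car.simps by (rule card_image_le) (simp add: finite_car)
  also have "\<dots> \<le> sizeN (cenc \<phi>) * sizeN (cenc \<psi>)"
    unfolding card_cartesian_product using Nand.IH by (rule mult_le_mono)
  also have "\<dots> = sizeN (cenc (Nand \<phi> \<psi>))"
    using look_cov_table[OF cenc_less(1)[where \<phi> = \<phi> and \<psi> = \<psi>], of sizeH]
      look_cov_table[OF cenc_less(2)[where \<phi> = \<phi> and \<psi> = \<psi>], of sizeH]
    unfolding sizeN_def cov_rec_def[of _ "cenc (Nand \<phi> \<psi>)"] by (subst sizeH_def) simp
  finally show ?case .
next
  case (Exq b i \<phi>)
  have "card (car (Exq b i \<phi>)) \<le> card (Pow (qcar \<phi>))"
    unfolding car.simps qcar_def by (rule card_image_le) (simp add: finite_car)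
  also have "\<dots> = 2 ^ card (qcar \<phi>)" by (simp add: card_Pow finite_qcar)
  also have "\<dots> \<le> 2 ^ (3 * sizeN (cenc \<phi>))"
    using card_qcar[of \<phi>] Exq.IH by (intro power_increasing) auto
  also have "\<dots> = sizeN (cenc (Exq b i \<phi>))"
    using look_cov_table[OF cenc_less'[where \<phi> = \<phi> and b = b and i = i], of sizeH]
    unfolding sizeN_def cov_rec_def[of _ "cenc (Exq b i \<phi>)"] by (subst sizeH_def) simp
  finally show ?case .
qed

text \<open>Until the first repetition each round adds an element, and by \<open>det\<close> the
  chain is constant from then on.\<close>

lemma iterate_stabilizes:
  assumes sub: "\<And>k. C k \<subseteq> U" "\<And>k. C k \<subseteq> C (Suc k)" and fin: "finite U" "card U \<le> K"
    and det: "\<And>j k. C j = C k \<Longrightarrow> C (Suc j) = C (Suc k)"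
  shows "C (Suc K) = C K"
proof (rule ccontr)
  assume neq: "C (Suc K) \<noteq> C K"
  have ne: "C (Suc k) \<noteq> C k" if "k \<le> K" for k
  proof
    assume eq: "C (Suc k) = C k"
    have "C (Suc (k + j)) = C (k + j)" for j
    proof (induction j)
      case (Suc j)
      from det[OF this] show ?case by simp
    qed (use eq in simp)
    from this[of "K - k"] show False using neq that by simp
  qed
  have "k \<le> card (C k)" if "k \<le> Suc K" for k
    using that
  proof (induction k)
    case (Suc k)
    have "C k \<subset> C (Suc k)" using sub(2)[of k] ne[of k] Suc.prems by auto
    then have "card (C k) < card (C (Suc k))"
      using finite_subset[OF sub(1) fin(1)] by (intro psubset_card_mono)
    then show ?case using Suc by simp
  qed simp
  from this[of "Suc K"] card_mono[OF fin(1) sub(1)[of "Suc K"]] fin(2) show False by simp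
qed

definition qmN :: "nat \<Rightarrow> nat \<Rightarrow> nat \<Rightarrow> nat" where
  "qmN p a c = prod_encode (min 2 (pfst a + pfst c), mulN p (psnd a) (psnd c))"

lemma computable_qmN [computable_intros]:
  "computable f \<Longrightarrow> computable g \<Longrightarrow> computable h \<Longrightarrow> computable (\<lambda>x. qmN (f x) (g x) (h x))"
  unfolding qmN_def by (intro computable_intros)

text \<open>The closure lives in \<open>qcar\<close>, where the factor 3 accounts for the three
  possible counts; so many rounds reach the least fixed point.\<close>

definition closureN :: "nat \<Rightarrow> nat \<Rightarrow> nat \<Rightarrow> nat" where
  "closureN p u v = rec_nat u (\<lambda>_ r. un r (union_code (\<lambda>c. union_code (\<lambda>b. image_code (qmN p (qmN p c b)) u) v) r))
     (3 * sizeN p)"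

lemma computable_closureN [computable_intros]:
  assumes "computable f" "computable g" "computable h" shows "computable (\<lambda>x. closureN (f x) (g x) (h x))"
  unfolding closureN_def
  by (intro computable_intros assms computable_comp[OF assms(1)] computable_comp[OF assms(2)] computable_comp[OF assms(3)])

lemma closureN_cenc:
  assumes "set_decode u \<subseteq> qcar \<phi>" "set_decode v \<subseteq> qcar \<phi>"
  shows "set_decode (closureN (cenc \<phi>) u v) = op_closure (qm (mul \<phi>)) (set_decode u) (set_decode v)"
proof -
  let ?p = "cenc \<phi>" and ?m = "qm (mul \<phi>)"
  have qmN: "qmN ?p a c = ?m a c" for a c by (simp add: qmN_def qm_def mulN_cenc)
  define Fu where "Fu r = un r (union_code (\<lambda>c. union_code (\<lambda>b. image_code (qmN ?p (qmN ?p c b)) u) v) r)" for r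
  define C where "C k = set_decode (rec_nat u (\<lambda>_. Fu) k)" for k
  have CS: "C (Suc k) = C k \<union> {?m (?m c b) a | c b a. c \<in> C k \<and> b \<in> set_decode v \<and> a \<in> set_decode u}" for k
    by (auto simp: C_def Fu_def qmN image_iff)
  have C0: "C 0 = set_decode u" by (simp add: C_def)
  have sub: "C k \<subseteq> op_closure ?m (set_decode u) (set_decode v)" for k
    by (induction k) (auto simp: C0 CS intro: op_closure.intros)
  have "op_closure ?m (set_decode u) (set_decode v) \<subseteq> qcar \<phi>"
    by (rule op_closure_subset) (use assms qm_qcar in auto)
  then have subq: "C k \<subseteq> qcar \<phi>" for k using sub by blast
  have "card (qcar \<phi>) \<le> 3 * sizeN ?p" using card_qcar[of \<phi>] card_car_le[of \<phi>] by simp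
  then have stab: "C (Suc (3 * sizeN ?p)) = C (3 * sizeN ?p)"
    by (intro iterate_stabilizes[of C "qcar \<phi>"] subq finite_qcar) (auto simp: CS)
  have mono: "C 0 \<subseteq> C k" for k by (induction k) (auto simp: CS)
  have "x \<in> C (3 * sizeN ?p)" if "x \<in> op_closure ?m (set_decode u) (set_decode v)" for x
    using that
  proof induction
    case (base a)
    then show ?case using mono C0 by blast
  next
    case (step c b a)
    then have "?m (?m c b) a \<in> C (Suc (3 * sizeN ?p))" unfolding CS by blast
    then show ?case using stab by simp
  qed
  moreover have "closureN ?p u v = rec_nat u (\<lambda>_. Fu) (3 * sizeN ?p)" by (simp add: closureN_def Fu_def[abs_def])
  ultimately show ?thesis using sub[of "3 * sizeN ?p"] by (auto simp: C_def)
qed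

definition opH :: "nat \<Rightarrow> nat \<Rightarrow> nat" where
  "opH z T = (
     if pfst (pfst z) = 0 then enc3 (of_bool (pfst (psnd (pfst z)) \<in> set_decode (psnd z)))
       (of_bool (psnd (psnd (pfst z)) \<in> set_decode (psnd z)))
       (of_bool (pfst (psnd (pfst z)) \<in> set_decode (psnd z) \<and> psnd (psnd (pfst z)) \<in> set_decode (psnd z)))
     else if pfst (pfst z) = 1 then
       of_bool (pfst (psnd (pfst z)) \<in> set_decode (psnd z) \<and> psnd (psnd (pfst z)) \<in> set_decode (psnd z))
     else if pfst (pfst z) = 2 then
       prod_encode (look T (prod_encode (pfst (psnd (pfst z)), psnd z)), look T (prod_encode (psnd (psnd (pfst z)), psnd z)))
     else closureN (psnd (psnd (psnd (pfst z))))
       (ins (prod_encode (0, look T (prod_encode (psnd (psnd (psnd (pfst z))), del (pfst (psnd (pfst z))) (psnd z)))))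
         (ins (prod_encode (2, look T (prod_encode (psnd (psnd (psnd (pfst z))), ins (pfst (psnd (pfst z))) (psnd z))))) 0))
       (ins (prod_encode (0, ptN (psnd (psnd (psnd (pfst z)))) (del (pfst (psnd (pfst z))) (psnd z))))
         (ins (prod_encode (1, ptN (psnd (psnd (psnd (pfst z)))) (ins (pfst (psnd (pfst z))) (psnd z)))) 0)))"

definition opN :: "nat \<Rightarrow> nat \<Rightarrow> nat" where
  "opN p a = cov_rec opH (prod_encode (p, a))"

lemma computable_opN [computable_intros]:
  assumes "computable f" "computable g" shows "computable (\<lambda>x. opN (f x) (g x))"
proof -
  have "computable (\<lambda>z. opH (pfst z) (psnd z))" unfolding opH_def by (intro computable_intros)
  then show ?thesis unfolding opN_def by (intro computable_comp[OF computable_cov_rec] computable_intros assms)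
qed

lemma opN_cenc: "opN (cenc \<phi>) a = op \<phi> (set_decode a)"
proof (induction \<phi> arbitrary: a)
  case (Nand \<phi> \<psi>)
  note * = letter_less(3)[of \<phi> a \<psi>, THEN look_cov_table[of _ _ opH], folded opN_def, unfolded Nand.IH]
    letter_less(4)[of \<psi> a \<phi>, THEN look_cov_table[of _ _ opH], folded opN_def, unfolded Nand.IH]
  show ?case unfolding opN_def cov_rec_def
    by (subst opH_def) (use * in simp)
next
  case (Exq b i \<phi>)
  note * = letter_less(1)[of \<phi> i a b, THEN look_cov_table[of _ _ opH], folded opN_def, unfolded Exq.IH]
    letter_less(2)[of \<phi> i a b, THEN look_cov_table[of _ _ opH], folded opN_def, unfolded Exq.IH]
  have eq: "opN (cenc (Exq b i \<phi>)) a = closureN (cenc \<phi>)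
    (ins (prod_encode (0, op \<phi> (set_decode a - {i}))) (ins (prod_encode (2, op \<phi> (insert i (set_decode a)))) 0))
    (ins (prod_encode (0, pt \<phi> (set_decode a - {i}))) (ins (prod_encode (1, pt \<phi> (insert i (set_decode a)))) 0))"
    unfolding opN_def cov_rec_def by (subst opH_def) (use * in \<open>simp add: ptN_cenc\<close>)
  show ?case
  proof (rule set_decode_inject)
    show "set_decode (opN (cenc (Exq b i \<phi>)) a) = set_decode (op (Exq b i \<phi>) (set_decode a))"
      unfolding eq set_decode_op_Exq by (subst closureN_cenc) (auto simp: qcar_iff op_car pt_car)
  qed
qed (simp_all add: opN_def cov_rec_def opH_def)

text \<open>Tag 4 is the quantifier over singletons, from the summand \<open>of_bool b\<close> in
  \<open>cenc\<close>.\<close>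

definition accH :: "nat \<Rightarrow> nat \<Rightarrow> nat" where
  "accH z T = (
     if pfst (pfst z) = 0 then of_bool (psnd (psnd (pfst (psnd z))) \<noteq> 0)
     else if pfst (pfst z) = 1 then of_bool (pfst (psnd z) \<noteq> 0)
     else if pfst (pfst z) = 2 then
       of_bool (\<not> (look T (prod_encode (pfst (psnd (pfst z)), prod_encode (pfst (pfst (psnd z)), pfst (psnd (psnd z))))) \<noteq> 0 \<and>
         look T (prod_encode (psnd (psnd (pfst z)), prod_encode (psnd (pfst (psnd z)), psnd (psnd (psnd z))))) \<noteq> 0))
     else of_bool (\<exists>x\<in>set_decode (pfst (psnd z)). \<exists>y\<in>set_decode (psnd (psnd z)).
       mulN (psnd (psnd (psnd (pfst z)))) (psnd x) (psnd y) = psnd x \<and>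
       mulN (psnd (psnd (psnd (pfst z)))) (psnd y) (psnd y) = psnd y \<and>
       (pfst (pfst z) = 4 \<longrightarrow> pfst x = 1 \<and> pfst y = 0) \<and>
       look T (prod_encode (psnd (psnd (psnd (pfst z))), prod_encode (psnd x, psnd y))) \<noteq> 0))"

definition accN :: "nat \<Rightarrow> nat \<Rightarrow> nat \<Rightarrow> bool" where
  "accN p s e \<longleftrightarrow> cov_rec accH (prod_encode (p, prod_encode (s, e))) \<noteq> 0"

lemma decidable_accN [computable_intros]:
  assumes "computable f" "computable g" "computable h" shows "decidable (\<lambda>x. accN (f x) (g x) (h x))"
proof -
  have "computable (\<lambda>z. accH (pfst z) (psnd z))" unfolding accH_def by (intro computable_intros)
  then show ?thesis unfolding accN_def
    by (intro computable_intros computable_comp[OF computable_cov_rec] assms)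
qed

lemma accN_cenc: "accN (cenc \<phi>) s e \<longleftrightarrow> acc \<phi> s e"
proof (induction \<phi> arbitrary: s e)
  case (Nand \<phi> \<psi>)
  have le: "prod_encode (pfst s, pfst e) \<le> prod_encode (s, e)" "prod_encode (psnd s, psnd e) \<le> prod_encode (s, e)"
    by (intro prod_encode_mono pfst_le psnd_le)+
  have "prod_encode (cenc \<phi>, prod_encode (pfst s, pfst e)) < prod_encode (cenc (Nand \<phi> \<psi>), prod_encode (s, e))"
    "prod_encode (cenc \<psi>, prod_encode (psnd s, psnd e)) < prod_encode (cenc (Nand \<phi> \<psi>), prod_encode (s, e))"
    by (intro prod_encode_less add_less_le_mono cenc_less le)+
  note * = this[THEN look_cov_table[of _ _ accH]]
  have "accN (cenc (Nand \<phi> \<psi>)) s e \<longleftrightarrow> \<not> (accN (cenc \<phi>) (pfst s) (pfst e) \<and> accN (cenc \<psi>) (psnd s) (psnd e))"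
    unfolding accN_def cov_rec_def[of accH "prod_encode (cenc (Nand \<phi> \<psi>), prod_encode (s, e))"]
    by (subst accH_def) (use * in simp)
  then show ?case using Nand.IH by simp
next
  case (Exq b i \<phi>)
  let ?z = "prod_encode (cenc (Exq b i \<phi>), prod_encode (s, e))"
  have *: "look (cov_table accH ?z) (prod_encode (cenc \<phi>, prod_encode (psnd x, psnd y))) \<noteq> 0 \<longleftrightarrow> acc \<phi> (psnd x) (psnd y)"
    if "x \<in> set_decode s" "y \<in> set_decode e" for x y
  proof -
    have "psnd x \<le> s" "psnd y \<le> e"
      using set_decode_less[OF that(1)] set_decode_less[OF that(2)] psnd_le[of x] psnd_le[of y] by auto
    then have "prod_encode (cenc \<phi>, prod_encode (psnd x, psnd y)) < ?z"
      by (intro prod_encode_less add_less_le_mono cenc_less' prod_encode_mono)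
    from look_cov_table[OF this, of accH] show ?thesis using Exq.IH unfolding accN_def by simp
  qed
  have "accN (cenc (Exq b i \<phi>)) s e \<longleftrightarrow> (\<exists>x\<in>set_decode s. \<exists>y\<in>set_decode e.
       mul \<phi> (psnd x) (psnd y) = psnd x \<and> mul \<phi> (psnd y) (psnd y) = psnd y \<and>
       (b \<longrightarrow> pfst x = 1 \<and> pfst y = 0) \<and>
       look (cov_table accH ?z) (prod_encode (cenc \<phi>, prod_encode (psnd x, psnd y))) \<noteq> 0)"
    unfolding accN_def cov_rec_def by (subst accH_def) (cases b; auto simp add: mulN_cenc)
  also have "\<dots> \<longleftrightarrow> acc (Exq b i \<phi>) s e"
    unfolding acc.simps by (intro bex_cong refl conj_cong) (simp only: *)
  finally show ?case .
qed (simp_all add: accN_def cov_rec_def accH_def)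

section \<open>The decision procedure\<close>

definition neg :: "core \<Rightarrow> core" where "neg \<phi> = Nand \<phi> \<phi>"

text \<open>First-order variables go to odd and second-order ones to even numbers, so that the two
  copies of the naturals do not clash.\<close>

fun tr :: "mso \<Rightarrow> core" where
  "tr (Less t v) = Lt (2 * t + 1) (2 * v + 1)"
| "tr (Pred X t) = Inn (2 * t + 1) (2 * X)"
| "tr (Neg \<phi>) = neg (tr \<phi>)"
| "tr (Conj \<phi> \<psi>) = neg (Nand (tr \<phi>) (tr \<psi>))"
| "tr (Disj \<phi> \<psi>) = Nand (neg (tr \<phi>)) (neg (tr \<psi>))"
| "tr (Impl \<phi> \<psi>) = Nand (tr \<phi>) (neg (tr \<psi>))"
| "tr (Ex1 t \<phi>) = Exq True (2 * t + 1) (tr \<phi>)"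
| "tr (All1 t \<phi>) = neg (Exq True (2 * t + 1) (neg (tr \<phi>)))"
| "tr (Ex2 X \<phi>) = Exq False (2 * X) (tr \<phi>)"
| "tr (All2 X \<phi>) = neg (Exq False (2 * X) (neg (tr \<phi>)))"

definition merged :: "(nat \<Rightarrow> real) \<Rightarrow> (nat \<Rightarrow> real set) \<Rightarrow> nat \<Rightarrow> real set" where
  "merged \<alpha> \<beta> i = (if even i then \<beta> (i div 2) else {\<alpha> (i div 2)})"

lemma merged_upd:
  "merged (\<alpha>(t := r)) \<beta> = (merged \<alpha> \<beta>)(2 * t + 1 := {r})"
  "merged \<alpha> (\<beta>(X := S)) = (merged \<alpha> \<beta>)(2 * X := S)"
  by (auto simp: merged_def fun_eq_iff elim!: evenE oddE)

lemma ex_singleton_signal: "(\<exists>S\<in>boolean_signals. (\<exists>p. S = {p}) \<and> P S) \<longleftrightarrow> (\<exists>r\<in>{0..}. P {r})"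
proof
  assume "\<exists>S\<in>boolean_signals. (\<exists>p. S = {p}) \<and> P S"
  then obtain p where "{p} \<in> boolean_signals" "P {p}" by blast
  then show "\<exists>r\<in>{0..}. P {r}" unfolding boolean_signals_iff by blast
next
  assume "\<exists>r\<in>{0..}. P {r}"
  then obtain r where "0 \<le> r" "P {r}" by auto
  then show "\<exists>S\<in>boolean_signals. (\<exists>p. S = {p}) \<and> P S" using boolean_signals_singleton[of r] by blast
qed

lemma satc_tr: "satc (tr \<Psi>) (merged \<alpha> \<beta>) \<longleftrightarrow> FVsig_sat \<alpha> \<beta> \<Psi>"
proof (induction \<Psi> arbitrary: \<alpha> \<beta>)
  case (Ex1 t \<Psi>)
  show ?case unfolding tr.simps satc.simps FVsig_sat.simps Ex1.IH[symmetric] merged_upd(1)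
    by (simp add: ex_singleton_signal)
next
  case (All1 t \<Psi>)
  show ?case unfolding tr.simps neg_def satc.simps FVsig_sat.simps All1.IH[symmetric] merged_upd(1)
    by (simp add: ex_singleton_signal)
qed (auto simp: merged_def[of _ _ "Suc (2 * _)"] merged_def[of _ _ "2 * _"] neg_def merged_upd(2)[symmetric])

fun fvc :: "core \<Rightarrow> nat set" where
  "fvc (Lt i j) = {i, j}"
| "fvc (Inn i j) = {i, j}"
| "fvc (Nand \<phi> \<psi>) = fvc \<phi> \<union> fvc \<psi>"
| "fvc (Exq b i \<phi>) = fvc \<phi> - {i}"

lemma satc_cong: "(\<And>i. i \<in> fvc \<phi> \<Longrightarrow> M i = M' i) \<Longrightarrow> satc \<phi> M \<longleftrightarrow> satc \<phi> M'"
proof (induction \<phi> arbitrary: M M')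
  case (Nand \<phi> \<psi>)
  have "satc \<phi> M \<longleftrightarrow> satc \<phi> M'" "satc \<psi> M \<longleftrightarrow> satc \<psi> M'" by (rule Nand.IH; use Nand.prems in simp)+
  then show ?case by simp
next
  case (Exq b i \<phi>)
  have "satc \<phi> (M(i := S)) \<longleftrightarrow> satc \<phi> (M'(i := S))" for S by (rule Exq.IH) (use Exq.prems in simp)
  then show ?case by simp
qed simp_all

lemma fvc_tr: "fvc (tr \<Psi>) = (\<lambda>t. 2 * t + 1) ` fv1 \<Psi> \<union> (\<lambda>X. 2 * X) ` fv2 \<Psi>"
proof (induction \<Psi>)
  case (Ex1 t \<Psi>)
  then show ?case by auto presburger+
next
  case (All1 t \<Psi>)
  then show ?case by (auto simp: neg_def) presburger+
next
  case (Ex2 t \<Psi>)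
  then show ?case by auto presburger+
next
  case (All2 t \<Psi>)
  then show ?case by (auto simp: neg_def) presburger+
qed (auto simp: neg_def)

section \<open>Tuples of boolean signals and signals of letters\<close>

definition eX :: "nat \<Rightarrow> bool list \<Rightarrow> nat" where
  "eX m b = set_encode {2 * i | i. i < m \<and> b ! i}"

definition eY :: "nat \<Rightarrow> nat \<Rightarrow> bool list \<Rightarrow> nat" where
  "eY m n b = set_encode {2 * (m + j) | j. j < n \<and> b ! j}"

definition dX :: "nat \<Rightarrow> nat \<Rightarrow> bool list" where
  "dX m x = map (\<lambda>i. 2 * i \<in> set_decode x) [0..<m]"

definition dY :: "nat \<Rightarrow> nat \<Rightarrow> nat \<Rightarrow> bool list" where
  "dY m n y = map (\<lambda>j. 2 * (m + j) \<in> set_decode y) [0..<n]"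

lemma set_decode_eX: "set_decode (eX m b) = {2 * i | i. i < m \<and> b ! i}"
  and set_decode_eY: "set_decode (eY m n b) = {2 * (m + j) | j. j < n \<and> b ! j}"
  unfolding eX_def eY_def by (simp_all add: set_encode_inverse)

lemma eX_in: "eX m b \<in> XS m" and eY_in: "eY m n b \<in> YS m n"
  by (auto simp: XS_def YS_def set_decode_eX set_decode_eY)

lemma dX_in: "dX m x \<in> bits m" and dY_in: "dY m n y \<in> bits n"
  by (simp_all add: bits_def dX_def dY_def)

lemma eX_dX: "x \<in> XS m \<Longrightarrow> eX m (dX m x) = x"
  by (rule set_decode_inject) (auto simp: set_decode_eX XS_def dX_def elim!: evenE)

lemma eY_dY:
  assumes "y \<in> YS m n" shows "eY m n (dY m n y) = y"
proof (rule set_decode_inject, rule set_eqI)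
  fix i
  have "\<exists>j<n. i = 2 * (m + j)" if "i \<in> set_decode y"
  proof -
    have "even i" "2 * m \<le> i" "i < 2 * (m + n)" using assms \<open>i \<in> set_decode y\<close> by (auto simp: YS_def)
    then show ?thesis by (intro exI[of _ "i div 2 - m"]) auto
  qed
  then show "i \<in> set_decode (eY m n (dY m n y)) \<longleftrightarrow> i \<in> set_decode y"
    by (auto simp: set_decode_eY dY_def)
qed

lemma set_decode_add_disjoint:
  assumes "set_decode a \<inter> set_decode b = {}" shows "set_decode (a + b) = set_decode a \<union> set_decode b"
proof -
  have "set_encode (set_decode a \<union> set_decode b) = set_encode (set_decode a) + set_encode (set_decode b)"
    unfolding set_encode_def using assms by (intro sum.union_disjoint) auto
  then show ?thesis by (metis finite_UnI finite_set_decode set_decode_inverse set_encode_inverse)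
qed

lemma FVsig_models_iff:
  assumes "is_spec m n \<Psi>"
  shows "FVsig_models m n \<Psi> X Y \<longleftrightarrow> satc (tr \<Psi>) (Mof (\<lambda>t. eX m (X t) + eY m n (Y t)))"
proof -
  let ?\<beta> = "\<lambda>i. if i < m then track X i else if i < m + n then track Y (i - m) else {}"
  have "FVsig_models m n \<Psi> X Y \<longleftrightarrow> satc (tr \<Psi>) (merged (\<lambda>_. 0) ?\<beta>)"
    unfolding FVsig_models_def by (rule satc_tr[symmetric])
  also have "\<dots> \<longleftrightarrow> satc (tr \<Psi>) (Mof (\<lambda>t. eX m (X t) + eY m n (Y t)))"
  proof (rule satc_cong)
    fix v assume "v \<in> fvc (tr \<Psi>)"
    then obtain i where v: "v = 2 * i" "i < m + n"
      using assms unfolding fvc_tr is_spec_def by auto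
    have "set_decode (eX m b + eY m n c) = {2 * i | i. i < m \<and> b ! i} \<union> {2 * (m + j) | j. j < n \<and> c ! j}" for b c
      by (subst set_decode_add_disjoint) (auto simp: set_decode_eX set_decode_eY)
    then have "v \<in> set_decode (eX m b + eY m n c) \<longleftrightarrow> (if i < m then b ! i else c ! (i - m))" for b c
      unfolding v(1) using v(2) by (auto intro: exI[of _ "i - m"] simp del: distrib_left_numeral)
    then show "merged (\<lambda>_. 0) ?\<beta> v = Mof (\<lambda>t. eX m (X t) + eY m n (Y t)) v"
      using v(2) by (auto simp: merged_def Mof_def track_def v(1))
  qed
  finally show ?thesis .
qed

definition lift :: "('a \<Rightarrow> 'b) \<Rightarrow> (real \<Rightarrow> 'a) \<Rightarrow> real \<Rightarrow> 'b" where
  "lift h X = (\<lambda>t\<in>{0..}. h (X t))"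

lemma lift_signal:
  assumes "X \<in> signals A" "\<And>a. a \<in> A \<Longrightarrow> h a \<in> B" shows "lift h X \<in> signals B"
proof -
  have "locally_fv (lift h X) \<longleftrightarrow> locally_fv (\<lambda>t. h (X t))"
    by (rule locally_fv_cong) (simp add: lift_def)
  moreover have "locally_fv X" using assms(1) by (simp add: signals_iff)
  then have "locally_fv (\<lambda>t. h (X t))" by (rule locally_fv_comp)
  moreover have "lift h X \<in> {0..} \<rightarrow>\<^sub>E B" using assms by (auto simp: lift_def signals_iff)
  ultimately show ?thesis by (simp add: signals_iff)
qed

lemma lift_C_operator:
  assumes "C_operator A B F" "\<And>a. a \<in> A' \<Longrightarrow> g a \<in> A" "\<And>b. b \<in> B \<Longrightarrow> h b \<in> B'"
  shows "C_operator A' B' (\<lambda>X. lift h (F (lift g X)))"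
  unfolding C_operator_def
proof (intro conjI allI impI ballI Pi_I)
  fix X assume "X \<in> signals A'"
  then have "F (lift g X) \<in> signals B"
    using lift_signal[of X A' g A] assms(1,2) by (auto simp: C_operator_def)
  then show "lift h (F (lift g X)) \<in> signals B'" using assms(3) by (rule lift_signal)
next
  fix t :: real and X Y assume t: "0 \<le> t" and X: "X \<in> signals A'" and Y: "Y \<in> signals A'"
    and eq: "\<forall>s\<in>{0..t}. X s = Y s"
  have "lift g X \<in> signals A" "lift g Y \<in> signals A" using lift_signal X Y assms(2) by blast+
  moreover have "\<forall>s\<in>{0..t}. lift g X s = lift g Y s" using eq by (simp add: lift_def)
  ultimately have "F (lift g X) t = F (lift g Y) t" using assms(1) t unfolding C_operator_def by blast
  then show "lift h (F (lift g X)) t = lift h (F (lift g Y)) t" using t by (simp add: lift_def)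
qed

lemma Mof_cong: "(\<And>t. 0 \<le> t \<Longrightarrow> L t = L' t) \<Longrightarrow> Mof L = Mof L'"
  by (auto simp: Mof_def fun_eq_iff)

text \<open>The translations of letters act pointwise in time, so they preserve finite variability
  and causality; an operator is transported by translating its input and its output.\<close>

lemma realizable_iff:
  assumes "is_spec m n \<Psi>"
  shows "(\<exists>F. C_operator (bits m) (bits n) F \<and> (\<forall>X\<in>signals (bits m). FVsig_models m n \<Psi> X (F X))) \<longleftrightarrow>
    (\<exists>G. C_operator (XS m) (YS m n) G \<and> (\<forall>X\<in>signals (XS m). satc (tr \<Psi>) (Mof (\<lambda>t. X t + G X t))))"
proof
  assume "\<exists>F. C_operator (bits m) (bits n) F \<and> (\<forall>X\<in>signals (bits m). FVsig_models m n \<Psi> X (F X))"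
  then obtain F where F: "C_operator (bits m) (bits n) F" "\<And>X. X \<in> signals (bits m) \<Longrightarrow> FVsig_models m n \<Psi> X (F X)"
    by blast
  let ?G = "\<lambda>X. lift (eY m n) (F (lift (dX m) X))"
  have "satc (tr \<Psi>) (Mof (\<lambda>t. X t + ?G X t))" if X: "X \<in> signals (XS m)" for X
  proof -
    have "lift (dX m) X \<in> signals (bits m)" using lift_signal[OF X] dX_in by blast
    from F(2)[OF this, unfolded FVsig_models_iff[OF assms]]
    have "satc (tr \<Psi>) (Mof (\<lambda>t. eX m (lift (dX m) X t) + eY m n (F (lift (dX m) X) t)))" .
    moreover have "Mof (\<lambda>t. eX m (lift (dX m) X t) + eY m n (F (lift (dX m) X) t)) = Mof (\<lambda>t. X t + ?G X t)"
    proof (rule Mof_cong)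
      fix t :: real assume "0 \<le> t"
      moreover from this have "X t \<in> XS m" using X by (auto simp: signals_iff)
      ultimately show "eX m (lift (dX m) X t) + eY m n (F (lift (dX m) X) t) = X t + ?G X t"
        by (simp add: lift_def eX_dX)
    qed
    ultimately show ?thesis by simp
  qed
  moreover have "C_operator (XS m) (YS m n) ?G"
    by (rule lift_C_operator[OF F(1)]) (auto intro: dX_in eY_in)
  ultimately show "\<exists>G. C_operator (XS m) (YS m n) G \<and> (\<forall>X\<in>signals (XS m). satc (tr \<Psi>) (Mof (\<lambda>t. X t + G X t)))"
    by blast
next
  assume "\<exists>G. C_operator (XS m) (YS m n) G \<and> (\<forall>X\<in>signals (XS m). satc (tr \<Psi>) (Mof (\<lambda>t. X t + G X t)))"
  then obtain G where G: "C_operator (XS m) (YS m n) G"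
    "\<And>X. X \<in> signals (XS m) \<Longrightarrow> satc (tr \<Psi>) (Mof (\<lambda>t. X t + G X t))"
    by blast
  let ?F = "\<lambda>X. lift (dY m n) (G (lift (eX m) X))"
  have "FVsig_models m n \<Psi> X (?F X)" if X: "X \<in> signals (bits m)" for X
  proof -
    have X': "lift (eX m) X \<in> signals (XS m)" using lift_signal[OF X] eX_in by blast
    then have GX: "G (lift (eX m) X) \<in> signals (YS m n)" using G(1) by (auto simp: C_operator_def)
    have "Mof (\<lambda>t. eX m (X t) + eY m n (?F X t)) = Mof (\<lambda>t. lift (eX m) X t + G (lift (eX m) X) t)"
    proof (rule Mof_cong)
      fix t :: real assume "0 \<le> t"
      moreover from this have "G (lift (eX m) X) t \<in> YS m n" using GX by (auto simp: signals_iff)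
      ultimately show "eX m (X t) + eY m n (?F X t) = lift (eX m) X t + G (lift (eX m) X) t"
        by (simp add: lift_def eY_dY)
    qed
    then show ?thesis unfolding FVsig_models_iff[OF assms] using G(2)[OF X'] by simp
  qed
  moreover have "C_operator (bits m) (bits n) ?F"
    by (rule lift_C_operator[OF G(1)]) (auto intro: eX_in dY_in)
  ultimately show "\<exists>F. C_operator (bits m) (bits n) F \<and> (\<forall>X\<in>signals (bits m). FVsig_models m n \<Psi> X (F X))"
    by blast
qed

section \<open>The translation of formulas on codes\<close>

definition nandc :: "nat \<Rightarrow> nat \<Rightarrow> nat" where "nandc a b = prod_encode (2, prod_encode (a, b))"
definition exc :: "nat \<Rightarrow> nat \<Rightarrow> nat \<Rightarrow> nat" where
  "exc b i a = prod_encode (3 + b, prod_encode (i, prod_encode (2 ^ i, a)))"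

lemma computable_nandc [computable_intros]:
  "computable f \<Longrightarrow> computable g \<Longrightarrow> computable (\<lambda>x. nandc (f x) (g x))"
  unfolding nandc_def by (intro computable_intros)

lemma computable_exc [computable_intros]:
  "computable f \<Longrightarrow> computable g \<Longrightarrow> computable h \<Longrightarrow> computable (\<lambda>x. exc (f x) (g x) (h x))"
  unfolding exc_def by (intro computable_intros)

lemma cenc_nandc: "nandc (cenc \<phi>) (cenc \<psi>) = cenc (Nand \<phi> \<psi>)"
  and cenc_exc1: "exc 1 i (cenc \<phi>) = cenc (Exq True i \<phi>)"
  and cenc_exc0: "exc 0 i (cenc \<phi>) = cenc (Exq False i \<phi>)"
  by (simp_all add: nandc_def exc_def)

text \<open>The last branch treats \<open>Less\<close> and also every number with a tag that no
  formula has; thus the result codes a \<open>core\<close> formula in any case.\<close>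

definition trH :: "nat \<Rightarrow> nat \<Rightarrow> nat" where
  "trH p T = (
     if pfst p = 1 then prod_encode (1, prod_encode (2 * psnd (psnd p) + 1, 2 * pfst (psnd p)))
     else if pfst p = 2 then nandc (look T (psnd p)) (look T (psnd p))
     else if pfst p = 3 then nandc (nandc (look T (pfst (psnd p))) (look T (psnd (psnd p))))
       (nandc (look T (pfst (psnd p))) (look T (psnd (psnd p))))
     else if pfst p = 4 then nandc (nandc (look T (pfst (psnd p))) (look T (pfst (psnd p))))
       (nandc (look T (psnd (psnd p))) (look T (psnd (psnd p))))
     else if pfst p = 5 then nandc (look T (pfst (psnd p))) (nandc (look T (psnd (psnd p))) (look T (psnd (psnd p))))
     else if pfst p = 6 then exc 1 (2 * pfst (psnd p) + 1) (look T (psnd (psnd p)))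
     else if pfst p = 7 then
       nandc (exc 1 (2 * pfst (psnd p) + 1) (nandc (look T (psnd (psnd p))) (look T (psnd (psnd p)))))
         (exc 1 (2 * pfst (psnd p) + 1) (nandc (look T (psnd (psnd p))) (look T (psnd (psnd p)))))
     else if pfst p = 8 then exc 0 (2 * pfst (psnd p)) (look T (psnd (psnd p)))
     else if pfst p = 9 then
       nandc (exc 0 (2 * pfst (psnd p)) (nandc (look T (psnd (psnd p))) (look T (psnd (psnd p)))))
         (exc 0 (2 * pfst (psnd p)) (nandc (look T (psnd (psnd p))) (look T (psnd (psnd p)))))
     else prod_encode (0, prod_encode (2 * pfst (psnd p) + 1, 2 * psnd (psnd p) + 1)))"

definition trN :: "nat \<Rightarrow> nat" where "trN = cov_rec trH"

lemma computable_trN [computable_intros]: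
  assumes "computable f" shows "computable (\<lambda>x. trN (f x))"
proof -
  have "computable (\<lambda>z. trH (pfst z) (psnd z))" unfolding trH_def by (intro computable_intros)
  then show ?thesis unfolding trN_def by (intro computable_comp[OF computable_cov_rec] assms)
qed

lemma trN_look:
  assumes "pfst p \<noteq> 0"
  shows "look (cov_table trH p) (psnd p) = trN (psnd p)"
    "look (cov_table trH p) (pfst (psnd p)) = trN (pfst (psnd p))"
    "look (cov_table trH p) (psnd (psnd p)) = trN (psnd (psnd p))"
proof -
  have "psnd p < p" using prod_encode_ge[of "pfst p" "psnd p"] assms by simp
  then have "psnd p < p" "pfst (psnd p) < p" "psnd (psnd p) < p"
    using pfst_le[of "psnd p"] psnd_le[of "psnd p"] by linarith+
  then show "look (cov_table trH p) (psnd p) = trN (psnd p)"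
    "look (cov_table trH p) (pfst (psnd p)) = trN (pfst (psnd p))"
    "look (cov_table trH p) (psnd (psnd p)) = trN (psnd (psnd p))"
    by (simp_all add: trN_def look_cov_table)
qed

lemma trN_mso_encode: "trN (mso_encode \<Psi>) = cenc (tr \<Psi>)"
proof -
  have *: "trN p = trH p (cov_table trH p)" for p by (simp add: trN_def cov_rec_def)
  have look1: "look (cov_table trH (prod_encode (t, u))) u = trN u" if "t \<noteq> 0" for t u
    using trN_look(1)[of "prod_encode (t, u)"] that by simp
  have look2: "look (cov_table trH (prod_encode (t, prod_encode (a, b)))) a = trN a"
    "look (cov_table trH (prod_encode (t, prod_encode (a, b)))) b = trN b" if "t \<noteq> 0" for t a b
    using trN_look(2,3)[of "prod_encode (t, prod_encode (a, b))"] that by simp_all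
  show ?thesis
  proof (induction \<Psi>)
    case (Less t v)
    show ?case unfolding * trH_def by simp
  next
    case (Pred X t)
    show ?case unfolding * trH_def by simp
  qed (subst *, subst trH_def, simp add: look1 look2 neg_def
      cenc_nandc cenc_exc1[unfolded One_nat_def] cenc_exc0 del: cenc.simps)+
qed

text \<open>Minimisation is restricted to regular functions, so the search for a certificate has to
  end on every number, whether or not it codes a formula. Here every number is seen to denote some
  \<open>core\<close> formula, to which determinacy applies.\<close>

lemma trN_range: "\<exists>\<phi>. trN p = cenc \<phi>"
proof (induction p rule: less_induct)
  case (less p)
  have *: "trN p = trH p (cov_table trH p)" by (simp add: trN_def cov_rec_def)
  show ?case
  proof (cases "pfst p = 0")
    case True
    then show ?thesis unfolding * trH_def
      by (intro exI[of _ "Lt (2 * pfst (psnd p) + 1) (2 * psnd (psnd p) + 1)"]) simp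
  next
    case False
    have "psnd p < p" using prod_encode_ge[of "pfst p" "psnd p"] False by simp
    then have "psnd p < p" "pfst (psnd p) < p" "psnd (psnd p) < p"
      using pfst_le[of "psnd p"] psnd_le[of "psnd p"] by linarith+
    then obtain a b c where abc: "trN (psnd p) = cenc a" "trN (pfst (psnd p)) = cenc b" "trN (psnd (psnd p)) = cenc c"
      using less.IH by metis
    have lt: "prod_encode (0, prod_encode (i, j)) = cenc (Lt i j)"
      and inn: "prod_encode (1, prod_encode (i, j)) = cenc (Inn i j)" for i j by simp_all
    show ?thesis unfolding * trH_def trN_look[OF False] abc lt inn cenc_nandc cenc_exc1 cenc_exc0
      by (auto simp del: cenc.simps)
  qed
qed

section \<open>Arithmetical checking of certificates\<close>

definition triples :: "nat \<Rightarrow> (nat \<times> nat \<times> nat) set" where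
  "triples r = (\<lambda>t. (pfst t, pfst (psnd t), psnd (psnd t))) ` set_decode r"

lemma triples_iff: "(z, s, z') \<in> triples r \<longleftrightarrow> enc3 z s z' \<in> set_decode r"
  unfolding triples_def enc3_def by (auto simp: image_iff) force

lemma triples_surj: "finite R \<Longrightarrow> \<exists>r. triples r = R"
proof -
  assume "finite R"
  then have "triples (set_encode ((\<lambda>(z, s, z'). enc3 z s z') ` R)) = R"
  proof -
    have "(z, s, z') \<in> triples (set_encode ((\<lambda>(z, s, z'). enc3 z s z') ` R)) \<longleftrightarrow> (z, s, z') \<in> R" for z s z'
    proof -
      have "enc3 z s z' \<in> (\<lambda>(z, s, z'). enc3 z s z') ` R \<longleftrightarrow> (z, s, z') \<in> R"
      proof
        assume "(z, s, z') \<in> R"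
        then show "enc3 z s z' \<in> (\<lambda>(z, s, z'). enc3 z s z') ` R" by (intro image_eqI[of _ _ "(z, s, z')"]) auto
      qed (auto simp: enc3_def)
      then show ?thesis unfolding triples_iff using \<open>finite R\<close> by (simp add: set_encode_inverse)
    qed
    then show ?thesis by auto
  qed
  then show ?thesis by blast
qed

lemma finite_triples: "finite (triples r)"
  by (simp add: triples_def)

definition gmulN :: "nat \<Rightarrow> nat \<Rightarrow> nat \<Rightarrow> nat" where
  "gmulN p a b = enc3 (mulN p (pfst a) (pfst b)) (max (pfst (psnd a)) (pfst (psnd b)))
     (max (psnd (psnd a)) (psnd (psnd b)))"

definition gaccN :: "nat \<Rightarrow> nat \<Rightarrow> nat \<Rightarrow> bool" where
  "gaccN p s e \<longleftrightarrow> (pfst (psnd e) \<noteq> 0 \<longrightarrow> accN p (pfst s) (pfst e)) \<and> (pfst (psnd e) = 0 \<longrightarrow> psnd (psnd e) \<noteq> 0)"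

definition glbN :: "nat \<Rightarrow> nat \<Rightarrow> nat \<Rightarrow> nat \<Rightarrow> nat" where
  "glbN p q x y = (if pfst q = 1 then enc3 (opN p (psnd x + psnd y)) 0 (of_bool (psnd x \<noteq> psnd q))
     else enc3 (ptN p (psnd x + psnd y)) (pfst y) (pfst x))"

lemma gN_cenc: "gmulN (cenc \<phi>) = gmul \<phi>" "gaccN (cenc \<phi>) = gacc \<phi>" "glbN (cenc \<phi>) = glb \<phi>"
  by (auto simp: fun_eq_iff gmulN_def gmul_def gaccN_def gacc_def glbN_def glb_def mulN_cenc accN_cenc ptN_cenc opN_cenc)

lemma computable_gmulN [computable_intros]:
  "computable f \<Longrightarrow> computable g \<Longrightarrow> computable h \<Longrightarrow> computable (\<lambda>x. gmulN (f x) (g x) (h x))"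
  unfolding gmulN_def by (intro computable_intros)

lemma decidable_gaccN [computable_intros]:
  "computable f \<Longrightarrow> computable g \<Longrightarrow> computable h \<Longrightarrow> decidable (\<lambda>x. gaccN (f x) (g x) (h x))"
  unfolding gaccN_def by (intro computable_intros)

lemma computable_glbN [computable_intros]:
  "computable f \<Longrightarrow> computable g \<Longrightarrow> computable h \<Longrightarrow> computable k \<Longrightarrow>
    computable (\<lambda>x. glbN (f x) (g x) (h x) (k x))"
  unfolding glbN_def by (intro computable_intros)

lemma computable_gdl [computable_intros]:
  "computable f \<Longrightarrow> computable g \<Longrightarrow> computable h \<Longrightarrow> computable (\<lambda>x. gdl (f x) (g x) (h x))"
  unfolding gdl_def by (intro computable_intros)

lemma XS_iff: "x \<in> XS m \<longleftrightarrow> (\<forall>i\<in>set_decode x. \<exists>j<m. i = 2 * j)"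
  by (auto simp: XS_def elim!: evenE)

lemma YS_iff: "y \<in> YS m n \<longleftrightarrow> (\<forall>i\<in>set_decode y. \<exists>j<n. i = 2 * (m + j))"
proof
  assume y: "y \<in> YS m n"
  show "\<forall>i\<in>set_decode y. \<exists>j<n. i = 2 * (m + j)"
  proof
    fix i assume "i \<in> set_decode y"
    then have "even i" "2 * m \<le> i" "i < 2 * (m + n)" using y by (auto simp: YS_def)
    then show "\<exists>j<n. i = 2 * (m + j)" by (intro exI[of _ "i div 2 - m"]) auto
  qed
next
  assume "\<forall>i\<in>set_decode y. \<exists>j<n. i = 2 * (m + j)"
  then show "y \<in> YS m n" unfolding YS_def by fastforce
qed

lemma decidable_XS [computable_intros]:
  assumes "computable f" "computable g" shows "decidable (\<lambda>w. f w \<in> XS (g w))"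
  unfolding XS_iff by (intro computable_intros assms computable_comp[OF assms(1)] computable_comp[OF assms(2)])

lemma decidable_YS [computable_intros]:
  assumes "computable f" "computable g" "computable h" shows "decidable (\<lambda>w. f w \<in> YS (g w) (h w))"
  unfolding YS_iff
  by (intro computable_intros assms computable_comp[OF assms(1)] computable_comp[OF assms(2)] computable_comp[OF assms(3)])

lemma decidable_gLX [computable_intros]:
  "computable f \<Longrightarrow> computable g \<Longrightarrow> computable h \<Longrightarrow> decidable (\<lambda>w. f w \<in> gLX (g w) (h w))"
  unfolding gLX_def mem_Collect_eq by (intro computable_intros)

lemma decidable_gLY [computable_intros]:
  "computable f \<Longrightarrow> computable g \<Longrightarrow> computable h \<Longrightarrow> computable k \<Longrightarrow> computable l \<Longrightarrow>
    decidable (\<lambda>w. f w \<in> gLY (g w) (h w) (k w) (l w))"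
  unfolding gLY_def mem_Collect_eq by (intro computable_intros)

lemma less_power_if_bits:
  assumes "\<And>i. i \<in> set_decode x \<Longrightarrow> i < k" shows "x < 2 ^ k"
proof -
  have "x = (\<Sum>i\<in>set_decode x. 2 ^ i)" using set_decode_inverse[of x] by (simp add: set_encode_def)
  also have "\<dots> \<le> (\<Sum>i\<in>{0..<k}. 2 ^ i)" using assms by (intro sum_mono2) auto
  also have "\<dots> < 2 ^ k" by (simp add: sum_power2)
  finally show ?thesis .
qed

text \<open>A move is a pair of a bit and a letter with bits below \<open>2 * m\<close>; this bounds
  the quantifiers over moves. The bound \<open>bY\<close> arises in the same way.\<close>

definition bX :: "nat \<Rightarrow> nat" where "bX m = Suc (prod_encode (1, 2 ^ (2 * m)))"
definition bY :: "nat \<Rightarrow> nat \<Rightarrow> nat" where "bY m n = Suc (prod_encode (1, 2 ^ (2 * (m + n))))"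

lemma gLX_bound: "x \<in> gLX m q \<Longrightarrow> x < bX m"
proof -
  assume x: "x \<in> gLX m q"
  then have "psnd x < 2 ^ (2 * m)" by (intro less_power_if_bits) (auto simp: gLX_def XS_def)
  moreover have "pfst x \<le> 1" using x by (auto simp: gLX_def)
  ultimately have "prod_encode (pfst x, psnd x) \<le> prod_encode (1, 2 ^ (2 * m))"
    by (intro prod_encode_mono) auto
  then show ?thesis by (simp add: bX_def)
qed

lemma gLY_bound: "y \<in> gLY m n q x \<Longrightarrow> y < bY m n"
proof -
  assume y: "y \<in> gLY m n q x"
  then have "psnd y < 2 ^ (2 * (m + n))" by (intro less_power_if_bits) (auto simp: gLY_def YS_def)
  moreover have "pfst y \<le> 1" using y by (auto simp: gLY_def)
  ultimately have "prod_encode (pfst y, psnd y) \<le> prod_encode (1, 2 ^ (2 * (m + n)))"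
    by (intro prod_encode_mono) auto
  then show ?thesis by (simp add: bY_def)
qed

text \<open>The number \<open>b\<close> selects the player: 1 asks the linked pairs on lassos to be
  accepting, 0 to be rejecting.\<close>

definition okN :: "nat \<Rightarrow> nat \<Rightarrow> nat \<Rightarrow> bool" where
  "okN p r b \<longleftrightarrow> (\<forall>t\<in>set_decode r. \<forall>t'\<in>set_decode r. psnd (psnd t) = pfst t' \<longrightarrow>
      enc3 (pfst t) (gmulN p (pfst (psnd t)) (pfst (psnd t'))) (psnd (psnd t')) \<in> set_decode r) \<and>
    (\<forall>t\<in>set_decode r. \<forall>t'\<in>set_decode r. pfst t = 0 \<and> psnd (psnd t) = pfst t' \<and> psnd (psnd t') = pfst t' \<and>
      gmulN p (pfst (psnd t)) (pfst (psnd t')) = pfst (psnd t) \<and>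
      gmulN p (pfst (psnd t')) (pfst (psnd t')) = pfst (psnd t') \<longrightarrow>
      of_bool (gaccN p (pfst (psnd t)) (pfst (psnd t'))) = b)"

text \<open>The next certificate state is sought among the triples of \<open>r\<close>, which turns
  an unbounded quantifier into a bounded one.\<close>

definition succN :: "nat \<Rightarrow> nat \<Rightarrow> nat \<Rightarrow> nat \<Rightarrow> nat \<Rightarrow> bool" where
  "succN p r z x y \<longleftrightarrow> (\<exists>t\<in>set_decode r. pfst t = z \<and> pfst (psnd t) = glbN p (pfst z) x y \<and>
     pfst (psnd (psnd t)) = gdl (pfst z) x y)"

definition stepY :: "nat \<Rightarrow> nat \<Rightarrow> nat \<Rightarrow> nat \<Rightarrow> nat \<Rightarrow> bool" where
  "stepY m n p r z \<longleftrightarrow> (\<forall>x<bX m. x \<in> gLX m (pfst z) \<longrightarrow>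
     (\<exists>y<bY m n. y \<in> gLY m n (pfst z) x \<and> succN p r z x y))"

definition stepX :: "nat \<Rightarrow> nat \<Rightarrow> nat \<Rightarrow> nat \<Rightarrow> nat \<Rightarrow> bool" where
  "stepX m n p r z \<longleftrightarrow> (\<exists>x<bX m. x \<in> gLX m (pfst z) \<and>
     (\<forall>y<bY m n. y \<in> gLY m n (pfst z) x \<longrightarrow> succN p r z x y))"

definition Ychk :: "nat \<Rightarrow> nat \<Rightarrow> nat \<Rightarrow> nat \<Rightarrow> bool" where
  "Ychk m n p r \<longleftrightarrow> okN p r 1 \<and> stepY m n p r 0 \<and> (\<forall>t\<in>set_decode r. stepY m n p r (psnd (psnd t)))"

definition Xchk :: "nat \<Rightarrow> nat \<Rightarrow> nat \<Rightarrow> nat \<Rightarrow> bool" where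
  "Xchk m n p r \<longleftrightarrow> okN p r 0 \<and> stepX m n p r 0 \<and> (\<forall>t\<in>set_decode r. stepX m n p r (psnd (psnd t)))"

lemma okN_iff:
  "okN (cenc \<phi>) r 1 \<longleftrightarrow> cert_ok (gmul \<phi>) 0 (triples r) (gacc \<phi>)"
  "okN (cenc \<phi>) r 0 \<longleftrightarrow> cert_ok (gmul \<phi>) 0 (triples r) (\<lambda>s e. \<not> gacc \<phi> s e)"
proof -
  have all: "(\<forall>t\<in>set_decode r. P (pfst t) (pfst (psnd t)) (psnd (psnd t))) \<longleftrightarrow> (\<forall>(z, s, z')\<in>triples r. P z s z')" for P
    by (simp add: triples_def)
  have trans: "(\<forall>t\<in>set_decode r. \<forall>t'\<in>set_decode r. psnd (psnd t) = pfst t' \<longrightarrow>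
      enc3 (pfst t) (gmul \<phi> (pfst (psnd t)) (pfst (psnd t'))) (psnd (psnd t')) \<in> set_decode r) \<longleftrightarrow>
    (\<forall>z s z' t z''. (z, s, z') \<in> triples r \<longrightarrow> (z', t, z'') \<in> triples r \<longrightarrow> (z, gmul \<phi> s t, z'') \<in> triples r)"
    unfolding triples_iff[of _ "gmul \<phi> _ _"]
    using all[of "\<lambda>z s z'. \<forall>t'\<in>set_decode r. z' = pfst t' \<longrightarrow> enc3 z (gmul \<phi> s (pfst (psnd t'))) (psnd (psnd t')) \<in> set_decode r"]
      all[of "\<lambda>u t z''. z' = u \<longrightarrow> enc3 z (gmul \<phi> s t) z'' \<in> set_decode r" for z z' s]
    by auto
  have acc: "(\<forall>t\<in>set_decode r. \<forall>t'\<in>set_decode r. pfst t = 0 \<and> psnd (psnd t) = pfst t' \<and> psnd (psnd t') = pfst t' \<and>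
      gmul \<phi> (pfst (psnd t)) (pfst (psnd t')) = pfst (psnd t) \<and>
      gmul \<phi> (pfst (psnd t')) (pfst (psnd t')) = pfst (psnd t') \<longrightarrow> A (pfst (psnd t)) (pfst (psnd t'))) \<longleftrightarrow>
    (\<forall>s z e. (0, s, z) \<in> triples r \<longrightarrow> (z, e, z) \<in> triples r \<longrightarrow> gmul \<phi> s e = s \<longrightarrow> gmul \<phi> e e = e \<longrightarrow> A s e)" for A
    unfolding triples_def by (auto simp: image_iff) metis
  have b: "of_bool Q = (1 :: nat) \<longleftrightarrow> Q" "of_bool Q = (0 :: nat) \<longleftrightarrow> \<not> Q" for Q by auto
  show "okN (cenc \<phi>) r 1 \<longleftrightarrow> cert_ok (gmul \<phi>) 0 (triples r) (gacc \<phi>)"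
    unfolding okN_def cert_ok_def gN_cenc b trans acc[of "gacc \<phi>"] using finite_triples by blast
  show "okN (cenc \<phi>) r 0 \<longleftrightarrow> cert_ok (gmul \<phi>) 0 (triples r) (\<lambda>s e. \<not> gacc \<phi> s e)"
    unfolding okN_def cert_ok_def gN_cenc b trans acc[of "\<lambda>s e. \<not> gacc \<phi> s e"] using finite_triples by blast
qed

lemma succN_iff: "succN (cenc \<phi>) r z x y \<longleftrightarrow>
    (\<exists>z'. pfst z' = gdl (pfst z) x y \<and> (z, glb \<phi> (pfst z) x y, z') \<in> triples r)"
proof
  assume "succN (cenc \<phi>) r z x y"
  then obtain t where t: "t \<in> set_decode r" "pfst t = z" "pfst (psnd t) = glb \<phi> (pfst z) x y"
    "pfst (psnd (psnd t)) = gdl (pfst z) x y" unfolding succN_def gN_cenc by blast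
  then have "(z, glb \<phi> (pfst z) x y, psnd (psnd t)) \<in> triples r"
    unfolding triples_def by (intro image_eqI[of _ _ t]) auto
  then show "\<exists>z'. pfst z' = gdl (pfst z) x y \<and> (z, glb \<phi> (pfst z) x y, z') \<in> triples r" using t(4) by blast
next
  assume "\<exists>z'. pfst z' = gdl (pfst z) x y \<and> (z, glb \<phi> (pfst z) x y, z') \<in> triples r"
  then show "succN (cenc \<phi>) r z x y" unfolding succN_def gN_cenc triples_def by auto
qed

lemma cert_states_ball: "(\<forall>z\<in>cert_states 0 (triples r). P z) \<longleftrightarrow> P 0 \<and> (\<forall>t\<in>set_decode r. P (psnd (psnd t)))"
  unfolding cert_states_def triples_def by (auto simp: image_iff)

lemma Ychk_iff: "Ychk m n (cenc \<phi>) r \<longleftrightarrow> Ycert (gmul \<phi>) (gLX m) (gLY m n) gdl (glb \<phi>) 0 (gacc \<phi>) (triples r)"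
proof -
  have "stepY m n (cenc \<phi>) r z \<longleftrightarrow> (\<forall>x\<in>gLX m (pfst z). \<exists>y\<in>gLY m n (pfst z) x. \<exists>z'.
        pfst z' = gdl (pfst z) x y \<and> (z, glb \<phi> (pfst z) x y, z') \<in> triples r)" for z
    unfolding stepY_def succN_iff using gLX_bound gLY_bound by blast
  then show ?thesis unfolding Ychk_def Ycert_def okN_iff cert_states_ball by blast
qed

lemma Xchk_iff: "Xchk m n (cenc \<phi>) r \<longleftrightarrow> Xcert (gmul \<phi>) (gLX m) (gLY m n) gdl (glb \<phi>) 0 (gacc \<phi>) (triples r)"
proof -
  have "stepX m n (cenc \<phi>) r z \<longleftrightarrow> (\<exists>x\<in>gLX m (pfst z). \<forall>y\<in>gLY m n (pfst z) x. \<exists>z'.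
        pfst z' = gdl (pfst z) x y \<and> (z, glb \<phi> (pfst z) x y, z') \<in> triples r)" for z
    unfolding stepX_def succN_iff using gLX_bound gLY_bound by blast
  then show ?thesis unfolding Xchk_def Xcert_def okN_iff cert_states_ball by blast
qed

lemma decidable_okN [computable_intros]:
  assumes "computable f" "computable g" "computable h" shows "decidable (\<lambda>w. okN (f w) (g w) (h w))"
  unfolding okN_def
  by (intro computable_intros assms computable_comp[OF assms(1)] computable_comp[OF assms(2)] computable_comp[OF assms(3)])

lemma decidable_succN [computable_intros]:
  assumes "computable f" "computable g" "computable h" "computable k" "computable l"
  shows "decidable (\<lambda>w. succN (f w) (g w) (h w) (k w) (l w))"
  unfolding succN_def
  by (intro computable_intros assms computable_comp[OF assms(1)] computable_comp[OF assms(2)]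
      computable_comp[OF assms(3)] computable_comp[OF assms(4)] computable_comp[OF assms(5)])

lemma decidable_steps [computable_intros]:
  assumes "computable f" "computable g" "computable h" "computable k" "computable l"
  shows "decidable (\<lambda>w. stepY (f w) (g w) (h w) (k w) (l w))" "decidable (\<lambda>w. stepX (f w) (g w) (h w) (k w) (l w))"
  unfolding stepY_def stepX_def bX_def bY_def
  by (intro computable_intros assms computable_comp[OF assms(1)] computable_comp[OF assms(2)]
      computable_comp[OF assms(3)] computable_comp[OF assms(4)] computable_comp[OF assms(5)])+

lemma decidable_chk [computable_intros]:
  assumes "computable f" "computable g" "computable h" "computable k"
  shows "decidable (\<lambda>w. Ychk (f w) (g w) (h w) (k w))" "decidable (\<lambda>w. Xchk (f w) (g w) (h w) (k w))"
  unfolding Ychk_def Xchk_def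
  by (intro computable_intros assms computable_comp[OF assms(1)] computable_comp[OF assms(2)]
      computable_comp[OF assms(3)] computable_comp[OF assms(4)])+

text \<open>Determinacy provides a certificate for one of the players, and being finite it has a
  code.\<close>

lemma certificate_ex: "\<exists>r. Ychk m n (cenc \<phi>) r \<or> Xchk m n (cenc \<phi>) r"
proof -
  interpret sg_game "gmul \<phi>" "gS \<phi>" "gLX m" "gLY m n" gdl "glb \<phi>" 0 "gQ m n" "gacc \<phi>"
    by (rule sg_game_gmul)
  have "\<exists>R. finite R \<and> (Ycert (gmul \<phi>) (gLX m) (gLY m n) gdl (glb \<phi>) 0 (gacc \<phi>) R \<or>
      Xcert (gmul \<phi>) (gLX m) (gLY m n) gdl (glb \<phi>) 0 (gacc \<phi>) R)"
    using cert_exists unfolding prod_encode_0 Ycert_def Xcert_def cert_ok_def by blast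
  then show ?thesis unfolding Ychk_iff Xchk_iff using triples_surj by metis
qed

theorem theorem1p6:
  shows "decidable_problem spec_encode
    {(m, n, \<Psi>). is_spec m n \<Psi>}
    (\<lambda>(m, n, \<Psi>). \<exists>F. C_operator (bits m) (bits n) F \<and>
       (\<forall>X\<in>signals (bits m). FVsig_models m n \<Psi> X (F X)))"
proof -
  define Y where "Y w r \<longleftrightarrow> Ychk (pfst w) (pfst (psnd w)) (trN (psnd (psnd w))) r" for w r
  define X where "X w r \<longleftrightarrow> Xchk (pfst w) (pfst (psnd w)) (trN (psnd (psnd w))) r" for w r
  \<comment> \<open>One search for both kinds of certificate; the kind that is found gives the
    answer.\<close>
  define c where "c w = (LEAST r. Y w r \<or> X w r)" for w
  have ex: "\<exists>r. Y w r \<or> X w r" for w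
    unfolding Y_def X_def using trN_range[of "psnd (psnd w)"] certificate_ex by metis
  have dec: "decidable (\<lambda>z. Y (pfst z) (psnd z) \<or> X (pfst z) (psnd z))"
    unfolding Y_def X_def by (intro computable_intros)
  have comp_c: "computable c" unfolding c_def using dec ex by (rule computable_Least)
  have "decidable (\<lambda>w. Y w (c w))"
    unfolding Y_def by (intro computable_intros comp_c)
  then have "recursive 1 (\<lambda>xs. of_bool (Y (xs ! 0) (c (xs ! 0))))"
    by (simp add: decidable_def computable_def)
  moreover have "of_bool (Y ([spec_encode x] ! 0) (c ([spec_encode x] ! 0))) =
      (if (\<lambda>(m, n, \<Psi>). \<exists>F. C_operator (bits m) (bits n) F \<and>
        (\<forall>X\<in>signals (bits m). FVsig_models m n \<Psi> X (F X))) x then 1 else (0 :: nat))"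
    if spec: "x \<in> {(m, n, \<Psi>). is_spec m n \<Psi>}" for x
  proof -
    obtain m n \<Psi> where x: "x = (m, n, \<Psi>)" by (cases x) auto
    have sp: "is_spec m n \<Psi>" using spec x by simp
    let ?w = "spec_encode x"
    have Yw: "Y ?w r \<longleftrightarrow> Ycert (gmul (tr \<Psi>)) (gLX m) (gLY m n) gdl (glb (tr \<Psi>)) 0 (gacc (tr \<Psi>)) (triples r)"
      and Xw: "X ?w r \<longleftrightarrow> Xcert (gmul (tr \<Psi>)) (gLX m) (gLY m n) gdl (glb (tr \<Psi>)) 0 (gacc (tr \<Psi>)) (triples r)" for r
      unfolding Y_def X_def by (simp_all add: x trN_mso_encode Ychk_iff Xchk_iff)
    have "Y ?w (c ?w) \<or> X ?w (c ?w)" unfolding c_def by (rule LeastI_ex) (rule ex)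
    \<comment> \<open>The two kinds exclude each other through their meaning: a certificate of the
      input player refutes every operator.\<close>
    moreover have "\<not> X ?w (c ?w)" if "\<exists>G. C_operator (XS m) (YS m n) G \<and>
        (\<forall>X\<in>signals (XS m). satc (tr \<Psi>) (Mof (\<lambda>t. X t + G X t)))"
      using that Xcert_imp_no_operator unfolding Xw by blast
    moreover have "\<exists>G. C_operator (XS m) (YS m n) G \<and>
        (\<forall>X\<in>signals (XS m). satc (tr \<Psi>) (Mof (\<lambda>t. X t + G X t)))" if "Y ?w (c ?w)"
      using that Ycert_imp_operator unfolding Yw by blast
    ultimately have "Y ?w (c ?w) \<longleftrightarrow> (\<exists>F. C_operator (bits m) (bits n) F \<and>
        (\<forall>X\<in>signals (bits m). FVsig_models m n \<Psi> X (F X)))"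
      unfolding realizable_iff[OF sp] by blast
    then show ?thesis by (simp add: x)
  qed
  ultimately show ?thesis unfolding decidable_problem_def by blast
qed

end
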